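(* Let $W=S_n$, $\mathfrak{h}=\mathbb{C}^n$, $\mathfrak{h}_{\mathbb{R}}=\mathbb{R}^n$, $2\le m\le n$ and $c=1/m$. Then the minimal nonzero submodule $N_{1/m}\subset\mathbb{C}[x_1,\dots,x_n]$ of the polynomial representation $M_{1/m}(\mathbb{C})$ of $H_{1/m}(S_n,\mathbb{C}^n)$ is contained in $L^2(\mathbb{R}^n,d\mu_c)$. In particular, $N_{1/m}$ is a unitary representation. Thus the answer to Cherednik's question is affirmative in type $A$: for $W=S_n$ acting on its reflection representation $\mathfrak{h}=\mathbb{C}^{n-1}$ (vectors in $\mathbb{C}^n$ with zero coordinate sum) and $c=1/d$ with $d\in\{2,\dots,n\}$ a degree of $W$, the minimal nonzero submodule $N_c$ of the polynomial representation is contained in $L^2(\mathfrak{h}_{\mathbb{R}},d\mu_c)$ and is unitary.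
   Context: Let $\mathfrak{h}_{\mathbb R}$ be a Euclidean space with complexification $\mathfrak{h}$ (with the induced positive definite Hermitian product), $W$ a finite group of orthogonal transformations of $\mathfrak{h}_{\mathbb R}$ with set of reflections $S$, and $c$ a real constant. For $s\in S$ let $\alpha_s\in\mathfrak{h}_{\mathbb R}^*$ generate $\mathrm{Im}(s-1)|_{\mathfrak{h}^*}$ and $\alpha_s^\vee\in\mathfrak{h}_{\mathbb R}$ generate $\mathrm{Im}(s-1)|_{\mathfrak{h}}$, with $(\alpha_s,\alpha_s^\vee)=2$. $H_c(W,\mathfrak{h})$ is the quotient of $\mathbb{C}W\ltimes T(\mathfrak{h}\oplus\mathfrak{h}^* )$ by the relations $[x,x']=0$, $[y,y']=0$, $[y,x]=(y,x)-c\sum_{s\in S}(y,\alpha_s)(x,\alpha_s^\vee)s$ for $x,x'\in\mathfrak{h}^*$, $y,y'\in\mathfrak{h}$. For $S_n$ acting on $\mathbb{C}^n$ one takes $\alpha_{s_{ij}}=x_i-x_j$. For an irreducible representation $\tau$ of $W$, $M_c(\tau)=H_c(W,\mathfrak{h})\otimes_{\mathbb{C}W\ltimes S\mathfrak{h}}\tau$ (with $\mathfrak{h}$ acting on $\tau$ by $0$) and $L_c(\tau)$ is its unique irreducible quotient. $M_c(\mathbb{C})=\mathbb{C}[\mathfrak{h}]$ is the polynomial representation ($\mathbb{C}$ = trivial representation). For $c>0$, $N_c$ denotes the minimal nonzero submodule of $M_c(\mathbb{C})$; it is the unique simple submodule, and $N_c\cong L_c(\tau_c)$ for some irreducible representation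 $\tau_c$ of $W$. Let $T:\mathfrak{h}\to\mathfrak{h}^*$ be the antilinear isomorphism $(Ty_1)(y_2)=(y_2,y_1)$. $L_c(\tau)$ carries a unique $W$-invariant Hermitian form restricting to a given $W$-invariant positive definite Hermitian form on the lowest degree component $\tau$ and satisfying $(yv,v')=(v,Ty\cdot v')$ for $y\in\mathfrak{h}$; $L_c(\tau)$ is unitary if this form is positive definite. The measure is $d\mu_c(z)=e^{-|z|^2/2}\prod_{s\in S}|\alpha_s(z)|^{-2c}\,dz$ on $\mathfrak{h}_{\mathbb R}$; a space of polynomials is contained in $L^2(\mathfrak{h}_{\mathbb R},d\mu_c)$ if $\int_{\mathfrak{h}_{\mathbb R}}|P(z)|^2d\mu_c(z)<\infty$ for each $P$ in it. *)

theory Defs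
  imports
    "HOL-Analysis.Analysis"
    "HOL-Algebra.QuotRing"
    "HOL-Library.Poly_Mapping"
    "HOL-Combinatorics.Permutations"
begin

section \<open>The complexification of a Euclidean space\<close>

text \<open>
  The Euclidean space \<open>h_R\<close> is a type \<open>'a :: euclidean_space\<close>.  A vector \<open>u + i v\<close> of its
  complexification \<open>h\<close> is the pair \<open>(u, v)\<close>, and a complex linear functional on \<open>h\<close> is
  represented by its restriction to \<open>h_R\<close>, a real linear map \<open>'a \<Rightarrow> complex\<close>.  In the same way
  a polynomial function on \<open>h\<close> is represented by its restriction to \<open>h_R\<close>.
\<close>

definition cscale :: "complex \<Rightarrow> 'a::euclidean_space \<times> 'a \<Rightarrow> 'a \<times> 'a" where
  "cscale a y = (Re a *\<^sub>R fst y - Im a *\<^sub>R snd y, Re a *\<^sub>R snd y + Im a *\<^sub>R fst y)"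

definition pairing :: "'a::euclidean_space \<times> 'a \<Rightarrow> ('a \<Rightarrow> complex) \<Rightarrow> complex" where
  "pairing y \<xi> = \<xi> (fst y) + \<i> * \<xi> (snd y)"

text \<open>The Hermitian product on \<open>h\<close>, linear in the first argument.\<close>

definition herm :: "'a::euclidean_space \<times> 'a \<Rightarrow> 'a \<times> 'a \<Rightarrow> complex" where
  "herm y z = Complex (inner (fst y) (fst z) + inner (snd y) (snd z))
     (inner (snd y) (fst z) - inner (fst y) (snd z))"

text \<open>The antilinear isomorphism \<open>T\<close> with \<open>(T y) z = (z, y)\<close>; here \<open>z = (v, 0)\<close> is real.\<close>

definition T_map :: "'a::euclidean_space \<times> 'a \<Rightarrow> 'a \<Rightarrow> complex" where
  "T_map y = (\<lambda>v. herm (v, 0) y)"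

definition act_h :: "('a::euclidean_space \<Rightarrow> 'a) \<Rightarrow> 'a \<times> 'a \<Rightarrow> 'a \<times> 'a" where
  "act_h w y = (w (fst y), w (snd y))"

definition act_dual :: "('a::euclidean_space \<Rightarrow> 'a) \<Rightarrow> ('a \<Rightarrow> complex) \<Rightarrow> 'a \<Rightarrow> complex" where
  "act_dual w \<xi> = (\<lambda>v. \<xi> (inv_into UNIV w v))"

section \<open>Free algebras\<close>

text \<open>
  The convolution algebra \<open>'g fword \<Rightarrow>\<^sub>0 complex\<close> of finitely supported functions on the free
  monoid is the free associative unital algebra over the complex numbers on the set \<open>'g\<close>.
\<close>

datatype 'g fword = FWord (letters: "'g list")

instantiation fword :: (type) monoid_add
begin

definition zero_fword :: "'a fword" where "zero_fword = FWord []"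

definition plus_fword :: "'a fword \<Rightarrow> 'a fword \<Rightarrow> 'a fword" where
  "plus_fword u v = FWord (letters u @ letters v)"

instance by standard (simp_all add: zero_fword_def plus_fword_def)

end

datatype 'a gen =
    GW "'a \<Rightarrow> 'a"
  | GX "'a \<Rightarrow> complex"
  | GY "'a \<times> 'a"

type_synonym 'a free = "'a gen fword \<Rightarrow>\<^sub>0 complex"

abbreviation gen :: "'a gen \<Rightarrow> 'a free" where
  "gen g \<equiv> Poly_Mapping.single (FWord [g]) 1"

abbreviation scal :: "complex \<Rightarrow> 'a free" where
  "scal a \<equiv> Poly_Mapping.single 0 a"

text \<open>\<open>T(h^*)\<close> inside the free algebra, and the polynomial function defined by one of its elements.\<close>

definition dual_tensors :: "'a::euclidean_space free set" where
  "dual_tensors = {p. \<forall>u\<in>Poly_Mapping.keys p. \<forall>g\<in>set (letters u). \<exists>\<xi>. linear \<xi> \<and> g = GX \<xi>}"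

definition dual_tensors_of_degree :: "nat \<Rightarrow> 'a::euclidean_space free set" where
  "dual_tensors_of_degree d = {p \<in> dual_tensors. \<forall>u\<in>Poly_Mapping.keys p. length (letters u) = d}"

fun eval_gen :: "'a gen \<Rightarrow> 'a \<Rightarrow> complex" where
  "eval_gen (GX \<xi>) v = \<xi> v"
| "eval_gen _ v = 0"

definition eval_tensor :: "'a free \<Rightarrow> 'a \<Rightarrow> complex" where
  "eval_tensor p v = (\<Sum>u\<in>Poly_Mapping.keys p.
     Poly_Mapping.lookup p u * (\<Prod>g\<leftarrow>letters u. eval_gen g v))"

definition left_ideal :: "('r, 'm) ring_scheme \<Rightarrow> 'r set \<Rightarrow> bool" where
  "left_ideal R J \<longleftrightarrow> additive_subgroup J R \<and> (\<forall>r\<in>carrier R. \<forall>j\<in>J. r \<otimes>\<^bsub>R\<^esub> j \<in> J)"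

section \<open>The rational Cherednik algebra and its polynomial representation\<close>

text \<open>
  \<open>\<alpha> s\<close> and \<open>\<alpha>v s\<close> are an arbitrary choice of root and coroot for each reflection \<open>s\<close>.  The
  algebra does not depend on the choice, and the measure \<open>mu\<close> changes by a positive factor only.
\<close>

locale rational_cherednik =
  fixes W :: "('a::euclidean_space \<Rightarrow> 'a) set"
    and \<alpha> :: "('a \<Rightarrow> 'a) \<Rightarrow> 'a \<Rightarrow> real"
    and \<alpha>v :: "('a \<Rightarrow> 'a) \<Rightarrow> 'a"
    and c :: real
  assumes finite_W: "finite W"
    and orthogonal_W: "w \<in> W \<Longrightarrow> orthogonal_transformation w"
    and id_W: "id \<in> W"
    and comp_W: "w \<in> W \<Longrightarrow> w' \<in> W \<Longrightarrow> w \<circ> w' \<in> W"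
    and inv_W: "w \<in> W \<Longrightarrow> inv_into UNIV w \<in> W"
    and linear_root: "s \<in> W \<Longrightarrow> dim (range (\<lambda>v. s v - v)) = 1 \<Longrightarrow> linear (\<alpha> s)"
    and root: "s \<in> W \<Longrightarrow> dim (range (\<lambda>v. s v - v)) = 1 \<Longrightarrow>
      {\<lambda>v. act_dual s \<xi> v - \<xi> v |\<xi>. linear \<xi>} = {\<lambda>v. a * complex_of_real (\<alpha> s v) |a. True}"
    and coroot: "s \<in> W \<Longrightarrow> dim (range (\<lambda>v. s v - v)) = 1 \<Longrightarrow>
      {act_h s y - y |y. True} = {cscale a (\<alpha>v s, 0) |a. True}"
    and root_coroot: "s \<in> W \<Longrightarrow> dim (range (\<lambda>v. s v - v)) = 1 \<Longrightarrow> \<alpha> s (\<alpha>v s) = 2"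
begin

definition reflections :: "('a \<Rightarrow> 'a) set" where
  "reflections = {s \<in> W. dim (range (\<lambda>v. s v - v)) = 1}"

text \<open>
  The free algebra on the disjoint union of \<open>W\<close>, \<open>h^*\<close> and \<open>h\<close>.  Its quotient by \<open>smash_relations\<close>
  is the semidirect product of the group algebra of \<open>W\<close> with the tensor algebra of the direct sum
  of \<open>h\<close> and \<open>h^*\<close>.
\<close>

definition free_algebra :: "'a free ring" where
  "free_algebra =
     \<lparr>carrier = {p. \<forall>u\<in>Poly_Mapping.keys p. \<forall>g\<in>set (letters u).
          case g of GW w \<Rightarrow> w \<in> W | GX \<xi> \<Rightarrow> linear \<xi> | GY y \<Rightarrow> True},
      monoid.mult = (*), one = 1, zero = 0, add = (+)\<rparr>"

definition smash_relations :: "'a free set" where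
  "smash_relations =
     {gen (GW id) - 1}
   \<union> {gen (GW w) * gen (GW w') - gen (GW (w \<circ> w')) |w w'. w \<in> W \<and> w' \<in> W}
   \<union> {gen (GX (\<lambda>v. a * \<xi> v + b * \<eta> v)) - (scal a * gen (GX \<xi>) + scal b * gen (GX \<eta>))
        |a b \<xi> \<eta>. linear \<xi> \<and> linear \<eta>}
   \<union> {gen (GY (cscale a y + cscale b z)) - (scal a * gen (GY y) + scal b * gen (GY z))
        |a b y z. True}
   \<union> {gen (GW w) * gen (GX \<xi>) - gen (GX (act_dual w \<xi>)) * gen (GW w) |w \<xi>. w \<in> W \<and> linear \<xi>}
   \<union> {gen (GW w) * gen (GY y) - gen (GY (act_h w y)) * gen (GW w) |w y. w \<in> W}"

definition cherednik_relations :: "'a free set" where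
  "cherednik_relations =
     {gen (GX \<xi>) * gen (GX \<eta>) - gen (GX \<eta>) * gen (GX \<xi>) |\<xi> \<eta>. linear \<xi> \<and> linear \<eta>}
   \<union> {gen (GY y) * gen (GY z) - gen (GY z) * gen (GY y) |y z. True}
   \<union> {gen (GY y) * gen (GX \<xi>) - gen (GX \<xi>) * gen (GY y)
        - (scal (pairing y \<xi>)
           - scal (complex_of_real c) *
             (\<Sum>s\<in>reflections.
                scal (pairing y (\<lambda>v. complex_of_real (\<alpha> s v)) * pairing (\<alpha>v s, 0) \<xi>) * gen (GW s)))
        |y \<xi>. linear \<xi>}"

definition rel_ideal :: "'a free set" where
  "rel_ideal = Idl\<^bsub>free_algebra\<^esub> (smash_relations \<union> cherednik_relations)"

definition H_alg :: "'a free set ring" where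
  "H_alg = free_algebra Quot rel_ideal"

definition cls :: "'a free \<Rightarrow> 'a free set" where
  "cls p = rel_ideal +>\<^bsub>free_algebra\<^esub> p"

text \<open>
  \<open>M_c(\<complex>)\<close> is induced from the one-dimensional module of the subalgebra generated by \<open>W\<close> and \<open>h\<close>
  on which \<open>w\<close> acts by 1 and \<open>y\<close> by 0.  The kernel of this character is the left ideal of the
  subalgebra generated by all \<open>w - 1\<close> and \<open>y\<close>; hence the tensor product is the quotient of
  \<open>H_c\<close> by the left ideal which these elements generate, and \<open>h \<otimes> 1\<close> is the coset of \<open>h\<close>.
\<close>

definition triv_ideal :: "'a free set set" where
  "triv_ideal = \<Inter>{J. left_ideal H_alg J \<and>
      {cls (gen (GW w) - 1) |w. w \<in> W} \<union> {cls (gen (GY y)) |y. True} \<subseteq> J}"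

definition M_triv :: "'a free set set set" where
  "M_triv = a_rcosets\<^bsub>H_alg\<^esub> triv_ideal"

definition act :: "'a free set \<Rightarrow> 'a free set set \<Rightarrow> 'a free set set" where
  "act h m = triv_ideal <+>\<^bsub>H_alg\<^esub> (h <#\<^bsub>H_alg\<^esub> m)"

abbreviation madd :: "'a free set set \<Rightarrow> 'a free set set \<Rightarrow> 'a free set set" where
  "madd m m' \<equiv> m <+>\<^bsub>H_alg\<^esub> m'"

abbreviation mzero :: "'a free set set" where
  "mzero \<equiv> triv_ideal"

definition submodule :: "'a free set set set \<Rightarrow> bool" where
  "submodule N \<longleftrightarrow> N \<subseteq> M_triv \<and> mzero \<in> N \<and> (\<forall>m\<in>N. \<forall>m'\<in>N. madd m m' \<in> N)
     \<and> (\<forall>h\<in>carrier H_alg. \<forall>m\<in>N. act h m \<in> N)"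

text \<open>The minimal nonzero submodule \<open>N_c\<close>.\<close>

definition is_minimal_nonzero_submodule :: "'a free set set set \<Rightarrow> bool" where
  "is_minimal_nonzero_submodule N \<longleftrightarrow> submodule N \<and> N \<noteq> {mzero}
     \<and> (\<forall>N'. submodule N' \<and> N' \<noteq> {mzero} \<longrightarrow> N \<subseteq> N')"

definition N_min :: "'a free set set set" where
  "N_min = (THE N. is_minimal_nonzero_submodule N)"

text \<open>
  The identification of \<open>\<complex>[h] = S(h^*)\<close> with \<open>M_c(\<complex>)\<close> sends the polynomial function of a tensor
  \<open>p\<close> to \<open>p \<otimes> 1\<close>.  The set \<open>polynomials N\<close> is the space of polynomials corresponding to \<open>N\<close>.
\<close>

definition tensor_one :: "'a free \<Rightarrow> 'a free set set" where
  "tensor_one p = triv_ideal +>\<^bsub>H_alg\<^esub> cls p"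

definition polynomials :: "'a free set set set \<Rightarrow> ('a \<Rightarrow> complex) set" where
  "polynomials N = {eval_tensor p |p. p \<in> dual_tensors \<and> tensor_one p \<in> N}"

definition degree_part :: "nat \<Rightarrow> 'a free set set set" where
  "degree_part d = tensor_one ` dual_tensors_of_degree d"

definition lowest_part :: "'a free set set set \<Rightarrow> 'a free set set set" where
  "lowest_part N = N \<inter> degree_part (LEAST d. N \<inter> degree_part d \<noteq> {mzero})"

subsection \<open>Square integrability\<close>

definition mu :: "'a measure" where
  "mu = density lborel (\<lambda>z. ennreal (exp (- (norm z)\<^sup>2 / 2) *
      (\<Prod>s\<in>reflections. \<bar>\<alpha> s z\<bar> powr (- 2 * c))))"

definition contained_in_L2 :: "'a free set set set \<Rightarrow> bool" where
  "contained_in_L2 N \<longleftrightarrow>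
     (\<forall>P\<in>polynomials N. (\<integral>\<^sup>+ z. ennreal ((cmod (P z))\<^sup>2) \<partial>mu) < \<infinity>)"

subsection \<open>Unitarity\<close>

definition contravariant_form ::
    "'a free set set set \<Rightarrow> ('a free set set \<Rightarrow> 'a free set set \<Rightarrow> complex) \<Rightarrow> bool" where
  "contravariant_form N B \<longleftrightarrow>
     (\<forall>m\<in>N. \<forall>m'\<in>N. \<forall>k\<in>N. B (madd m m') k = B m k + B m' k)
   \<and> (\<forall>a. \<forall>m\<in>N. \<forall>k\<in>N. B (act (cls (scal a)) m) k = a * B m k)
   \<and> (\<forall>m\<in>N. \<forall>k\<in>N. B k m = cnj (B m k))
   \<and> (\<forall>w\<in>W. \<forall>m\<in>N. \<forall>k\<in>N. B (act (cls (gen (GW w))) m) (act (cls (gen (GW w))) k) = B m k)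
   \<and> (\<forall>y. \<forall>m\<in>N. \<forall>k\<in>N. B (act (cls (gen (GY y))) m) k = B m (act (cls (gen (GX (T_map y)))) k))"

text \<open>For a Hermitian form \<open>B m m\<close> is real.\<close>

definition positive_definite_on ::
    "'a free set set set \<Rightarrow> ('a free set set \<Rightarrow> 'a free set set \<Rightarrow> complex) \<Rightarrow> bool" where
  "positive_definite_on N B \<longleftrightarrow> (\<forall>m\<in>N. m \<noteq> mzero \<longrightarrow> Re (B m m) > 0)"

text \<open>
  The contravariant form of an irreducible lowest weight module is normalised by prescribing a
  positive definite form on the lowest degree component; the module is unitary if such a form
  exists and is positive definite, whatever the normalisation.
\<close>

definition unitary :: "'a free set set set \<Rightarrow> bool" where
  "unitary N \<longleftrightarrow>
     (\<exists>B. contravariant_form N B \<and> positive_definite_on (lowest_part N) B)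
   \<and> (\<forall>B. contravariant_form N B \<and> positive_definite_on (lowest_part N) B
          \<longrightarrow> positive_definite_on N B)"

end

section \<open>The symmetric group\<close>

definition perm_act :: "('n \<Rightarrow> 'n) \<Rightarrow> real ^ 'n \<Rightarrow> real ^ 'n" where
  "perm_act \<sigma> v = (\<chi> i. v $ inv_into UNIV \<sigma> i)"

definition sym_group :: "(real ^ 'n \<Rightarrow> real ^ 'n) set" where
  "sym_group = {perm_act \<sigma> |\<sigma>. \<sigma> permutes UNIV}"

text \<open>
  An isometric identification of a Euclidean space with the space of vectors with zero coordinate
  sum, and the symmetric group acting on this reflection representation.
\<close>

definition reflection_embedding :: "('a::euclidean_space \<Rightarrow> real ^ 'n) \<Rightarrow> bool" where
  "reflection_embedding \<iota> \<longleftrightarrow> linear \<iota> \<and> (\<forall>v. norm (\<iota> v) = norm v)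
     \<and> range \<iota> = {z. (\<Sum>i\<in>UNIV. z $ i) = 0}"

definition sym_group_refl :: "('a::euclidean_space \<Rightarrow> real ^ 'n) \<Rightarrow> ('a \<Rightarrow> 'a) set" where
  "sym_group_refl \<iota> = {g. \<exists>\<sigma>. \<sigma> permutes UNIV \<and> (\<forall>v. \<iota> (g v) = perm_act \<sigma> (\<iota> v))}"

end

(* The polynomial representation is realised on polynomial functions, with h acting by Dunkl
   operators. The minimal submodule lies in every nonzero submodule, so it suffices to find singular
   polynomials generating a square integrable submodule. Colour {1..n} with m-1 colours, as evenly as
   possible, and take the product of x_i - x_j over the pairs of equal colour. These polynomials are
   killed by the Dunkl operators: on a pair of colour classes this is the differentiated partial
   fraction expansion of a quotient of two products of linear factors.

   Integrability of their products against the singular weight is a power counting statement: when k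
   variables collide the total exponent exceeds -(k-1), by convexity of the squares of the numbers of
   variables of each colour. An iterated splitting at large gaps bounds the integrand by a sum, over
   spanning trees, of products of |x_i - x_j|^(-s) with s < 1, whose factors are independent.

   Square integrability makes x - D adjoint to the Dunkl operator D for the L^2 product (the weight is
   regularised by exp(-e/u), where u is the product of the squared roots, and the divided differences
   are produced by reflecting half of the integral). Conjugating the positive definite L^2 product
   with exp(-Lap/2) gives a positive definite contravariant form, and contravariant forms are unique up
   to scaling. *)

theory Submission
  imports Defs "HOL-Computational_Algebra.Polynomial" "HOL-Library.Function_Algebras"
    "HOL-Real_Asymp.Real_Asymp"
begin

section \<open>Polynomial functions on a Euclidean space\<close>

text \<open>The number of colours is dictated by \<open>c = 1/m\<close>. Differentiating the product
  in \<open>z i\<close> gives a sum \<open>S\<close> over the other variables of its colour. The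
  divided differences give \<open>2 * S\<close> from that colour and exactly \<open>S\<close> from
  each other colour, hence \<open>m * S\<close> for \<open>m - 1\<close> colours. Evenness bounds
  the degree of the numerators in the partial fractions, so that their polynomial part is a constant
  and disappears under differentiation. Integration by parts needs the products with one derivative
  as well, so one extra simple pole must stay integrable; the power counting is strict enough to pay
  for it. \<open>N_min\<close> is a definite description, so a least nonzero submodule has to be
  shown to exist. Elements of lowest degree are singular, a maximum on the unit sphere bounds their
  degree, and in bounded degree submodules are compared by dimension. The module is a quotient of a
  free algebra. Its identification with polynomials needs both halves of a normal form theorem:
  spanning by reordering words, independence by Euler's formula.\<close>

inductive is_hom :: "nat \<Rightarrow> ('a::euclidean_space \<Rightarrow> complex) \<Rightarrow> bool" where
  const: "is_hom 0 (\<lambda>x. a)"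
| lin: "linear \<xi> \<Longrightarrow> is_hom d f \<Longrightarrow> is_hom (Suc d) (\<lambda>x. \<xi> x * f x)"
| add: "is_hom d f \<Longrightarrow> is_hom d g \<Longrightarrow> is_hom d (\<lambda>x. f x + g x)"

definition Hom :: "nat \<Rightarrow> ('a::euclidean_space \<Rightarrow> complex) set" where
  "Hom d = {f. is_hom d f}"

lemma Hom_const: "(\<lambda>x. a) \<in> Hom 0"
  and Hom_lin: "linear \<xi> \<Longrightarrow> f \<in> Hom d \<Longrightarrow> (\<lambda>x. \<xi> x * f x) \<in> Hom (Suc d)"
  and Hom_add: "f \<in> Hom d \<Longrightarrow> g \<in> Hom d \<Longrightarrow> (\<lambda>x. f x + g x) \<in> Hom d"
  by (simp_all add: Hom_def is_hom.intros)

lemma Hom_induct [consumes 1, case_names const lin add]: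
  assumes "f \<in> Hom d"
    and "\<And>a. P 0 (\<lambda>x. a)"
    and "\<And>\<xi> f d. linear \<xi> \<Longrightarrow> f \<in> Hom d \<Longrightarrow> P d f \<Longrightarrow> P (Suc d) (\<lambda>x. \<xi> x * f x)"
    and "\<And>f d g. f \<in> Hom d \<Longrightarrow> P d f \<Longrightarrow> g \<in> Hom d \<Longrightarrow> P d g \<Longrightarrow> P d (\<lambda>x. f x + g x)"
  shows "P d f"
  using assms(1) unfolding Hom_def mem_Collect_eq
  by (induction rule: is_hom.induct) (use assms(2-4) in \<open>auto simp: Hom_def\<close>)

text \<open>Coordinate free, so that an induction step multiplies by one linear functional. This is
  the shape in which the product rules \<open>pd_lin\<close>, \<open>dd_lin\<close> and
  \<open>D_lin\<close> are available.\<close>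

inductive_set Pol :: "('a::euclidean_space \<Rightarrow> complex) set" where
  const: "(\<lambda>x. a) \<in> Pol"
| lin: "linear \<xi> \<Longrightarrow> f \<in> Pol \<Longrightarrow> (\<lambda>x. \<xi> x * f x) \<in> Pol"
| add: "f \<in> Pol \<Longrightarrow> g \<in> Pol \<Longrightarrow> (\<lambda>x. f x + g x) \<in> Pol"

lemma linear_const_mult:
  fixes \<xi> :: "'a::real_vector \<Rightarrow> complex"
  shows "linear \<xi> \<Longrightarrow> linear (\<lambda>x. a * \<xi> x)"
  by (auto simp: linear_iff algebra_simps)

lemma linear_zero_fun: "linear (\<lambda>x. 0)"
  by (simp add: linear_iff)

lemma Hom_scale: "f \<in> Hom d \<Longrightarrow> (\<lambda>x. a * f x) \<in> Hom d"
proof (induction rule: Hom_induct)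
  case (const b)
  show ?case by (rule Hom_const[of "a * b"])
next
  case (lin \<xi> f d)
  have "(\<lambda>x. \<xi> x * (a * f x)) \<in> Hom (Suc d)" by (rule Hom_lin) fact+
  then show ?case by (simp add: algebra_simps)
next
  case (add f d g)
  have "(\<lambda>x. a * f x + a * g x) \<in> Hom d" by (rule Hom_add) fact+
  then show ?case by (simp add: algebra_simps)
qed

lemma Hom_zero: "(\<lambda>x::'a::euclidean_space. 0) \<in> Hom d"
proof (induction d)
  case 0
  show ?case by (rule Hom_const)
next
  case (Suc d)
  have "(\<lambda>x::'a. 0 * 0) \<in> Hom (Suc d)"
    using Hom_lin[OF linear_zero_fun Suc] by simp
  then show ?case by simp
qed

lemma Hom_Pol: "f \<in> Hom d \<Longrightarrow> f \<in> Pol"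
  by (induction rule: Hom_induct) (auto intro: Pol.intros)

lemma Pol_lin1: "linear \<xi> \<Longrightarrow> \<xi> \<in> Pol"
  using Pol.lin[OF _ Pol.const[of 1], of \<xi>] by simp

lemma Pol_mult: "f \<in> Pol \<Longrightarrow> g \<in> Pol \<Longrightarrow> (\<lambda>x. f x * g x) \<in> Pol"
proof (induction f rule: Pol.induct)
  case (const a)
  from const show ?case
  proof (induction g rule: Pol.induct)
    case (const b)
    show ?case by (rule Pol.const)
  next
    case (lin \<xi> f)
    have "(\<lambda>x. \<xi> x * (a * f x)) \<in> Pol" by (rule Pol.lin) fact+
    then show ?case by (simp add: algebra_simps)
  next
    case (add f g)
    have "(\<lambda>x. a * f x + a * g x) \<in> Pol" by (rule Pol.add) fact+
    then show ?case by (simp add: algebra_simps)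
  qed
next
  case (lin \<xi> f)
  have "(\<lambda>x. \<xi> x * (f x * g x)) \<in> Pol" by (rule Pol.lin) (use lin in auto)
  then show ?case by (simp add: algebra_simps)
next
  case (add f g')
  have "(\<lambda>x. f x * g x + g' x * g x) \<in> Pol" by (rule Pol.add) (use add in auto)
  then show ?case by (simp add: algebra_simps)
qed

lemma Pol_scale: "f \<in> Pol \<Longrightarrow> (\<lambda>x. a * f x) \<in> Pol"
  by (rule Pol_mult[OF Pol.const])

lemma Pol_diff: "f \<in> Pol \<Longrightarrow> g \<in> Pol \<Longrightarrow> (\<lambda>x. f x - g x) \<in> Pol"
  using Pol.add[OF _ Pol_scale[of g "-1"], of f] by simp

lemma Hom_diff: "f \<in> Hom d \<Longrightarrow> g \<in> Hom d \<Longrightarrow> (\<lambda>x. f x - g x) \<in> Hom d"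
  using Hom_add[OF _ Hom_scale[of g d "-1"], of f] by simp

lemma Hom_sum: "(\<And>i. i \<in> I \<Longrightarrow> f i \<in> Hom d) \<Longrightarrow> (\<lambda>x. \<Sum>i\<in>I. f i x) \<in> Hom d"
  by (induction I rule: infinite_finite_induct) (auto intro: Hom_zero Hom_add)

lemma Pol_sum: "(\<And>i. i \<in> I \<Longrightarrow> f i \<in> Pol) \<Longrightarrow> (\<lambda>x. \<Sum>i\<in>I. f i x) \<in> Pol"
  by (induction I rule: infinite_finite_induct) (auto intro: Pol.intros)

lemma Pol_prod: "(\<And>i. i \<in> I \<Longrightarrow> f i \<in> Pol) \<Longrightarrow> (\<lambda>x. \<Prod>i\<in>I. f i x) \<in> Pol"
  by (induction I rule: infinite_finite_induct) (auto intro: Pol.const Pol_mult)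

lemma Pol_cnj: "f \<in> Pol \<Longrightarrow> (\<lambda>x. cnj (f x)) \<in> Pol"
proof (induction rule: Pol.induct)
  case (lin \<xi> f)
  have "linear (\<lambda>x. cnj (\<xi> x))" using lin(1) by (auto simp: linear_iff)
  from Pol.lin[OF this lin.IH] show ?case by simp
next
  case (add f g)
  from Pol.add[OF add.IH] show ?case by simp
qed (rule Pol.const)

lemma linear_of_real: "linear \<alpha> \<Longrightarrow> linear (\<lambda>x. complex_of_real (\<alpha> x))"
  by (auto simp: linear_iff scaleR_conv_of_real)

lemma Hom_compose: "f \<in> Hom d \<Longrightarrow> linear w \<Longrightarrow> (\<lambda>x. f (w x)) \<in> Hom d"
proof (induction rule: Hom_induct)
  case (lin \<xi> f d)
  have "linear (\<lambda>x. \<xi> (w x))" using lin by (auto simp: linear_iff)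
  with lin show ?case using Hom_lin by fastforce
qed (auto intro: Hom_const Hom_lin Hom_add)

lemma Pol_compose: "f \<in> Pol \<Longrightarrow> linear w \<Longrightarrow> (\<lambda>x. f (w x)) \<in> Pol"
proof (induction rule: Pol.induct)
  case (lin \<xi> f)
  have "linear (\<lambda>x. \<xi> (w x))" using lin by (auto simp: linear_iff)
  with lin show ?case using Pol.lin by fastforce
qed (auto intro: Pol.intros)

lemma Hom_scaleR: "f \<in> Hom d \<Longrightarrow> f (t *\<^sub>R x) = of_real t ^ d * f x"
  by (induction rule: Hom_induct) (auto simp: linear_cmul algebra_simps scaleR_conv_of_real)

lemma Pol_decompose: "f \<in> Pol \<Longrightarrow> \<exists>n F. (\<forall>d. F d \<in> Hom d) \<and> f = (\<lambda>x. \<Sum>d\<le>n. F d x)"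
proof (induction rule: Pol.induct)
  case (const a)
  show ?case
    by (rule exI[of _ 0], rule exI[of _ "\<lambda>d. if d = 0 then (\<lambda>x. a) else (\<lambda>x. 0)"]) (auto intro: Hom_const Hom_zero)
next
  case (lin \<xi> f)
  then obtain n F where F: "\<forall>d. F d \<in> Hom d" "f = (\<lambda>x. \<Sum>d\<le>n. F d x)" by auto
  let ?F = "\<lambda>d. case d of 0 \<Rightarrow> (\<lambda>x. 0) | Suc d \<Rightarrow> (\<lambda>x. \<xi> x * F d x)"
  have "\<forall>d. ?F d \<in> Hom d" using F(1) lin(1) by (auto intro: Hom_zero Hom_lin split: nat.split)
  moreover have "(\<lambda>x. \<xi> x * f x) = (\<lambda>x. \<Sum>d\<le>Suc n. ?F d x)"
    unfolding sum.atMost_Suc_shift F(2) by (auto simp: sum_distrib_left)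
  ultimately show ?case by blast
next
  case (add f g)
  then obtain n F m G where F: "\<forall>d. F d \<in> Hom d" "f = (\<lambda>x. \<Sum>d\<le>n. F d x)"
    and G: "\<forall>d. G d \<in> Hom d" "g = (\<lambda>x. \<Sum>d\<le>m. G d x)" by auto
  define F' where "F' d = (if d \<le> n then F d else (\<lambda>x. 0))" for d
  define G' where "G' d = (if d \<le> m then G d else (\<lambda>x. 0))" for d
  have "f x = (\<Sum>d\<le>max n m. F' d x)" for x
    unfolding F(2) by (rule sum.mono_neutral_cong_left) (auto simp: F'_def)
  moreover have "g x = (\<Sum>d\<le>max n m. G' d x)" for x
    unfolding G(2) by (rule sum.mono_neutral_cong_left) (auto simp: G'_def)
  ultimately have "(\<lambda>x. f x + g x) = (\<lambda>x. \<Sum>d\<le>max n m. F' d x + G' d x)"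
    by (auto simp: sum.distrib)
  moreover have "\<forall>d. (\<lambda>x. F' d x + G' d x) \<in> Hom d"
    using F G by (auto simp: F'_def G'_def intro: Hom_add Hom_zero)
  ultimately show ?case by (intro exI[of _ "max n m"] exI[of _ "\<lambda>d x. F' d x + G' d x"]) blast
qed

text \<open>Scaling \<open>x\<close> by a real \<open>t\<close> turns the sum into a polynomial in
  \<open>t\<close> whose coefficients are the values \<open>F d x\<close>; it has infinitely many
  roots.\<close>

lemma Hom_sum_eq_0:
  assumes "\<And>d. F d \<in> Hom d" "\<And>x. (\<Sum>d\<le>n. F d x) = 0" "d \<le> n"
  shows "F d x = 0"
proof -
  have "(\<Sum>d\<le>n. F d x * z ^ d) = poly (\<Sum>d\<le>n. monom (F d x) d) z" for z
    by (simp add: poly_sum poly_monom)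
  moreover have "(\<Sum>d\<le>n. F d x * of_real t ^ d) = 0" for t
    using assms(2)[of "t *\<^sub>R x"] Hom_scaleR[OF assms(1)] by (simp add: mult.commute)
  ultimately have r: "poly (\<Sum>d\<le>n. monom (F d x) d) (of_real t) = 0" for t
    by simp
  have "range complex_of_real \<subseteq> {z. poly (\<Sum>d\<le>n. monom (F d x) d) z = 0}" using r by auto
  moreover have "infinite (range complex_of_real)"
    by (simp add: finite_image_iff infinite_UNIV_char_0 inj_of_real)
  ultimately have "(\<Sum>d\<le>n. monom (F d x) d) = 0"
    using poly_roots_finite finite_subset by blast
  then have "coeff (\<Sum>d\<le>n. monom (F d x) d) d = 0" by simp
  then show ?thesis using assms(3) by (simp add: coeff_sum)
qed

lemma Pol_line: "f \<in> Pol \<Longrightarrow> \<exists>p. \<forall>t. f (a + t *\<^sub>R v) = poly p (complex_of_real t)"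
proof (induction rule: Pol.induct)
  case (const b)
  show ?case by (rule exI[of _ "[:b:]"]) simp
next
  case (lin \<xi> f)
  then obtain p where p: "\<forall>t. f (a + t *\<^sub>R v) = poly p (complex_of_real t)" by auto
  have "\<xi> (a + t *\<^sub>R v) = poly [:\<xi> a, \<xi> v:] (complex_of_real t)" for t
    using lin(1) by (simp add: linear_add linear_cmul scaleR_conv_of_real)
  then show ?case using p by (intro exI[of _ "[:\<xi> a, \<xi> v:] * p"]) (simp del: mult_pCons_left)
next
  case (add f g)
  then obtain p q where "\<forall>t. f (a + t *\<^sub>R v) = poly p (complex_of_real t)"
    "\<forall>t. g (a + t *\<^sub>R v) = poly q (complex_of_real t)" by auto
  then show ?case by (intro exI[of _ "p + q"]) simp
qed

text \<open>Restricted to the line from \<open>x\<close> to \<open>b\<close>, both functions are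
  one-variable polynomials, nonzero if the claim fails, and their product vanishes at all real
  parameters. With a product of roots as \<open>g\<close>, this extends identities from the
  complement of the reflecting hyperplanes to the whole space.\<close>

lemma Pol_domain:
  assumes "f \<in> Pol" "g \<in> Pol" "\<And>x. f x * g x = 0" "g b \<noteq> 0"
  shows "f x = 0"
proof (rule ccontr)
  assume nz: "f x \<noteq> 0"
  obtain p where p: "\<forall>t. f (x + t *\<^sub>R (b - x)) = poly p (complex_of_real t)"
    using Pol_line[OF assms(1)] by blast
  obtain q where q: "\<forall>t. g (x + t *\<^sub>R (b - x)) = poly q (complex_of_real t)"
    using Pol_line[OF assms(2)] by blast
  have "p \<noteq> 0" using p[rule_format, of 0] nz by auto
  moreover have "q \<noteq> 0" using q[rule_format, of 1] assms(4) by auto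
  ultimately have "p * q \<noteq> 0" by simp
  have "poly (p * q) (of_real t) = 0" for t using p q assms(3)
    by (metis poly_mult)
  then have "range complex_of_real \<subseteq> {z. poly (p * q) z = 0}" by auto
  moreover have "infinite (range complex_of_real)"
    by (simp add: finite_image_iff infinite_UNIV_char_0 inj_of_real)
  ultimately show False
    using poly_roots_finite[OF \<open>p * q \<noteq> 0\<close>] finite_subset by blast
qed

section \<open>Directional derivatives of polynomial functions\<close>

definition pd :: "'a::euclidean_space \<Rightarrow> ('a \<Rightarrow> complex) \<Rightarrow> 'a \<Rightarrow> complex" where
  "pd y f x = vector_derivative (\<lambda>t. f (x + t *\<^sub>R y)) (at 0)"

lemma Pol_has_pd: "f \<in> Pol \<Longrightarrow> ((\<lambda>t. f (x + t *\<^sub>R y)) has_vector_derivative pd y f (x + t *\<^sub>R y)) (at t)"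
proof -
  assume f: "f \<in> Pol"
  obtain p where p: "\<forall>t. f (x + t *\<^sub>R y) = poly p (complex_of_real t)"
    using Pol_line[OF f] by blast
  have d: "((\<lambda>t. f (x + t *\<^sub>R y)) has_vector_derivative poly (pderiv p) (of_real t)) (at t)" for t
    using has_vector_derivative_real_field[OF poly_DERIV[of p "of_real t"]] p by auto
  have "((\<lambda>u. f (x + t *\<^sub>R y + u *\<^sub>R y)) has_vector_derivative poly (pderiv p) (of_real t)) (at 0)"
  proof -
    have "((\<lambda>u. t + u) has_vector_derivative 1) (at 0)"
      by (auto intro!: derivative_eq_intros)
    from vector_diff_chain_at[OF this, of "\<lambda>t. f (x + t *\<^sub>R y)" "poly (pderiv p) (of_real t)"] d[of t]
    have "((\<lambda>u. f (x + (t + u) *\<^sub>R y)) has_vector_derivative poly (pderiv p) (of_real t)) (at 0)"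
      by (simp add: o_def)
    moreover have "(\<lambda>u. f (x + (t + u) *\<^sub>R y)) = (\<lambda>u. f (x + t *\<^sub>R y + u *\<^sub>R y))"
      by (simp only: scaleR_add_left add.assoc)
    ultimately show ?thesis by simp
  qed
  then have "pd y f (x + t *\<^sub>R y) = poly (pderiv p) (of_real t)"
    unfolding pd_def by (rule vector_derivative_at)
  then show ?thesis using d by simp
qed

lemma pd_eqI: "((\<lambda>t. f (x + t *\<^sub>R y)) has_vector_derivative D) (at 0) \<Longrightarrow> pd y f x = D"
  unfolding pd_def by (rule vector_derivative_at)

lemma Pol_has_pd0: "f \<in> Pol \<Longrightarrow> ((\<lambda>t. f (x + t *\<^sub>R y)) has_vector_derivative pd y f x) (at 0)"
  using Pol_has_pd[of f x y 0] by simp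

lemma pd_const: "pd y (\<lambda>x. a) x = 0"
  by (rule pd_eqI) simp

lemma pd_add: "f \<in> Pol \<Longrightarrow> g \<in> Pol \<Longrightarrow> pd y (\<lambda>x. f x + g x) x = pd y f x + pd y g x"
  by (rule pd_eqI) (intro has_vector_derivative_add Pol_has_pd0)

lemma pd_mult: "f \<in> Pol \<Longrightarrow> g \<in> Pol \<Longrightarrow> pd y (\<lambda>x. f x * g x) x = f x * pd y g x + pd y f x * g x"
  by (rule pd_eqI) (use has_vector_derivative_mult[OF Pol_has_pd0 Pol_has_pd0, of f g x y x y] in simp)

lemma pd_lin1: "linear \<xi> \<Longrightarrow> pd y \<xi> x = \<xi> y"
  by (rule pd_eqI) (auto simp: linear_add linear_cmul intro!: derivative_eq_intros)

lemma pd_lin: "linear \<xi> \<Longrightarrow> f \<in> Pol \<Longrightarrow> pd y (\<lambda>x. \<xi> x * f x) x = \<xi> y * f x + \<xi> x * pd y f x"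
  by (simp add: pd_mult Pol_lin1 pd_lin1)

lemma pd_scale: "f \<in> Pol \<Longrightarrow> pd y (\<lambda>x. a * f x) x = a * pd y f x"
  by (simp add: pd_mult Pol.const pd_const)

lemma pd_sum: "(\<And>i. i \<in> I \<Longrightarrow> f i \<in> Pol) \<Longrightarrow> pd y (\<lambda>x. \<Sum>i\<in>I. f i x) x = (\<Sum>i\<in>I. pd y (f i) x)"
  by (induction I rule: infinite_finite_induct) (auto simp: pd_const pd_add Pol_sum)

text \<open>The subtraction is truncated, so degree \<open>0\<close> needs the second conjunct:
  without it \<open>\<xi> x * pd y f x\<close> could not be placed in \<open>Hom d\<close> for
  \<open>d = 0\<close>.\<close>

lemma Hom_pd: "f \<in> Hom d \<Longrightarrow> pd y f \<in> Hom (d - 1) \<and> (d = 0 \<longrightarrow> pd y f = (\<lambda>x. 0))"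
proof (induction rule: Hom_induct)
  case (const a)
  show ?case by (auto simp: pd_const fun_eq_iff intro: Hom_zero)
next
  case (lin \<xi> f d)
  have "pd y (\<lambda>x. \<xi> x * f x) = (\<lambda>x. \<xi> y * f x + \<xi> x * pd y f x)"
    using lin by (auto simp: pd_lin Hom_Pol)
  moreover have "(\<lambda>x. \<xi> x * pd y f x) \<in> Hom d"
  proof (cases d)
    case 0
    then show ?thesis using lin by (simp add: Hom_zero)
  next
    case (Suc k)
    then show ?thesis using lin Hom_lin[of \<xi> "pd y f" k] by simp
  qed
  ultimately show ?case using lin by (auto intro!: Hom_add Hom_scale)
next
  case (add f d g)
  have "pd y (\<lambda>x. f x + g x) = (\<lambda>x. pd y f x + pd y g x)"
    using add by (auto simp: pd_add Hom_Pol)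
  then show ?case using add by (auto intro: Hom_add)
qed

lemma Pol_pd: "f \<in> Pol \<Longrightarrow> pd y f \<in> Pol"
proof (induction rule: Pol.induct)
  case (const a)
  have "pd y (\<lambda>x. a) = (\<lambda>x. 0)" by (auto simp: pd_const)
  then show ?case by (simp add: Pol.const)
next
  case (lin \<xi> f)
  have "pd y (\<lambda>x. \<xi> x * f x) = (\<lambda>x. \<xi> y * f x + \<xi> x * pd y f x)"
    using lin by (auto simp: pd_lin)
  then show ?case using lin by (auto intro!: Pol.add Pol_scale Pol.lin)
next
  case (add f g)
  have "pd y (\<lambda>x. f x + g x) = (\<lambda>x. pd y f x + pd y g x)"
    using add by (auto simp: pd_add)
  then show ?case using add by (auto intro: Pol.add)
qed

lemma Pol_pd_linear: "f \<in> Pol \<Longrightarrow> linear (\<lambda>y. pd y f x)"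
proof (induction rule: Pol.induct)
  case (const a)
  show ?case by (simp add: pd_const linear_zero_fun)
next
  case (lin \<xi> f)
  then show ?case by (auto simp: pd_lin linear_iff algebra_simps)
next
  case (add f g)
  then show ?case by (auto simp: pd_add linear_iff algebra_simps)
qed

lemma Pol_continuous: "f \<in> Pol \<Longrightarrow> continuous_on A f"
  by (induction rule: Pol.induct) (auto intro!: continuous_intros simp: linear_continuous_on linear_conv_bounded_linear)

lemma Pol_growth: "f \<in> Pol \<Longrightarrow> \<exists>K\<ge>0. \<exists>k. \<forall>x. cmod (f x) \<le> K * (1 + norm x) ^ k"
proof (induction rule: Pol.induct)
  case (const a)
  show ?case by (rule exI[of _ "cmod a"]) (auto intro: exI[of _ 0])
next
  case (lin \<xi> f)
  then obtain K k where K: "K \<ge> 0" "\<And>x. cmod (f x) \<le> K * (1 + norm x) ^ k" by auto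
  obtain B where B: "B > 0" "\<And>x. cmod (\<xi> x) \<le> B * norm x"
    using linear_bounded_pos[OF lin(1)] by blast
  have "cmod (\<xi> x * f x) \<le> (B * K) * (1 + norm x) ^ Suc k" for x
  proof -
    have "cmod (\<xi> x * f x) \<le> (B * (1 + norm x)) * (K * (1 + norm x) ^ k)"
      unfolding norm_mult
      by (rule mult_mono) (use B K in \<open>auto intro: order_trans[OF B(2)]\<close>)
    then show ?thesis by (simp add: algebra_simps)
  qed
  then show ?case using B K by (intro exI[of _ "B*K"] conjI exI[of _ "Suc k"]) auto
next
  case (add f g)
  then obtain K k L l where K: "K \<ge> 0" "\<And>x. cmod (f x) \<le> K * (1 + norm x) ^ k"
    and L: "L \<ge> 0" "\<And>x. cmod (g x) \<le> L * (1 + norm x) ^ l" by auto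
  have "cmod (f x + g x) \<le> (K + L) * (1 + norm x) ^ (k + l)" for x
  proof -
    have "cmod (f x + g x) \<le> K * (1 + norm x) ^ k + L * (1 + norm x) ^ l"
      using norm_triangle_ineq[of "f x" "g x"] K(2)[of x] L(2)[of x] by simp
    also have "\<dots> \<le> K * (1 + norm x) ^ (k+l) + L * (1 + norm x) ^ (k+l)"
      using K L by (intro add_mono mult_left_mono power_increasing) auto
    finally show ?thesis by (simp add: algebra_simps)
  qed
  then show ?case using K L by (intro exI[of _ "K+L"] conjI exI[of _ "k+l"]) auto
qed

lemma Pol_measurable: "f \<in> Pol \<Longrightarrow> f \<in> borel_measurable borel"
  by (rule borel_measurable_continuous_onI[OF Pol_continuous])

lemma linear_expand:
  fixes \<xi> :: "'a::euclidean_space \<Rightarrow> complex"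
  assumes "linear \<xi>"
  shows "\<xi> x = (\<Sum>b\<in>Basis. of_real (x \<bullet> b) * \<xi> b)"
proof -
  have "\<xi> x = \<xi> (\<Sum>b\<in>Basis. (x \<bullet> b) *\<^sub>R b)" by (simp add: euclidean_representation)
  also have "\<dots> = (\<Sum>b\<in>Basis. of_real (x \<bullet> b) * \<xi> b)"
    using assms by (simp add: linear_sum linear_cmul scaleR_conv_of_real)
  finally show ?thesis .
qed

text \<open>The homogeneous pieces are finite dimensional: multiply a spanning set of one degree by
  the coordinate functions. The dimension count for the minimal submodule and the orthonormal
  expansions in the lowest degree rest on this.\<close>

lemma Hom_span_finite:
  "\<exists>S. finite S \<and> S \<subseteq> Hom d \<and> (\<forall>f\<in>Hom d. \<exists>z. f = (\<lambda>x. \<Sum>g\<in>S. z g * g x))"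
proof (induction d)
  case 0
  have const: "\<exists>a. f = (\<lambda>x. a)" if "f \<in> Hom 0" for f :: "'a \<Rightarrow> complex"
    using that by (induction "0::nat" f rule: Hom_induct) auto
  have "\<exists>z. f = (\<lambda>x. \<Sum>g\<in>{\<lambda>x. 1}. z g * g x)" if "f \<in> Hom 0" for f :: "'a \<Rightarrow> complex"
  proof -
    from const[OF that] obtain a where "f = (\<lambda>x. a)" by blast
    then show ?thesis by (intro exI[of _ "\<lambda>_. a"]) simp
  qed
  then have "\<forall>f\<in>Hom 0. \<exists>z. f = (\<lambda>x::'a. \<Sum>g\<in>{\<lambda>x. 1}. z g * g x)" by blast
  moreover have "finite {\<lambda>x::'a. 1::complex}" "{\<lambda>x::'a. 1::complex} \<subseteq> Hom 0"
    by (simp_all add: Hom_const)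
  ultimately show ?case by (intro exI conjI)
next
  case (Suc d)
  then obtain S where S: "finite S" "S \<subseteq> Hom d" "\<forall>f\<in>Hom d. \<exists>z. f = (\<lambda>x::'a. \<Sum>g\<in>S. z g * g x)"
    by (elim exE conjE)
  define m where "m = (\<lambda>(b::'a, g) x. complex_of_real (x \<bullet> b) * g x)"
  let ?T = "m ` (Basis \<times> S)"
  have T: "finite ?T" using S by simp
  have ll: "linear (\<lambda>x::'a. complex_of_real (x \<bullet> b))" for b
    by (auto simp: linear_iff inner_left_distrib scaleR_conv_of_real)
  have sub: "?T \<subseteq> Hom (Suc d)"
    using S(2) Hom_lin[OF ll] by (auto simp: m_def)
  define Sp where "Sp = {f. \<exists>z. f = (\<lambda>x. \<Sum>g\<in>?T. z g * g x)}"
  have Sp_add: "(\<lambda>x. f x + g x) \<in> Sp" if "f \<in> Sp" "g \<in> Sp" for f g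
  proof -
    from that obtain z z' where "f = (\<lambda>x. \<Sum>g\<in>?T. z g * g x)" "g = (\<lambda>x. \<Sum>g\<in>?T. z' g * g x)"
      unfolding Sp_def mem_Collect_eq by (elim exE)
    then have "(\<lambda>x. f x + g x) = (\<lambda>x. \<Sum>g\<in>?T. (z g + z' g) * g x)"
      by (auto simp: sum.distrib algebra_simps)
    then show ?thesis unfolding Sp_def mem_Collect_eq by (rule exI[where x="\<lambda>g. z g + z' g"])
  qed
  have Sp_scale: "(\<lambda>x. a * f x) \<in> Sp" if "f \<in> Sp" for f a
  proof -
    from that obtain z where "f = (\<lambda>x. \<Sum>g\<in>?T. z g * g x)"
      unfolding Sp_def mem_Collect_eq by (elim exE)
    then have "(\<lambda>x. a * f x) = (\<lambda>x. \<Sum>g\<in>?T. (a * z g) * g x)"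
      by (auto simp: sum_distrib_left algebra_simps)
    then show ?thesis unfolding Sp_def mem_Collect_eq by (rule exI[where x="\<lambda>g. a * z g"])
  qed
  have Sp_zero: "(\<lambda>x. 0) \<in> Sp" unfolding Sp_def mem_Collect_eq by (intro exI[of _ "\<lambda>_. 0"]) simp
  have Sp_sum: "(\<lambda>x. \<Sum>i\<in>I. h i x) \<in> Sp" if "\<And>i. i \<in> I \<Longrightarrow> h i \<in> Sp" for I :: "'i set" and h
    using that by (induction I rule: infinite_finite_induct) (auto intro: Sp_zero Sp_add)
  have Sp_base: "h \<in> Sp" if "h \<in> ?T" for h
  proof -
    have "h = (\<lambda>x. \<Sum>g\<in>?T. (if g = h then 1 else 0) * g x)"
    proof
      fix x
      have "(\<Sum>g\<in>?T. (if g = h then 1 else 0) * g x) = (\<Sum>g\<in>?T. if g = h then h x else 0)"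
        by (rule sum.cong) auto
      also have "\<dots> = h x" using T that by (simp add: sum.delta)
      finally show "h x = (\<Sum>g\<in>?T. (if g = h then 1 else 0) * g x)" by simp
    qed
    then show ?thesis unfolding Sp_def by (intro CollectI exI)
  qed
  have "f \<in> Sp" if "f \<in> Hom k" "k = Suc d" for f k
    using that
  proof (induction rule: Hom_induct)
    case (const a)
    then show ?case by simp
  next
    case (lin \<xi> f d')
    then have "f \<in> Hom d" by simp
    with S(3) obtain z where z: "f = (\<lambda>x. \<Sum>g\<in>S. z g * g x)" by (elim bspec[elim_format] exE)
    have "(\<lambda>x. \<xi> x * f x) = (\<lambda>x. \<Sum>b\<in>Basis. \<Sum>g\<in>S. (\<xi> b * z g) * m (b, g) x)"
    proof
      fix x
      have "\<xi> x * f x = (\<Sum>b\<in>Basis. of_real (x \<bullet> b) * \<xi> b) * (\<Sum>g\<in>S. z g * g x)"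
        unfolding z using linear_expand[OF lin(1), of x] by simp
      also have "\<dots> = (\<Sum>b\<in>Basis. \<Sum>g\<in>S. (\<xi> b * z g) * m (b, g) x)"
        unfolding sum_product m_def by (auto intro!: sum.cong simp: algebra_simps)
      finally show "\<xi> x * f x = \<dots>" .
    qed
    also have "\<dots> \<in> Sp" by (intro Sp_sum Sp_scale Sp_base) auto
    finally show ?case .
  next
    case (add f d' g)
    then show ?case by (auto intro: Sp_add)
  qed
  then have "\<forall>f\<in>Hom (Suc d). \<exists>z. f = (\<lambda>x. \<Sum>g\<in>?T. z g * g x)" unfolding Sp_def by simp
  with T sub show ?case by (intro exI conjI)
qed

section \<open>Dunkl operators\<close>

context rational_cherednik
begin

section \<open>Reflections, roots and coroots\<close>

lemma reflections_subset: "s \<in> reflections \<Longrightarrow> s \<in> W"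
  and reflections_dim: "s \<in> reflections \<Longrightarrow> dim (range (\<lambda>v. s v - v)) = 1"
  by (simp_all add: reflections_def)

lemma finite_reflections: "finite reflections"
  by (rule finite_subset[OF _ finite_W]) (auto simp: reflections_def)

lemma linear_W: "w \<in> W \<Longrightarrow> linear w"
  using orthogonal_W orthogonal_transformation_def by blast

lemma bij_W: "w \<in> W \<Longrightarrow> bij w"
  using orthogonal_W orthogonal_transformation_bij by blast

lemma inv_W_cancel [simp]: "w \<in> W \<Longrightarrow> inv_into UNIV w (w x) = x" "w \<in> W \<Longrightarrow> w (inv_into UNIV w x) = x"
  using bij_W[of w] by (simp_all add: bij_def surj_f_inv_f)

lemma norm_W: "w \<in> W \<Longrightarrow> norm (w x) = norm x"
  using orthogonal_W orthogonal_transformation by blast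

lemma inner_W: "w \<in> W \<Longrightarrow> w x \<bullet> w y = x \<bullet> y"
  using orthogonal_W orthogonal_transformation_def by blast

lemma linear_\<alpha>: "s \<in> reflections \<Longrightarrow> linear (\<alpha> s)"
  using linear_root by (simp add: reflections_def)

lemma \<alpha>_\<alpha>v: "s \<in> reflections \<Longrightarrow> \<alpha> s (\<alpha>v s) = 2"
  using root_coroot by (simp add: reflections_def)

lemma \<alpha>v_nonzero: "s \<in> reflections \<Longrightarrow> \<alpha>v s \<noteq> 0"
  using \<alpha>_\<alpha>v linear_\<alpha> linear_0 by fastforce

text \<open>The axioms describe only the images of \<open>s - 1\<close>. Writing
  \<open>s v - v\<close> as \<open>k v\<close> times \<open>a\<close>, orthogonality leaves for each
  \<open>v\<close> only \<open>k v = 0\<close> or the value \<open>l v\<close> of the usual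
  reflection, and additivity decides between them uniformly. The root is then proportional to the
  inner product with \<open>a\<close>, and \<open>\<alpha> s (\<alpha>v s) = 2\<close> fixes the
  factor.\<close>

lemma reflection_formula_aux:
  assumes s: "s \<in> reflections"
  defines "a \<equiv> \<alpha>v s"
  shows "s v = v - (2 * (v \<bullet> a) / (a \<bullet> a)) *\<^sub>R a" "inv_into UNIV s = s"
    "\<alpha> s v = 2 * (v \<bullet> a) / (a \<bullet> a)"
proof -
  have sW: "s \<in> W" using s by (rule reflections_subset)
  have lin: "linear s" using sW by (rule linear_W)
  have a0: "a \<noteq> 0" "a \<bullet> a \<noteq> 0" using \<alpha>v_nonzero[OF s] by (auto simp: a_def)
  have "\<exists>k. s v - v = k *\<^sub>R a" for v
  proof -
    have "act_h s (v, 0) - (v, 0) \<in> {cscale a (\<alpha>v s, 0) |a. True}"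
      using coroot[OF sW reflections_dim[OF s]] by blast
    then show ?thesis by (auto simp: act_h_def cscale_def a_def)
  qed
  then obtain k where k: "\<And>v. s v - v = k v *\<^sub>R a" by metis
  define l where "l v = - 2 * (v \<bullet> a) / (a \<bullet> a)" for v
  have k_eq: "k v = ((s v - v) \<bullet> a) / (a \<bullet> a)" for v
    using a0 by (simp add: k)
  have k_add: "k (u + v) = k u + k v" for u v
    unfolding k_eq linear_add[OF lin] by (simp add: inner_diff_left inner_add_left add_divide_distrib diff_divide_distrib)
  have l_add: "l (u + v) = l u + l v" for u v
    unfolding l_def inner_add_left distrib_left add_divide_distrib by (rule refl)
  have dich: "k v = 0 \<or> k v = l v" for v
  proof -
    have "(v + k v *\<^sub>R a) \<bullet> (v + k v *\<^sub>R a) = v \<bullet> v"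
      using inner_W[OF sW, of v v] k[of v] by (simp add: algebra_simps)
    then have "k v * (2 * (v \<bullet> a) + k v * (a \<bullet> a)) = 0"
      by (simp add: inner_add_left inner_add_right inner_commute algebra_simps)
    then have "k v = 0 \<or> 2 * (v \<bullet> a) + k v * (a \<bullet> a) = 0" by simp
    then show ?thesis using a0 by (auto simp: l_def field_simps add_eq_0_iff)
  qed
  obtain v1 where v1: "k v1 \<noteq> 0"
  proof (rule ccontr)
    assume "\<not> thesis"
    then have "k v = 0" for v using that by blast
    then have "range (\<lambda>v. s v - v) = {0}" by (auto simp: k)
    then show False using reflections_dim[OF s] by simp
  qed
  \<comment> \<open>A \<open>v\<close> with \<open>k v = 0\<close> and \<open>l v\<close> nonzero is
    impossible: adding a vector \<open>v1\<close> with \<open>k v1\<close> nonzero gives a point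
    where \<open>k\<close> is neither \<open>0\<close> nor \<open>l\<close>.\<close>
  have kl: "k v = l v" for v
  proof (rule ccontr)
    assume "k v \<noteq> l v"
    then have "k v = 0" "l v \<noteq> 0" using dich[of v] by auto
    then show False using dich[of v1] dich[of "v1 + v"] v1 by (auto simp: k_add l_add)
  qed
  show sv: "s v = v - (2 * (v \<bullet> a) / (a \<bullet> a)) *\<^sub>R a" for v
    using k[of v] by (simp add: kl l_def algebra_simps)
  have "s (s v) = v" for v
    using a0 by (simp add: sv inner_diff_left algebra_simps)
  then show inv: "inv_into UNIV s = s"
    by (simp add: inv_equality)
  \<comment> \<open>The root axiom is applied to the inner product with \<open>a\<close> itself: its
    image under \<open>s - 1\<close> is \<open>- 2\<close> times the same functional, which is
    thereby a multiple of the root.\<close>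
  have "linear (\<lambda>v. complex_of_real (v \<bullet> a))"
    by (auto simp: linear_iff inner_left_distrib scaleR_conv_of_real)
  then have "(\<lambda>v. act_dual s (\<lambda>v. complex_of_real (v \<bullet> a)) v - complex_of_real (v \<bullet> a))
      \<in> {\<lambda>v. a * complex_of_real (\<alpha> s v) |a. True}"
    using root[OF sW reflections_dim[OF s]] by blast
  then obtain z where "\<And>v. complex_of_real (s v \<bullet> a) - complex_of_real (v \<bullet> a) = z * complex_of_real (\<alpha> s v)"
    unfolding act_dual_def inv by (auto simp: fun_eq_iff)
  then have z: "complex_of_real ((s v - v) \<bullet> a) = z * complex_of_real (\<alpha> s v)" for v
    by (simp add: inner_diff_left)
  have "(s v - v) \<bullet> a = - 2 * (v \<bullet> a)" for v using a0 by (simp add: k kl l_def)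
  note z = z[unfolded this]
  have "\<alpha> s a = 2" using \<alpha>_\<alpha>v[OF s] by (simp only: a_def)
  then have "complex_of_real (- 2 * (a \<bullet> a)) = z * 2" using z[of a] by (simp only: of_real_numeral)
  then have "z * 2 = (- complex_of_real (a \<bullet> a)) * 2" by (simp only: of_real_mult of_real_minus of_real_numeral)
      (simp only: mult_minus_left mult_minus_right mult.commute)
  then have zz: "z = - complex_of_real (a \<bullet> a)" by (rule mult_right_cancel[THEN iffD1, rotated]) simp
  have "complex_of_real (\<alpha> s v * (a \<bullet> a)) = complex_of_real (2 * (v \<bullet> a))"
    using z[of v] unfolding zz of_real_mult of_real_minus by (simp add: mult.commute)
  then have "\<alpha> s v * (a \<bullet> a) = 2 * (v \<bullet> a)" by (simp only: of_real_eq_iff)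
  then show "\<alpha> s v = 2 * (v \<bullet> a) / (a \<bullet> a)" using a0 by (simp add: field_simps)
qed

lemma reflection_formula: "s \<in> reflections \<Longrightarrow> s v = v - \<alpha> s v *\<^sub>R \<alpha>v s"
  using reflection_formula_aux(1,3)[of s v] by simp

lemma reflection_inv: "s \<in> reflections \<Longrightarrow> inv_into UNIV s = s"
  by (rule reflection_formula_aux)

lemma reflection_invol: "s \<in> reflections \<Longrightarrow> s (s v) = v"
  using inv_W_cancel(2)[OF reflections_subset[of s], of v] reflection_inv[of s] by simp

lemma \<alpha>_reflection: "s \<in> reflections \<Longrightarrow> \<alpha> s (s v) = - \<alpha> s v"
  by (simp add: reflection_formula linear_diff[OF linear_\<alpha>] linear_cmul[OF linear_\<alpha>] \<alpha>_\<alpha>v)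

lemma reflection_symmetric: "s \<in> reflections \<Longrightarrow> s u \<bullet> v = u \<bullet> s v"
  using inner_W[OF reflections_subset[of s], of u "s v"] reflection_invol[of s v] by simp

lemma reflections_conj:
  assumes "w \<in> W" "s \<in> reflections"
  shows "w \<circ> s \<circ> inv_into UNIV w \<in> reflections"
proof -
  have eq: "range (\<lambda>v. (w \<circ> s \<circ> inv_into UNIV w) v - v) = w ` range (\<lambda>v. s v - v)"
  proof safe
    fix v
    have "(w \<circ> s \<circ> inv_into UNIV w) v - v = w (s (inv_into UNIV w v) - inv_into UNIV w v)"
      using assms by (simp add: linear_diff[OF linear_W])
    then show "(w \<circ> s \<circ> inv_into UNIV w) v - v \<in> w ` range (\<lambda>v. s v - v)" by blast
  next
    fix v
    have "w (s v - v) = (w \<circ> s \<circ> inv_into UNIV w) (w v) - w v"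
      using assms by (simp add: linear_diff[OF linear_W])
    then show "w (s v - v) \<in> range (\<lambda>v. (w \<circ> s \<circ> inv_into UNIV w) v - v)"
      by (rule image_eqI[where x = "w v"]) simp
  qed
  have "inj w" using bij_W[OF assms(1)] by (simp add: bij_def)
  then have "dim (w ` range (\<lambda>v. s v - v)) = 1"
    using dim_image_eq[OF linear_W[OF assms(1)]] reflections_dim[OF assms(2)]
    by (metis inj_on_subset subset_UNIV)
  then have "dim (range (\<lambda>v. (w \<circ> s \<circ> inv_into UNIV w) v - v)) = 1" by (simp only: eq)
  moreover have "w \<circ> s \<circ> inv_into UNIV w \<in> W"
    by (intro comp_W inv_W assms(1) reflections_subset[OF assms(2)])
  ultimately show ?thesis unfolding reflections_def by blast
qed

lemma reflections_conj_bij: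
  assumes "w \<in> W"
  shows "bij_betw (\<lambda>s. w \<circ> s \<circ> inv_into UNIV w) reflections reflections"
proof (rule bij_betw_byWitness[where f' = "\<lambda>s. inv_into UNIV w \<circ> s \<circ> w"])
  have inv: "inv_into UNIV (inv_into UNIV w) = w"
    using bij_W[OF assms] by (simp add: inv_inv_eq)
  show "\<forall>s\<in>reflections. inv_into UNIV w \<circ> (w \<circ> s \<circ> inv_into UNIV w) \<circ> w = s"
    "\<forall>s\<in>reflections. w \<circ> (inv_into UNIV w \<circ> s \<circ> w) \<circ> inv_into UNIV w = s"
    by (simp_all add: fun_eq_iff inv_W_cancel[OF assms])
  show "(\<lambda>s. w \<circ> s \<circ> inv_into UNIV w) ` reflections \<subseteq> reflections"
    using assms reflections_conj by blast
  show "(\<lambda>s. inv_into UNIV w \<circ> s \<circ> w) ` reflections \<subseteq> reflections"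
  proof
    fix t assume "t \<in> (\<lambda>s. inv_into UNIV w \<circ> s \<circ> w) ` reflections"
    then obtain s where s: "s \<in> reflections" "t = inv_into UNIV w \<circ> s \<circ> w" by blast
    from reflections_conj[OF inv_W[OF assms] s(1)] show "t \<in> reflections"
      unfolding inv s(2) .
  qed
qed

section \<open>Divided differences\<close>

definition dd :: "('a \<Rightarrow> 'a) \<Rightarrow> ('a \<Rightarrow> complex) \<Rightarrow> 'a \<Rightarrow> complex" where
  "dd s f = (THE g. g \<in> Pol \<and> (\<forall>x. of_real (\<alpha> s x) * g x = f x - f (s x)))"

text \<open>Justifies the \<open>THE\<close> in \<open>dd\<close>. The quotient is characterised by
  multiplication with the root, so its values on the reflecting hyperplane are those of the
  polynomial and not of a division by zero.\<close>

lemma dd_unique: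
  assumes "s \<in> reflections" "g \<in> Pol" "h \<in> Pol"
    "\<And>x. of_real (\<alpha> s x) * g x = of_real (\<alpha> s x) * h x"
  shows "g = h"
proof
  fix x
  have "(\<lambda>x. g x - h x) \<in> Pol" using assms Pol_diff by blast
  moreover have "(\<lambda>x. complex_of_real (\<alpha> s x)) \<in> Pol"
    by (intro Pol_lin1 linear_of_real linear_\<alpha> assms)
  ultimately have "g x - h x = 0"
    by (rule Pol_domain[of "\<lambda>x. g x - h x" "\<lambda>x. of_real (\<alpha> s x)" "\<alpha>v s"])
      (use assms \<alpha>_\<alpha>v in \<open>auto simp: algebra_simps\<close>)
  then show "g x = h x" by simp
qed

lemma dd_eqI:
  assumes "s \<in> reflections" "g \<in> Pol" "\<And>x. of_real (\<alpha> s x) * g x = f x - f (s x)"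
  shows "dd s f = g"
  unfolding dd_def using assms by (intro the_equality) (auto intro: dd_unique[of s])

text \<open>The twisted product rule: \<open>\<xi> - \<xi> \<circ> s\<close> is
  \<open>\<xi> (\<alpha>v s)\<close> times the root, so \<open>\<xi>\<close> passes through the
  divided difference up to a reflected term.\<close>

lemma dd_lin_aux:
  fixes \<xi> f g :: "'a \<Rightarrow> complex"
  assumes "s \<in> reflections" "linear \<xi>" "of_real (\<alpha> s x) * g x = f x - f (s x)"
  shows "of_real (\<alpha> s x) * (\<xi> x * g x + \<xi> (\<alpha>v s) * f (s x)) = \<xi> x * f x - \<xi> (s x) * f (s x)"
proof -
  have "\<xi> (s x) = \<xi> x - of_real (\<alpha> s x) * \<xi> (\<alpha>v s)"
    using assms by (simp add: reflection_formula linear_diff linear_cmul scaleR_conv_of_real)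
  moreover have "f (s x) = f x - of_real (\<alpha> s x) * g x" using assms(3) by simp
  ultimately show ?thesis by (simp only:) (simp add: algebra_simps)
qed

text \<open>Existence of the quotient, its degree and its defining equation are proved in one
  induction, because the product rule needs the equation for the remaining factor.\<close>

lemma dd_Hom:
  assumes s: "s \<in> reflections"
  shows "f \<in> Hom d \<Longrightarrow> dd s f \<in> Hom (d - 1) \<and> (d = 0 \<longrightarrow> dd s f = (\<lambda>x. 0))
    \<and> (\<forall>x. of_real (\<alpha> s x) * dd s f x = f x - f (s x))"
proof (induction rule: Hom_induct)
  case (const a)
  have "dd s (\<lambda>x. a) = (\<lambda>x. 0)" by (rule dd_eqI) (use s in \<open>auto intro: Pol.const\<close>)
  then show ?case by (auto intro: Hom_zero)
next
  case (lin \<xi> f d)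
  let ?g = "\<lambda>x. \<xi> x * dd s f x + \<xi> (\<alpha>v s) * f (s x)"
  have 1: "(\<lambda>x. \<xi> x * dd s f x) \<in> Hom d"
  proof (cases d)
    case 0
    then show ?thesis using lin by (simp add: Hom_zero)
  next
    case (Suc k)
    then show ?thesis using lin Hom_lin[of \<xi> "dd s f" k] by simp
  qed
  have 2: "?g \<in> Hom d"
    by (intro Hom_add 1 Hom_scale Hom_compose[OF lin(2) linear_W[OF reflections_subset[OF s]]])
  have 3: "of_real (\<alpha> s x) * ?g x = \<xi> x * f x - \<xi> (s x) * f (s x)" for x
    by (rule dd_lin_aux) (use s lin in auto)
  have "dd s (\<lambda>x. \<xi> x * f x) = ?g"
    by (rule dd_eqI) (use s 2 3 Hom_Pol in auto)
  then show ?case using 2 3 by simp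
next
  case (add f d g)
  let ?g = "\<lambda>x. dd s f x + dd s g x"
  have 3: "of_real (\<alpha> s x) * ?g x = (f x + g x) - (f (s x) + g (s x))" for x
  proof -
    have "of_real (\<alpha> s x) * ?g x = (f x - f (s x)) + (g x - g (s x))"
      using add by (simp add: distrib_left)
    then show ?thesis by simp
  qed
  have 2: "?g \<in> Hom (d - 1)" using add by (auto intro: Hom_add)
  have "dd s (\<lambda>x. f x + g x) = ?g"
    by (rule dd_eqI) (use s 2 3 Hom_Pol in auto)
  then show ?case using 2 3 add by simp
qed

lemma dd_Pol:
  assumes s: "s \<in> reflections"
  shows "f \<in> Pol \<Longrightarrow> dd s f \<in> Pol \<and> (\<forall>x. of_real (\<alpha> s x) * dd s f x = f x - f (s x))"
proof (induction rule: Pol.induct)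
  case (const a)
  have "dd s (\<lambda>x. a) = (\<lambda>x. 0)" by (rule dd_eqI) (use s in \<open>auto intro: Pol.const\<close>)
  then show ?case by (auto intro: Pol.const)
next
  case (lin \<xi> f)
  let ?g = "\<lambda>x. \<xi> x * dd s f x + \<xi> (\<alpha>v s) * f (s x)"
  have 2: "?g \<in> Pol"
    using lin by (intro Pol.add Pol.lin[OF lin(1)] Pol_scale
      Pol_compose[OF lin(2) linear_W[OF reflections_subset[OF s]]]) auto
  have 3: "of_real (\<alpha> s x) * ?g x = \<xi> x * f x - \<xi> (s x) * f (s x)" for x
    by (rule dd_lin_aux) (use s lin in auto)
  have "dd s (\<lambda>x. \<xi> x * f x) = ?g"
    by (rule dd_eqI) (use s 2 3 in auto)
  then show ?case using 2 3 by simp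
next
  case (add f g)
  let ?g = "\<lambda>x. dd s f x + dd s g x"
  have 3: "of_real (\<alpha> s x) * ?g x = (f x + g x) - (f (s x) + g (s x))" for x
  proof -
    have "of_real (\<alpha> s x) * ?g x = (f x - f (s x)) + (g x - g (s x))"
      using add by (simp add: distrib_left)
    then show ?thesis by simp
  qed
  have 2: "?g \<in> Pol" using add by (auto intro: Pol.add)
  have "dd s (\<lambda>x. f x + g x) = ?g"
    by (rule dd_eqI) (use s 2 3 in auto)
  then show ?case using 2 3 by simp
qed

lemma dd_in: "s \<in> reflections \<Longrightarrow> f \<in> Pol \<Longrightarrow> dd s f \<in> Pol"
  and dd_eq: "s \<in> reflections \<Longrightarrow> f \<in> Pol \<Longrightarrow> of_real (\<alpha> s x) * dd s f x = f x - f (s x)"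
  using dd_Pol by blast+

lemma Pol_W: "f \<in> Pol \<Longrightarrow> w \<in> W \<Longrightarrow> (\<lambda>x. f (w x)) \<in> Pol"
  by (rule Pol_compose[OF _ linear_W])

lemma Pol_refl: "f \<in> Pol \<Longrightarrow> s \<in> reflections \<Longrightarrow> (\<lambda>x. f (s x)) \<in> Pol"
  by (rule Pol_W[OF _ reflections_subset])

lemma dd_lin:
  assumes "s \<in> reflections" "linear \<xi>" "f \<in> Pol"
  shows "dd s (\<lambda>x. \<xi> x * f x) = (\<lambda>x. \<xi> x * dd s f x + \<xi> (\<alpha>v s) * f (s x))"
  by (rule dd_eqI[OF assms(1) Pol.add[OF Pol.lin[OF assms(2) dd_in[OF assms(1,3)]]
    Pol_scale[OF Pol_refl[OF assms(3,1)]]]]) (rule dd_lin_aux[OF assms(1,2) dd_eq[OF assms(1,3)]])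

lemma dd_add:
  assumes "s \<in> reflections" "f \<in> Pol" "g \<in> Pol"
  shows "dd s (\<lambda>x. f x + g x) = (\<lambda>x. dd s f x + dd s g x)"
  by (rule dd_eqI[OF assms(1) Pol.add[OF dd_in[OF assms(1,2)] dd_in[OF assms(1,3)]]])
    (simp add: distrib_left dd_eq assms)

lemma dd_scale:
  assumes "s \<in> reflections" "f \<in> Pol"
  shows "dd s (\<lambda>x. a * f x) = (\<lambda>x. a * dd s f x)"
  by (rule dd_eqI[OF assms(1) Pol_scale[OF dd_in[OF assms]]])
    (simp add: mult.left_commute[of _ a] dd_eq right_diff_distrib assms)

lemma dd_const: "s \<in> reflections \<Longrightarrow> dd s (\<lambda>x. a) = (\<lambda>x. 0)"
  by (intro dd_eqI) (auto intro: Pol.const)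

section \<open>Dunkl operators\<close>

definition D :: "'a \<Rightarrow> ('a \<Rightarrow> complex) \<Rightarrow> 'a \<Rightarrow> complex" where
  "D b f x = pd b f x - of_real c * (\<Sum>s\<in>reflections. of_real (\<alpha> s b) * dd s f x)"

lemma D_Pol: "f \<in> Pol \<Longrightarrow> D b f \<in> Pol"
  unfolding D_def[abs_def] by (intro Pol_diff Pol_scale Pol_sum dd_in Pol_pd)

lemma D_Hom: "f \<in> Hom d \<Longrightarrow> D b f \<in> Hom (d - 1)"
  unfolding D_def[abs_def] using Hom_pd[of f d b] dd_Hom[of _ f d]
  by (intro Hom_diff Hom_scale Hom_sum) auto

lemma D_const: "D b (\<lambda>x. a) = (\<lambda>x. 0)"
  by (auto simp: D_def pd_const dd_const intro!: ext)

lemma D_Hom0: "f \<in> Hom 0 \<Longrightarrow> D b f = (\<lambda>x. 0)"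
  using Hom_pd[of f 0 b] dd_Hom[of _ f 0] by (auto simp: D_def intro!: ext)

lemma D_add: "f \<in> Pol \<Longrightarrow> g \<in> Pol \<Longrightarrow> D b (\<lambda>x. f x + g x) x = D b f x + D b g x"
  by (simp add: D_def pd_add dd_add sum.distrib algebra_simps)

lemma D_scale: "f \<in> Pol \<Longrightarrow> D b (\<lambda>x. a * f x) x = a * D b f x"
  by (simp add: D_def pd_scale dd_scale sum_distrib_left algebra_simps)

lemma D_diff: "f \<in> Pol \<Longrightarrow> g \<in> Pol \<Longrightarrow> D b (\<lambda>x. f x - g x) x = D b f x - D b g x"
  using D_add[of f "\<lambda>x. -1 * g x" b x] D_scale[of g b "-1" x] Pol_scale[of g "-1"] by simp

lemma D_sum: "(\<And>i. i \<in> I \<Longrightarrow> f i \<in> Pol) \<Longrightarrow> D b (\<lambda>x. \<Sum>i\<in>I. f i x) x = (\<Sum>i\<in>I. D b (f i) x)"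
  by (induction I rule: infinite_finite_induct) (auto simp: D_const D_add Pol_sum)

lemma D_linear: "f \<in> Pol \<Longrightarrow> linear (\<lambda>b. D b f x)"
  using Pol_pd_linear[of f x] linear_\<alpha>
  by (auto simp: linear_iff D_def algebra_simps sum.distrib sum_distrib_left scaleR_conv_of_real)

text \<open>The relation between \<open>y\<close> and \<open>x\<close> in the algebra, read on
  functions. Writing the reflection term with \<open>\<xi> (b - s b)\<close> removes the chosen
  roots from the formula.\<close>

lemma D_lin:
  assumes "linear \<xi>" "f \<in> Pol"
  shows "D b (\<lambda>x. \<xi> x * f x) x = \<xi> x * D b f x + \<xi> b * f x
    - of_real c * (\<Sum>s\<in>reflections. \<xi> (b - s b) * f (s x))"
proof -
  have "\<xi> (b - s b) = of_real (\<alpha> s b) * \<xi> (\<alpha>v s)" if "s \<in> reflections" for s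
    using that assms by (simp add: reflection_formula linear_cmul scaleR_conv_of_real)
  then have "(\<Sum>s\<in>reflections. \<xi> (b - s b) * f (s x)) = (\<Sum>s\<in>reflections. of_real (\<alpha> s b) * (\<xi> (\<alpha>v s) * f (s x)))"
    by (intro sum.cong) auto
  moreover have "(\<Sum>s\<in>reflections. of_real (\<alpha> s b) * dd s (\<lambda>x. \<xi> x * f x) x)
    = \<xi> x * (\<Sum>s\<in>reflections. of_real (\<alpha> s b) * dd s f x) + (\<Sum>s\<in>reflections. of_real (\<alpha> s b) * (\<xi> (\<alpha>v s) * f (s x)))"
    unfolding sum_distrib_left sum.distrib[symmetric]
    by (intro sum.cong) (auto simp: dd_lin assms algebra_simps)
  ultimately show ?thesis using assms by (simp add: D_def pd_lin algebra_simps)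
qed

text \<open>Induction through \<open>D_lin\<close> avoids asking how the chosen roots transform
  under \<open>W\<close>; conjugation only permutes the reflections.\<close>

lemma D_W:
  assumes w: "w \<in> W"
  shows "f \<in> Pol \<Longrightarrow> D b (\<lambda>x. f (w x)) x = D (w b) f (w x)"
proof (induction arbitrary: x rule: Pol.induct)
  case (const a)
  show ?case by (simp add: D_const)
next
  case (lin \<xi> f)
  have l: "linear (\<lambda>x. \<xi> (w x))" using lin(1) linear_W[OF w] by (auto simp: linear_iff)
  have "(\<Sum>s\<in>reflections. \<xi> (w b - s (w b)) * f (s (w x)))
      = (\<Sum>s\<in>reflections. \<xi> (w b - (w \<circ> s \<circ> inv_into UNIV w) (w b)) * f ((w \<circ> s \<circ> inv_into UNIV w) (w x)))"
    by (rule sum.reindex_bij_betw[OF reflections_conj_bij[OF w], symmetric])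
  also have "\<dots> = (\<Sum>s\<in>reflections. \<xi> (w (b - s b)) * f (w (s x)))"
    using w by (simp add: linear_diff[OF linear_W])
  finally have eq: "(\<Sum>s\<in>reflections. \<xi> (w (b - s b)) * f (w (s x)))
     = (\<Sum>s\<in>reflections. \<xi> (w b - s (w b)) * f (s (w x)))" ..
  show ?case
    using D_lin[OF l Pol_W[OF lin(2) w], of b x] D_lin[OF lin(1,2), of "w b" "w x"] lin eq
    by simp
next
  case (add f g)
  then show ?case using Pol_W[OF add(1) w] Pol_W[OF add(2) w] by (simp add: D_add)
qed

lemma D_refl: "s \<in> reflections \<Longrightarrow> f \<in> Pol \<Longrightarrow> D b (\<lambda>x. f (s x)) x = D (s b) f (s x)"
  by (rule D_W[OF reflections_subset])

text \<open>In the product step the terms without reflections are symmetric in \<open>a\<close> and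
  \<open>b\<close> by induction, and the reflection terms are symmetric one reflection at a
  time.\<close>

lemma D_commute: "f \<in> Pol \<Longrightarrow> D a (D b f) x = D b (D a f) x"
proof (induction arbitrary: x rule: Pol.induct)
  case (const z)
  show ?case by (simp add: D_const)
next
  case (lin \<xi> f)
  have fs: "\<And>s. s \<in> reflections \<Longrightarrow> (\<lambda>x. f (s x)) \<in> Pol" using Pol_refl[OF lin(2)] .
  have expand: "D a (D b (\<lambda>x. \<xi> x * f x)) x = \<xi> x * D a (D b f) x + \<xi> a * D b f x + \<xi> b * D a f x
      - of_real c * (\<Sum>s\<in>reflections. \<xi> (a - s a) * D b f (s x) + \<xi> (b - s b) * D (s a) f (s x))" for a b
  proof -
    have "D b (\<lambda>x. \<xi> x * f x) = (\<lambda>x. \<xi> x * D b f x + \<xi> b * f x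
        - of_real c * (\<Sum>s\<in>reflections. \<xi> (b - s b) * f (s x)))"
      using lin by (auto simp: D_lin)
    then have "D a (D b (\<lambda>x. \<xi> x * f x)) x = D a (\<lambda>x. \<xi> x * D b f x + \<xi> b * f x
        - of_real c * (\<Sum>s\<in>reflections. \<xi> (b - s b) * f (s x))) x" by simp
    also have "\<dots> = D a (\<lambda>x. \<xi> x * D b f x) x + \<xi> b * D a f x
       - of_real c * (\<Sum>s\<in>reflections. \<xi> (b - s b) * D a (\<lambda>x. f (s x)) x)"
      using lin fs
      by (simp add: D_diff D_add D_scale D_sum Pol.add Pol.lin Pol_scale Pol_sum D_Pol)
    also have "D a (\<lambda>x. \<xi> x * D b f x) x = \<xi> x * D a (D b f) x + \<xi> a * D b f x
       - of_real c * (\<Sum>s\<in>reflections. \<xi> (a - s a) * D b f (s x))"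
      using lin by (simp add: D_lin D_Pol)
    also have "(\<Sum>s\<in>reflections. \<xi> (b - s b) * D a (\<lambda>x. f (s x)) x)
      = (\<Sum>s\<in>reflections. \<xi> (b - s b) * D (s a) f (s x))"
      using lin by (intro sum.cong) (auto simp: D_refl)
    finally show ?thesis by (simp add: sum.distrib algebra_simps)
  qed
  \<comment> \<open>Expanding \<open>D (s u)\<close> by linearity, both sides become
    \<open>\<xi> (\<alpha>v s)\<close> times \<open>\<alpha> s a * D b f + \<alpha> s b * D a f -
    \<alpha> s a * \<alpha> s b * D (\<alpha>v s) f\<close>, taken at \<open>s x\<close>.\<close>
  have "\<xi> (a - s a) * D b f (s x) + \<xi> (b - s b) * D (s a) f (s x)
      = \<xi> (b - s b) * D a f (s x) + \<xi> (a - s a) * D (s b) f (s x)" if s: "s \<in> reflections" for s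
  proof -
    have "D (s u) f y = D u f y - of_real (\<alpha> s u) * D (\<alpha>v s) f y" for u y
      using linear_diff[OF D_linear[OF lin(2)]] linear_cmul[OF D_linear[OF lin(2)]] s
      by (simp add: reflection_formula scaleR_conv_of_real)
    moreover have "\<xi> (u - s u) = of_real (\<alpha> s u) * \<xi> (\<alpha>v s)" for u
      using s lin(1) by (simp add: reflection_formula linear_cmul scaleR_conv_of_real)
    ultimately show ?thesis by (simp only:) (simp add: algebra_simps)
  qed
  then have "(\<Sum>s\<in>reflections. \<xi> (a - s a) * D b f (s x) + \<xi> (b - s b) * D (s a) f (s x))
      = (\<Sum>s\<in>reflections. \<xi> (b - s b) * D a f (s x) + \<xi> (a - s a) * D (s b) f (s x))"
    by (intro sum.cong) auto
  then show ?case unfolding expand using lin by simp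
next
  case (add f g)
  have "D a (\<lambda>x. f x + g x) = (\<lambda>x. D a f x + D a g x)" for a using add by (auto simp: D_add)
  then show ?case using add by (simp add: D_add D_Pol)
qed

lemma linear_sum_Basis_inner:
  fixes \<xi> :: "'a \<Rightarrow> complex"
  assumes "linear \<xi>"
  shows "(\<Sum>b\<in>Basis. of_real (x \<bullet> b) * \<xi> b) = \<xi> x"
  by (rule linear_expand[OF assms, symmetric])

text \<open>The Euler field corrected by reflections comes from the algebra and acts on
  \<open>Hom d\<close> as the number \<open>d\<close>. It makes submodules graded, bounds the degree
  of singular vectors and separates degrees for contravariant forms.\<close>

lemma Euler:
  shows "f \<in> Hom d \<Longrightarrow> (\<Sum>b\<in>Basis. of_real (x \<bullet> b) * D b f x)
     + of_real c * (\<Sum>s\<in>reflections. f x - f (s x)) = of_nat d * f x"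
proof (induction rule: Hom_induct)
  case (const a)
  show ?case by (simp add: D_const)
next
  case (lin \<xi> f d)
  have f: "f \<in> Pol" using lin Hom_Pol by blast
  have "(\<Sum>b\<in>Basis. of_real (x \<bullet> b) * D b (\<lambda>x. \<xi> x * f x) x)
     = (\<Sum>b\<in>Basis. \<xi> x * (of_real (x \<bullet> b) * D b f x) + (of_real (x \<bullet> b) * \<xi> b) * f x
        - of_real c * (\<Sum>s\<in>reflections. of_real (x \<bullet> b) * \<xi> (b - s b) * f (s x)))"
    by (intro sum.cong refl) (simp add: D_lin[OF lin(1) f] algebra_simps sum_distrib_left)
  also have "\<dots> = \<xi> x * (\<Sum>b\<in>Basis. of_real (x \<bullet> b) * D b f x) + \<xi> x * f x
      - of_real c * (\<Sum>s\<in>reflections. (\<Sum>b\<in>Basis. of_real (x \<bullet> b) * \<xi> (b - s b)) * f (s x))"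
    unfolding sum_subtractf sum.distrib sum_distrib_left[symmetric] sum_distrib_right[symmetric]
      linear_sum_Basis_inner[OF lin(1)]
    by (subst sum.swap) (simp add: sum_distrib_right)
  also have "(\<Sum>s\<in>reflections. (\<Sum>b\<in>Basis. of_real (x \<bullet> b) * \<xi> (b - s b)) * f (s x))
     = (\<Sum>s\<in>reflections. (\<xi> x - \<xi> (s x)) * f (s x))"
  proof (rule sum.cong[OF refl])
    fix s assume s: "s \<in> reflections"
    have "linear (\<lambda>b. \<xi> (b - s b))"
      using linear_compose[OF linear_compose_sub[OF linear_ident linear_W[OF reflections_subset[OF s]]] lin(1)]
      by (simp add: o_def)
    from linear_sum_Basis_inner[OF this, of x] lin(1)
    show "(\<Sum>b\<in>Basis. of_real (x \<bullet> b) * \<xi> (b - s b)) * f (s x) = (\<xi> x - \<xi> (s x)) * f (s x)"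
      by (simp add: linear_diff)
  qed
  finally have "(\<Sum>b\<in>Basis. of_real (x \<bullet> b) * D b (\<lambda>x. \<xi> x * f x) x)
     + of_real c * (\<Sum>s\<in>reflections. \<xi> x * f x - \<xi> (s x) * f (s x))
     = \<xi> x * (\<Sum>b\<in>Basis. of_real (x \<bullet> b) * D b f x) + \<xi> x * f x
       + of_real c * (\<Sum>s\<in>reflections. (\<xi> x * f x - \<xi> (s x) * f (s x)) - (\<xi> x - \<xi> (s x)) * f (s x))"
    by (simp add: sum_subtractf algebra_simps)
  also have "(\<Sum>s\<in>reflections. (\<xi> x * f x - \<xi> (s x) * f (s x)) - (\<xi> x - \<xi> (s x)) * f (s x))
     = \<xi> x * (\<Sum>s\<in>reflections. f x - f (s x))"
    unfolding sum_distrib_left by (intro sum.cong) (auto simp: algebra_simps)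
  finally show ?case using arg_cong[OF lin.IH, of "\<lambda>z. \<xi> x * z"] by (simp add: algebra_simps)
next
  case (add f d g)
  have "f \<in> Pol" "g \<in> Pol" using add Hom_Pol by auto
  then show ?case using add.IH
    by (simp add: D_add sum.distrib sum_subtractf algebra_simps)
qed

section \<open>The Dunkl Laplacian\<close>

definition Lap :: "('a \<Rightarrow> complex) \<Rightarrow> 'a \<Rightarrow> complex" where
  "Lap f x = (\<Sum>b\<in>Basis. D b (D b f) x)"

lemma Lap_Pol: "f \<in> Pol \<Longrightarrow> Lap f \<in> Pol"
  unfolding Lap_def[abs_def] by (intro Pol_sum D_Pol)

lemma Lap_add: "f \<in> Pol \<Longrightarrow> g \<in> Pol \<Longrightarrow> Lap (\<lambda>x. f x + g x) x = Lap f x + Lap g x"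
proof -
  assume fg: "f \<in> Pol" "g \<in> Pol"
  then have "D b (\<lambda>x. f x + g x) = (\<lambda>x. D b f x + D b g x)" for b by (auto simp: D_add)
  then show ?thesis using fg by (simp add: Lap_def D_add D_Pol sum.distrib)
qed

lemma Lap_scale: "f \<in> Pol \<Longrightarrow> Lap (\<lambda>x. a * f x) x = a * Lap f x"
proof -
  assume f: "f \<in> Pol"
  then have "D b (\<lambda>x. a * f x) = (\<lambda>x. a * D b f x)" for b by (auto simp: D_scale)
  then show ?thesis using f by (simp add: Lap_def D_scale D_Pol sum_distrib_left)
qed

lemma Lap_D: "f \<in> Pol \<Longrightarrow> Lap (D a f) x = D a (Lap f) x"
proof -
  assume f: "f \<in> Pol"
  have "D b (D b (D a f)) x = D a (D b (D b f)) x" for b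
  proof -
    have "D b (D a f) = D a (D b f)" using f by (auto simp: D_commute[of f b a])
    then show ?thesis using D_commute[OF D_Pol[OF f], of b a b x] by simp
  qed
  then show ?thesis using f unfolding Lap_def[abs_def] by (subst D_sum) (auto intro: D_Pol)
qed

text \<open>The commutator of \<open>Lap\<close> with multiplication by a coordinate is
  \<open>2 * D a\<close>, as for the ordinary Laplacian; the two contributions of each reflection
  cancel.\<close>

lemma Lap_lin:
  assumes f: "f \<in> Pol"
  shows "Lap (\<lambda>x. of_real (x \<bullet> a) * f x) x = of_real (x \<bullet> a) * Lap f x + 2 * D a f x"
proof -
  let ?\<xi> = "\<lambda>x::'a. complex_of_real (x \<bullet> a)"
  have l: "linear ?\<xi>" by (auto simp: linear_iff inner_left_distrib scaleR_conv_of_real)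
  have Ds: "(\<Sum>b\<in>Basis. of_real (u \<bullet> b) * D b f y) = D u f y" for u y
    using linear_sum_Basis_inner[OF D_linear[OF f]] by simp
  have fs: "\<And>s. s \<in> reflections \<Longrightarrow> (\<lambda>x. f (s x)) \<in> Pol" using Pol_refl[OF f] .
  have step: "D b (D b (\<lambda>x. ?\<xi> x * f x)) x = ?\<xi> x * D b (D b f) x + 2 * (of_real (a \<bullet> b) * D b f x)
      - of_real c * (\<Sum>s\<in>reflections. of_real ((a - s a) \<bullet> b) * D b f (s x)
          + of_real ((a - s a) \<bullet> b) * D (s b) f (s x))" for b
  proof -
    have sym: "?\<xi> (b - s b) = of_real ((a - s a) \<bullet> b)" if "s \<in> reflections" for s
      using reflection_symmetric[OF that, of b a]
      by (simp add: inner_diff_left inner_diff_right inner_commute)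
    have "D b (\<lambda>x. ?\<xi> x * f x) = (\<lambda>x. ?\<xi> x * D b f x + ?\<xi> b * f x
        - of_real c * (\<Sum>s\<in>reflections. ?\<xi> (b - s b) * f (s x)))"
      using D_lin[OF l f] by auto
    then have "D b (D b (\<lambda>x. ?\<xi> x * f x)) x = D b (\<lambda>x. ?\<xi> x * D b f x + ?\<xi> b * f x
        - of_real c * (\<Sum>s\<in>reflections. ?\<xi> (b - s b) * f (s x))) x" by simp
    also have "\<dots> = D b (\<lambda>x. ?\<xi> x * D b f x) x + ?\<xi> b * D b f x
       - of_real c * (\<Sum>s\<in>reflections. ?\<xi> (b - s b) * D b (\<lambda>x. f (s x)) x)"
      using f l fs by (simp add: D_diff D_add D_scale D_sum Pol.add Pol.lin Pol_scale Pol_sum D_Pol)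
    also have "D b (\<lambda>x. ?\<xi> x * D b f x) x = ?\<xi> x * D b (D b f) x + ?\<xi> b * D b f x
       - of_real c * (\<Sum>s\<in>reflections. ?\<xi> (b - s b) * D b f (s x))"
      using D_lin[OF l D_Pol[OF f]] .
    also have "(\<Sum>s\<in>reflections. ?\<xi> (b - s b) * D b (\<lambda>x. f (s x)) x)
      = (\<Sum>s\<in>reflections. ?\<xi> (b - s b) * D (s b) f (s x))"
      using f by (intro sum.cong) (auto simp: D_refl)
    finally have "D b (D b (\<lambda>x. ?\<xi> x * f x)) x = ?\<xi> x * D b (D b f) x + 2 * (of_real (a \<bullet> b) * D b f x)
      - of_real c * (\<Sum>s\<in>reflections. ?\<xi> (b - s b) * D b f (s x) + ?\<xi> (b - s b) * D (s b) f (s x))"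
      unfolding sum.distrib by (simp add: algebra_simps inner_commute)
    also have "(\<Sum>s\<in>reflections. ?\<xi> (b - s b) * D b f (s x) + ?\<xi> (b - s b) * D (s b) f (s x))
      = (\<Sum>s\<in>reflections. of_real ((a - s a) \<bullet> b) * D b f (s x) + of_real ((a - s a) \<bullet> b) * D (s b) f (s x))"
      using sym by (intro sum.cong) simp_all
    finally show ?thesis .
  qed
  have "Lap (\<lambda>x. ?\<xi> x * f x) x = ?\<xi> x * Lap f x + 2 * D a f x
      - of_real c * (\<Sum>s\<in>reflections. (\<Sum>b\<in>Basis. of_real ((a - s a) \<bullet> b) * D b f (s x))
          + (\<Sum>b\<in>Basis. of_real ((a - s a) \<bullet> b) * D (s b) f (s x)))"
    unfolding Lap_def step sum_subtractf sum.distrib sum_distrib_left[symmetric] Ds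
    by (subst (1 2) sum.swap[of _ _ Basis]) (simp add: Ds)
  \<comment> \<open>With \<open>u = a - s a\<close>, the first inner sum is \<open>D u f\<close> and
    the second is \<open>D (s u) f\<close>, and \<open>s u = - u\<close>.\<close>
  also have "(\<Sum>s\<in>reflections. (\<Sum>b\<in>Basis. of_real ((a - s a) \<bullet> b) * D b f (s x))
          + (\<Sum>b\<in>Basis. of_real ((a - s a) \<bullet> b) * D (s b) f (s x))) = 0"
  proof (rule sum.neutral, rule ballI)
    fix s assume s: "s \<in> reflections"
    have "linear (\<lambda>b. D (s b) f (s x))"
      using linear_compose[OF linear_W[OF reflections_subset[OF s]] D_linear[OF f, of "s x"]] by (simp add: o_def)
    from linear_sum_Basis_inner[OF this]
    have "(\<Sum>b\<in>Basis. of_real ((a - s a) \<bullet> b) * D (s b) f (s x)) = D (s (a - s a)) f (s x)" .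
    moreover have "s (a - s a) = - (a - s a)"
      using s by (simp add: linear_diff[OF linear_W[OF reflections_subset]] reflection_invol)
    moreover have "D (- (a - s a)) f (s x) = - D (a - s a) f (s x)"
      using linear_neg[OF D_linear[OF f]] by blast
    ultimately show "(\<Sum>b\<in>Basis. of_real ((a - s a) \<bullet> b) * D b f (s x))
          + (\<Sum>b\<in>Basis. of_real ((a - s a) \<bullet> b) * D (s b) f (s x)) = 0"
      unfolding Ds by simp
  qed
  finally show ?thesis by simp
qed

end

section \<open>The polynomial representation\<close>

lemma poly_mapping_sum_single: "(\<Sum>u\<in>Poly_Mapping.keys p. Poly_Mapping.single u (Poly_Mapping.lookup p u)) = p"
proof (rule poly_mapping_eqI)
  fix k
  have "Poly_Mapping.lookup (\<Sum>u\<in>Poly_Mapping.keys p. Poly_Mapping.single u (Poly_Mapping.lookup p u)) k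
    = (\<Sum>u\<in>Poly_Mapping.keys p. if u = k then Poly_Mapping.lookup p u else 0)"
    unfolding lookup_sum by (intro sum.cong refl) (simp add: lookup_single when_def)
  also have "\<dots> = Poly_Mapping.lookup p k"
    by (simp add: sum.delta not_in_keys_iff_lookup_eq_zero)
  finally show "Poly_Mapping.lookup (\<Sum>u\<in>Poly_Mapping.keys p. Poly_Mapping.single u (Poly_Mapping.lookup p u)) k
    = Poly_Mapping.lookup p k" .
qed

lemma letters_zero [simp]: "letters 0 = []"
  by (simp add: zero_fword_def)

context rational_cherednik
begin

section \<open>The action of the free algebra on polynomial functions\<close>

definition valid_gen :: "'a gen \<Rightarrow> bool" where
  "valid_gen g = (case g of GW w \<Rightarrow> w \<in> W | GX \<xi> \<Rightarrow> linear \<xi> | GY y \<Rightarrow> True)"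

lemma valid_gen_simps [simp]:
  "valid_gen (GW w) \<longleftrightarrow> w \<in> W" "valid_gen (GX \<xi>) \<longleftrightarrow> linear \<xi>" "valid_gen (GY y)"
  by (simp_all add: valid_gen_def)

definition FC :: "'a free set" where
  "FC = {p. \<forall>u\<in>Poly_Mapping.keys p. \<forall>g\<in>set (letters u). valid_gen g}"

lemma free_algebra_simps [simp]:
  "carrier free_algebra = FC" "monoid.mult free_algebra = (*)" "one free_algebra = 1"
  "zero free_algebra = 0" "add free_algebra = (+)"
  by (simp_all add: free_algebra_def FC_def valid_gen_def)

lemma FC_zero [simp]: "0 \<in> FC" and FC_one [simp]: "1 \<in> FC"
  by (simp_all add: FC_def zero_fword_def)

lemma FC_single: "a = 0 \<or> (\<forall>g\<in>set (letters u). valid_gen g) \<Longrightarrow> Poly_Mapping.single u a \<in> FC"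
  by (auto simp: FC_def)

lemma FC_scal [simp]: "scal a \<in> FC"
  by (rule FC_single) (simp add: zero_fword_def)

lemma FC_gen [simp]: "valid_gen g \<Longrightarrow> gen g \<in> FC"
  by (rule FC_single) simp

lemma FC_add [simp]: "p \<in> FC \<Longrightarrow> q \<in> FC \<Longrightarrow> p + q \<in> FC"
  unfolding FC_def using keys_add[of p q] by blast

lemma FC_minus [simp]: "p \<in> FC \<Longrightarrow> - p \<in> FC"
  unfolding FC_def by (auto simp: in_keys_iff)

lemma FC_diff [simp]: "p \<in> FC \<Longrightarrow> q \<in> FC \<Longrightarrow> p - q \<in> FC"
  using FC_add[of p "- q"] by simp

lemma FC_mult [simp]: "p \<in> FC \<Longrightarrow> q \<in> FC \<Longrightarrow> p * q \<in> FC"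
proof -
  assume pq: "p \<in> FC" "q \<in> FC"
  have "\<forall>g\<in>set (letters u). valid_gen g" if u: "u \<in> Poly_Mapping.keys (p * q)" for u
  proof -
    obtain a b where "a \<in> Poly_Mapping.keys p" "b \<in> Poly_Mapping.keys q" "u = a + b"
      using keys_mult[of p q] u by blast
    then show ?thesis using pq by (auto simp: FC_def plus_fword_def)
  qed
  then show ?thesis by (simp add: FC_def)
qed

lemma FC_sum [simp]: "(\<And>i. i \<in> I \<Longrightarrow> f i \<in> FC) \<Longrightarrow> sum f I \<in> FC"
  by (induction I rule: infinite_finite_induct) auto

lemma FC_induct [consumes 1, case_names zero single add]:
  assumes "p \<in> FC"
    and "P 0"
    and "\<And>us a. (\<And>g. g \<in> set us \<Longrightarrow> valid_gen g) \<Longrightarrow> P (Poly_Mapping.single (FWord us) a)"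
    and "\<And>p q. p \<in> FC \<Longrightarrow> P p \<Longrightarrow> q \<in> FC \<Longrightarrow> P q \<Longrightarrow> P (p + q)"
  shows "P p"
proof -
  have "P (\<Sum>u\<in>U. Poly_Mapping.single u (Poly_Mapping.lookup p u)) \<and>
     (\<Sum>u\<in>U. Poly_Mapping.single u (Poly_Mapping.lookup p u)) \<in> FC" if "finite U" "U \<subseteq> Poly_Mapping.keys p" for U
    using that
  proof (induction U rule: finite_induct)
    case empty
    show ?case using assms(2) by simp
  next
    case (insert u U)
    then have v: "\<And>g. g \<in> set (letters u) \<Longrightarrow> valid_gen g" using assms(1) by (auto simp: FC_def)
    have "P (Poly_Mapping.single u (Poly_Mapping.lookup p u))"
      using assms(3)[OF v] by (metis fword.collapse)
    moreover have "Poly_Mapping.single u (Poly_Mapping.lookup p u) \<in> FC"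
      by (rule FC_single) (use v in auto)
    ultimately show ?case using insert assms(4) by simp
  qed
  from this[of "Poly_Mapping.keys p"] show ?thesis by (simp add: poly_mapping_sum_single)
qed

definition DD :: "'a \<times> 'a \<Rightarrow> ('a \<Rightarrow> complex) \<Rightarrow> 'a \<Rightarrow> complex" where
  "DD y f x = D (fst y) f x + \<i> * D (snd y) f x"

fun rho_gen :: "'a gen \<Rightarrow> ('a \<Rightarrow> complex) \<Rightarrow> 'a \<Rightarrow> complex" where
  "rho_gen (GW w) f = (\<lambda>x. f (inv_into UNIV w x))"
| "rho_gen (GX \<xi>) f = (\<lambda>x. \<xi> x * f x)"
| "rho_gen (GY y) f = DD y f"

definition rho_word :: "'a gen list \<Rightarrow> ('a \<Rightarrow> complex) \<Rightarrow> 'a \<Rightarrow> complex" where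
  "rho_word us f = foldr rho_gen us f"

definition rho :: "'a free \<Rightarrow> ('a \<Rightarrow> complex) \<Rightarrow> 'a \<Rightarrow> complex" where
  "rho p f x = (\<Sum>u\<in>Poly_Mapping.keys p. Poly_Mapping.lookup p u * rho_word (letters u) f x)"

lemma rho_word_simps [simp]: "rho_word [] f = f" "rho_word (g # us) f = rho_gen g (rho_word us f)"
  "rho_word (us @ vs) f = rho_word us (rho_word vs f)"
  by (simp_all add: rho_word_def)

lemma DD_Pol: "f \<in> Pol \<Longrightarrow> DD y f \<in> Pol"
  unfolding DD_def[abs_def] by (intro Pol.add Pol_scale D_Pol)

lemma rho_gen_Pol: "valid_gen g \<Longrightarrow> f \<in> Pol \<Longrightarrow> rho_gen g f \<in> Pol"
  using Pol_W[OF _ inv_W] by (cases g) (auto intro: Pol.lin DD_Pol)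

lemma rho_gen_add: "valid_gen g \<Longrightarrow> f \<in> Pol \<Longrightarrow> h \<in> Pol \<Longrightarrow>
    rho_gen g (\<lambda>x. f x + h x) = (\<lambda>x. rho_gen g f x + rho_gen g h x)"
  by (cases g) (auto simp: DD_def D_add algebra_simps intro!: ext)

lemma rho_gen_scale: "valid_gen g \<Longrightarrow> f \<in> Pol \<Longrightarrow>
    rho_gen g (\<lambda>x. a * f x) = (\<lambda>x. a * rho_gen g f x)"
  by (cases g) (auto simp: DD_def D_scale algebra_simps intro!: ext)

lemma rho_word_Pol: "(\<And>g. g \<in> set us \<Longrightarrow> valid_gen g) \<Longrightarrow> f \<in> Pol \<Longrightarrow> rho_word us f \<in> Pol"
  by (induction us) (auto intro: rho_gen_Pol)

lemma rho_word_add: "(\<And>g. g \<in> set us \<Longrightarrow> valid_gen g) \<Longrightarrow> f \<in> Pol \<Longrightarrow> h \<in> Pol \<Longrightarrow>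
    rho_word us (\<lambda>x. f x + h x) = (\<lambda>x. rho_word us f x + rho_word us h x)"
  by (induction us) (auto simp: rho_gen_add rho_word_Pol)

lemma rho_word_scale: "(\<And>g. g \<in> set us \<Longrightarrow> valid_gen g) \<Longrightarrow> f \<in> Pol \<Longrightarrow>
    rho_word us (\<lambda>x. a * f x) = (\<lambda>x. a * rho_word us f x)"
  by (induction us) (auto simp: rho_gen_scale rho_word_Pol)

lemma rho_zero [simp]: "rho 0 f = (\<lambda>x. 0)"
  by (auto simp: rho_def)

lemma rho_single [simp]: "rho (Poly_Mapping.single u a) f = (\<lambda>x. a * rho_word (letters u) f x)"
  by (auto simp: rho_def)

lemma rho_add [simp]: "rho (p + q) f = (\<lambda>x. rho p f x + rho q f x)"
  unfolding rho_def by (subst setsum_keys_plus_distrib) (auto simp: algebra_simps)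

lemma rho_minus [simp]: "rho (- p) f = (\<lambda>x. - rho p f x)"
proof -
  have "(\<lambda>x. rho p f x + rho (- p) f x) = (\<lambda>x. 0)" using rho_add[of p "- p" f] by simp
  then show ?thesis by (auto simp: fun_eq_iff add_eq_0_iff2 minus_equation_iff)
qed

lemma rho_diff [simp]: "rho (p - q) f = (\<lambda>x. rho p f x - rho q f x)"
  using rho_add[of p "- q" f] by simp

lemma rho_sum: "rho (sum p I) f = (\<lambda>x. \<Sum>i\<in>I. rho (p i) f x)"
  by (induction I rule: infinite_finite_induct) auto

lemma rho_one [simp]: "rho 1 f = f"
  using rho_single[of 0 1 f] unfolding single_one by (simp add: zero_fword_def)

lemma rho_scal [simp]: "rho (scal a) f = (\<lambda>x. a * f x)"
  by (simp add: zero_fword_def)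

lemma rho_gen [simp]: "rho (gen g) f = rho_gen g f"
  by simp

lemma rho_Pol: "p \<in> FC \<Longrightarrow> f \<in> Pol \<Longrightarrow> rho p f \<in> Pol"
proof (induction p rule: FC_induct)
  case zero
  then show ?case by (simp add: Pol.const)
next
  case (single us a)
  then show ?case by (simp add: Pol_scale rho_word_Pol)
next
  case (add p q)
  then show ?case by (simp add: Pol.add)
qed

lemma rho_fadd: "p \<in> FC \<Longrightarrow> f \<in> Pol \<Longrightarrow> g \<in> Pol \<Longrightarrow> rho p (\<lambda>x. f x + g x) = (\<lambda>x. rho p f x + rho p g x)"
  by (induction p rule: FC_induct) (auto simp: rho_word_add algebra_simps)

lemma rho_fscale: "p \<in> FC \<Longrightarrow> f \<in> Pol \<Longrightarrow> rho p (\<lambda>x. a * f x) = (\<lambda>x. a * rho p f x)"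
  by (induction p rule: FC_induct) (auto simp: rho_word_scale algebra_simps)

lemma rho_fzero: "p \<in> FC \<Longrightarrow> rho p (\<lambda>x. 0) = (\<lambda>x. 0)"
  using rho_fscale[of p "\<lambda>x. 0" 0] by (simp add: Pol.const)

lemma rho_mult:
  assumes "p \<in> FC" "q \<in> FC" and f: "f \<in> Pol"
  shows "rho (p * q) f = rho p (rho q f)"
  using assms(2)
proof (induction q rule: FC_induct)
  case zero
  show ?case by (simp add: rho_fzero assms(1))
next
  case (single us a)
  from assms(1) show ?case
  proof (induction p rule: FC_induct)
    case zero
    show ?case by simp
  next
    case (single vs b)
    then show ?case using \<open>\<And>g. g \<in> set us \<Longrightarrow> valid_gen g\<close> f
      by (simp add: mult_single plus_fword_def rho_word_scale rho_word_Pol mult.assoc)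
  next
    case (add p p')
    then show ?case by (simp add: distrib_right)
  qed
next
  case (add q q')
  then show ?case using assms by (simp add: distrib_left rho_fadd rho_Pol)
qed

lemma ring_free_algebra: "ring free_algebra"
proof (rule ringI)
  show "abelian_group free_algebra"
  proof (rule abelian_groupI)
    fix x assume "x \<in> carrier free_algebra"
    then show "\<exists>y\<in>carrier free_algebra. y \<oplus>\<^bsub>free_algebra\<^esub> x = \<zero>\<^bsub>free_algebra\<^esub>"
      by (intro bexI[of _ "- x"]) auto
  qed (auto simp: add.assoc add.commute)
  show "Group.monoid free_algebra"
    by (rule Group.monoidI) (auto simp: mult.assoc)
qed (auto simp: distrib_left distrib_right)

lemma a_inv_free_algebra: "p \<in> FC \<Longrightarrow> \<ominus>\<^bsub>free_algebra\<^esub> p = - p"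
  using abelian_group.minus_equality[OF ring.is_abelian_group[OF ring_free_algebra], of "- p" p] by simp

lemma a_minus_free_algebra: "p \<in> FC \<Longrightarrow> q \<in> FC \<Longrightarrow> p \<ominus>\<^bsub>free_algebra\<^esub> q = p - q"
  by (simp add: a_minus_def a_inv_free_algebra)

lemma D_linear': "f \<in> Pol \<Longrightarrow> D (u + v) f x = D u f x + D v f x"
  "f \<in> Pol \<Longrightarrow> D (u - v) f x = D u f x - D v f x"
  "f \<in> Pol \<Longrightarrow> D (r *\<^sub>R u) f x = of_real r * D u f x"
  using linear_add[OF D_linear] linear_diff[OF D_linear] linear_cmul[OF D_linear]
  by (simp_all add: scaleR_conv_of_real)

text \<open>The annihilator of the polynomial functions. It is a two-sided ideal containing every
  relation, which is how the action descends to \<open>H_alg\<close>.\<close>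

definition KF :: "'a free set" where
  "KF = {p \<in> FC. \<forall>f\<in>Pol. rho p f = (\<lambda>x. 0)}"

lemma KF_I: "p \<in> FC \<Longrightarrow> (\<And>f x. f \<in> Pol \<Longrightarrow> rho p f x = 0) \<Longrightarrow> p \<in> KF"
  by (auto simp: KF_def)

lemma linear_act_dual: "w \<in> W \<Longrightarrow> linear \<xi> \<Longrightarrow> linear (act_dual w \<xi>)"
  using linear_compose[OF linear_W[OF inv_W]] by (auto simp: act_dual_def o_def)

lemma smash_relations_KF: "smash_relations \<subseteq> KF"
proof
  fix r assume "r \<in> smash_relations"
  then consider (1) "r = gen (GW id) - 1"
    | (2) w w' where "r = gen (GW w) * gen (GW w') - gen (GW (w \<circ> w'))" "w \<in> W" "w' \<in> W"
    | (3) a b \<xi> \<eta> where "r = gen (GX (\<lambda>v. a * \<xi> v + b * \<eta> v)) - (scal a * gen (GX \<xi>) + scal b * gen (GX \<eta>))"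
        "linear \<xi>" "linear \<eta>"
    | (4) a b y z where "r = gen (GY (cscale a y + cscale b z)) - (scal a * gen (GY y) + scal b * gen (GY z))"
    | (5) w \<xi> where "r = gen (GW w) * gen (GX \<xi>) - gen (GX (act_dual w \<xi>)) * gen (GW w)" "w \<in> W" "linear \<xi>"
    | (6) w y where "r = gen (GW w) * gen (GY y) - gen (GY (act_h w y)) * gen (GW w)" "w \<in> W"
    unfolding smash_relations_def by blast
  then show "r \<in> KF"
  proof cases
    case 1
    show ?thesis unfolding 1 by (rule KF_I) (auto simp: id_W inv_id)
  next
    case 2
    have inv: "inv_into UNIV (w \<circ> w') x = inv_into UNIV w' (inv_into UNIV w x)" for x
      using o_inv_distrib[OF bij_W[OF 2(2)] bij_W[OF 2(3)]] by simp
    have "w \<circ> w' \<in> W" using 2 by (simp add: comp_W)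
    then show ?thesis unfolding 2(1) using 2(2,3)
      by (intro KF_I) (auto simp: rho_mult inv simp del: mult_single)
  next
    case 3
    have l: "linear (\<lambda>v. a * \<xi> v + b * \<eta> v)"
      using 3 by (intro linear_compose_add linear_const_mult)
    show ?thesis unfolding 3(1) using 3(2,3) l
      by (intro KF_I) (auto simp: rho_mult algebra_simps simp del: mult_single)
  next
    case 4
    have "rho (gen (GY (cscale a y + cscale b z)) - (scal a * gen (GY y) + scal b * gen (GY z))) f x = 0"
      if f: "f \<in> Pol" for f x
    proof -
      have a: "a = of_real (Re a) + \<i> * of_real (Im a)" "b = of_real (Re b) + \<i> * of_real (Im b)"
        by (simp_all add: complex_eq_iff)
      have "DD (cscale a y + cscale b z) f x
         = (of_real (Re a) + \<i> * of_real (Im a)) * DD y f x + (of_real (Re b) + \<i> * of_real (Im b)) * DD z f x"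
        unfolding DD_def cscale_def using f
        by (simp add: D_linear') (simp add: algebra_simps)
      then show ?thesis using f by (simp add: rho_mult a[symmetric] del: mult_single)
    qed
    then show ?thesis unfolding 4 by (intro KF_I) auto
  next
    case 5
    have l: "linear (act_dual w \<xi>)" using 5 by (simp add: linear_act_dual)
    show ?thesis unfolding 5(1) using 5(2,3) l
      by (intro KF_I) (auto simp: rho_mult act_dual_def simp del: mult_single)
  next
    case 6
    have "DD y f (inv_into UNIV w x) = DD (act_h w y) (\<lambda>x. f (inv_into UNIV w x)) x" if "f \<in> Pol" for f x
      using 6(2) that by (simp add: DD_def act_h_def D_W[OF inv_W[OF 6(2)]])
    then show ?thesis unfolding 6(1) using 6(2)
      by (intro KF_I) (auto simp: rho_mult simp del: mult_single)
  qed
qed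

lemma DD_commute:
  assumes f: "f \<in> Pol"
  shows "DD y (DD z f) x = DD z (DD y f) x"
proof -
  have e: "DD y (DD z f) x = D (fst y) (D (fst z) f) x + \<i> * D (fst y) (D (snd z) f) x
     + \<i> * (D (snd y) (D (fst z) f) x + \<i> * D (snd y) (D (snd z) f) x)" for y z
    unfolding DD_def[abs_def] using f by (simp add: D_add D_scale D_Pol Pol_scale)
  show ?thesis unfolding e
    using D_commute[OF f, of "fst y" "fst z" x] D_commute[OF f, of "fst y" "snd z" x]
      D_commute[OF f, of "snd y" "fst z" x] D_commute[OF f, of "snd y" "snd z" x]
    by (simp add: algebra_simps)
qed

lemma DD_lin:
  assumes "linear \<xi>" and f: "f \<in> Pol"
  shows "DD y (\<lambda>x. \<xi> x * f x) x = \<xi> x * DD y f x + pairing y \<xi> * f x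
    - of_real c * (\<Sum>s\<in>reflections. pairing y (\<lambda>v. of_real (\<alpha> s v)) * pairing (\<alpha>v s, 0) \<xi> * f (s x))"
proof -
  have e: "\<xi> (b - s b) = of_real (\<alpha> s b) * \<xi> (\<alpha>v s)" if "s \<in> reflections" for s b
    using that assms by (simp add: reflection_formula linear_cmul scaleR_conv_of_real)
  have "DD y (\<lambda>x. \<xi> x * f x) x = \<xi> x * DD y f x + pairing y \<xi> * f x
    - of_real c * (\<Sum>s\<in>reflections. \<xi> (fst y - s (fst y)) * f (s x) + \<i> * (\<xi> (snd y - s (snd y)) * f (s x)))"
    unfolding DD_def pairing_def sum.distrib sum_distrib_left[symmetric]
    using assms by (simp add: D_lin algebra_simps)
  also have "(\<Sum>s\<in>reflections. \<xi> (fst y - s (fst y)) * f (s x) + \<i> * (\<xi> (snd y - s (snd y)) * f (s x)))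
    = (\<Sum>s\<in>reflections. pairing y (\<lambda>v. of_real (\<alpha> s v)) * pairing (\<alpha>v s, 0) \<xi> * f (s x))"
    using assms(1) by (intro sum.cong refl) (simp add: e pairing_def linear_0 algebra_simps)
  finally show ?thesis .
qed

definition yx_relation :: "'a \<times> 'a \<Rightarrow> ('a \<Rightarrow> complex) \<Rightarrow> 'a free" where
  "yx_relation y \<xi> = gen (GY y) * gen (GX \<xi>) - gen (GX \<xi>) * gen (GY y)
        - (scal (pairing y \<xi>)
           - scal (complex_of_real c) *
             (\<Sum>s\<in>reflections.
                scal (pairing y (\<lambda>v. complex_of_real (\<alpha> s v)) * pairing (\<alpha>v s, 0) \<xi>) * gen (GW s)))"

lemma cherednik_relations_KF: "cherednik_relations \<subseteq> KF"
proof
  fix r assume "r \<in> cherednik_relations"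
  then consider (1) \<xi> \<eta> where "r = gen (GX \<xi>) * gen (GX \<eta>) - gen (GX \<eta>) * gen (GX \<xi>)" "linear \<xi>" "linear \<eta>"
    | (2) y z where "r = gen (GY y) * gen (GY z) - gen (GY z) * gen (GY y)"
    | (3) y \<xi> where "r = yx_relation y \<xi>" "linear \<xi>"
    unfolding cherednik_relations_def yx_relation_def by blast
  then show "r \<in> KF"
  proof cases
    case 1
    show ?thesis unfolding 1(1) using 1(2,3)
      by (intro KF_I) (auto simp: rho_mult simp del: mult_single)
  next
    case 2
    show ?thesis unfolding 2
      by (intro KF_I) (auto simp: rho_mult DD_commute simp del: mult_single)
  next
    case 3
    have sW: "s \<in> reflections \<Longrightarrow> s \<in> W" for s by (rule reflections_subset)
    have fc: "scal z * gen (GW s) \<in> FC" if "s \<in> reflections" for s z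
      using sW[OF that] by (intro FC_mult) simp_all
    have sum_FC: "(\<Sum>s\<in>reflections. scal (z s) * gen (GW s)) \<in> FC" for z
      by (rule FC_sum) (rule fc)
    have FC: "yx_relation y \<xi> \<in> FC" unfolding yx_relation_def
      using 3 sum_FC by (intro FC_diff FC_mult) simp_all
    have "rho (yx_relation y \<xi>) f x = 0" if f: "f \<in> Pol" for f x
    proof -
      have "rho (\<Sum>s\<in>reflections. scal (z s) * gen (GW s)) f x = (\<Sum>s\<in>reflections. z s * f (s x))" for z
        unfolding rho_sum using f sW by (intro sum.cong refl) (simp add: rho_mult reflection_inv del: mult_single)
      then show ?thesis
        unfolding yx_relation_def using 3 f sum_FC DD_lin[OF 3(2) f, of y x]
        by (simp add: rho_mult del: mult_single)
    qed
    then show ?thesis unfolding 3(1) using FC by (intro KF_I)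
  qed
qed

section \<open>The ideal of relations, the quotient algebra and the left ideal defining the
  module\<close>

lemma subgroup_add_monoid_free_algebra:
  "0 \<in> J \<Longrightarrow> J \<subseteq> FC \<Longrightarrow> (\<And>p q. p \<in> J \<Longrightarrow> q \<in> J \<Longrightarrow> p + q \<in> J) \<Longrightarrow> (\<And>p. p \<in> J \<Longrightarrow> - p \<in> J)
   \<Longrightarrow> subgroup J (add_monoid free_algebra)"
proof (unfold_locales, goal_cases)
  case (4 x)
  then have "inv\<^bsub>add_monoid free_algebra\<^esub> x = - x"
    using a_inv_free_algebra[of x] by (auto simp: a_inv_def)
  then show ?case using 4 by simp
qed auto

lemma KF_ideal: "ideal KF free_algebra"
proof (rule idealI[OF ring_free_algebra])
  show "subgroup KF (add_monoid free_algebra)"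
    by (rule subgroup_add_monoid_free_algebra) (auto simp: KF_def)
  fix a x assume "a \<in> KF" "x \<in> carrier free_algebra"
  then show "x \<otimes>\<^bsub>free_algebra\<^esub> a \<in> KF" "a \<otimes>\<^bsub>free_algebra\<^esub> x \<in> KF"
    by (auto simp: KF_def rho_mult rho_fzero rho_Pol)
qed

lemma rel_ideal_ideal: "ideal rel_ideal free_algebra"
  unfolding rel_ideal_def
  by (rule ring.genideal_ideal[OF ring_free_algebra])
    (use smash_relations_KF cherednik_relations_KF in \<open>auto simp: KF_def\<close>)

lemma rel_ideal_KF: "rel_ideal \<subseteq> KF"
  unfolding rel_ideal_def
  by (rule ring.genideal_minimal[OF ring_free_algebra KF_ideal])
    (use smash_relations_KF cherednik_relations_KF in auto)

lemma relations_rel_ideal: "smash_relations \<union> cherednik_relations \<subseteq> rel_ideal"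
  unfolding rel_ideal_def
  by (rule ring.genideal_self[OF ring_free_algebra])
    (use smash_relations_KF cherednik_relations_KF in \<open>auto simp: KF_def\<close>)

lemma rel_ideal_FC: "p \<in> rel_ideal \<Longrightarrow> p \<in> FC"
  using rel_ideal_KF by (auto simp: KF_def)

lemma rel_ideal_mult: "p \<in> rel_ideal \<Longrightarrow> q \<in> FC \<Longrightarrow> q * p \<in> rel_ideal" "p \<in> rel_ideal \<Longrightarrow> q \<in> FC \<Longrightarrow> p * q \<in> rel_ideal"
  using ideal.I_l_closed[OF rel_ideal_ideal] ideal.I_r_closed[OF rel_ideal_ideal] by simp_all

lemma rel_ideal_zero: "0 \<in> rel_ideal"
  and rel_ideal_add: "p \<in> rel_ideal \<Longrightarrow> q \<in> rel_ideal \<Longrightarrow> p + q \<in> rel_ideal"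
  using additive_subgroup.zero_closed[OF ideal.axioms(1)[OF rel_ideal_ideal]]
    additive_subgroup.a_closed[OF ideal.axioms(1)[OF rel_ideal_ideal]] by simp_all

lemma cls_eq_iff: "p \<in> FC \<Longrightarrow> q \<in> FC \<Longrightarrow> cls p = cls q \<longleftrightarrow> p - q \<in> rel_ideal"
  using ring.quotient_eq_iff_same_a_r_cos[OF ring_free_algebra rel_ideal_ideal, of p q]
  by (auto simp: cls_def a_minus_free_algebra)

lemma ring_H_alg: "ring H_alg"
  unfolding H_alg_def by (rule ideal.quotient_is_ring[OF rel_ideal_ideal])

lemma carrier_H_alg: "carrier H_alg = cls ` FC"
  unfolding H_alg_def FactRing_def cls_def[abs_def] by (auto simp: A_RCOSETS_def')

lemma cls_mult: "p \<in> FC \<Longrightarrow> q \<in> FC \<Longrightarrow> cls p \<otimes>\<^bsub>H_alg\<^esub> cls q = cls (p * q)"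
  using ideal.rcoset_mult_add[OF rel_ideal_ideal, of p q] by (simp add: H_alg_def FactRing_def cls_def)

lemma cls_add: "p \<in> FC \<Longrightarrow> q \<in> FC \<Longrightarrow> cls p \<oplus>\<^bsub>H_alg\<^esub> cls q = cls (p + q)"
  using ideal.a_rcos_sum[OF rel_ideal_ideal, of p q] by (simp add: H_alg_def FactRing_def cls_def)

lemma cls_zero: "\<zero>\<^bsub>H_alg\<^esub> = cls 0"
  using ring.a_rcos_zero[OF ring_free_algebra rel_ideal_ideal, of 0] rel_ideal_zero
  by (simp add: H_alg_def FactRing_def cls_def)

lemma cls_uminus: "p \<in> FC \<Longrightarrow> \<ominus>\<^bsub>H_alg\<^esub> (cls p) = cls (- p)"
  using abelian_group.minus_equality[OF ring.is_abelian_group[OF ring_H_alg], of "cls (-p)" "cls p"]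
  by (simp add: carrier_H_alg cls_add cls_zero)

lemma left_ideal_iff:
  "left_ideal H_alg J \<longleftrightarrow> J \<subseteq> cls ` FC \<and> cls 0 \<in> J \<and> (\<forall>a\<in>J. \<forall>b\<in>J. a \<oplus>\<^bsub>H_alg\<^esub> b \<in> J) \<and>
     (\<forall>r\<in>cls ` FC. \<forall>j\<in>J. r \<otimes>\<^bsub>H_alg\<^esub> j \<in> J)"
proof
  assume "left_ideal H_alg J"
  then have J: "additive_subgroup J H_alg" "\<forall>r\<in>carrier H_alg. \<forall>j\<in>J. r \<otimes>\<^bsub>H_alg\<^esub> j \<in> J"
    by (auto simp: left_ideal_def)
  show "J \<subseteq> cls ` FC \<and> cls 0 \<in> J \<and> (\<forall>a\<in>J. \<forall>b\<in>J. a \<oplus>\<^bsub>H_alg\<^esub> b \<in> J) \<and>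
     (\<forall>r\<in>cls ` FC. \<forall>j\<in>J. r \<otimes>\<^bsub>H_alg\<^esub> j \<in> J)"
    using additive_subgroup.a_subset[OF J(1)] additive_subgroup.zero_closed[OF J(1)]
      additive_subgroup.a_closed[OF J(1)] J(2) by (auto simp: carrier_H_alg cls_zero)
next
  assume J: "J \<subseteq> cls ` FC \<and> cls 0 \<in> J \<and> (\<forall>a\<in>J. \<forall>b\<in>J. a \<oplus>\<^bsub>H_alg\<^esub> b \<in> J) \<and>
     (\<forall>r\<in>cls ` FC. \<forall>j\<in>J. r \<otimes>\<^bsub>H_alg\<^esub> j \<in> J)"
  \<comment> \<open>Negation is left multiplication by the class of \<open>- 1\<close>, so closure
    under sums and left multiples is enough.\<close>
  have inv: "\<ominus>\<^bsub>H_alg\<^esub> x \<in> J" if x: "x \<in> J" for x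
  proof -
    obtain p where p: "p \<in> FC" "x = cls p" using J x by auto
    have "\<ominus>\<^bsub>H_alg\<^esub> x = cls (- 1) \<otimes>\<^bsub>H_alg\<^esub> x"
      using p by (simp add: cls_mult cls_uminus)
    also have "\<dots> \<in> J" using J x by auto
    finally show ?thesis .
  qed
  have "subgroup J (add_monoid H_alg)"
  proof (unfold_locales, goal_cases)
    case (4 x)
    then show ?case using inv[of x] by (simp add: a_inv_def)
  qed (use J in \<open>auto simp: carrier_H_alg cls_zero\<close>)
  then show "left_ideal H_alg J"
    using J by (auto simp: left_ideal_def carrier_H_alg additive_subgroup_def)
qed

definition triv_gens :: "'a free set set" where
  "triv_gens = {cls (gen (GW w) - 1) |w. w \<in> W} \<union> {cls (gen (GY y)) |y. True}"

lemma triv_ideal_left_ideal: "left_ideal H_alg triv_ideal"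
proof -
  have t: "triv_ideal = \<Inter>{J. left_ideal H_alg J \<and> triv_gens \<subseteq> J}"
    by (simp add: triv_ideal_def triv_gens_def)
  have "triv_gens \<subseteq> cls ` FC" by (auto simp: triv_gens_def)
  moreover have "left_ideal H_alg (cls ` FC)"
    unfolding left_ideal_iff by (auto simp: cls_add cls_mult)
  ultimately have "triv_ideal \<subseteq> cls ` FC" unfolding t by blast
  then show ?thesis unfolding left_ideal_iff
    unfolding t by (auto simp: left_ideal_iff)
qed

lemma triv_gens_subset: "triv_gens \<subseteq> triv_ideal"
  unfolding triv_ideal_def triv_gens_def by blast

text \<open>The preimage of \<open>triv_ideal\<close> in the free algebra. Arguments about cosets
  are carried out on representatives modulo \<open>LF\<close>.\<close>

definition LF :: "'a free set" where
  "LF = {p \<in> FC. cls p \<in> triv_ideal}"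

lemma LF_FC: "p \<in> LF \<Longrightarrow> p \<in> FC" by (simp add: LF_def)

lemma triv_ideal_eq: "triv_ideal = cls ` LF"
  using triv_ideal_left_ideal unfolding left_ideal_iff LF_def by auto

lemma LF_add: "p \<in> LF \<Longrightarrow> q \<in> LF \<Longrightarrow> p + q \<in> LF"
  using triv_ideal_left_ideal unfolding left_ideal_iff LF_def by (auto simp: cls_add[symmetric])

lemma LF_mult: "p \<in> FC \<Longrightarrow> q \<in> LF \<Longrightarrow> p * q \<in> LF"
  using triv_ideal_left_ideal unfolding left_ideal_iff LF_def by (auto simp: cls_mult[symmetric])

lemma LF_minus: "p \<in> LF \<Longrightarrow> - p \<in> LF"
  using LF_mult[of "-1" p] by simp

lemma LF_diff: "p \<in> LF \<Longrightarrow> q \<in> LF \<Longrightarrow> p - q \<in> LF"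
  using LF_add[of p "- q"] LF_minus by simp

lemma rel_ideal_LF: "p \<in> rel_ideal \<Longrightarrow> p \<in> LF"
proof -
  assume p: "p \<in> rel_ideal"
  then have "cls p = cls 0" using cls_eq_iff[of p 0] rel_ideal_FC by simp
  then show ?thesis using triv_ideal_left_ideal p rel_ideal_FC unfolding left_ideal_iff LF_def by auto
qed

lemma LF_zero: "0 \<in> LF"
  by (rule rel_ideal_LF[OF rel_ideal_zero])

lemma LF_sum: "(\<And>i. i \<in> I \<Longrightarrow> f i \<in> LF) \<Longrightarrow> sum f I \<in> LF"
  by (induction I rule: infinite_finite_induct) (auto intro: LF_zero LF_add)

lemma LF_GW: "w \<in> W \<Longrightarrow> gen (GW w) - 1 \<in> LF"
  using triv_gens_subset unfolding LF_def triv_gens_def by auto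

lemma LF_GY: "gen (GY y) \<in> LF"
proof -
  have "cls (gen (GY y)) \<in> triv_gens" unfolding triv_gens_def by blast
  then show ?thesis using triv_gens_subset unfolding LF_def by auto
qed

text \<open>The classes of elements annihilating the constant \<open>1\<close> form a left ideal,
  and it contains the generators: group elements fix \<open>1\<close> and Dunkl operators kill
  it.\<close>

lemma LF_rho: "p \<in> LF \<Longrightarrow> rho p (\<lambda>x. 1) = (\<lambda>x. 0)"
proof -
  assume p: "p \<in> LF"
  let ?K = "{p \<in> FC. rho p (\<lambda>x. 1) = (\<lambda>x. 0)}"
  have one: "(\<lambda>x. 1) \<in> (Pol :: ('a \<Rightarrow> complex) set)" by (rule Pol.const)
  have "left_ideal H_alg (cls ` ?K)"
    unfolding left_ideal_iff
    by (auto simp: cls_add cls_mult intro!: imageI simp: rho_mult one rho_fzero)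
  moreover have "triv_gens \<subseteq> cls ` ?K"
    unfolding triv_gens_def by (auto intro!: imageI simp: DD_def D_const)
  ultimately have "triv_ideal \<subseteq> cls ` ?K"
    unfolding triv_ideal_def triv_gens_def by blast
  then obtain q where q: "q \<in> ?K" "cls p = cls q" using p unfolding LF_def by blast
  then have "p - q \<in> rel_ideal" using cls_eq_iff[of p q] p LF_FC by auto
  then have "rho (p - q) (\<lambda>x. 1) = (\<lambda>x. 0)" using rel_ideal_KF one by (auto simp: KF_def)
  then show ?thesis using q by (auto simp: fun_eq_iff)
qed

end

lemma pm_word_induct [consumes 1, case_names zero single add]:
  fixes p :: "'g fword \<Rightarrow>\<^sub>0 complex"
  assumes "\<forall>u\<in>Poly_Mapping.keys p. Q (letters u)"
    and "P 0"
    and "\<And>us a. Q us \<Longrightarrow> P (Poly_Mapping.single (FWord us) a)"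
    and "\<And>p q. P p \<Longrightarrow> P q \<Longrightarrow> P (p + q)"
  shows "P p"
proof -
  have "P (\<Sum>u\<in>U. Poly_Mapping.single u (Poly_Mapping.lookup p u))"
    if "finite U" "U \<subseteq> Poly_Mapping.keys p" for U
    using that
  proof (induction U rule: finite_induct)
    case empty
    show ?case using assms(2) by simp
  next
    case (insert u U)
    have "P (Poly_Mapping.single u (Poly_Mapping.lookup p u))"
      using assms(3)[of "letters u"] assms(1) insert by simp
    then show ?case using insert assms(4) by simp
  qed
  from this[of "Poly_Mapping.keys p"] show ?thesis by (simp add: poly_mapping_sum_single)
qed

lemma gen_single: "gen g * Poly_Mapping.single (FWord us) a = Poly_Mapping.single (FWord (g # us)) a"
  by (simp add: mult_single plus_fword_def)

lemma scal_single: "scal a * Poly_Mapping.single u b = Poly_Mapping.single u (a * b)"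
  by (simp add: mult_single)

lemma scal_commute: "p * scal a = scal a * p"
proof -
  have "\<forall>u\<in>Poly_Mapping.keys p. True" by simp
  then show ?thesis
    by (induction p rule: pm_word_induct[where Q = "\<lambda>_. True"])
      (auto simp: mult_single mult.commute distrib_left distrib_right)
qed

lemma single_Nil: "Poly_Mapping.single (FWord []) a = scal a"
  by (simp add: zero_fword_def)

definition xword :: "'a::euclidean_space gen list \<Rightarrow> bool" where
  "xword us \<longleftrightarrow> (\<forall>g\<in>set us. \<exists>\<xi>. linear \<xi> \<and> g = GX \<xi>)"

lemma xword_simps [simp]: "xword []" "xword (g # us) \<longleftrightarrow> (\<exists>\<xi>. linear \<xi> \<and> g = GX \<xi>) \<and> xword us"
  by (auto simp: xword_def)

lemma dual_tensors_iff: "p \<in> dual_tensors \<longleftrightarrow> (\<forall>u\<in>Poly_Mapping.keys p. xword (letters u))"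
  by (simp add: dual_tensors_def xword_def)

lemma dual_degree_iff: "p \<in> dual_tensors_of_degree d \<longleftrightarrow>
    (\<forall>u\<in>Poly_Mapping.keys p. xword (letters u) \<and> length (letters u) = d)"
  by (auto simp: dual_tensors_of_degree_def dual_tensors_iff)

lemma dual_zero: "0 \<in> dual_tensors" "0 \<in> dual_tensors_of_degree d"
  by (simp_all add: dual_tensors_iff dual_degree_iff)

lemma dual_single: "xword us \<Longrightarrow> Poly_Mapping.single (FWord us) a \<in> dual_tensors"
  "xword us \<Longrightarrow> length us = d \<Longrightarrow> Poly_Mapping.single (FWord us) a \<in> dual_tensors_of_degree d"
  by (simp_all add: dual_tensors_iff dual_degree_iff)

lemma dual_add: "p \<in> dual_tensors \<Longrightarrow> q \<in> dual_tensors \<Longrightarrow> p + q \<in> dual_tensors"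
  "p \<in> dual_tensors_of_degree d \<Longrightarrow> q \<in> dual_tensors_of_degree d \<Longrightarrow> p + q \<in> dual_tensors_of_degree d"
  using keys_add[of p q] by (auto simp: dual_tensors_iff dual_degree_iff)

lemma dual_degree_dual: "p \<in> dual_tensors_of_degree d \<Longrightarrow> p \<in> dual_tensors"
  by (simp add: dual_tensors_of_degree_def)

lemma dual_gen: "p \<in> dual_tensors \<Longrightarrow> linear \<xi> \<Longrightarrow> gen (GX \<xi>) * p \<in> dual_tensors"
  unfolding dual_tensors_iff[of p]
  by (induction p rule: pm_word_induct) (auto simp: gen_single distrib_left intro: dual_zero dual_add dual_single)

lemma dual_gen_degree: "p \<in> dual_tensors_of_degree d \<Longrightarrow> linear \<xi> \<Longrightarrow> gen (GX \<xi>) * p \<in> dual_tensors_of_degree (Suc d)"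
  unfolding dual_degree_iff[of p]
  by (induction p rule: pm_word_induct[where Q = "\<lambda>us. xword us \<and> length us = d"])
    (auto simp: gen_single distrib_left intro: dual_zero dual_add dual_single)

lemma dual_scal: "p \<in> dual_tensors \<Longrightarrow> scal a * p \<in> dual_tensors"
  unfolding dual_tensors_iff[of p]
  by (induction p rule: pm_word_induct) (auto simp: scal_single distrib_left intro: dual_zero dual_add dual_single)

lemma dual_scal_degree: "p \<in> dual_tensors_of_degree d \<Longrightarrow> scal a * p \<in> dual_tensors_of_degree d"
  unfolding dual_degree_iff[of p]
  by (induction p rule: pm_word_induct[where Q = "\<lambda>us. xword us \<and> length us = d"])
    (auto simp: scal_single distrib_left intro: dual_zero dual_add dual_single)

lemma dual_sum_degree: "(\<And>i. i \<in> I \<Longrightarrow> f i \<in> dual_tensors_of_degree d) \<Longrightarrow> sum f I \<in> dual_tensors_of_degree d"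
  by (induction I rule: infinite_finite_induct) (auto intro: dual_zero dual_add)

text \<open>The formal directional derivative of a word; by Euler's formula it detects when a word
  combination vanishes modulo the relations.\<close>

primrec word_deriv :: "'a::euclidean_space \<Rightarrow> 'a gen list \<Rightarrow> 'a free" where
  "word_deriv b [] = 0"
| "word_deriv b (g # us) = scal (eval_gen g b) * Poly_Mapping.single (FWord us) 1 + gen g * word_deriv b us"

lemma word_deriv_degree: "xword us \<Longrightarrow> word_deriv b us \<in> dual_tensors_of_degree (length us - 1)"
proof (induction us)
  case Nil
  show ?case by (simp add: dual_zero)
next
  case (Cons g us)
  have "gen g * word_deriv b us \<in> dual_tensors_of_degree (length us)"
  proof (cases us)
    case Nil
    then show ?thesis by (simp add: dual_zero)
  next
    case (Cons h vs)
    then show ?thesis using Cons.IH Cons.prems dual_gen_degree[of "word_deriv b us" "length us - 1"] by auto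
  qed
  then show ?case using Cons.prems by (auto simp: scal_single intro!: dual_add dual_single)
qed

context rational_cherednik
begin

section \<open>Normal form in the induced module: spanning and independence\<close>

lemma xword_valid: "xword us \<Longrightarrow> g \<in> set us \<Longrightarrow> valid_gen g"
  by (auto simp: xword_def)

lemma dual_FC: "p \<in> dual_tensors \<Longrightarrow> p \<in> FC"
  by (auto simp: dual_tensors_iff FC_def intro: xword_valid)

text \<open>The elements represented by a tensor in the dual space modulo \<open>LF\<close>.
  \<open>FC_SF\<close> shows that these are all, by moving group elements and vectors to the right,
  where they meet the generators of the left ideal.\<close>

definition SF :: "'a free set" where
  "SF = {p \<in> FC. \<exists>q\<in>dual_tensors. p - q \<in> LF}"

lemma SF_LF: "p \<in> LF \<Longrightarrow> p \<in> SF"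
  unfolding SF_def using LF_FC dual_zero(1) by (auto intro!: bexI[of _ 0])

lemma SF_dual: "p \<in> dual_tensors \<Longrightarrow> p \<in> SF"
  unfolding SF_def using dual_FC LF_zero by (auto intro!: bexI[of _ p])

lemma SF_add: "p \<in> SF \<Longrightarrow> q \<in> SF \<Longrightarrow> p + q \<in> SF"
proof -
  assume "p \<in> SF" "q \<in> SF"
  then obtain p' q' where "p \<in> FC" "p' \<in> dual_tensors" "p - p' \<in> LF" "q \<in> FC" "q' \<in> dual_tensors" "q - q' \<in> LF"
    unfolding SF_def by blast
  then show ?thesis unfolding SF_def
    using LF_add[of "p - p'" "q - q'"] dual_add(1)[of p' q']
    by (auto intro!: bexI[of _ "p' + q'"] simp: algebra_simps)
qed

lemma SF_gen: "p \<in> SF \<Longrightarrow> linear \<xi> \<Longrightarrow> gen (GX \<xi>) * p \<in> SF"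
proof -
  assume "p \<in> SF" and l: "linear \<xi>"
  then obtain p' where p': "p \<in> FC" "p' \<in> dual_tensors" "p - p' \<in> LF"
    unfolding SF_def by blast
  have "gen (GX \<xi>) * p - gen (GX \<xi>) * p' \<in> LF"
    using LF_mult[of "gen (GX \<xi>)" "p - p'"] p' l by (simp add: right_diff_distrib)
  then show ?thesis unfolding SF_def using dual_gen[OF p'(2) l] p' l by auto
qed

lemma SF_scal: "p \<in> SF \<Longrightarrow> scal a * p \<in> SF"
proof -
  assume "p \<in> SF"
  then obtain p' where p': "p \<in> FC" "p' \<in> dual_tensors" "p - p' \<in> LF"
    unfolding SF_def by blast
  have "scal a * p - scal a * p' \<in> LF"
    using LF_mult[of "scal a" "p - p'"] p' by (simp add: right_diff_distrib)
  then show ?thesis unfolding SF_def using dual_scal[OF p'(2)] p' by auto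
qed

lemma SF_sum: "(\<And>i. i \<in> I \<Longrightarrow> f i \<in> SF) \<Longrightarrow> sum f I \<in> SF"
  by (induction I rule: infinite_finite_induct) (auto intro: SF_LF[OF LF_zero] SF_add)

lemma rel_WX: "w \<in> W \<Longrightarrow> linear \<xi> \<Longrightarrow> gen (GW w) * gen (GX \<xi>) - gen (GX (act_dual w \<xi>)) * gen (GW w) \<in> rel_ideal"
  using relations_rel_ideal unfolding smash_relations_def by blast

lemma rel_XX: "linear \<xi> \<Longrightarrow> linear \<eta> \<Longrightarrow> gen (GX \<xi>) * gen (GX \<eta>) - gen (GX \<eta>) * gen (GX \<xi>) \<in> rel_ideal"
  using relations_rel_ideal unfolding cherednik_relations_def by blast

lemma rel_YX: "linear \<xi> \<Longrightarrow> yx_relation y \<xi> \<in> rel_ideal"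
  using relations_rel_ideal unfolding cherednik_relations_def yx_relation_def by blast

lemma rel_X_lin:
  assumes "linear \<xi>" "linear \<eta>"
  shows "gen (GX (\<lambda>v. a * \<xi> v + b * \<eta> v)) - (scal a * gen (GX \<xi>) + scal b * gen (GX \<eta>)) \<in> rel_ideal"
proof -
  have "gen (GX (\<lambda>v. a * \<xi> v + b * \<eta> v)) - (scal a * gen (GX \<xi>) + scal b * gen (GX \<eta>)) \<in> smash_relations"
    unfolding smash_relations_def
    by (rule UnI1, rule UnI1, rule UnI1, rule UnI2, rule CollectI, intro exI conjI, rule refl) (rule assms)+
  then show ?thesis using relations_rel_ideal by blast
qed

lemma single_xword_FC: "xword us \<Longrightarrow> Poly_Mapping.single (FWord us) a \<in> FC"
  by (rule dual_FC[OF dual_single(1)])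

lemma SF_GW: "xword us \<Longrightarrow> w \<in> W \<Longrightarrow> gen (GW w) * Poly_Mapping.single (FWord us) a \<in> SF"
proof (induction us)
  case Nil
  have "gen (GW w) * Poly_Mapping.single (FWord []) a = scal a * (gen (GW w) - 1) + scal a"
    unfolding single_Nil scal_commute right_diff_distrib by simp
  moreover have "scal a \<in> SF" using SF_dual[OF dual_single(1)[OF xword_simps(1)]] unfolding single_Nil .
  moreover have "scal a * (gen (GW w) - 1) \<in> LF" using Nil LF_mult LF_GW by simp
  ultimately show ?case using SF_add SF_LF by simp
next
  case (Cons g us)
  then obtain \<xi> where \<xi>: "linear \<xi>" "g = GX \<xi>" by auto
  let ?r = "Poly_Mapping.single (FWord us) a"
  have "gen (GW w) * Poly_Mapping.single (FWord (g # us)) a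
     = (gen (GW w) * gen (GX \<xi>) - gen (GX (act_dual w \<xi>)) * gen (GW w)) * ?r
       + gen (GX (act_dual w \<xi>)) * (gen (GW w) * ?r)"
    unfolding \<xi>(2) gen_single[of "GX \<xi>" us a, symmetric] by (simp only: left_diff_distrib mult.assoc diff_add_cancel)
  moreover have "(gen (GW w) * gen (GX \<xi>) - gen (GX (act_dual w \<xi>)) * gen (GW w)) * ?r \<in> SF"
    using Cons.prems \<xi> by (intro SF_LF rel_ideal_LF rel_ideal_mult(2) rel_WX single_xword_FC) auto
  moreover have "gen (GX (act_dual w \<xi>)) * (gen (GW w) * ?r) \<in> SF"
    using Cons \<xi> by (intro SF_gen linear_act_dual) auto
  ultimately show ?case by (simp only: SF_add)
qed

lemma SF_GY: "xword us \<Longrightarrow> gen (GY y) * Poly_Mapping.single (FWord us) a \<in> SF"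
proof (induction us)
  case Nil
  have "gen (GY y) * Poly_Mapping.single (FWord []) a = scal a * gen (GY y)"
    unfolding single_Nil scal_commute ..
  moreover have "scal a * gen (GY y) \<in> LF" using LF_mult LF_GY by simp
  ultimately show ?case using SF_LF by simp
next
  case (Cons g us)
  then obtain \<xi> where \<xi>: "linear \<xi>" "g = GX \<xi>" by auto
  have us: "xword us" using Cons.prems by simp
  let ?r = "Poly_Mapping.single (FWord us) a"
  let ?z = "\<lambda>s. pairing y (\<lambda>v. complex_of_real (\<alpha> s v)) * pairing (\<alpha>v s, 0) \<xi>"
  \<comment> \<open>Commuting \<open>y\<close> past the first factor leaves a multiple of a
    relation, a product in which \<open>y\<close> meets a shorter word, a word without
    \<open>y\<close>, and words led by a reflection, which \<open>SF_GW\<close> treats.\<close>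
  have "gen (GY y) * Poly_Mapping.single (FWord (g # us)) a
     = yx_relation y \<xi> * ?r + gen (GX \<xi>) * (gen (GY y) * ?r) + scal (pairing y \<xi>) * ?r
       + scal (- complex_of_real c) * (\<Sum>s\<in>reflections. scal (?z s) * (gen (GW s) * ?r))"
  proof -
    have neg: "scal (- complex_of_real c) = - scal (complex_of_real c)" by (simp add: single_uminus)
    show ?thesis
      unfolding neg \<xi>(2) gen_single[of "GX \<xi>" us a, symmetric] yx_relation_def
      by (simp only: left_diff_distrib mult.assoc sum_distrib_right mult_minus_left) simp
  qed
  moreover have "yx_relation y \<xi> * ?r \<in> SF"
    using us \<xi> by (intro SF_LF rel_ideal_LF rel_ideal_mult(2) rel_YX single_xword_FC) auto
  moreover have "gen (GX \<xi>) * (gen (GY y) * ?r) \<in> SF"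
    using Cons \<xi> by (intro SF_gen) auto
  moreover have "scal (pairing y \<xi>) * ?r \<in> SF"
    using us by (intro SF_scal SF_dual dual_single(1))
  moreover have "scal (- complex_of_real c) * (\<Sum>s\<in>reflections. scal (?z s) * (gen (GW s) * ?r)) \<in> SF"
    using us by (intro SF_scal SF_sum SF_GW reflections_subset)
  ultimately show ?case by (simp only: SF_add)
qed

lemma SF_word: "(\<And>g. g \<in> set us \<Longrightarrow> valid_gen g) \<Longrightarrow> Poly_Mapping.single (FWord us) a \<in> SF"
proof (induction us)
  case Nil
  show ?case by (rule SF_dual[OF dual_single(1)]) simp
next
  case (Cons g us)
  then obtain q where q: "q \<in> dual_tensors" "Poly_Mapping.single (FWord us) a - q \<in> LF"
    unfolding SF_def by auto
  have g: "valid_gen g" using Cons.prems by simp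
  \<comment> \<open>Since \<open>LF\<close> is a left ideal, the remaining word may be replaced by
    the dual tensor \<open>q\<close>; only words in the dual space have to be multiplied by
    \<open>g\<close>.\<close>
  have "gen g * q \<in> SF"
    using q(1) unfolding dual_tensors_iff
  proof (induction q rule: pm_word_induct)
    case zero
    show ?case using SF_LF[OF LF_zero] by simp
  next
    case (single us a)
    then show ?case using g SF_GW SF_GY SF_dual[OF dual_single(1), of "g # us" a]
      by (cases g) (auto simp: gen_single)
  next
    case (add p q)
    then show ?case by (simp add: distrib_left SF_add)
  qed
  moreover have "gen g * (Poly_Mapping.single (FWord us) a - q) \<in> SF"
    using g q by (intro SF_LF LF_mult) auto
  ultimately have "gen g * (Poly_Mapping.single (FWord us) a - q) + gen g * q \<in> SF"
    by (intro SF_add)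
  then show ?case by (simp only: right_diff_distrib diff_add_cancel gen_single)
qed

lemma FC_SF: "p \<in> FC \<Longrightarrow> p \<in> SF"
  by (induction p rule: FC_induct) (auto intro: SF_LF[OF LF_zero] SF_word SF_add)

abbreviation one_fun :: "'a \<Rightarrow> complex" where "one_fun \<equiv> (\<lambda>x. 1)"

lemma one_fun_Pol: "one_fun \<in> Pol" by (rule Pol.const)

lemma rel_expand:
  assumes "finite B"
  shows "gen (GX (\<lambda>v. \<Sum>b\<in>B. \<xi> b * complex_of_real (v \<bullet> b)))
     - (\<Sum>b\<in>B. scal (\<xi> b) * gen (GX (\<lambda>v. complex_of_real (v \<bullet> b)))) \<in> rel_ideal"
  using assms
proof (induction B rule: finite_induct)
  case empty
  from rel_X_lin[OF linear_zero_fun linear_zero_fun, of 0 0] show ?case by simp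
next
  case (insert b B)
  have l: "linear (\<lambda>v::'a. complex_of_real (v \<bullet> b))" for b
    by (auto simp: linear_iff inner_left_distrib scaleR_conv_of_real)
  have l2: "linear (\<lambda>v::'a. \<Sum>b\<in>B. \<xi> b * complex_of_real (v \<bullet> b))"
    by (intro linear_compose_sum ballI linear_const_mult l)
  from rel_ideal_add[OF rel_X_lin[OF l[of b] l2, of "\<xi> b" 1] insert.IH]
  show ?case using insert.hyps by (simp add: algebra_simps)
qed

lemma rel_expand':
  "linear \<xi> \<Longrightarrow> (\<Sum>b\<in>Basis. scal (\<xi> b) * gen (GX (\<lambda>v. complex_of_real (v \<bullet> b)))) - gen (GX \<xi>) \<in> rel_ideal"
proof -
  assume l: "linear \<xi>"
  have "(\<lambda>v. \<Sum>b\<in>Basis. \<xi> b * complex_of_real (v \<bullet> b)) = \<xi>"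
  proof
    fix v
    show "(\<Sum>b\<in>Basis. \<xi> b * complex_of_real (v \<bullet> b)) = \<xi> v"
      unfolding linear_expand[OF l, of v] by (intro sum.cong refl mult.commute)
  qed
  with rel_expand[of Basis \<xi>] have
    "gen (GX \<xi>) - (\<Sum>b\<in>Basis. scal (\<xi> b) * gen (GX (\<lambda>v. complex_of_real (v \<bullet> b)))) \<in> rel_ideal" by simp
  from rel_ideal_mult(1)[OF this, of "-1"] show ?thesis by simp
qed

lemma rel_ideal_sum: "(\<And>i. i \<in> I \<Longrightarrow> f i \<in> rel_ideal) \<Longrightarrow> sum f I \<in> rel_ideal"
  by (induction I rule: infinite_finite_induct) (auto intro: rel_ideal_zero rel_ideal_add)

abbreviation xb :: "'a \<Rightarrow> 'a free" where "xb b \<equiv> gen (GX (\<lambda>v. complex_of_real (v \<bullet> b)))"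

lemma linear_xb: "linear (\<lambda>v::'a. complex_of_real (v \<bullet> b))"
  by (auto simp: linear_iff inner_left_distrib scaleR_conv_of_real)

text \<open>Euler's formula for words. It uses only that the generators from the dual space depend
  linearly on the functional and commute, so the difference lies already in
  \<open>rel_ideal\<close>.\<close>

lemma word_deriv_Euler:
  "xword us \<Longrightarrow> (\<Sum>b\<in>Basis. xb b * word_deriv b us) - scal (of_nat (length us)) * Poly_Mapping.single (FWord us) 1 \<in> rel_ideal"
proof (induction us)
  case Nil
  show ?case by (simp add: rel_ideal_zero)
next
  case (Cons g us)
  then obtain \<xi> where \<xi>: "linear \<xi>" "g = GX \<xi>" by auto
  have us: "xword us" using Cons.prems by simp
  let ?r = "Poly_Mapping.single (FWord us) 1 :: 'a free"
  let ?n = "scal (of_nat (length us)) :: 'a free"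
  have n: "scal (of_nat (length (g # us))) = ?n + (1::'a free)"
  proof -
    have "?n + 1 = scal (of_nat (length us)) + scal 1" by (simp only: single_one)
    also have "\<dots> = scal (of_nat (length us) + 1)" by (simp only: single_add)
    finally have e: "?n + 1 = scal (of_nat (length us) + 1)" .
    have "of_nat (length (g # us)) = (of_nat (length us) + 1 :: complex)" by simp
    then show ?thesis unfolding e by (rule arg_cong)
  qed
  have r: "Poly_Mapping.single (FWord (g # us)) 1 = gen (GX \<xi>) * ?r" by (simp add: \<xi> gen_single)
  have "(\<Sum>b\<in>Basis. xb b * word_deriv b (g # us)) - scal (of_nat (length (g # us))) * Poly_Mapping.single (FWord (g # us)) 1
    = ((\<Sum>b\<in>Basis. scal (\<xi> b) * xb b) - gen (GX \<xi>)) * ?r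
      + (\<Sum>b\<in>Basis. (xb b * gen (GX \<xi>) - gen (GX \<xi>) * xb b) * word_deriv b us)
      + gen (GX \<xi>) * ((\<Sum>b\<in>Basis. xb b * word_deriv b us) - ?n * ?r)"
  proof -
    have "xb b * word_deriv b (g # us) = scal (\<xi> b) * xb b * ?r + (xb b * gen (GX \<xi>) - gen (GX \<xi>) * xb b) * word_deriv b us
       + gen (GX \<xi>) * (xb b * word_deriv b us)" for b
      unfolding word_deriv.simps \<xi>(2) eval_gen.simps distrib_left
      by (simp only: mult.assoc[symmetric] scal_commute[of "xb b"] left_diff_distrib) simp
    then have e: "(\<Sum>b\<in>Basis. xb b * word_deriv b (g # us)) = (\<Sum>b\<in>Basis. scal (\<xi> b) * xb b) * ?r
       + (\<Sum>b\<in>Basis. (xb b * gen (GX \<xi>) - gen (GX \<xi>) * xb b) * word_deriv b us)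
       + gen (GX \<xi>) * (\<Sum>b\<in>Basis. xb b * word_deriv b us)"
      by (simp only: sum.distrib sum_distrib_left sum_distrib_right)
    have c: "gen (GX \<xi>) * (?n * ?r) = ?n * (gen (GX \<xi>) * ?r)"
      by (simp only: mult.assoc[symmetric] scal_commute)
    show ?thesis unfolding e n r right_diff_distrib left_diff_distrib distrib_right c by simp
  qed
  moreover have "((\<Sum>b\<in>Basis. scal (\<xi> b) * xb b) - gen (GX \<xi>)) * ?r \<in> rel_ideal"
    using us \<xi> by (intro rel_ideal_mult(2) rel_expand' single_xword_FC)
  moreover have "(\<Sum>b\<in>Basis. (xb b * gen (GX \<xi>) - gen (GX \<xi>) * xb b) * word_deriv b us) \<in> rel_ideal"
    using us \<xi> by (intro rel_ideal_sum rel_ideal_mult(2) rel_XX dual_FC[OF dual_degree_dual[OF word_deriv_degree]] linear_xb)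
  moreover have "gen (GX \<xi>) * ((\<Sum>b\<in>Basis. xb b * word_deriv b us) - ?n * ?r) \<in> rel_ideal"
    using Cons.IH us \<xi> by (intro rel_ideal_mult(1)) auto
  ultimately show ?case by (simp only: rel_ideal_add)
qed

lemma rho_word_one_Pol: "xword us \<Longrightarrow> rho_word us one_fun \<in> Pol"
  by (rule rho_word_Pol[OF xword_valid one_fun_Pol])

lemma rho_word_deriv: "xword us \<Longrightarrow> rho (word_deriv b us) one_fun x = pd b (rho_word us one_fun) x"
proof (induction us)
  case Nil
  show ?case by (simp add: pd_const)
next
  case (Cons g us)
  then obtain \<xi> where \<xi>: "linear \<xi>" "g = GX \<xi>" by auto
  have us: "xword us" using Cons.prems by simp
  have "word_deriv b us \<in> FC" using us dual_FC[OF dual_degree_dual[OF word_deriv_degree]] by blast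
  then show ?case using Cons.IH us \<xi> rho_word_one_Pol[OF us]
    by (simp add: rho_mult one_fun_Pol pd_lin scal_single del: mult_single)
qed

lemma rho_xword_Hom: "xword us \<Longrightarrow> rho_word us one_fun \<in> Hom (length us)"
  by (induction us) (auto intro: Hom_const Hom_lin)

lemma rho_dual_Hom: "p \<in> dual_tensors_of_degree d \<Longrightarrow> rho p one_fun \<in> Hom d"
  unfolding dual_degree_iff
  by (induction p rule: pm_word_induct[where Q = "\<lambda>us. xword us \<and> length us = d"])
    (auto intro: Hom_zero Hom_add Hom_scale rho_xword_Hom)

text \<open>Independence. The formal derivatives of \<open>q\<close> represent the derivatives of
  its polynomial function, which is zero, so by induction they lie in \<open>LF\<close>. Euler's
  formula recovers \<open>Suc d\<close> times \<open>q\<close> from them, and \<open>Suc d\<close>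
  is invertible.\<close>

lemma dual_kernel_degree: "q \<in> dual_tensors_of_degree d \<Longrightarrow> rho q one_fun = (\<lambda>x. 0) \<Longrightarrow> q \<in> LF"
proof (induction d arbitrary: q)
  case 0
  have "\<exists>a. q = scal a"
    using 0(1) unfolding dual_degree_iff
  proof (induction q rule: pm_word_induct[where Q = "\<lambda>us. xword us \<and> length us = 0"])
    case zero
    show ?case by (intro exI[of _ 0]) simp
  next
    case (single us a)
    then show ?case by (auto simp: single_Nil)
  next
    case (add p q)
    then show ?case by (metis single_add)
  qed
  then obtain a where "q = scal a" by blast
  with 0(2) have "q = 0" by (auto simp: fun_eq_iff)
  then show ?case using LF_zero by simp
next
  case (Suc d)
  have k: "xword (letters u)" "length (letters u) = Suc d" if "u \<in> Poly_Mapping.keys q" for u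
    using Suc.prems(1) that by (auto simp: dual_degree_iff)
  define dq where "dq b = (\<Sum>u\<in>Poly_Mapping.keys q. scal (Poly_Mapping.lookup q u) * word_deriv b (letters u))" for b
  have dq: "dq b \<in> dual_tensors_of_degree d" for b
    unfolding dq_def by (intro dual_sum_degree dual_scal_degree) (use word_deriv_degree k in fastforce)
  have wFC: "word_deriv b (letters u) \<in> FC" if "u \<in> Poly_Mapping.keys q" for u b
    using dual_FC[OF dual_degree_dual[OF word_deriv_degree[OF k(1)[OF that]]]] .
  have "rho (dq b) one_fun x = 0" for b x
  proof -
    have "rho (dq b) one_fun x = (\<Sum>u\<in>Poly_Mapping.keys q. Poly_Mapping.lookup q u * pd b (rho_word (letters u) one_fun) x)"
      unfolding dq_def rho_sum using wFC k by (intro sum.cong refl) (simp add: rho_mult one_fun_Pol rho_word_deriv)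
    also have "\<dots> = pd b (\<lambda>x. \<Sum>u\<in>Poly_Mapping.keys q. Poly_Mapping.lookup q u * rho_word (letters u) one_fun x) x"
      using k by (subst pd_sum) (auto intro!: Pol_scale rho_word_one_Pol sum.cong simp: pd_scale rho_word_one_Pol)
    also have "(\<lambda>x. \<Sum>u\<in>Poly_Mapping.keys q. Poly_Mapping.lookup q u * rho_word (letters u) one_fun x) = (\<lambda>x. 0)"
      using Suc.prems(2) by (simp add: rho_def[abs_def])
    finally show ?thesis by (simp add: pd_const)
  qed
  then have "dq b \<in> LF" for b using Suc.IH[OF dq] by auto
  then have 1: "(\<Sum>b\<in>Basis. xb b * dq b) \<in> LF"
    by (intro LF_sum LF_mult) (auto simp: linear_xb)
  have "(\<Sum>b\<in>Basis. xb b * dq b) - scal (of_nat (Suc d)) * q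
     = (\<Sum>u\<in>Poly_Mapping.keys q. scal (Poly_Mapping.lookup q u) *
        ((\<Sum>b\<in>Basis. xb b * word_deriv b (letters u)) - scal (of_nat (length (letters u))) * Poly_Mapping.single (FWord (letters u)) 1))"
  proof -
    have "xb b * dq b = (\<Sum>u\<in>Poly_Mapping.keys q. scal (Poly_Mapping.lookup q u) * (xb b * word_deriv b (letters u)))" for b
      unfolding dq_def sum_distrib_left
      by (intro sum.cong refl) (simp only: mult.assoc[symmetric] scal_commute)
    then have "(\<Sum>b\<in>Basis. xb b * dq b) = (\<Sum>u\<in>Poly_Mapping.keys q. scal (Poly_Mapping.lookup q u) * (\<Sum>b\<in>Basis. xb b * word_deriv b (letters u)))"
      by (simp only: sum_distrib_left) (rule sum.swap)
    moreover have "scal (of_nat (Suc d)) * q = (\<Sum>u\<in>Poly_Mapping.keys q. scal (Poly_Mapping.lookup q u) * (scal (of_nat (length (letters u))) * Poly_Mapping.single (FWord (letters u)) 1))"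
    proof -
      have "scal (of_nat (Suc d)) * q = scal (of_nat (Suc d)) * (\<Sum>u\<in>Poly_Mapping.keys q. Poly_Mapping.single u (Poly_Mapping.lookup q u))"
        by (simp only: poly_mapping_sum_single)
      then show ?thesis
        unfolding sum_distrib_left using k
        by (auto intro!: sum.cong simp: scal_single mult.commute)
    qed
    ultimately show ?thesis by (simp only: right_diff_distrib sum_subtractf)
  qed
  also have "\<dots> \<in> rel_ideal"
    using k by (intro rel_ideal_sum rel_ideal_mult(1) word_deriv_Euler) auto
  finally have "(\<Sum>b\<in>Basis. xb b * dq b) - ((\<Sum>b\<in>Basis. xb b * dq b) - scal (of_nat (Suc d)) * q) \<in> LF"
    by (rule LF_diff[OF 1 rel_ideal_LF])
  then have "scal (of_nat (Suc d)) * q \<in> LF" by (simp only: diff_diff_eq2 add_diff_cancel_left')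
  then have "scal (1 / of_nat (Suc d)) * (scal (of_nat (Suc d)) * q) \<in> LF"
    by (rule LF_mult[OF FC_scal])
  moreover have "scal (1 / of_nat (Suc d)) * (scal (of_nat (Suc d)) * q) = q"
  proof -
    have "scal (1 / of_nat (Suc d)) * (scal (of_nat (Suc d)) * q) = scal (1 / of_nat (Suc d) * of_nat (Suc d)) * q"
      by (simp only: mult.assoc[symmetric] scal_single)
    also have "1 / of_nat (Suc d) * of_nat (Suc d) = (1::complex)" by (simp del: of_nat_Suc)
    finally show ?thesis by (simp only: single_one mult_1_left)
  qed
  ultimately show ?case by (simp only:)
qed

text \<open>Sorting the words by length splits the polynomial function into homogeneous components,
  which vanish separately.\<close>

lemma dual_kernel:
  assumes "q \<in> dual_tensors" "rho q one_fun = (\<lambda>x. 0)"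
  shows "q \<in> LF"
proof -
  define qd where "qd d = (\<Sum>u\<in>{u\<in>Poly_Mapping.keys q. length (letters u) = d}. Poly_Mapping.single u (Poly_Mapping.lookup q u))" for d
  define n where "n = Max (insert 0 ((\<lambda>u. length (letters u)) ` Poly_Mapping.keys q))"
  have qd: "qd d \<in> dual_tensors_of_degree d" for d
    unfolding qd_def
  proof (rule dual_sum_degree)
    fix u assume u: "u \<in> {u \<in> Poly_Mapping.keys q. length (letters u) = d}"
    then show "Poly_Mapping.single u (Poly_Mapping.lookup q u) \<in> dual_tensors_of_degree d"
      using assms(1) dual_single(2)[of "letters u" d "Poly_Mapping.lookup q u"] by (auto simp: dual_tensors_iff)
  qed
  have "(\<Sum>d\<le>n. qd d) = (\<Sum>u\<in>Poly_Mapping.keys q. Poly_Mapping.single u (Poly_Mapping.lookup q u))"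
    unfolding qd_def by (rule sum.group) (auto simp: n_def)
  then have q: "q = (\<Sum>d\<le>n. qd d)" by (simp add: poly_mapping_sum_single)
  have "(\<Sum>d\<le>n. rho (qd d) one_fun x) = 0" for x
    using assms(2) unfolding q rho_sum by (auto simp: fun_eq_iff)
  then have "rho (qd d) one_fun = (\<lambda>x. 0)" if "d \<le> n" for d
    using Hom_sum_eq_0[of "\<lambda>d. rho (qd d) one_fun", OF rho_dual_Hom[OF qd] _ that] by blast
  then show ?thesis unfolding q by (intro LF_sum) (auto intro: dual_kernel_degree[OF qd])
qed

text \<open>Hence an element of the induced module is the same as the polynomial function
  \<open>rho p one_fun\<close> of any of its representatives.\<close>

lemma LF_iff: "p \<in> LF \<longleftrightarrow> p \<in> FC \<and> rho p one_fun = (\<lambda>x. 0)"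
proof
  assume "p \<in> LF"
  then show "p \<in> FC \<and> rho p one_fun = (\<lambda>x. 0)" using LF_rho LF_FC by blast
next
  assume p: "p \<in> FC \<and> rho p one_fun = (\<lambda>x. 0)"
  then obtain q where q: "q \<in> dual_tensors" "p - q \<in> LF" using FC_SF unfolding SF_def by blast
  then have "rho (p - q) one_fun = (\<lambda>x. 0)" using LF_rho by blast
  then have "rho q one_fun = (\<lambda>x. 0)" using p by (auto simp: fun_eq_iff)
  then have "q \<in> LF" using q dual_kernel by blast
  then show "p \<in> LF" using LF_add[OF q(2)] by fastforce
qed

section \<open>The induced module as the space of polynomial functions\<close>

lemma ex_dual_Hom: "f \<in> Hom d \<Longrightarrow> \<exists>p\<in>dual_tensors_of_degree d. rho p one_fun = f"
proof (induction rule: Hom_induct)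
  case (const a)
  show ?case using dual_single(2)[of "[]" 0 a] by (intro bexI[of _ "scal a"]) (auto simp: single_Nil)
next
  case (lin \<xi> f d)
  then obtain p where p: "p \<in> dual_tensors_of_degree d" "rho p one_fun = f" by blast
  have "p \<in> FC" using p dual_FC dual_degree_dual by blast
  then show ?case using p lin dual_gen_degree[OF p(1) lin(1)]
    by (intro bexI[of _ "gen (GX \<xi>) * p"]) (simp_all add: rho_mult one_fun_Pol del: mult_single)
next
  case (add f d g)
  then obtain p q where p: "p \<in> dual_tensors_of_degree d" "rho p one_fun = f"
     "q \<in> dual_tensors_of_degree d" "rho q one_fun = g" by blast
  then show ?case using dual_add(2) by (intro bexI[of _ "p + q"]) auto
qed

lemma ex_dual_Pol: "f \<in> Pol \<Longrightarrow> \<exists>p\<in>dual_tensors. rho p one_fun = f"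
proof (induction rule: Pol.induct)
  case (const a)
  show ?case using dual_single(1)[of "[]" a] by (intro bexI[of _ "scal a"]) (auto simp: single_Nil)
next
  case (lin \<xi> f)
  then obtain p where p: "p \<in> dual_tensors" "rho p one_fun = f" by blast
  have "p \<in> FC" using p dual_FC by blast
  then show ?case using p lin dual_gen[OF p(1) lin(1)]
    by (intro bexI[of _ "gen (GX \<xi>) * p"]) (simp_all add: rho_mult one_fun_Pol del: mult_single)
next
  case (add f g)
  then obtain p q where p: "p \<in> dual_tensors" "rho p one_fun = f"
     "q \<in> dual_tensors" "rho q one_fun = g" by blast
  then show ?case using dual_add(1) by (intro bexI[of _ "p + q"]) auto
qed

lemma eval_tensor_rho: "p \<in> dual_tensors \<Longrightarrow> eval_tensor p = rho p one_fun"
proof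
  fix v assume p: "p \<in> dual_tensors"
  have "xword us \<Longrightarrow> (\<Prod>g\<leftarrow>us. eval_gen g v) = rho_word us one_fun v" for us
    by (induction us) auto
  then show "eval_tensor p v = rho p one_fun v"
    using p unfolding eval_tensor_def rho_def by (intro sum.cong) (auto simp: dual_tensors_iff)
qed

text \<open>The coset does not depend on the chosen \<open>p\<close>, by \<open>LF_iff\<close>.
  Representatives in the whole free algebra are allowed, so that \<open>\<Phi>_act\<close> needs no
  reordering into dual tensors.\<close>

definition \<Phi> :: "('a \<Rightarrow> complex) \<Rightarrow> 'a free set set" where
  "\<Phi> f = tensor_one (SOME p. p \<in> FC \<and> rho p one_fun = f)"

lemma tensor_one_eq: "tensor_one p = {x \<oplus>\<^bsub>H_alg\<^esub> cls p |x. x \<in> triv_ideal}"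
  unfolding tensor_one_def a_r_coset_def' by blast

lemma tensor_one_eq': "p \<in> FC \<Longrightarrow> tensor_one p = {cls (l + p) |l. l \<in> LF}"
  unfolding tensor_one_eq triv_ideal_eq using LF_FC by (force simp: cls_add)

lemma tensor_one_cong: "p \<in> FC \<Longrightarrow> q \<in> FC \<Longrightarrow> p - q \<in> LF \<Longrightarrow> tensor_one p = tensor_one q"
proof -
  assume pq: "p \<in> FC" "q \<in> FC" "p - q \<in> LF"
  have sub: "{cls (l + p) |l. l \<in> LF} \<subseteq> {cls (l + q) |l. l \<in> LF}" if "p - q \<in> LF" for p q
  proof clarify
    fix l assume "l \<in> LF"
    then show "\<exists>k. cls (l + p) = cls (k + q) \<and> k \<in> LF"
      using LF_add[OF _ that] by (intro exI[of _ "l + (p - q)"]) simp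
  qed
  have "q - p \<in> LF" using LF_minus[OF pq(3)] by simp
  then show ?thesis unfolding tensor_one_eq'[OF pq(1)] tensor_one_eq'[OF pq(2)]
    by (intro equalityI sub pq(3))
qed

lemma tensor_one_eq_iff: "p \<in> FC \<Longrightarrow> q \<in> FC \<Longrightarrow> tensor_one p = tensor_one q \<longleftrightarrow> rho p one_fun = rho q one_fun"
proof
  assume pq: "p \<in> FC" "q \<in> FC" "tensor_one p = tensor_one q"
  have "cls (0 + p) \<in> tensor_one p" using pq(1) LF_zero by (auto simp: tensor_one_eq' simp del: add_0)
  then obtain l where l: "l \<in> LF" "cls p = cls (l + q)" using pq by (auto simp: tensor_one_eq')
  then have "p - (l + q) \<in> LF" using cls_eq_iff[of p "l + q"] pq LF_FC rel_ideal_LF by auto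
  from LF_add[OF this l(1)] have "p - q \<in> LF" by simp
  then have "rho (p - q) one_fun = (\<lambda>x. 0)" using LF_rho by blast
  then show "rho p one_fun = rho q one_fun" by (auto simp: fun_eq_iff)
next
  assume pq: "p \<in> FC" "q \<in> FC" "rho p one_fun = rho q one_fun"
  then have "p - q \<in> LF" by (auto simp: LF_iff)
  then show "tensor_one p = tensor_one q" using pq tensor_one_cong by blast
qed

lemma \<Phi>_eq: "p \<in> FC \<Longrightarrow> rho p one_fun = f \<Longrightarrow> tensor_one p = \<Phi> f"
proof -
  assume p: "p \<in> FC" "rho p one_fun = f"
  define q where "q = (SOME p. p \<in> FC \<and> rho p one_fun = f)"
  have "q \<in> FC \<and> rho q one_fun = f" unfolding q_def by (rule someI[of _ p]) (use p in auto)
  then show ?thesis using p tensor_one_eq_iff unfolding \<Phi>_def q_def[symmetric] by blast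
qed

lemma \<Phi>_obtain:
  assumes "f \<in> Pol"
  obtains p where "p \<in> dual_tensors" "p \<in> FC" "rho p one_fun = f" "eval_tensor p = f" "\<Phi> f = tensor_one p"
  using ex_dual_Pol[OF assms] \<Phi>_eq dual_FC eval_tensor_rho by metis

lemma \<Phi>_inject: "f \<in> Pol \<Longrightarrow> g \<in> Pol \<Longrightarrow> \<Phi> f = \<Phi> g \<longleftrightarrow> f = g"
  by (metis \<Phi>_obtain tensor_one_eq_iff)

lemma M_triv_eq: "M_triv = \<Phi> ` Pol"
proof -
  have "M_triv = tensor_one ` FC"
    unfolding M_triv_def A_RCOSETS_def' carrier_H_alg tensor_one_def by blast
  also have "\<dots> = \<Phi> ` Pol"
  proof safe
    fix p assume "p \<in> FC"
    then show "tensor_one p \<in> \<Phi> ` Pol" using \<Phi>_eq rho_Pol one_fun_Pol by blast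
  next
    fix f :: "'a \<Rightarrow> complex" assume "f \<in> Pol"
    then obtain p where "p \<in> dual_tensors" "p \<in> FC" "rho p one_fun = f" "eval_tensor p = f" "\<Phi> f = tensor_one p"
      by (rule \<Phi>_obtain)
    then show "\<Phi> f \<in> tensor_one ` FC" by blast
  qed
  finally show ?thesis .
qed

lemma tensor_one_add:
  assumes "p \<in> FC" "q \<in> FC"
  shows "madd (tensor_one p) (tensor_one q) = tensor_one (p + q)"
proof -
  have e: "cls (l + p) \<oplus>\<^bsub>H_alg\<^esub> cls (l' + q) = cls ((l + p) + (l' + q))" if "l \<in> LF" "l' \<in> LF" for l l'
    using that assms LF_FC by (intro cls_add) auto
  have "madd (tensor_one p) (tensor_one q) = {u. \<exists>l l'. l \<in> LF \<and> l' \<in> LF \<and> u = cls (l + p) \<oplus>\<^bsub>H_alg\<^esub> cls (l' + q)}"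
    unfolding set_add_def' tensor_one_eq'[OF assms(1)] tensor_one_eq'[OF assms(2)] by blast
  also have "\<dots> = {u. \<exists>l l'. l \<in> LF \<and> l' \<in> LF \<and> u = cls ((l + p) + (l' + q))}"
    by (simp add: e cong: conj_cong)
  also have "\<dots> = {cls ((l + p) + (l' + q)) |l l'. l \<in> LF \<and> l' \<in> LF}" by blast
  also have "\<dots> = {cls (l + (p + q)) |l. l \<in> LF}"
  proof safe
    fix l l' assume "l \<in> LF" "l' \<in> LF"
    then show "\<exists>k. cls (l + p + (l' + q)) = cls (k + (p + q)) \<and> k \<in> LF"
      using LF_add by (intro exI[of _ "l + l'"]) (auto simp: algebra_simps)
  next
    fix l assume "l \<in> LF"
    then show "\<exists>k l'. cls (l + (p + q)) = cls (k + p + (l' + q)) \<and> k \<in> LF \<and> l' \<in> LF"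
      using LF_zero by (intro exI[of _ l] exI[of _ 0]) (auto simp: algebra_simps)
  qed
  finally show ?thesis using assms by (simp add: tensor_one_eq')
qed

lemma act_tensor_one:
  assumes "h \<in> FC" "p \<in> FC"
  shows "act (cls h) (tensor_one p) = tensor_one (h * p)"
proof -
  have e: "cls l \<oplus>\<^bsub>H_alg\<^esub> (cls h \<otimes>\<^bsub>H_alg\<^esub> cls (l' + p)) = cls (l + h * (l' + p))" if "l \<in> LF" "l' \<in> LF" for l l'
    using that assms LF_FC by (simp add: cls_add cls_mult)
  have "act (cls h) (tensor_one p) = {u. \<exists>l l'. l \<in> LF \<and> l' \<in> LF \<and> u = cls l \<oplus>\<^bsub>H_alg\<^esub> (cls h \<otimes>\<^bsub>H_alg\<^esub> cls (l' + p))}"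
    unfolding act_def set_add_def' l_coset_def triv_ideal_eq tensor_one_eq'[OF assms(2)] by blast
  also have "\<dots> = {u. \<exists>l l'. l \<in> LF \<and> l' \<in> LF \<and> u = cls (l + h * (l' + p))}"
    by (simp add: e cong: conj_cong)
  also have "\<dots> = {cls (l + h * (l' + p)) |l l'. l \<in> LF \<and> l' \<in> LF}" by blast
  also have "\<dots> = {cls (l + h * p) |l. l \<in> LF}"
  proof safe
    fix l l' assume "l \<in> LF" "l' \<in> LF"
    then show "\<exists>k. cls (l + h * (l' + p)) = cls (k + h * p) \<and> k \<in> LF"
      using LF_add LF_mult[OF assms(1)] by (intro exI[of _ "l + h * l'"]) (auto simp: algebra_simps)
  next
    fix l assume "l \<in> LF"
    then show "\<exists>k l'. cls (l + h * p) = cls (k + h * (l' + p)) \<and> k \<in> LF \<and> l' \<in> LF"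
      using LF_zero by (intro exI[of _ l] exI[of _ 0]) (auto simp: algebra_simps)
  qed
  finally show ?thesis using assms by (simp add: tensor_one_eq')
qed

lemma \<Phi>_add: "f \<in> Pol \<Longrightarrow> g \<in> Pol \<Longrightarrow> madd (\<Phi> f) (\<Phi> g) = \<Phi> (\<lambda>x. f x + g x)"
proof -
  assume fg: "f \<in> Pol" "g \<in> Pol"
  obtain p where p: "p \<in> dual_tensors" "p \<in> FC" "rho p one_fun = f" "eval_tensor p = f" "\<Phi> f = tensor_one p"
    by (rule \<Phi>_obtain[OF fg(1)])
  obtain q where q: "q \<in> dual_tensors" "q \<in> FC" "rho q one_fun = g" "eval_tensor q = g" "\<Phi> g = tensor_one q"
    by (rule \<Phi>_obtain[OF fg(2)])
  show ?thesis using p q \<Phi>_eq[of "p + q"] by (simp add: tensor_one_add)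
qed

lemma \<Phi>_act: "h \<in> FC \<Longrightarrow> f \<in> Pol \<Longrightarrow> act (cls h) (\<Phi> f) = \<Phi> (rho h f)"
proof -
  assume h: "h \<in> FC" and f: "f \<in> Pol"
  obtain p where p: "p \<in> dual_tensors" "p \<in> FC" "rho p one_fun = f" "eval_tensor p = f" "\<Phi> f = tensor_one p"
    by (rule \<Phi>_obtain[OF f])
  show ?thesis using p h \<Phi>_eq[of "h * p"] by (simp add: act_tensor_one rho_mult one_fun_Pol)
qed

lemma \<Phi>_zero: "mzero = \<Phi> (\<lambda>x. 0)"
proof -
  have "tensor_one 0 = mzero"
    using tensor_one_eq'[of 0] unfolding triv_ideal_eq by auto
  then show ?thesis using \<Phi>_eq[of 0] by simp
qed

lemma degree_part_eq: "degree_part d = \<Phi> ` Hom d"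
proof -
  have "\<Phi> f \<in> tensor_one ` dual_tensors_of_degree d" if "f \<in> Hom d" for f :: "'a \<Rightarrow> complex"
    using ex_dual_Hom[OF that] \<Phi>_eq dual_FC dual_degree_dual by (metis imageI)
  moreover have "tensor_one p \<in> \<Phi> ` Hom d" if "p \<in> dual_tensors_of_degree d" for p
    using \<Phi>_eq[of p] rho_dual_Hom[OF that] dual_FC dual_degree_dual that by blast
  ultimately show ?thesis unfolding degree_part_def by blast
qed

lemma polynomials_eq: "polynomials N = {f \<in> Pol. \<Phi> f \<in> N}"
proof -
  have "eval_tensor p \<in> Pol \<and> \<Phi> (eval_tensor p) \<in> N" if "p \<in> dual_tensors" "tensor_one p \<in> N" for p
    using that \<Phi>_eq[of p] eval_tensor_rho[of p] dual_FC[of p] rho_Pol one_fun_Pol by metis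
  moreover have "\<exists>p. f = eval_tensor p \<and> p \<in> dual_tensors \<and> tensor_one p \<in> N" if "f \<in> Pol" "\<Phi> f \<in> N" for f
    using \<Phi>_obtain[OF that(1)] that(2) by metis
  ultimately show ?thesis unfolding polynomials_def by blast
qed

end

section \<open>Submodules as spaces of polynomials\<close>

context rational_cherednik
begin

text \<open>Submodules described on polynomial functions. Closure under \<open>D b\<close> for real
  \<open>b\<close> covers complex vectors, as \<open>DD\<close> is a complex combination of two such
  operators.\<close>

definition psub :: "('a \<Rightarrow> complex) set \<Rightarrow> bool" where
  "psub U \<longleftrightarrow> U \<subseteq> Pol \<and> (\<lambda>x. 0) \<in> U \<and> (\<forall>f\<in>U. \<forall>g\<in>U. (\<lambda>x. f x + g x) \<in> U)
    \<and> (\<forall>a. \<forall>f\<in>U. (\<lambda>x. a * f x) \<in> U) \<and> (\<forall>w\<in>W. \<forall>f\<in>U. (\<lambda>x. f (w x)) \<in> U)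
    \<and> (\<forall>\<xi>. \<forall>f\<in>U. linear \<xi> \<longrightarrow> (\<lambda>x. \<xi> x * f x) \<in> U) \<and> (\<forall>b. \<forall>f\<in>U. D b f \<in> U)"

lemma psubD:
  assumes "psub U"
  shows "f \<in> U \<Longrightarrow> f \<in> Pol" "(\<lambda>x. 0) \<in> U" "f \<in> U \<Longrightarrow> g \<in> U \<Longrightarrow> (\<lambda>x. f x + g x) \<in> U"
    "f \<in> U \<Longrightarrow> (\<lambda>x. a * f x) \<in> U" "w \<in> W \<Longrightarrow> f \<in> U \<Longrightarrow> (\<lambda>x. f (w x)) \<in> U"
    "f \<in> U \<Longrightarrow> linear \<xi> \<Longrightarrow> (\<lambda>x. \<xi> x * f x) \<in> U" "f \<in> U \<Longrightarrow> D b f \<in> U"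
  using assms unfolding psub_def by blast+

lemma psub_diff: "psub U \<Longrightarrow> f \<in> U \<Longrightarrow> g \<in> U \<Longrightarrow> (\<lambda>x. f x - g x) \<in> U"
  using psubD(3)[of U f "\<lambda>x. -1 * g x"] psubD(4)[of U g "-1"] by simp

lemma psub_sum: "psub U \<Longrightarrow> (\<And>i. i \<in> I \<Longrightarrow> f i \<in> U) \<Longrightarrow> (\<lambda>x. \<Sum>i\<in>I. f i x) \<in> U"
  by (induction I rule: infinite_finite_induct) (auto intro: psubD(2) psubD(3))

lemma psub_Pol_mult:
  assumes U: "psub U" and p: "p \<in> Pol" and f: "f \<in> U"
  shows "(\<lambda>x. p x * f x) \<in> U"
  using p
proof (induction p rule: Pol.induct)
  case (const a)
  show ?case by (rule psubD(4)[OF U f])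
next
  case (lin \<xi> p)
  from psubD(6)[OF U lin(3) lin(1)] show ?case by (simp add: mult.assoc)
next
  case (add p q)
  from psubD(3)[OF U add.IH] show ?case by (simp add: distrib_right)
qed

lemma psub_rho:
  assumes U: "psub U" and f: "f \<in> U"
  shows "p \<in> FC \<Longrightarrow> rho p f \<in> U"
proof (induction p rule: FC_induct)
  case zero
  show ?case using psubD(2)[OF U] by simp
next
  case (single us a)
  have "rho_gen g h \<in> U" if "valid_gen g" "h \<in> U" for g h
  proof (cases g)
    case (GW w)
    then show ?thesis using that psubD(5)[OF U inv_W] by auto
  next
    case (GX \<xi>)
    then show ?thesis using that psubD(6)[OF U] by auto
  next
    case (GY y)
    then show ?thesis using that unfolding DD_def[abs_def]
      by (auto simp: DD_def[abs_def] intro!: psubD(3)[OF U] psubD(4)[OF U] psubD(7)[OF U])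
  qed
  then have "rho_word us f \<in> U" using single f by (induction us) auto
  then show ?case using psubD(4)[OF U] by simp
next
  case (add p q)
  then show ?case using psubD(3)[OF U] by simp
qed

lemma polynomials_image: "U \<subseteq> Pol \<Longrightarrow> polynomials (\<Phi> ` U) = U"
  unfolding polynomials_eq using \<Phi>_inject by blast

lemma psub_submodule:
  assumes U: "psub U"
  shows "submodule (\<Phi> ` U)"
  unfolding submodule_def
proof (intro conjI ballI)
  show "\<Phi> ` U \<subseteq> M_triv" using psubD(1)[OF U] by (auto simp: M_triv_eq)
  show "mzero \<in> \<Phi> ` U" using psubD(2)[OF U] by (auto simp: \<Phi>_zero)
next
  fix m m' assume "m \<in> \<Phi> ` U" "m' \<in> \<Phi> ` U"
  then show "madd m m' \<in> \<Phi> ` U" using psubD(1,3)[OF U] by (auto simp: \<Phi>_add)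
next
  fix h m assume "h \<in> carrier H_alg" "m \<in> \<Phi> ` U"
  then obtain p f where "p \<in> FC" "h = cls p" "f \<in> U" "m = \<Phi> f" by (auto simp: carrier_H_alg)
  then show "act h m \<in> \<Phi> ` U" using psub_rho[OF U] psubD(1)[OF U] by (simp add: \<Phi>_act)
qed

lemma submodule_psub:
  assumes N: "submodule N"
  shows "psub (polynomials N)" "N = \<Phi> ` polynomials N"
proof -
  show N_eq: "N = \<Phi> ` polynomials N"
    using N unfolding submodule_def M_triv_eq polynomials_eq by blast
  have act: "rho h f \<in> polynomials N" if "h \<in> FC" "f \<in> polynomials N" for h f
  proof -
    have f: "f \<in> Pol" "\<Phi> f \<in> N" using that by (auto simp: polynomials_eq)
    then have "act (cls h) (\<Phi> f) \<in> N" using N that by (auto simp: submodule_def carrier_H_alg)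
    then show ?thesis using f that by (simp add: \<Phi>_act polynomials_eq rho_Pol)
  qed
  show "psub (polynomials N)"
    unfolding psub_def
  proof (intro conjI ballI allI impI)
    show "polynomials N \<subseteq> Pol" by (auto simp: polynomials_eq)
    show "(\<lambda>x. 0) \<in> polynomials N" using N by (auto simp: polynomials_eq Pol.const \<Phi>_zero[symmetric] submodule_def)
  next
    fix f g assume "f \<in> polynomials N" "g \<in> polynomials N"
    then show "(\<lambda>x. f x + g x) \<in> polynomials N"
      using N by (auto simp: polynomials_eq Pol.add \<Phi>_add[symmetric] submodule_def)
  next
    fix a f assume "f \<in> polynomials N"
    from act[OF FC_scal this, of a] show "(\<lambda>x. a * f x) \<in> polynomials N" by simp
  next
    fix w f assume w: "w \<in> W" and f: "f \<in> polynomials N"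
    have "inv_into UNIV (inv_into UNIV w) = w" using bij_W[OF w] by (simp add: inv_inv_eq)
    with act[of "gen (GW (inv_into UNIV w))", OF _ f] inv_W[OF w]
    show "(\<lambda>x. f (w x)) \<in> polynomials N" by simp
  next
    fix \<xi> :: "'a \<Rightarrow> complex" and f assume "f \<in> polynomials N" "linear \<xi>"
    with act[of "gen (GX \<xi>)" f] show "(\<lambda>x. \<xi> x * f x) \<in> polynomials N" by simp
  next
    fix b f assume f: "f \<in> polynomials N"
    then have "f \<in> Pol" by (auto simp: polynomials_eq)
    then have "DD (b, 0) f = D b f" using linear_0[OF D_linear] by (auto simp: DD_def)
    with act[of "gen (GY (b, 0))" f] f show "D b f \<in> polynomials N" by simp
  qed
qed

text \<open>The Euler operator preserves \<open>U\<close> and acts on the components by distinct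
  numbers. Subtracting the eigenvalue of the top component removes it and rescales the others by
  nonzero factors.\<close>

lemma psub_graded:
  assumes U: "psub U"
  shows "(\<And>d. F d \<in> Hom d) \<Longrightarrow> (\<lambda>x. \<Sum>d\<le>n. F d x) \<in> U \<Longrightarrow> d \<le> n \<Longrightarrow> F d \<in> U"
proof (induction n arbitrary: F d)
  case 0
  then show ?case by simp
next
  case (Suc n)
  let ?f = "\<lambda>x. \<Sum>d\<le>Suc n. F d x"
  let ?E = "\<lambda>f x. (\<Sum>b\<in>Basis. of_real (x \<bullet> b) * D b f x) + of_real c * (\<Sum>s\<in>reflections. f x - f (s x))"
  have FP: "F d \<in> Pol" for d using Suc.prems(1) Hom_Pol by blast
  have E_eq: "?E ?f x = (\<Sum>d\<le>Suc n. of_nat d * F d x)" for x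
  proof -
    have "?E ?f x = (\<Sum>d\<le>Suc n. ?E (F d) x)"
      using FP
      by (simp only: D_sum sum_distrib_left sum_subtractf[symmetric] sum.swap[of _ "{..Suc n}" Basis]
        sum.swap[of _ "{..Suc n}" reflections] sum.distrib)
    also have "\<dots> = (\<Sum>d\<le>Suc n. of_nat d * F d x)"
      by (intro sum.cong refl Euler Suc.prems)
    finally show ?thesis .
  qed
  note f = Suc.prems(2)
  have h1: "(\<lambda>x. complex_of_real (x \<bullet> b) * D b ?f x) \<in> U" for b
    by (rule psubD(6)[OF U psubD(7)[OF U f] linear_xb])
  have h2: "(\<lambda>x. ?f x - ?f (s x)) \<in> U" if "s \<in> reflections" for s
    by (rule psub_diff[OF U f psubD(5)[OF U reflections_subset[OF that] f]])
  have "?E ?f \<in> U"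
    by (rule psubD(3)[OF U psub_sum[OF U h1] psubD(4)[OF U psub_sum[OF U h2]]])
  then have "(\<lambda>x. ?E ?f x - of_nat (Suc n) * ?f x) \<in> U"
    by (rule psub_diff[OF U _ psubD(4)[OF U f]])
  also have "(\<lambda>x. ?E ?f x - of_nat (Suc n) * ?f x) = (\<lambda>x. \<Sum>d\<le>n. (of_nat d - of_nat (Suc n)) * F d x)"
  proof
    fix x
    have "?E ?f x - of_nat (Suc n) * ?f x = (\<Sum>d\<le>Suc n. (of_nat d - of_nat (Suc n)) * F d x)"
      by (subst E_eq) (simp only: sum_distrib_left sum_subtractf left_diff_distrib)
    then show "?E ?f x - of_nat (Suc n) * ?f x = (\<Sum>d\<le>n. (of_nat d - of_nat (Suc n)) * F d x)"
      by simp
  qed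
  finally have "(\<lambda>x. \<Sum>d\<le>n. (of_nat d - of_nat (Suc n)) * F d x) \<in> U" .
  then have IH: "(\<lambda>x. (of_nat d - of_nat (Suc n)) * F d x) \<in> U" if "d \<le> n" for d
    using Suc.IH[of "\<lambda>d x. (of_nat d - of_nat (Suc n)) * F d x"] Suc.prems(1) Hom_scale that by blast
  have low: "F d \<in> U" if "d \<le> n" for d
  proof -
    have "(of_nat d - of_nat (Suc n) :: complex) \<noteq> 0"
      using that by (metis Suc_n_not_le_n eq_iff_diff_eq_0 of_nat_eq_iff)
    then show ?thesis
      using psubD(4)[OF U IH[OF that], of "1 / (of_nat d - of_nat (Suc n))"] by simp
  qed
  show ?case
  proof (cases "d \<le> n")
    case False
    then have "d = Suc n" using Suc.prems by simp
    moreover have "(\<lambda>x. ?f x - (\<Sum>d\<le>n. F d x)) \<in> U"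
      by (intro psub_diff[OF U] Suc.prems psub_sum[OF U] low) auto
    ultimately show ?thesis by simp
  qed (rule low)
qed

lemma psub_Hom_nonzero:
  assumes U: "psub U" and f: "f \<in> U" "f \<noteq> (\<lambda>x. 0)"
  shows "\<exists>d. \<exists>g\<in>U \<inter> Hom d. g \<noteq> (\<lambda>x. 0)"
proof -
  obtain n F where F: "\<forall>d. F d \<in> Hom d" "f = (\<lambda>x. \<Sum>d\<le>n. F d x)"
    using Pol_decompose[OF psubD(1)[OF U f(1)]] by blast
  have "\<exists>d\<le>n. F d \<noteq> (\<lambda>x. 0)"
  proof (rule ccontr)
    assume "\<not> ?thesis"
    then have "f = (\<lambda>x. 0)" unfolding F(2) by (auto intro!: ext sum.neutral)
    then show False using f by simp
  qed
  then obtain d where d: "d \<le> n" "F d \<noteq> (\<lambda>x. 0)" by blast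
  have "F d \<in> U" using psub_graded[OF U, of F n d] F f d by blast
  then show ?thesis using F d by blast
qed

text \<open>A nonzero element \<open>g\<close> of lowest degree \<open>d > 0\<close> is killed by
  all Dunkl operators, so Euler's formula equates \<open>d\<close> times \<open>g\<close> with
  \<open>c\<close> times the sum of the \<open>g - g \<circ> s\<close>. At a point of the unit
  sphere where \<open>cmod g\<close> is largest, each summand is at most twice that maximum.\<close>

lemma degree_bound:
  assumes U: "psub U" and f: "f \<in> U" "f \<noteq> (\<lambda>x. 0)" and c: "c \<ge> 0"
  shows "\<exists>d\<le>nat \<lceil>2 * c * real (card reflections)\<rceil>. \<exists>g\<in>U \<inter> Hom d. g \<noteq> (\<lambda>x. 0)"
proof -
  define d where "d = (LEAST d. \<exists>g\<in>U \<inter> Hom d. g \<noteq> (\<lambda>x. 0))"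
  obtain g where g: "g \<in> U" "g \<in> Hom d" "g \<noteq> (\<lambda>x. 0)"
    using LeastI_ex[OF psub_Hom_nonzero[OF U f]] unfolding d_def by blast
  have "real d \<le> 2 * c * real (card reflections)"
  proof (cases d)
    case 0
    then show ?thesis using c by simp
  next
    case (Suc k)
    have "D b g = (\<lambda>x. 0)" for b
    proof (rule ccontr)
      assume "D b g \<noteq> (\<lambda>x. 0)"
      moreover have "D b g \<in> U \<inter> Hom k" using D_Hom[OF g(2)] psubD(7)[OF U g(1)] Suc by simp
      ultimately have "d \<le> k" unfolding d_def by (intro Least_le) blast
      then show False using Suc by simp
    qed
    then have eig: "of_real c * (\<Sum>s\<in>reflections. g x - g (s x)) = of_nat d * g x" for x
      using Euler[OF g(2), of x] by simp
    obtain y where y: "g y \<noteq> 0" using g(3) by auto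
    have "y \<noteq> 0" using y Hom_scaleR[OF g(2), of 0 y] Suc by auto
    define z where "z = (1 / norm y) *\<^sub>R y"
    have z: "norm z = 1" "g z \<noteq> 0"
      using \<open>y \<noteq> 0\<close> y Hom_scaleR[OF g(2), of "1 / norm y" y] by (auto simp: z_def)
    have "compact (sphere (0::'a) 1)" by simp
    moreover have "sphere (0::'a) 1 \<noteq> {}" using z by (auto simp: dist_norm intro!: exI[of _ z])
    moreover have "continuous_on (sphere (0::'a) 1) (\<lambda>x. cmod (g x))"
      by (intro continuous_on_norm Pol_continuous Hom_Pol[OF g(2)])
    ultimately obtain x where x: "x \<in> sphere 0 1" "\<And>u. u \<in> sphere 0 1 \<Longrightarrow> cmod (g u) \<le> cmod (g x)"
      using continuous_attains_sup[of "sphere (0::'a) 1" "\<lambda>x. cmod (g x)"] by blast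
    have "0 < cmod (g z)" using z by simp
    also have "cmod (g z) \<le> cmod (g x)" using x(2)[of z] z by (simp add: dist_norm)
    finally have gx: "cmod (g x) > 0" .
    have "real d * cmod (g x) = cmod (of_real c * (\<Sum>s\<in>reflections. g x - g (s x)))"
      unfolding eig by (simp add: norm_mult)
    also have "\<dots> \<le> c * (\<Sum>s\<in>reflections. cmod (g x - g (s x)))"
      using c by (simp add: norm_mult mult_left_mono norm_sum)
    also have "\<dots> \<le> c * (\<Sum>s\<in>reflections. 2 * cmod (g x))"
    proof (intro mult_left_mono sum_mono c)
      fix s assume "s \<in> reflections"
      then have "s x \<in> sphere 0 1" using x(1) norm_W[OF reflections_subset] by (simp add: dist_norm)
      then have "cmod (g (s x)) \<le> cmod (g x)" by (rule x(2))
      then show "cmod (g x - g (s x)) \<le> 2 * cmod (g x)"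
        using norm_triangle_ineq4[of "g x" "g (s x)"] by linarith
    qed
    finally have "real d * cmod (g x) \<le> (2 * c * real (card reflections)) * cmod (g x)"
      by (simp add: algebra_simps)
    then show ?thesis using gx by simp
  qed
  then have "d \<le> nat \<lceil>2 * c * real (card reflections)\<rceil>" by linarith
  then show ?thesis using g by blast
qed

lemma psub_Inter:
  assumes "V \<in> \<U>" "\<And>U. U \<in> \<U> \<Longrightarrow> psub U"
  shows "psub (\<Inter>\<U>)"
  unfolding psub_def
proof (intro conjI ballI allI impI InterI)
  show "\<Inter>\<U> \<subseteq> Pol" using psubD(1)[OF assms(2)[OF assms(1)]] assms(1) by blast
next
  fix U assume U: "U \<in> \<U>"
  show "(\<lambda>x. 0) \<in> U" by (rule psubD(2)[OF assms(2)[OF U]])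
next
  fix f g U assume "f \<in> \<Inter>\<U>" "g \<in> \<Inter>\<U>" and U: "U \<in> \<U>"
  then show "(\<lambda>x. f x + g x) \<in> U" by (intro psubD(3)[OF assms(2)[OF U]]) auto
next
  fix a f U assume "f \<in> \<Inter>\<U>" and U: "U \<in> \<U>"
  then show "(\<lambda>x. a * f x) \<in> U" by (intro psubD(4)[OF assms(2)[OF U]]) auto
next
  fix w f U assume "w \<in> W" "f \<in> \<Inter>\<U>" and U: "U \<in> \<U>"
  then show "(\<lambda>x. f (w x)) \<in> U" by (rule_tac psubD(5)[OF assms(2)[OF U]]) auto
next
  fix \<xi> :: "'a \<Rightarrow> complex" and f U assume "f \<in> \<Inter>\<U>" "linear \<xi>" and U: "U \<in> \<U>"
  then show "(\<lambda>x. \<xi> x * f x) \<in> U" by (intro psubD(6)[OF assms(2)[OF U]]) auto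
next
  fix b f U assume "f \<in> \<Inter>\<U>" and U: "U \<in> \<U>"
  then show "D b f \<in> U" by (intro psubD(7)[OF assms(2)[OF U]]) auto
qed

section \<open>The least nonzero submodule\<close>

definition nonzero_psub :: "('a \<Rightarrow> complex) set \<Rightarrow> bool" where
  "nonzero_psub U \<longleftrightarrow> psub U \<and> (\<exists>f\<in>U. f \<noteq> (\<lambda>x. 0))"

lemma psub_Int: "psub U \<Longrightarrow> psub V \<Longrightarrow> psub (U \<inter> V)"
  using psub_Inter[of U "{U, V}"] by auto

text \<open>Submodules are ideals, so the product of nonzero elements of both lies in the
  intersection, and it is nonzero because polynomials form a domain.\<close>

lemma nonzero_psub_Int:
  assumes "nonzero_psub U" "nonzero_psub V"
  shows "nonzero_psub (U \<inter> V)"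
proof -
  obtain f g where fg: "f \<in> U" "f \<noteq> (\<lambda>x. 0)" "g \<in> V" "g \<noteq> (\<lambda>x. 0)" and U: "psub U" and V: "psub V"
    using assms unfolding nonzero_psub_def by blast
  have P: "f \<in> Pol" "g \<in> Pol" using fg psubD(1)[OF U] psubD(1)[OF V] by auto
  let ?h = "\<lambda>x. f x * g x"
  have "?h \<in> V" using psub_Pol_mult[OF V P(1) fg(3)] .
  moreover have "?h \<in> U" using psub_Pol_mult[OF U P(2) fg(1)] by (simp add: mult.commute)
  moreover have "?h \<noteq> (\<lambda>x. 0)"
  proof
    assume h: "?h = (\<lambda>x. 0)"
    obtain b where "g b \<noteq> 0" using fg by auto
    then have "f x = 0" for x using Pol_domain[OF P, of b x] h by (auto simp: fun_eq_iff)
    then show False using fg by auto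
  qed
  ultimately show ?thesis using psub_Int[OF U V] unfolding nonzero_psub_def by blast
qed

end

text \<open>Supplies spans and dimensions over the complex numbers for spaces of functions.\<close>

interpretation cfun: vector_space "\<lambda>(a::complex) (f::'x \<Rightarrow> complex) x. a * f x"
  by unfold_locales (auto simp: fun_eq_iff plus_fun_def algebra_simps)

lemma sum_fun_apply: "(\<Sum>i\<in>I. f i :: 'x \<Rightarrow> complex) x = (\<Sum>i\<in>I. f i x)"
  by (induction I rule: infinite_finite_induct) (auto simp: plus_fun_def zero_fun_def)

lemma sum_fun_eta: "(\<lambda>x. \<Sum>i\<in>I. f i x) = (\<Sum>i\<in>I. f i :: 'x \<Rightarrow> complex)"
  by (rule ext) (simp only: sum_fun_apply)

context rational_cherednik
begin

lemma psub_subspace: "psub U \<Longrightarrow> cfun.subspace U"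
  unfolding cfun.subspace_def using psubD(2-4)[of U] by (auto simp: plus_fun_def zero_fun_def)

definition Pol_le :: "nat \<Rightarrow> ('a \<Rightarrow> complex) set" where
  "Pol_le n = cfun.span (\<Union>d\<le>n. Hom d)"

lemma Pol_le_finite: "\<exists>T. finite T \<and> Pol_le n \<subseteq> cfun.span T"
proof -
  have "\<forall>d. \<exists>S. finite S \<and> S \<subseteq> Hom d \<and> (\<forall>f\<in>Hom d. \<exists>z. f = (\<lambda>x::'a. \<Sum>g\<in>S. z g * g x))"
    using Hom_span_finite by blast
  then obtain S where S: "\<And>d. finite (S d)" "\<And>d f. f \<in> Hom d \<Longrightarrow> \<exists>z. f = (\<lambda>x::'a. \<Sum>g\<in>S d. z g * g x)"
    by metis
  have "Hom d \<subseteq> cfun.span (\<Union>d\<le>n. S d)" if "d \<le> n" for d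
  proof
    fix f :: "'a \<Rightarrow> complex" assume "f \<in> Hom d"
    then obtain z where "f = (\<lambda>x. \<Sum>g\<in>S d. z g * g x)" using S(2) by blast
    then have f: "f = (\<Sum>g\<in>S d. (\<lambda>x. z g * g x))" by (simp add: sum_fun_eta)
    show "f \<in> cfun.span (\<Union>d\<le>n. S d)"
      unfolding f using that by (intro cfun.span_sum cfun.span_scale cfun.span_base) auto
  qed
  then have "(\<Union>d\<le>n. Hom d) \<subseteq> cfun.span (\<Union>d\<le>n. S d)" by blast
  then have "Pol_le n \<subseteq> cfun.span (\<Union>d\<le>n. S d)"
    unfolding Pol_le_def by (rule cfun.span_minimal) (rule cfun.subspace_span)
  then show ?thesis using S(1) by (intro exI[of _ "\<Union>d\<le>n. S d"]) auto
qed

text \<open>By \<open>degree_bound\<close> every nonzero submodule meets the finite dimensional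
  space \<open>Pol_le n\<close> nontrivially. If the part of \<open>U0\<close> in it has least
  dimension, this part lies in every nonzero submodule \<open>V\<close>, since intersecting with
  \<open>V\<close> cannot lower the dimension. So the intersection of all nonzero submodules is
  nonzero.\<close>

lemma ex_minimal_psub:
  assumes c: "c \<ge> 0"
  shows "\<exists>U. nonzero_psub U \<and> (\<forall>V. nonzero_psub V \<longrightarrow> U \<subseteq> V)"
proof -
  define n where "n = nat \<lceil>2 * c * real (card reflections)\<rceil>"
  obtain T where T: "finite T" "Pol_le n \<subseteq> cfun.span T" using Pol_le_finite by blast
  have Pol: "nonzero_psub Pol"
    unfolding nonzero_psub_def psub_def
    by (auto intro: Pol.intros Pol_scale Pol_W D_Pol intro!: bexI[of _ "\<lambda>x. 1"] simp: fun_eq_iff)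
  define \<delta> where "\<delta> U = cfun.dim (U \<inter> Pol_le n)" for U
  obtain U0 where U0: "nonzero_psub U0" "\<And>V. nonzero_psub V \<Longrightarrow> \<delta> U0 \<le> \<delta> V"
    using ex_has_least_nat[of nonzero_psub Pol \<delta>] Pol by blast
  have fin: "finite B \<and> card B \<le> card B'" if "cfun.independent B" "B \<subseteq> U \<inter> Pol_le n" "B' \<subseteq> U \<inter> Pol_le n"
    "U \<inter> Pol_le n \<subseteq> cfun.span B'" "cfun.independent B'" for B B' U
  proof -
    have "finite B'" using cfun.independent_span_bound[OF T(1) that(5)] that T by blast
    then show ?thesis using cfun.independent_span_bound[of B' B] that by blast
  qed
  have sub: "U0 \<inter> Pol_le n \<subseteq> V" if V: "nonzero_psub V" for V
  proof -
    let ?I = "(V \<inter> U0) \<inter> Pol_le n"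
    obtain B1 where B1: "B1 \<subseteq> ?I" "cfun.independent B1" "?I \<subseteq> cfun.span B1" "card B1 = cfun.dim ?I"
      using cfun.basis_exists[of ?I] by blast
    obtain B0 where B0: "B0 \<subseteq> U0 \<inter> Pol_le n" "cfun.independent B0" "U0 \<inter> Pol_le n \<subseteq> cfun.span B0"
      "card B0 = cfun.dim (U0 \<inter> Pol_le n)"
      using cfun.basis_exists[of "U0 \<inter> Pol_le n"] by blast
    have le: "card B0 \<le> card B1"
      using U0(2)[OF nonzero_psub_Int[OF V U0(1)]] B0(4) B1(4) by (simp add: \<delta>_def)
    have "U0 \<inter> Pol_le n \<subseteq> cfun.span B1"
    proof
      fix v assume v: "v \<in> U0 \<inter> Pol_le n"
      show "v \<in> cfun.span B1"
      proof (rule ccontr)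
        assume nv: "v \<notin> cfun.span B1"
        then have ind: "cfun.independent (insert v B1)" using B1(2) cfun.independent_insertI by blast
        have "insert v B1 \<subseteq> U0 \<inter> Pol_le n" using B1(1) v by blast
        from fin[OF ind this B0(1,3,2)]
        have "finite (insert v B1) \<and> card (insert v B1) \<le> card B0" .
        moreover have "v \<notin> B1" using nv cfun.span_base by blast
        ultimately show False using le by auto
      qed
    qed
    also have "cfun.span B1 \<subseteq> V"
      using B1(1) V unfolding nonzero_psub_def by (intro cfun.span_minimal psub_subspace) auto
    finally show ?thesis .
  qed
  obtain f where f: "f \<in> U0" "f \<noteq> (\<lambda>x. 0)" using U0(1) unfolding nonzero_psub_def by blast
  then obtain d g where g: "d \<le> n" "g \<in> U0" "g \<in> Hom d" "g \<noteq> (\<lambda>x. 0)"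
    using degree_bound[OF _ f c] U0(1) unfolding nonzero_psub_def n_def by blast
  have gP: "g \<in> Pol_le n" unfolding Pol_le_def using g by (intro cfun.span_base) auto
  let ?U = "\<Inter>{V. nonzero_psub V}"
  have "psub ?U" by (rule psub_Inter[of Pol]) (use Pol in \<open>auto simp: nonzero_psub_def\<close>)
  moreover have "g \<in> ?U" using sub g gP by blast
  ultimately have "nonzero_psub ?U" using g unfolding nonzero_psub_def by blast
  then show ?thesis by blast
qed

definition min_psub :: "('a \<Rightarrow> complex) set" where
  "min_psub = \<Inter>{V. nonzero_psub V}"

lemma min_psub_least: "nonzero_psub V \<Longrightarrow> min_psub \<subseteq> V"
  unfolding min_psub_def by blast

lemma nonzero_min_psub: "c \<ge> 0 \<Longrightarrow> nonzero_psub min_psub"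
proof -
  assume "c \<ge> 0"
  from ex_minimal_psub[OF this] obtain U where "nonzero_psub U" "\<And>V. nonzero_psub V \<Longrightarrow> U \<subseteq> V" by blast
  then have "min_psub = U" unfolding min_psub_def by blast
  then show ?thesis using \<open>nonzero_psub U\<close> by simp
qed

lemma image_\<Phi>_nonzero: "psub U \<Longrightarrow> \<Phi> ` U \<noteq> {mzero} \<longleftrightarrow> nonzero_psub U"
proof -
  assume U: "psub U"
  have "\<Phi> ` U = {\<Phi> (\<lambda>x. 0)} \<longleftrightarrow> (\<forall>f\<in>U. f = (\<lambda>x. 0))"
  proof
    assume eq: "\<Phi> ` U = {\<Phi> (\<lambda>x. 0)}"
    show "\<forall>f\<in>U. f = (\<lambda>x. 0)"
    proof
      fix f assume f: "f \<in> U"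
      then have "\<Phi> f = \<Phi> (\<lambda>x. 0)" using eq by blast
      then show "f = (\<lambda>x. 0)" using \<Phi>_inject[OF psubD(1)[OF U f] Pol.const] by blast
    qed
  next
    assume "\<forall>f\<in>U. f = (\<lambda>x. 0)"
    then have "U = {\<lambda>x. 0}" using psubD(2)[OF U] by blast
    then show "\<Phi> ` U = {\<Phi> (\<lambda>x. 0)}" by simp
  qed
  then show ?thesis using U by (auto simp: nonzero_psub_def \<Phi>_zero)
qed

lemma N_min_eq:
  assumes c: "c \<ge> 0"
  shows "N_min = \<Phi> ` min_psub"
  unfolding N_min_def
proof (rule the_equality)
  have U: "psub min_psub" "nonzero_psub min_psub" using nonzero_min_psub[OF c] by (auto simp: nonzero_psub_def)
  have least: "\<Phi> ` min_psub \<subseteq> N'" if "submodule N'" "N' \<noteq> {mzero}" for N'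
  proof -
    note P = submodule_psub[OF that(1)]
    have "nonzero_psub (polynomials N')"
      using image_\<Phi>_nonzero[OF P(1)] that(2) P(2) by simp
    then have "\<Phi> ` min_psub \<subseteq> \<Phi> ` polynomials N'" by (intro image_mono min_psub_least)
    then show ?thesis using P(2) by simp
  qed
  show 1: "is_minimal_nonzero_submodule (\<Phi> ` min_psub)"
    unfolding is_minimal_nonzero_submodule_def
    using psub_submodule[OF U(1)] image_\<Phi>_nonzero[OF U(1)] U(2) least by (intro conjI allI impI) auto
  show "N = \<Phi> ` min_psub" if "is_minimal_nonzero_submodule N" for N
  proof (rule subset_antisym)
    have "submodule N" "N \<noteq> {mzero}" using that by (auto simp: is_minimal_nonzero_submodule_def)
    then show "\<Phi> ` min_psub \<subseteq> N" by (rule least)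
    have "submodule (\<Phi> ` min_psub)" "\<Phi> ` min_psub \<noteq> {mzero}"
      using 1 by (simp_all add: is_minimal_nonzero_submodule_def)
    then show "N \<subseteq> \<Phi> ` min_psub" using that by (simp add: is_minimal_nonzero_submodule_def)
  qed
qed

end

section \<open>Hermitian forms\<close>

text \<open>Positivity is kept out, because differences of positive forms have to be handled as
  well.\<close>

locale herm_form =
  fixes L :: "('x \<Rightarrow> complex) set" and q :: "('x \<Rightarrow> complex) \<Rightarrow> ('x \<Rightarrow> complex) \<Rightarrow> complex"
  assumes zero_closed: "(\<lambda>x. 0) \<in> L"
    and add_closed: "f \<in> L \<Longrightarrow> g \<in> L \<Longrightarrow> (\<lambda>x. f x + g x) \<in> L"
    and scale_closed: "f \<in> L \<Longrightarrow> (\<lambda>x. a * f x) \<in> L"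
    and q_add: "f \<in> L \<Longrightarrow> g \<in> L \<Longrightarrow> h \<in> L \<Longrightarrow> q (\<lambda>x. f x + g x) h = q f h + q g h"
    and q_scale: "f \<in> L \<Longrightarrow> h \<in> L \<Longrightarrow> q (\<lambda>x. a * f x) h = a * q f h"
    and q_cnj: "f \<in> L \<Longrightarrow> h \<in> L \<Longrightarrow> q h f = cnj (q f h)"
begin

lemma diff_closed: "f \<in> L \<Longrightarrow> g \<in> L \<Longrightarrow> (\<lambda>x. f x - g x) \<in> L"
  using add_closed[of f "\<lambda>x. -1 * g x"] scale_closed[of g "-1"] by simp

lemma sum_closed: "(\<And>i. i \<in> I \<Longrightarrow> f i \<in> L) \<Longrightarrow> (\<lambda>x. \<Sum>i\<in>I. f i x) \<in> L"
  by (induction I rule: infinite_finite_induct) (auto intro: zero_closed add_closed)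

lemma q_zero: "h \<in> L \<Longrightarrow> q (\<lambda>x. 0) h = 0"
  using q_scale[OF zero_closed, of h 0] by simp

lemma q_add2: "f \<in> L \<Longrightarrow> g \<in> L \<Longrightarrow> h \<in> L \<Longrightarrow> q h (\<lambda>x. f x + g x) = q h f + q h g"
  using q_cnj[of "\<lambda>x. f x + g x" h] q_cnj[of f h] q_cnj[of g h] by (simp add: add_closed q_add)

lemma q_scale2: "f \<in> L \<Longrightarrow> h \<in> L \<Longrightarrow> q h (\<lambda>x. a * f x) = cnj a * q h f"
  using q_cnj[of "\<lambda>x. a * f x" h] q_cnj[of f h] by (simp add: scale_closed q_scale)

lemma q_diff: "f \<in> L \<Longrightarrow> g \<in> L \<Longrightarrow> h \<in> L \<Longrightarrow> q (\<lambda>x. f x - g x) h = q f h - q g h"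
  using q_add[of f "\<lambda>x. -1 * g x" h] scale_closed[of g "-1"] q_scale[of g h "-1"] by simp

lemma q_sum: "(\<And>i. i \<in> I \<Longrightarrow> f i \<in> L) \<Longrightarrow> h \<in> L \<Longrightarrow> q (\<lambda>x. \<Sum>i\<in>I. f i x) h = (\<Sum>i\<in>I. q (f i) h)"
  by (induction I rule: infinite_finite_induct) (auto simp: q_zero q_add sum_closed)

lemma q_sum2: "(\<And>i. i \<in> I \<Longrightarrow> f i \<in> L) \<Longrightarrow> h \<in> L \<Longrightarrow> q h (\<lambda>x. \<Sum>i\<in>I. f i x) = (\<Sum>i\<in>I. q h (f i))"
  using q_cnj[of "\<lambda>x. \<Sum>i\<in>I. f i x" h] by (simp add: sum_closed q_sum q_cnj[of _ h, symmetric])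

lemma q_real: "f \<in> L \<Longrightarrow> q f f = of_real (Re (q f f))"
  using q_cnj[of f f] by (simp add: complex_eq_iff)

text \<open>Besides orthonormality only the expansion of the vectors of \<open>S\<close> is
  recorded; this is the form that the Gram-Schmidt induction extends by one vector at a
  time.\<close>

definition orthonormal_expansion :: "('x \<Rightarrow> complex) set \<Rightarrow> ('x \<Rightarrow> complex) set \<Rightarrow> bool" where
  "orthonormal_expansion E S \<longleftrightarrow> finite E \<and> E \<subseteq> L \<and>
     (\<forall>e\<in>E. \<forall>e'\<in>E. q e e' = (if e = e' then 1 else 0)) \<and> (\<forall>v\<in>S. \<forall>x. (\<Sum>e\<in>E. q v e * e x) = v x)"

lemma orthonormal_expansionD:
  assumes "orthonormal_expansion E S"
  shows "finite E" "E \<subseteq> L" "e \<in> E \<Longrightarrow> e' \<in> E \<Longrightarrow> q e e' = (if e = e' then 1 else 0)"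
    "v \<in> S \<Longrightarrow> (\<Sum>e\<in>E. q v e * e x) = v x"
  using assms by (simp_all add: orthonormal_expansion_def)

lemma gram_schmidt:
  assumes pos: "\<And>f. f \<in> L \<Longrightarrow> f \<noteq> (\<lambda>x. 0) \<Longrightarrow> Re (q f f) > 0"
  shows "finite S \<Longrightarrow> S \<subseteq> L \<Longrightarrow> \<exists>E. orthonormal_expansion E S"
proof (induction S rule: finite_induct)
  case empty
  show ?case by (intro exI[of _ "{}"]) (simp add: orthonormal_expansion_def)
next
  case (insert g S)
  then obtain E where E0: "orthonormal_expansion E S" by blast
  note E = orthonormal_expansionD[OF E0]
  have gL: "g \<in> L" using insert by simp
  define p where "p = (\<lambda>x. \<Sum>e\<in>E. q g e * e x)"
  have pL: "p \<in> L" unfolding p_def using E(2) by (intro sum_closed scale_closed) auto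
  define u where "u = (\<lambda>x. g x - p x)"
  have uL: "u \<in> L" unfolding u_def by (intro diff_closed gL pL)
  have comb: "q (\<lambda>x. \<Sum>e\<in>E. z e * e x) e' = z e'" if "e' \<in> E" for z e'
  proof -
    have "q (\<lambda>x. \<Sum>e\<in>E. z e * e x) e' = (\<Sum>e\<in>E. z e * q e e')"
      using E(2) that by (subst q_sum) (auto intro!: sum.cong scale_closed q_scale)
    also have "\<dots> = (\<Sum>e\<in>E. if e = e' then z e else 0)"
      using E(3) that by (intro sum.cong) auto
    finally show ?thesis using E(1) that by simp
  qed
  have ue: "q u e = 0" if "e \<in> E" for e
    using comb[OF that, of "q g"] that E(2) gL pL unfolding u_def p_def[symmetric] by (subst q_diff) auto
  show ?case
  proof (cases "u = (\<lambda>x. 0)")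
    case True
    then have "g = p" by (auto simp: u_def fun_eq_iff)
    then have "(\<Sum>e\<in>E. q g e * e x) = g x" for x by (simp add: p_def fun_eq_iff)
    then have "orthonormal_expansion E (insert g S)"
      using E0 unfolding orthonormal_expansion_def by blast
    then show ?thesis by blast
  next
    case False
    define r where "r = sqrt (Re (q u u))"
    have r: "r > 0" "q u u = of_real r * of_real r"
      using pos[OF uL False] q_real[OF uL] by (auto simp: r_def simp flip: of_real_mult)
    define e0 where "e0 = (\<lambda>x. (1 / of_real r) * u x)"
    have e0L: "e0 \<in> L" unfolding e0_def by (intro scale_closed uL)
    have e0u: "q u e0 = of_real r" "q e0 e0 = 1"
    proof -
      have "q u e0 = cnj (1 / of_real r) * q u u" unfolding e0_def by (rule q_scale2[OF uL uL])
      then show 1: "q u e0 = of_real r" using r by simp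
      have "q e0 e0 = (1 / of_real r) * q u e0" by (subst (1) e0_def) (rule q_scale[OF uL e0L])
      then show "q e0 e0 = 1" using r 1 by simp
    qed
    have e0e: "q e0 e = 0" "q e e0 = 0" if "e \<in> E" for e
    proof -
      show "q e0 e = 0" unfolding e0_def using uL ue[OF that] that E(2) by (subst q_scale) auto
      then show "q e e0 = 0" using q_cnj[of e0 e] e0L that E(2) by auto
    qed
    have nin: "e0 \<notin> E" using e0u(2) e0e by auto
    have comb0: "q (\<lambda>x. \<Sum>e\<in>E. z e * e x) e0 = 0" for z
      using E(2) e0L e0e by (subst q_sum) (auto intro!: sum.neutral scale_closed simp: q_scale subsetD)
    have S: "(\<Sum>e\<in>insert e0 E. q v e * e x) = v x" if "v \<in> S" for v x
    proof -
      have "q v e0 = 0" using comb0[of "q v"] E(4)[OF that] by simp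
      then show ?thesis using E(1) nin E(4)[OF that] by simp
    qed
    have g: "(\<Sum>e\<in>insert e0 E. q g e * e x) = g x" for x
    proof -
      have "q g e0 = q (\<lambda>x. u x + p x) e0" by (simp add: u_def)
      also have "\<dots> = of_real r" using uL pL e0L comb0[of "q g"] by (simp add: q_add e0u p_def)
      finally have "q g e0 * e0 x = u x" for x using r by (simp add: e0_def)
      then show ?thesis using E(1) nin by (simp add: u_def p_def)
    qed
    have ortho: "\<forall>e\<in>insert e0 E. \<forall>e'\<in>insert e0 E. q e e' = (if e = e' then 1 else 0)"
      using E(3) e0u e0e nin by auto
    have "orthonormal_expansion (insert e0 E) (insert g S)"
      unfolding orthonormal_expansion_def
    proof (intro conjI ballI allI)
      fix v x assume "v \<in> insert g S"
      then show "(\<Sum>e\<in>insert e0 E. q v e * e x) = v x" using S g by blast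
    qed (use E(1,2) e0L ortho in blast)+
    then show ?thesis by blast
  qed
qed

text \<open>Both forms are written in coefficients with respect to a set orthonormal for
  \<open>q\<close>. There \<open>q\<close> is the sum of the squared coefficients, and
  \<open>r\<close> is bounded by it times the total size \<open>M\<close> of the matrix
  entries.\<close>

lemma compare:
  assumes r: "herm_form L r" and pos: "\<And>f. f \<in> L \<Longrightarrow> f \<noteq> (\<lambda>x. 0) \<Longrightarrow> Re (q f f) > 0"
    and S: "finite S" "S \<subseteq> L" "\<And>f. f \<in> L \<Longrightarrow> \<exists>z. f = (\<lambda>x. \<Sum>g\<in>S. z g * g x)"
  shows "\<exists>C>0. \<forall>v\<in>L. Re (r v v) \<le> C * Re (q v v)"
proof -
  interpret r: herm_form L r by fact
  obtain E where E0: "orthonormal_expansion E S" using gram_schmidt[OF pos S(1,2)] by blast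
  note E = orthonormal_expansionD[OF E0]
  have expand: "(\<lambda>x. \<Sum>e\<in>E. q v e * e x) = v" if v: "v \<in> L" for v
  proof -
    obtain z where z: "v = (\<lambda>x. \<Sum>g\<in>S. z g * g x)" using S(3)[OF v] by blast
    have qv: "q v e = (\<Sum>g\<in>S. z g * q g e)" if "e \<in> E" for e
      unfolding z using S(2) E(2) that by (subst q_sum) (auto intro!: sum.cong scale_closed q_scale)
    have "v x = (\<Sum>e\<in>E. q v e * e x)" for x
    proof -
      have "v x = (\<Sum>g\<in>S. z g * (\<Sum>e\<in>E. q g e * e x))"
        using E(4) by (simp add: z)
      also have "\<dots> = (\<Sum>e\<in>E. \<Sum>g\<in>S. z g * q g e * e x)"
        unfolding sum_distrib_left by (subst sum.swap) (simp add: mult.assoc)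
      also have "\<dots> = (\<Sum>e\<in>E. q v e * e x)"
        using qv by (intro sum.cong refl) (simp add: sum_distrib_right)
      finally show ?thesis .
    qed
    then show ?thesis by (intro ext) (rule sym)
  qed
  define M where "M = (\<Sum>e\<in>E. \<Sum>e'\<in>E. cmod (r e e'))"
  have "Re (r v v) \<le> M * Re (q v v)" if v: "v \<in> L" for v
  proof -
    let ?z = "\<lambda>e. q v e"
    define N where "N = (\<Sum>e\<in>E. (cmod (?z e))\<^sup>2)"
    have eL: "e \<in> E \<Longrightarrow> e \<in> L" for e using E(2) by blast
    have "q v v = q (\<lambda>x. \<Sum>e\<in>E. ?z e * e x) v" using expand[OF v] by simp
    also have "\<dots> = (\<Sum>e\<in>E. ?z e * q e v)"
      using eL v by (subst q_sum) (auto intro!: sum.cong scale_closed q_scale)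
    also have "\<dots> = (\<Sum>e\<in>E. of_real ((cmod (?z e))\<^sup>2))"
    proof (rule sum.cong[OF refl])
      fix e assume "e \<in> E"
      then have "q e v = cnj (q v e)" using eL v by (intro q_cnj)
      then show "?z e * q e v = of_real ((cmod (?z e))\<^sup>2)" by (simp only: complex_norm_square)
    qed
    finally have qN: "Re (q v v) = N" by (simp add: N_def)
    have zN: "cmod (?z e) * cmod (?z e') \<le> N" if "e \<in> E" "e' \<in> E" for e e'
    proof -
      have *: "(cmod (?z e))\<^sup>2 \<le> N" if "e \<in> E" for e
        unfolding N_def using E(1) that by (intro member_le_sum) auto
      have "2 * (cmod (?z e) * cmod (?z e')) \<le> (cmod (?z e))\<^sup>2 + (cmod (?z e'))\<^sup>2"
        using sum_squares_bound[of "cmod (?z e)" "cmod (?z e')"] by simp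
      then show ?thesis using *[OF that(1)] *[OF that(2)] by linarith
    qed
    have "r v v = r (\<lambda>x. \<Sum>e\<in>E. ?z e * e x) (\<lambda>x. \<Sum>e\<in>E. ?z e * e x)" using expand[OF v] by simp
    also have "\<dots> = (\<Sum>e\<in>E. ?z e * r e (\<lambda>x. \<Sum>e\<in>E. ?z e * e x))"
      using eL by (subst r.q_sum) (auto intro!: sum.cong scale_closed sum_closed r.q_scale)
    also have "\<dots> = (\<Sum>e\<in>E. ?z e * (\<Sum>e'\<in>E. cnj (?z e') * r e e'))"
      using eL by (intro sum.cong refl) (subst r.q_sum2; auto intro!: sum.cong scale_closed simp: r.q_scale2)
    finally have rv: "r v v = (\<Sum>e\<in>E. \<Sum>e'\<in>E. ?z e * (cnj (?z e') * r e e'))" by (simp add: sum_distrib_left)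
    have "Re (r v v) \<le> cmod (r v v)" by (rule complex_Re_le_cmod)
    also have "\<dots> \<le> (\<Sum>e\<in>E. \<Sum>e'\<in>E. cmod (?z e * (cnj (?z e') * r e e')))"
      unfolding rv by (intro order_trans[OF norm_sum] sum_mono order_refl)
    also have "\<dots> \<le> (\<Sum>e\<in>E. \<Sum>e'\<in>E. N * cmod (r e e'))"
      using zN by (intro sum_mono) (simp add: norm_mult mult_right_mono flip: mult.assoc)
    also have "\<dots> = M * N" by (simp add: M_def sum_distrib_left mult.commute)
    finally show ?thesis using qN by simp
  qed
  \<comment> \<open>\<open>M\<close> may be \<open>0\<close>, whereas the constant has to be
    positive.\<close>
  moreover have "M * Re (q v v) \<le> (M + 1) * Re (q v v)" if "v \<in> L" for v
    using pos[OF that] q_zero[OF zero_closed] by (cases "v = (\<lambda>x. 0)") (auto intro!: mult_right_mono)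
  moreover have "M + 1 > 0" unfolding M_def by (intro add_nonneg_pos sum_nonneg) auto
  ultimately show ?thesis by (meson order_trans)
qed

text \<open>The Cauchy-Schwarz argument: since \<open>q v v = 0\<close>, the quadratic form is
  affine along a suitable line through \<open>u\<close> in the direction of \<open>v\<close>, hence
  nonnegative only if its slope vanishes.\<close>

lemma psd_null:
  assumes psd: "\<And>f. f \<in> L \<Longrightarrow> Re (q f f) \<ge> 0" and v: "v \<in> L" "Re (q v v) = 0" and u: "u \<in> L"
  shows "q v u = 0"
proof (rule ccontr)
  assume nz: "q v u \<noteq> 0"
  define a where "a = q u v"
  have a: "q v u = cnj a" "a \<noteq> 0" using q_cnj[OF u v(1)] nz by (auto simp: a_def)
  have "Re (q u u) + 2 * t * (cmod a)\<^sup>2 \<ge> 0" for t :: real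
  proof -
    let ?b = "of_real t * a"
    let ?w = "\<lambda>x. u x + ?b * v x"
    have qv: "q v v = 0" using q_real[OF v(1)] v(2) by simp
    have sc: "(\<lambda>x. ?b * v x) \<in> L" using v by (intro scale_closed)
    have "q ?w ?w = q u u + cnj ?b * a + ?b * cnj a"
      using u v sc add_closed[OF u sc] qv
      by (simp only: q_add q_add2 q_scale q_scale2 a a_def[symmetric]) simp
    moreover have "cnj ?b * a + ?b * cnj a = of_real (2 * t * (cmod a)\<^sup>2)"
      by (simp only: of_real_mult complex_norm_square) (simp add: algebra_simps)
    ultimately have "Re (q ?w ?w) = Re (q u u) + 2 * t * (cmod a)\<^sup>2"
      by (simp add: add.assoc del: of_real_mult)
    moreover have "Re (q ?w ?w) \<ge> 0" by (rule psd[OF add_closed[OF u sc]])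
    ultimately show ?thesis by simp
  qed
  \<comment> \<open>For this \<open>t\<close> the expression would equal \<open>-1\<close>.\<close>
  from this[of "- (Re (q u u) + 1) / (2 * (cmod a)\<^sup>2)"] a(2) show False by (simp add: field_simps)
qed

end

lemma herm_form_combination:
  assumes "herm_form L q" "herm_form L r"
  shows "herm_form L (\<lambda>f g. of_real t * q f g - of_real t' * r f g)"
proof -
  interpret q: herm_form L q by fact
  interpret r: herm_form L r by fact
  show ?thesis
    by unfold_locales
      (auto simp: q.zero_closed q.add_closed q.scale_closed q.q_add r.q_add q.q_scale r.q_scale
        algebra_simps q.q_cnj[symmetric] r.q_cnj[symmetric])
qed

text \<open>For the least \<open>t\<close> with \<open>r \<le> t * q\<close> the form
  \<open>t * q - r\<close> is semidefinite but not definite, and a vector on which it vanishes lies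
  in its radical by \<open>psd_null\<close>.\<close>

lemma common_eigenvector:
  assumes q: "herm_form L q" and r: "herm_form L r"
    and qpos: "\<And>f. f \<in> L \<Longrightarrow> f \<noteq> (\<lambda>x. 0) \<Longrightarrow> Re (q f f) > 0"
    and rpos: "\<And>f. f \<in> L \<Longrightarrow> f \<noteq> (\<lambda>x. 0) \<Longrightarrow> Re (r f f) > 0"
    and S: "finite S" "S \<subseteq> L" "\<And>f. f \<in> L \<Longrightarrow> \<exists>z. f = (\<lambda>x. \<Sum>g\<in>S. z g * g x)"
    and v0: "v0 \<in> L" "v0 \<noteq> (\<lambda>x. 0)"
  shows "\<exists>t v. v \<in> L \<and> v \<noteq> (\<lambda>x. 0) \<and> (\<forall>u\<in>L. r v u = of_real t * q v u)"
proof -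
  interpret q: herm_form L q by fact
  interpret r: herm_form L r by fact
  define T where "T = {t::real. \<forall>v\<in>L. Re (r v v) \<le> t * Re (q v v)}"
  have T_ne: "T \<noteq> {}" using q.compare[OF r qpos S] unfolding T_def by blast
  have T_ge: "0 \<le> t" if "t \<in> T" for t
  proof -
    have "0 < t * Re (q v0 v0)" using that rpos[OF v0] v0 unfolding T_def by fastforce
    then show ?thesis using qpos[OF v0] by (simp add: zero_less_mult_iff)
  qed
  then have bdd: "bdd_below T" by (auto simp: bdd_below_def)
  define t where "t = Inf T"
  have q_nonneg: "Re (q v v) \<ge> 0" if "v \<in> L" for v
    using qpos[OF that] q.q_zero[OF q.zero_closed] by (cases "v = (\<lambda>x. 0)") auto
  have tT: "Re (r v v) \<le> t * Re (q v v)" if v: "v \<in> L" for v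
  proof (cases "v = (\<lambda>x. 0)")
    case True
    then show ?thesis using q.q_zero[OF q.zero_closed] r.q_zero[OF q.zero_closed] by simp
  next
    case False
    have "Re (r v v) / Re (q v v) \<le> t" unfolding t_def
      using T_ne v qpos[OF v False] by (intro cInf_greatest) (auto simp: T_def field_simps)
    then show ?thesis using qpos[OF v False] by (simp add: field_simps)
  qed
  define Q where "Q f g = of_real t * q f g - of_real 1 * r f g" for f g
  have Qh: "herm_form L Q" unfolding Q_def by (rule herm_form_combination[OF q r])
  interpret Q: herm_form L Q by fact
  have psd: "Re (Q f f) \<ge> 0" if "f \<in> L" for f using tT[OF that] by (simp add: Q_def)
  have "\<exists>v\<in>L. v \<noteq> (\<lambda>x. 0) \<and> Re (Q v v) = 0"
  proof (rule ccontr)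
    assume "\<not> ?thesis"
    then have "Re (Q f f) > 0" if "f \<in> L" "f \<noteq> (\<lambda>x. 0)" for f
      using psd[OF that(1)] that by (metis less_eq_real_def)
    \<comment> \<open>If the difference were definite, it would dominate \<open>q / C\<close>, and
      \<open>t\<close> could be lowered by \<open>1 / C\<close>.\<close>
    from Q.compare[OF q this S] obtain C where C: "C > 0" "\<And>v. v \<in> L \<Longrightarrow> Re (q v v) \<le> C * Re (Q v v)" by blast
    have "t - 1 / C \<in> T"
      unfolding T_def
    proof (intro CollectI ballI)
      fix v assume "v \<in> L"
      from C(2)[OF this] C(1) have "Re (q v v) / C \<le> Re (Q v v)" by (simp add: field_simps)
      then show "Re (r v v) \<le> (t - 1 / C) * Re (q v v)" by (simp add: Q_def algebra_simps)
    qed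
    then have "t \<le> t - 1 / C" unfolding t_def using bdd by (intro cInf_lower)
    then show False using C(1) by simp
  qed
  then obtain v where v: "v \<in> L" "v \<noteq> (\<lambda>x. 0)" "Re (Q v v) = 0" by blast
  have "Q v u = 0" if "u \<in> L" for u using Q.psd_null[OF psd v(1,3) that] .
  then have "\<forall>u\<in>L. r v u = of_real t * q v u" by (simp add: Q_def)
  then show ?thesis using v by blast
qed

section \<open>Contravariant forms and unitarity\<close>

context rational_cherednik
begin

text \<open>The conditions of a contravariant form on polynomials, for real vectors \<open>a\<close>
  only; for these \<open>T_map\<close> is the inner product with \<open>a\<close>.\<close>

definition cform :: "('a \<Rightarrow> complex) set \<Rightarrow> (('a \<Rightarrow> complex) \<Rightarrow> ('a \<Rightarrow> complex) \<Rightarrow> complex) \<Rightarrow> bool" where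
  "cform U b \<longleftrightarrow> herm_form U b \<and> (\<forall>w\<in>W. \<forall>f\<in>U. \<forall>g\<in>U. b (\<lambda>x. f (w x)) (\<lambda>x. g (w x)) = b f g)
    \<and> (\<forall>a. \<forall>f\<in>U. \<forall>g\<in>U. b (D a f) g = b f (\<lambda>x. of_real (x \<bullet> a) * g x))"

lemma T_map_eq: "T_map y v = of_real (v \<bullet> fst y) - \<i> * of_real (v \<bullet> snd y)"
  by (simp add: T_map_def herm_def complex_eq_iff)

lemma linear_T_map: "linear (T_map (y :: 'a \<times> 'a))"
  using linear_compose_sub[OF linear_xb[of "fst y"] linear_const_mult[OF linear_xb[of "snd y"], of "\<i>"]]
  by (simp add: T_map_eq[abs_def])

text \<open>For a complex vector the adjointness follows from its real and imaginary part:
  \<open>T_map\<close> is antilinear, and so is the form in its second argument.\<close>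

lemma contravariant_form_cform:
  assumes U: "psub U"
  shows "contravariant_form (\<Phi> ` U) B \<longleftrightarrow> cform U (\<lambda>f g. B (\<Phi> f) (\<Phi> g))"
proof -
  let ?b = "\<lambda>f g. B (\<Phi> f) (\<Phi> g)"
  have UP: "f \<in> U \<Longrightarrow> f \<in> Pol" for f by (rule psubD(1)[OF U])
  have scal: "act (cls (scal a)) (\<Phi> f) = \<Phi> (\<lambda>x. a * f x)" if "f \<in> U" for a f
    using \<Phi>_act[OF FC_scal UP[OF that]] by simp
  have gw: "act (cls (gen (GW w))) (\<Phi> f) = \<Phi> (\<lambda>x. f (inv_into UNIV w x))" if "f \<in> U" "w \<in> W" for w f
    using \<Phi>_act[OF _ UP[OF that(1)], of "gen (GW w)"] that by simp
  have gy: "act (cls (gen (GY y))) (\<Phi> f) = \<Phi> (DD y f)" if "f \<in> U" for y f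
    using \<Phi>_act[OF _ UP[OF that], of "gen (GY y)"] by simp
  have gx: "act (cls (gen (GX (T_map y)))) (\<Phi> f) = \<Phi> (\<lambda>x. T_map y x * f x)" if "f \<in> U" for y f
    using \<Phi>_act[OF _ UP[OF that], of "gen (GX (T_map y))"] linear_T_map by simp
  have lhs: "contravariant_form (\<Phi> ` U) B \<longleftrightarrow>
     (\<forall>f\<in>U. \<forall>g\<in>U. \<forall>h\<in>U. ?b (\<lambda>x. f x + g x) h = ?b f h + ?b g h)
   \<and> (\<forall>a. \<forall>f\<in>U. \<forall>h\<in>U. ?b (\<lambda>x. a * f x) h = a * ?b f h)
   \<and> (\<forall>f\<in>U. \<forall>h\<in>U. ?b h f = cnj (?b f h))
   \<and> (\<forall>w\<in>W. \<forall>f\<in>U. \<forall>h\<in>U. ?b (\<lambda>x. f (inv_into UNIV w x)) (\<lambda>x. h (inv_into UNIV w x)) = ?b f h)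
   \<and> (\<forall>y. \<forall>f\<in>U. \<forall>h\<in>U. ?b (DD y f) h = ?b f (\<lambda>x. T_map y x * h x))" (is "_ \<longleftrightarrow> ?R")
    unfolding contravariant_form_def using UP
    by (simp add: \<Phi>_add scal gw gy gx cong: ball_cong)
  have inv2: "inv_into UNIV (inv_into UNIV w) = w" if "w \<in> W" for w
    using bij_W[OF that] by (simp add: inv_inv_eq)
  show ?thesis
  proof
    assume "contravariant_form (\<Phi> ` U) B"
    then have R: ?R using lhs by blast
    note R1 = R[THEN conjunct1, rule_format] and R2 = R[THEN conjunct2, THEN conjunct1, rule_format]
      and R3 = R[THEN conjunct2, THEN conjunct2, THEN conjunct1, rule_format]
      and R4 = R[THEN conjunct2, THEN conjunct2, THEN conjunct2, THEN conjunct1, rule_format]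
      and R5 = R[THEN conjunct2, THEN conjunct2, THEN conjunct2, THEN conjunct2, rule_format]
    have h: "herm_form U ?b"
    proof (rule herm_form.intro, goal_cases)
      case 1 show ?case by (rule psubD(2)[OF U])
    next
      case (2 f g) then show ?case by (rule psubD(3)[OF U])
    next
      case (3 f a) then show ?case by (rule psubD(4)[OF U])
    next
      case (4 f g h) then show ?case by (rule R1)
    next
      case (5 f h a) then show ?case by (rule R2)
    next
      case (6 f h) then show ?case by (rule R3)
    qed
    have "?b (\<lambda>x. f (w x)) (\<lambda>x. g (w x)) = ?b f g" if "w \<in> W" "f \<in> U" "g \<in> U" for w f g
      using R4[OF inv_W[OF that(1)] that(2,3)] unfolding inv2[OF that(1)] .
    moreover have "?b (D a f) g = ?b f (\<lambda>x. of_real (x \<bullet> a) * g x)" if "f \<in> U" "g \<in> U" for a f g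
    proof -
      have "DD (a, 0) f = D a f" using linear_0[OF D_linear[OF UP[OF that(1)]]] by (auto simp: DD_def)
      moreover have "(\<lambda>x. T_map (a, 0) x * g x) = (\<lambda>x. of_real (x \<bullet> a) * g x)" by (auto simp: T_map_eq)
      moreover have "?b (DD (a, 0) f) g = ?b f (\<lambda>x. T_map (a, 0) x * g x)" by (rule R5[OF that])
      ultimately show ?thesis by simp
    qed
    ultimately show "cform U ?b" using h unfolding cform_def by blast
  next
    assume c: "cform U ?b"
    interpret h: herm_form U ?b using c unfolding cform_def by blast
    have e1: "?b (\<lambda>x. f (inv_into UNIV w x)) (\<lambda>x. h (inv_into UNIV w x)) = ?b f h" if "w \<in> W" "f \<in> U" "h \<in> U" for w f h
      using c inv_W[OF that(1)] that unfolding cform_def by blast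
    have e2: "?b (DD y f) g = ?b f (\<lambda>x. T_map y x * g x)" if fg: "f \<in> U" "g \<in> U" for y f g
    proof -
      let ?x = "\<lambda>a x. of_real (x \<bullet> a) * g x"
      have DU: "D a f \<in> U" "?x a \<in> U" for a using psubD(7)[OF U fg(1)] psubD(6)[OF U fg(2) linear_xb] by auto
      have adj: "?b (D a f) g = ?b f (?x a)" for a using c fg unfolding cform_def by blast
      have "?b (DD y f) g = ?b (D (fst y) f) g + \<i> * ?b (D (snd y) f) g"
        unfolding DD_def[abs_def] using DU fg by (simp add: h.q_add h.q_scale h.scale_closed)
      also have "\<dots> = ?b f (?x (fst y)) + \<i> * ?b f (?x (snd y))" by (simp add: adj)
      also have "\<dots> = ?b f (\<lambda>x. ?x (fst y) x + (- \<i>) * ?x (snd y) x)"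
        using h.q_add2[OF DU(2)[of "fst y"] h.scale_closed[OF DU(2)[of "snd y"], of "-\<i>"] fg(1)]
          h.q_scale2[OF DU(2)[of "snd y"] fg(1), of "-\<i>"] by simp
      also have "(\<lambda>x. ?x (fst y) x + (- \<i>) * ?x (snd y) x) = (\<lambda>x. T_map y x * g x)"
        by (auto simp: T_map_eq algebra_simps)
      finally show ?thesis .
    qed
    have ?R
    proof (intro conjI ballI allI)
      fix f g h assume "f \<in> U" "g \<in> U" "h \<in> U"
      then show "?b (\<lambda>x. f x + g x) h = ?b f h + ?b g h" by (rule h.q_add)
    next
      fix a f h assume "f \<in> U" "h \<in> U"
      then show "?b (\<lambda>x. a * f x) h = a * ?b f h" by (rule h.q_scale)
    next
      fix f h assume "f \<in> U" "h \<in> U"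
      then show "?b h f = cnj (?b f h)" by (rule h.q_cnj)
    next
      fix w f h assume "w \<in> W" "f \<in> U" "h \<in> U"
      then show "?b (\<lambda>x. f (inv_into UNIV w x)) (\<lambda>x. h (inv_into UNIV w x)) = ?b f h" by (rule e1)
    next
      fix y f h assume "f \<in> U" "h \<in> U"
      then show "?b (DD y f) h = ?b f (\<lambda>x. T_map y x * h x)" by (rule e2)
    qed
    then show "contravariant_form (\<Phi> ` U) B" using lhs by blast
  qed
qed

lemma cformD:
  assumes "cform U b"
  shows "herm_form U b" "w \<in> W \<Longrightarrow> f \<in> U \<Longrightarrow> g \<in> U \<Longrightarrow> b (\<lambda>x. f (w x)) (\<lambda>x. g (w x)) = b f g"
    "f \<in> U \<Longrightarrow> g \<in> U \<Longrightarrow> b (D a f) g = b f (\<lambda>x. of_real (x \<bullet> a) * g x)"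
  using assms unfolding cform_def by blast+

lemma cform_x:
  assumes U: "psub U" and b: "cform U b" and fg: "f \<in> U" "g \<in> U"
  shows "b (\<lambda>x. of_real (x \<bullet> a) * f x) g = b f (D a g)"
proof -
  interpret herm_form U b by (rule cformD(1)[OF b])
  have "(\<lambda>x. of_real (x \<bullet> a) * f x) \<in> U" "D a g \<in> U"
    using psubD(6)[OF U fg(1) linear_xb] psubD(7)[OF U fg(2)] .
  then show ?thesis
    using cformD(3)[OF b fg(2,1), of a] q_cnj[of "\<lambda>x. of_real (x \<bullet> a) * f x" g] q_cnj[OF fg(1), of "D a g"] fg
    by (metis q_cnj complex_cnj_cnj)
qed

text \<open>The operator in Euler's formula is self-adjoint for a contravariant form, and
  \<open>f\<close> and \<open>g\<close> are eigenvectors with different eigenvalues.\<close>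

lemma cform_orthogonal:
  assumes U: "psub U" and b: "cform U b" and f: "f \<in> U" "f \<in> Hom d" and g: "g \<in> U" "g \<in> Hom d'" and d: "d \<noteq> d'"
  shows "b f g = 0"
proof -
  interpret herm_form U b by (rule cformD(1)[OF b])
  let ?E = "\<lambda>f x. (\<Sum>a\<in>Basis. of_real (x \<bullet> a) * D a f x) + of_real c * (\<Sum>s\<in>reflections. f x - f (s x))"
  have DU: "D a f \<in> U" "(\<lambda>x. of_real (x \<bullet> a) * f x) \<in> U" if "f \<in> U" for f a
    using psubD(7)[OF U that] psubD(6)[OF U that linear_xb] .
  have sU: "(\<lambda>x. f (s x)) \<in> U" if "f \<in> U" "s \<in> reflections" for f s
    by (rule psubD(5)[OF U reflections_subset[OF that(2)] that(1)])
  have sb: "b (\<lambda>x. f (s x)) g = b f (\<lambda>x. g (s x))" if "f \<in> U" "g \<in> U" "s \<in> reflections" for f g s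
    using cformD(2)[OF b reflections_subset[OF that(3)] sU[OF that(1,3)] that(2)] reflection_invol[OF that(3)] by simp
  have E1: "b (?E f) g = (\<Sum>a\<in>Basis. b (D a f) (D a g)) + of_real c * (\<Sum>s\<in>reflections. b f g - b f (\<lambda>x. g (s x)))"
  proof -
    have 1: "b (\<lambda>x. of_real (x \<bullet> a) * D a f x) g = b (D a f) (D a g)" for a
      by (rule cform_x[OF U b DU(1)[OF f(1)] g(1)])
    have m1: "(\<lambda>x. \<Sum>a\<in>Basis. of_real (x \<bullet> a) * D a f x) \<in> U" by (intro sum_closed DU f)
    have m2: "(\<lambda>x. \<Sum>s\<in>reflections. f x - f (s x)) \<in> U" by (intro sum_closed diff_closed f(1) sU[OF f(1)])
    have "b (?E f) g = b (\<lambda>x. \<Sum>a\<in>Basis. of_real (x \<bullet> a) * D a f x) g + of_real c * b (\<lambda>x. \<Sum>s\<in>reflections. f x - f (s x)) g"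
      using q_add[OF m1 scale_closed[OF m2] g(1)] q_scale[OF m2 g(1)] by simp
    also have "b (\<lambda>x. \<Sum>a\<in>Basis. of_real (x \<bullet> a) * D a f x) g = (\<Sum>a\<in>Basis. b (D a f) (D a g))"
      using q_sum[of Basis "\<lambda>a x. of_real (x \<bullet> a) * D a f x" g] DU(2)[OF DU(1)[OF f(1)]] g(1) by (simp add: 1)
    also have "b (\<lambda>x. \<Sum>s\<in>reflections. f x - f (s x)) g = (\<Sum>s\<in>reflections. b f g - b f (\<lambda>x. g (s x)))"
      using q_sum[of reflections "\<lambda>s x. f x - f (s x)" g] diff_closed[OF f(1) sU[OF f(1)]] g(1)
      by (simp add: q_diff f(1) sU sb)
    finally show ?thesis .
  qed
  have E2: "b f (?E g) = (\<Sum>a\<in>Basis. b (D a f) (D a g)) + of_real c * (\<Sum>s\<in>reflections. b f g - b f (\<lambda>x. g (s x)))"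
  proof -
    have 1: "b f (\<lambda>x. of_real (x \<bullet> a) * D a g x) = b (D a f) (D a g)" for a
      by (rule cformD(3)[OF b f(1) DU(1)[OF g(1)], symmetric])
    have m1: "(\<lambda>x. \<Sum>a\<in>Basis. of_real (x \<bullet> a) * D a g x) \<in> U" by (intro sum_closed DU g)
    have m2: "(\<lambda>x. \<Sum>s\<in>reflections. g x - g (s x)) \<in> U" by (intro sum_closed diff_closed g(1) sU[OF g(1)])
    have "b f (?E g) = b f (\<lambda>x. \<Sum>a\<in>Basis. of_real (x \<bullet> a) * D a g x) + of_real c * b f (\<lambda>x. \<Sum>s\<in>reflections. g x - g (s x))"
      using q_add2[OF m1 scale_closed[OF m2] f(1)] q_scale2[OF m2 f(1), of "of_real c"] by simp
    also have "b f (\<lambda>x. \<Sum>a\<in>Basis. of_real (x \<bullet> a) * D a g x) = (\<Sum>a\<in>Basis. b (D a f) (D a g))"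
      using q_sum2[of Basis "\<lambda>a x. of_real (x \<bullet> a) * D a g x" f] DU(2)[OF DU(1)[OF g(1)]] f(1) by (simp add: 1)
    also have "b f (\<lambda>x. \<Sum>s\<in>reflections. g x - g (s x)) = (\<Sum>s\<in>reflections. b f g - b f (\<lambda>x. g (s x)))"
    proof -
      have "b f (\<lambda>x. g x - g (s x)) = b f g - b f (\<lambda>x. g (s x))" if "s \<in> reflections" for s
        using q_add2[OF g(1) scale_closed[OF sU[OF g(1) that], of "-1"] f(1)] q_scale2[OF sU[OF g(1) that] f(1), of "-1"]
        by simp
      then show ?thesis
        using q_sum2[of reflections "\<lambda>s x. g x - g (s x)" f] diff_closed[OF g(1) sU[OF g(1)]] f(1) by simp
    qed
    finally show ?thesis .
  qed
  have "?E f = (\<lambda>x. of_nat d * f x)" "?E g = (\<lambda>x. of_nat d' * g x)"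
    using Euler[OF f(2)] Euler[OF g(2)] by auto
  then have "of_nat d * b f g = of_nat d' * b f g"
    using E1 E2 q_scale[OF f(1) g(1), of "of_nat d"] q_scale2[OF g(1) f(1), of "of_nat d'"] by simp
  then show ?thesis using d by simp
qed

end

context rational_cherednik
begin

lemma Hom_psub_herm:
  assumes "psub U" "cform U b"
  shows "herm_form (U \<inter> Hom d) b"
proof -
  interpret herm_form U b by (rule cformD(1)[OF assms(2)])
  show ?thesis
  proof (rule herm_form.intro, goal_cases)
    case 1 show ?case using zero_closed Hom_zero by blast
  next
    case (2 f g) then show ?case using add_closed Hom_add by blast
  next
    case (3 f a) then show ?case using scale_closed Hom_scale by blast
  next
    case (4 f g h) then show ?case by (intro q_add) auto
  next
    case (5 f h a) then show ?case by (intro q_scale) auto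
  next
    case (6 f h) then show ?case by (intro q_cnj) auto
  qed
qed

lemma subspace_Hom_finite:
  assumes "psub U"
  shows "\<exists>S. finite S \<and> S \<subseteq> U \<inter> Hom d \<and> (\<forall>f\<in>U \<inter> Hom d. \<exists>z. f = (\<lambda>x. \<Sum>g\<in>S. z g * g x))"
proof -
  obtain B where B: "B \<subseteq> U \<inter> Hom d" "cfun.independent B" "U \<inter> Hom d \<subseteq> cfun.span B"
      "card B = cfun.dim (U \<inter> Hom d)"
    using cfun.basis_exists[of "U \<inter> Hom d"] by blast
  obtain T where T: "finite T" "Pol_le d \<subseteq> cfun.span T" using Pol_le_finite by blast
  have "Hom d \<subseteq> Pol_le d" unfolding Pol_le_def using cfun.span_superset[of "\<Union>d\<le>d. Hom d"] by (rule order_trans[rotated]) auto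
  then have "B \<subseteq> cfun.span T" using B(1) T(2) by (meson order_trans le_infE)
  then have fin: "finite B" using cfun.independent_span_bound[OF T(1) B(2)] by blast
  have "\<exists>z. f = (\<lambda>x. \<Sum>g\<in>B. z g * g x)" if "f \<in> U \<inter> Hom d" for f
  proof -
    have "f \<in> cfun.span B" using that B(3) by blast
    then obtain z where "f = (\<Sum>g\<in>B. (\<lambda>x. z g * g x))" unfolding cfun.span_finite[OF fin] by (elim rangeE)
    then have "f = (\<lambda>x. \<Sum>g\<in>B. z g * g x)" unfolding sum_fun_eta .
    then show ?thesis by (rule exI[where x = z])
  qed
  then show ?thesis using fin B(1) by (intro exI[of _ B] conjI ballI)
qed

lemma cform_combination:
  assumes "cform U b0" "cform U b1"
  shows "cform U (\<lambda>f g. of_real t * b0 f g - of_real t' * b1 f g)"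
  unfolding cform_def
proof (intro conjI ballI allI)
  show "herm_form U (\<lambda>f g. of_real t * b0 f g - of_real t' * b1 f g)"
    by (intro herm_form_combination cformD(1)[OF assms(1)] cformD(1)[OF assms(2)])
qed (simp_all add: cformD(2,3)[OF assms(1)] cformD(2,3)[OF assms(2)])

lemma xb_combination: "linear (\<xi> :: 'a \<Rightarrow> complex) \<Longrightarrow> (\<lambda>x. \<xi> x * f x) = (\<lambda>x. \<Sum>e\<in>Basis. \<xi> e * (of_real (x \<bullet> e) * f x))"
proof
  fix x :: 'a assume "linear \<xi>"
  then show "\<xi> x * f x = (\<Sum>e\<in>Basis. \<xi> e * (of_real (x \<bullet> e) * f x))"
    unfolding linear_expand[OF \<open>linear \<xi>\<close>, of x] sum_distrib_right
    by (intro sum.cong refl) (simp only: mult_ac)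
qed

text \<open>Each generator of the algebra has an adjoint that preserves \<open>U\<close>, so it maps
  the radical to itself.\<close>

lemma radical_psub:
  assumes U: "psub U" and b: "cform U b"
  shows "psub {f \<in> U. \<forall>g\<in>U. b f g = 0}" (is "psub ?R")
proof -
  interpret herm_form U b by (rule cformD(1)[OF b])
  have UP: "U \<subseteq> Pol" using psubD(1)[OF U] by blast
  have sums: "(\<lambda>x. \<Sum>i\<in>I. h i x) \<in> ?R" if "\<And>i. i \<in> I \<Longrightarrow> h i \<in> ?R" for I :: "'a set" and h
    using that by (auto intro!: sum_closed simp: q_sum)
  have scales: "(\<lambda>x. a * f x) \<in> ?R" if "f \<in> ?R" for a f
    using that by (auto intro!: scale_closed simp: q_scale)
  show ?thesis
    unfolding psub_def
  proof (intro conjI ballI allI impI)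
    show "?R \<subseteq> Pol" using UP by blast
    show "(\<lambda>x. 0) \<in> ?R" using zero_closed q_zero by blast
  next
    fix f g assume "f \<in> ?R" "g \<in> ?R"
    then show "(\<lambda>x. f x + g x) \<in> ?R" by (auto intro: add_closed simp: q_add)
  next
    fix a f assume "f \<in> ?R"
    then show "(\<lambda>x. a * f x) \<in> ?R" by (rule scales)
  next
    fix w f assume w: "w \<in> W" and f: "f \<in> ?R"
    have fw: "(\<lambda>x. f (w x)) \<in> U" using f psubD(5)[OF U w] by blast
    have "b (\<lambda>x. f (w x)) g = 0" if g: "g \<in> U" for g
    proof -
      have g': "(\<lambda>x. g (inv_into UNIV w x)) \<in> U" by (rule psubD(5)[OF U inv_W[OF w] g])
      have "b (\<lambda>x. f (w x)) (\<lambda>x. g (inv_into UNIV w (w x))) = b f (\<lambda>x. g (inv_into UNIV w x))"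
        using cformD(2)[OF b w _ g', of f] f by blast
      then show ?thesis using w f g' by simp
    qed
    then show "(\<lambda>x. f (w x)) \<in> ?R" using fw by blast
  next
    fix \<xi> :: "'a \<Rightarrow> complex" and f assume f: "f \<in> ?R" and \<xi>: "linear \<xi>"
    have "(\<lambda>x. of_real (x \<bullet> e) * f x) \<in> ?R" for e
    proof -
      have fU: "f \<in> U" using f by blast
      have "b (\<lambda>x. of_real (x \<bullet> e) * f x) g = 0" if "g \<in> U" for g
        unfolding cform_x[OF U b fU that] using f psubD(7)[OF U that] by blast
      then show ?thesis using psubD(6)[OF U fU linear_xb] by blast
    qed
    then have "(\<lambda>x. \<Sum>e\<in>Basis. \<xi> e * (of_real (x \<bullet> e) * f x)) \<in> ?R" by (intro sums scales)
    then show "(\<lambda>x. \<xi> x * f x) \<in> ?R" by (subst xb_combination[OF \<xi>, of f])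
  next
    fix a f assume f: "f \<in> ?R"
    then have "f \<in> U" by blast
    moreover have "b (D a f) g = 0" if "g \<in> U" for g
      using cformD(3)[OF b \<open>f \<in> U\<close> that, of a] f psubD(6)[OF U that linear_xb] by simp
    ultimately show "D a f \<in> ?R" using psubD(7)[OF U] by blast
  qed
qed

text \<open>The difference of one form and a suitable multiple of the other
  has a radical meeting the lowest degree component, and the radical is a submodule.\<close>

lemma cform_unique:
  assumes U: "psub U" and min: "\<And>V. nonzero_psub V \<Longrightarrow> U \<subseteq> V"
    and b0: "cform U b0" and b1: "cform U b1"
    and pos0: "\<And>f. f \<in> U \<Longrightarrow> f \<noteq> (\<lambda>x. 0) \<Longrightarrow> Re (b0 f f) > 0"
    and pos1: "\<And>f. f \<in> U \<Longrightarrow> f \<in> Hom d \<Longrightarrow> f \<noteq> (\<lambda>x. 0) \<Longrightarrow> Re (b1 f f) > 0"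
    and v0: "v0 \<in> U" "v0 \<in> Hom d" "v0 \<noteq> (\<lambda>x. 0)"
    and f: "f \<in> U" "f \<noteq> (\<lambda>x. 0)"
  shows "Re (b1 f f) > 0"
proof -
  obtain S where S: "finite S \<and> S \<subseteq> U \<inter> Hom d \<and> (\<forall>f\<in>U \<inter> Hom d. \<exists>z. f = (\<lambda>x. \<Sum>g\<in>S. z g * g x))"
    using subspace_Hom_finite[OF U, of d] by (elim exE)
  have "\<exists>t v. v \<in> U \<inter> Hom d \<and> v \<noteq> (\<lambda>x. 0) \<and> (\<forall>u\<in>U \<inter> Hom d. b1 v u = of_real t * b0 v u)"
  proof (rule common_eigenvector[OF Hom_psub_herm[OF U b0] Hom_psub_herm[OF U b1], where S = S and ?v0.0 = v0])
    show "finite S" by (rule conjunct1[OF S])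
    show "S \<subseteq> U \<inter> Hom d" by (rule conjunct1[OF conjunct2[OF S]])
    show "\<exists>z. f = (\<lambda>x. \<Sum>g\<in>S. z g * g x)" if "f \<in> U \<inter> Hom d" for f
      by (rule bspec[OF conjunct2[OF conjunct2[OF S]] that])
    show "Re (b0 f f) > 0" if "f \<in> U \<inter> Hom d" "f \<noteq> (\<lambda>x. 0)" for f using pos0 that by blast
    show "Re (b1 f f) > 0" if "f \<in> U \<inter> Hom d" "f \<noteq> (\<lambda>x. 0)" for f using pos1 that by blast
    show "v0 \<in> U \<inter> Hom d" "v0 \<noteq> (\<lambda>x. 0)" using v0 by blast+
  qed
  then obtain t v where v: "v \<in> U" "v \<in> Hom d" "v \<noteq> (\<lambda>x. 0)" "\<And>u. u \<in> U \<Longrightarrow> u \<in> Hom d \<Longrightarrow> b1 v u = of_real t * b0 v u"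
    by blast
  define b where "b = (\<lambda>f g. of_real t * b0 f g - of_real 1 * b1 f g)"
  have b: "cform U b" unfolding b_def by (rule cform_combination[OF b0 b1])
  interpret herm_form U b by (rule cformD(1)[OF b])
  \<comment> \<open>The eigenvector relation covers the component of \<open>g\<close> of degree
    \<open>d\<close>; the other components are orthogonal to \<open>v\<close> for every
    contravariant form.\<close>
  have "b v g = 0" if g: "g \<in> U" for g
  proof -
    obtain n F where F: "\<And>d. F d \<in> Hom d" "g = (\<lambda>x. \<Sum>d\<le>n. F d x)"
      using Pol_decompose[OF psubD(1)[OF U g]] by blast
    have FU: "F k \<in> U" if "k \<le> n" for k
      using psub_graded[OF U, of F n k] F g that by blast
    have "b v (F k) = 0" if "k \<le> n" for k
    proof (cases "k = d")
      case True
      then show ?thesis using v(4)[OF FU[OF that]] F(1)[of k] by (simp add: b_def)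
    next
      case False
      then show ?thesis using cform_orthogonal[OF U b v(1,2) FU[OF that] F(1)] by blast
    qed
    then show ?thesis unfolding F(2) using FU v(1) by (subst q_sum2) (auto intro: sum.neutral)
  qed
  then have "v \<in> {f \<in> U. \<forall>g\<in>U. b f g = 0}" using v(1) by blast
  then have "nonzero_psub {f \<in> U. \<forall>g\<in>U. b f g = 0}"
    using radical_psub[OF U b] v(3) unfolding nonzero_psub_def by blast
  \<comment> \<open>The radical is a nonzero submodule, so minimality makes it all of
    \<open>U\<close>.\<close>
  then have "b f f = 0" using min f(1) by blast
  then have "b1 f f = of_real t * b0 f f" by (simp add: b_def)
  moreover have "t > 0"
  proof -
    have "Re (b1 v v) > 0" "Re (b0 v v) > 0" using pos1 pos0 v by blast+
    moreover have "Re (b1 v v) = t * Re (b0 v v)" using v(4)[OF v(1,2)] by simp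
    ultimately show ?thesis by (simp add: zero_less_mult_iff)
  qed
  ultimately show ?thesis using pos0[OF f] by simp
qed

section \<open>Powers of the Dunkl Laplacian and the heat operator\<close>

lemma Lap_zero: "Lap (\<lambda>x. 0) = (\<lambda>x. 0)"
  by (auto simp: Lap_def D_const)

lemma Lap_pow_zero: "(Lap ^^ k) (\<lambda>x. 0) = (\<lambda>x. 0)"
  by (induction k) (auto simp: Lap_zero)

lemma Lap_pow_Pol: "f \<in> Pol \<Longrightarrow> (Lap ^^ k) f \<in> Pol"
  by (induction k) (auto intro: Lap_Pol)

lemma Lap_pow_add: "f \<in> Pol \<Longrightarrow> g \<in> Pol \<Longrightarrow> (Lap ^^ k) (\<lambda>x. f x + g x) = (\<lambda>x. (Lap ^^ k) f x + (Lap ^^ k) g x)"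
  by (induction k) (auto simp: Lap_add Lap_pow_Pol intro!: ext)

lemma Lap_pow_scale: "f \<in> Pol \<Longrightarrow> (Lap ^^ k) (\<lambda>x. a * f x) = (\<lambda>x. a * (Lap ^^ k) f x)"
  by (induction k) (auto simp: Lap_scale Lap_pow_Pol intro!: ext)

lemma Lap_pow_sum: "(\<And>i. i \<in> I \<Longrightarrow> f i \<in> Pol) \<Longrightarrow> (Lap ^^ k) (\<lambda>x. \<Sum>i\<in>I. f i x) = (\<lambda>x. \<Sum>i\<in>I. (Lap ^^ k) (f i) x)"
  by (induction I rule: infinite_finite_induct) (auto simp: Lap_pow_zero Lap_pow_add Pol_sum)

lemma Lap_pow_D: "f \<in> Pol \<Longrightarrow> (Lap ^^ k) (D a f) = D a ((Lap ^^ k) f)"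
proof (induction k)
  case (Suc k)
  then show ?case using Lap_D[OF Lap_pow_Pol[of f k], of a] by auto
qed simp

text \<open>Iterates \<open>Lap_lin\<close>. For \<open>k = 0\<close> the truncated exponent
  \<open>k - 1\<close> is harmless because its factor \<open>2 * k\<close> vanishes.\<close>

lemma Lap_pow_lin:
  assumes f: "f \<in> Pol"
  shows "(Lap ^^ k) (\<lambda>x. of_real (x \<bullet> a) * f x) x = of_real (x \<bullet> a) * (Lap ^^ k) f x + of_nat (2 * k) * D a ((Lap ^^ (k - 1)) f) x"
proof (induction k arbitrary: x)
  case (Suc k)
  have P: "(Lap ^^ j) f \<in> Pol" for j by (rule Lap_pow_Pol[OF f])
  have "(Lap ^^ Suc k) (\<lambda>x. of_real (x \<bullet> a) * f x) x
     = Lap (\<lambda>x. of_real (x \<bullet> a) * (Lap ^^ k) f x + of_nat (2 * k) * D a ((Lap ^^ (k - 1)) f) x) x"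
    using Suc.IH by (auto intro: arg_cong[where f = "\<lambda>g. Lap g x"])
  also have "\<dots> = Lap (\<lambda>x. of_real (x \<bullet> a) * (Lap ^^ k) f x) x + of_nat (2 * k) * Lap (D a ((Lap ^^ (k - 1)) f)) x"
    using Lap_add[OF Pol.lin[OF linear_xb P[of k]] Pol_scale[OF D_Pol[OF P[of "k-1"]]], of a "of_nat (2 * k)" a x]
      Lap_scale[OF D_Pol[OF P[of "k - 1"]], of "of_nat (2 * k)" a x] by simp
  also have "Lap (\<lambda>x. of_real (x \<bullet> a) * (Lap ^^ k) f x) x = of_real (x \<bullet> a) * Lap ((Lap ^^ k) f) x + 2 * D a ((Lap ^^ k) f) x"
    by (rule Lap_lin[OF P])
  also have "of_nat (2 * k) * Lap (D a ((Lap ^^ (k - 1)) f)) x = of_nat (2 * k) * D a ((Lap ^^ k) f) x"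
    using Lap_D[OF P[of "k - 1"], of a x] by (cases k) auto
  finally show ?case by (simp add: algebra_simps)
qed simp

text \<open>\<open>Lap\<close> is the trace of the bilinear form \<open>B\<close> of second Dunkl
  derivatives, and a trace is the same in every orthonormal basis.\<close>

lemma Lap_W:
  assumes w: "w \<in> W" and f: "f \<in> Pol"
  shows "Lap (\<lambda>x. f (w x)) x = Lap f (w x)"
proof -
  have comp: "D b (D b (\<lambda>x. f (w x))) x = D (w b) (D (w b) f) (w x)" for b
  proof -
    have "D b (\<lambda>x. f (w x)) = (\<lambda>x. D (w b) f (w x))" using D_W[OF w f] by auto
    then show ?thesis using D_W[OF w D_Pol[OF f]] by simp
  qed
  define B where "B u v = D u (D v f) (w x)" for u v
  have lin1: "linear (\<lambda>u. B u v)" for v unfolding B_def by (rule D_linear[OF D_Pol[OF f]])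
  have sym: "B u v = B v u" for u v unfolding B_def by (rule D_commute[OF f])
  have exp: "B u v = (\<Sum>e\<in>Basis. \<Sum>e'\<in>Basis. of_real (u \<bullet> e) * of_real (v \<bullet> e') * B e e')" for u v
  proof -
    have 1: "B u v = (\<Sum>e\<in>Basis. of_real (u \<bullet> e) * B e v)" for u v by (rule linear_expand[OF lin1])
    have "B e v = (\<Sum>e'\<in>Basis. of_real (v \<bullet> e') * B e e')" for e
      using 1[of v e] by (simp add: sym[of e])
    then show ?thesis using 1[of u v] by (simp add: sum_distrib_left mult.assoc)
  qed
  have adj: "w b \<bullet> e = b \<bullet> inv_into UNIV w e" for b e
    using inner_W[OF w, of b "inv_into UNIV w e"] w by simp
  have orth: "(\<Sum>b\<in>Basis. (w b \<bullet> e) * (w b \<bullet> e')) = e \<bullet> e'" for e e'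
  proof -
    have "(\<Sum>b\<in>Basis. (w b \<bullet> e) * (w b \<bullet> e')) = inv_into UNIV w e \<bullet> inv_into UNIV w e'"
      unfolding adj by (subst (3) euclidean_inner) (simp add: inner_commute)
    also have "\<dots> = e \<bullet> e'" by (rule inner_W[OF inv_W[OF w]])
    finally show ?thesis .
  qed
  have "Lap (\<lambda>x. f (w x)) x = (\<Sum>b\<in>Basis. B (w b) (w b))"
    unfolding Lap_def comp B_def ..
  also have "\<dots> = (\<Sum>b\<in>Basis. \<Sum>e\<in>Basis. \<Sum>e'\<in>Basis. of_real (w b \<bullet> e) * of_real (w b \<bullet> e') * B e e')"
    by (intro sum.cong refl exp)
  also have "\<dots> = (\<Sum>e\<in>Basis. \<Sum>b\<in>Basis. \<Sum>e'\<in>Basis. of_real (w b \<bullet> e) * of_real (w b \<bullet> e') * B e e')"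
    by (rule sum.swap)
  also have "\<dots> = (\<Sum>e\<in>Basis. \<Sum>e'\<in>Basis. of_real (e \<bullet> e') * B e e')"
  proof (rule sum.cong[OF refl])
    fix e :: 'a
    have "(\<Sum>b\<in>Basis. \<Sum>e'\<in>Basis. of_real (w b \<bullet> e) * of_real (w b \<bullet> e') * B e e')
        = (\<Sum>e'\<in>Basis. \<Sum>b\<in>Basis. of_real (w b \<bullet> e) * of_real (w b \<bullet> e') * B e e')" by (rule sum.swap)
    also have "\<dots> = (\<Sum>e'\<in>Basis. of_real (\<Sum>b\<in>Basis. (w b \<bullet> e) * (w b \<bullet> e')) * B e e')"
      by (simp add: sum_distrib_right)
    finally show "(\<Sum>b\<in>Basis. \<Sum>e'\<in>Basis. of_real (w b \<bullet> e) * of_real (w b \<bullet> e') * B e e')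
        = (\<Sum>e'\<in>Basis. of_real (e \<bullet> e') * B e e')" by (simp only: orth)
  qed
  also have "\<dots> = (\<Sum>e\<in>Basis. B e e)"
  proof (rule sum.cong[OF refl])
    fix e :: 'a assume e: "e \<in> Basis"
    have "(\<Sum>e'\<in>Basis. of_real (e \<bullet> e') * B e e') = (\<Sum>e'\<in>Basis. if e' = e then B e e' else 0)"
      using e by (intro sum.cong refl) (auto simp: inner_Basis)
    then show "(\<Sum>e'\<in>Basis. of_real (e \<bullet> e') * B e e') = B e e" using e by (simp add: sum.delta)
  qed
  also have "\<dots> = Lap f (w x)" by (simp add: Lap_def B_def)
  finally show ?thesis .
qed

lemma Lap_pow_W:
  assumes "w \<in> W" "f \<in> Pol"
  shows "(Lap ^^ k) (\<lambda>x. f (w x)) = (\<lambda>x. (Lap ^^ k) f (w x))"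
proof (induction k)
  case (Suc k)
  then show ?case using Lap_W[OF assms(1) Lap_pow_Pol[OF assms(2)], of k] by auto
qed simp

lemma Lap_nilpotent_Hom: "f \<in> Hom d \<Longrightarrow> d < k \<Longrightarrow> (Lap ^^ k) f = (\<lambda>x. 0)"
proof (induction k arbitrary: d f)
  case (Suc k)
  have L: "Lap f \<in> Hom (d - 1 - 1)"
    unfolding Lap_def[abs_def] by (intro Hom_sum D_Hom Suc.prems)
  show ?case
  proof (cases d)
    case 0
    then have "D b f = (\<lambda>x. 0)" for b using D_Hom0 Suc.prems by blast
    then have "Lap f = (\<lambda>x. 0)" by (auto simp: Lap_def D_const)
    then show ?thesis using Lap_pow_zero[of k] by (simp only: funpow_Suc_right o_apply)
  next
    case (Suc e)
    then have "(Lap ^^ k) (Lap f) = (\<lambda>x. 0)" using Suc.IH[OF L] Suc.prems by auto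
    then show ?thesis by (simp only: funpow_Suc_right o_apply)
  qed
qed simp

lemma Lap_nilpotent: "f \<in> Pol \<Longrightarrow> \<exists>n. \<forall>k\<ge>n. (Lap ^^ k) f = (\<lambda>x. 0)"
proof -
  assume "f \<in> Pol"
  then obtain n F where F: "\<forall>d. F d \<in> Hom d" "f = (\<lambda>x. \<Sum>d\<le>n. F d x)" using Pol_decompose by blast
  have "(Lap ^^ k) f = (\<lambda>x. 0)" if k: "k \<ge> Suc n" for k
  proof -
    have "(Lap ^^ k) (F d) = (\<lambda>x. 0)" if "d \<le> n" for d
      using Lap_nilpotent_Hom[of "F d" d k] F(1) that k by simp
    then show ?thesis unfolding F(2) using F(1) Hom_Pol by (subst Lap_pow_sum) (auto intro!: ext sum.neutral)
  qed
  then show ?thesis by blast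
qed

text \<open>The operator \<open>exp (- Lap / 2)\<close>, which turns the Gaussian form into a contravariant one.\<close>

definition heat_coeff :: "nat \<Rightarrow> complex" where
  "heat_coeff k = (- 1 / 2) ^ k / fact k"

definition heat :: "('a \<Rightarrow> complex) \<Rightarrow> 'a \<Rightarrow> complex" where
  "heat f x = suminf (\<lambda>k. heat_coeff k * (Lap ^^ k) f x)"

lemma heat_coeff_Suc: "heat_coeff (Suc k) * of_nat (2 * Suc k) = - heat_coeff k"
  unfolding heat_coeff_def power_Suc fact_Suc of_nat_mult by (simp add: field_simps del: of_nat_Suc)

lemma heat_finite:
  assumes "\<forall>k\<ge>n. (Lap ^^ k) f = (\<lambda>x. 0)"
  shows "heat f = (\<lambda>x. \<Sum>k<n. heat_coeff k * (Lap ^^ k) f x)"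
  unfolding heat_def[abs_def] using assms by (intro ext suminf_finite) (auto simp: not_less)

lemma heat_in:
  assumes U: "psub U" and f: "f \<in> U"
  shows "heat f \<in> U"
proof -
  obtain n where n: "\<forall>k\<ge>n. (Lap ^^ k) f = (\<lambda>x. 0)" using Lap_nilpotent[OF psubD(1)[OF U f]] by blast
  have "(Lap ^^ k) f \<in> U" for k
  proof (induction k)
    case (Suc k)
    then show ?case unfolding funpow.simps o_apply Lap_def[abs_def] by (intro psub_sum[OF U] psubD(7)[OF U])
  qed (simp add: f)
  then show ?thesis unfolding heat_finite[OF n] by (intro psub_sum[OF U] psubD(4)[OF U])
qed

lemma heat_common:
  assumes "f \<in> Pol" "g \<in> Pol"
  obtains n where "\<forall>k\<ge>n. (Lap ^^ k) f = (\<lambda>x. 0)" "\<forall>k\<ge>n. (Lap ^^ k) g = (\<lambda>x. 0)"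
proof -
  obtain n m where "\<forall>k\<ge>n. (Lap ^^ k) f = (\<lambda>x. 0)" "\<forall>k\<ge>m. (Lap ^^ k) g = (\<lambda>x. 0)"
    using Lap_nilpotent assms by metis
  then show ?thesis using that[of "max n m"] by simp
qed

lemma heat_add: "f \<in> Pol \<Longrightarrow> g \<in> Pol \<Longrightarrow> heat (\<lambda>x. f x + g x) = (\<lambda>x. heat f x + heat g x)"
proof -
  assume fg: "f \<in> Pol" "g \<in> Pol"
  obtain n where n: "\<forall>k\<ge>n. (Lap ^^ k) f = (\<lambda>x. 0)" "\<forall>k\<ge>n. (Lap ^^ k) g = (\<lambda>x. 0)" by (rule heat_common[OF fg])
  then have "\<forall>k\<ge>n. (Lap ^^ k) (\<lambda>x. f x + g x) = (\<lambda>x. 0)" using fg by (simp add: Lap_pow_add)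
  from heat_finite[OF this] heat_finite[OF n(1)] heat_finite[OF n(2)] fg
  show ?thesis by (simp add: Lap_pow_add sum.distrib algebra_simps)
qed

lemma heat_scale: "f \<in> Pol \<Longrightarrow> heat (\<lambda>x. a * f x) = (\<lambda>x. a * heat f x)"
proof -
  assume f: "f \<in> Pol"
  obtain n where n: "\<forall>k\<ge>n. (Lap ^^ k) f = (\<lambda>x. 0)" using Lap_nilpotent[OF f] by blast
  then have "\<forall>k\<ge>n. (Lap ^^ k) (\<lambda>x. a * f x) = (\<lambda>x. 0)" using f by (simp add: Lap_pow_scale)
  from heat_finite[OF this] heat_finite[OF n] f
  show ?thesis by (simp add: Lap_pow_scale sum_distrib_left algebra_simps)
qed

lemma heat_W: "f \<in> Pol \<Longrightarrow> w \<in> W \<Longrightarrow> heat (\<lambda>x. f (w x)) = (\<lambda>x. heat f (w x))"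
  unfolding heat_def[abs_def] by (simp add: Lap_pow_W)

lemma heat_D: "f \<in> Pol \<Longrightarrow> heat (D a f) = D a (heat f)"
proof -
  assume f: "f \<in> Pol"
  obtain n where n: "\<forall>k\<ge>n. (Lap ^^ k) f = (\<lambda>x. 0)" using Lap_nilpotent[OF f] by blast
  then have "\<forall>k\<ge>n. (Lap ^^ k) (D a f) = (\<lambda>x. 0)" using f by (simp add: Lap_pow_D D_const)
  from heat_finite[OF this] heat_finite[OF n] f
  show ?thesis by (auto simp: Lap_pow_D D_sum D_scale Pol_scale Lap_pow_Pol)
qed

text \<open>Moving a coordinate through \<open>exp (- Lap / 2)\<close> produces minus half of the
  commutator \<open>2 * D a\<close>. So the coordinate becomes itself minus \<open>D a\<close>,
  which is the adjoint of \<open>D a\<close> for a Gaussian form.\<close>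

lemma heat_x:
  assumes f: "f \<in> Pol"
  shows "heat (\<lambda>x. of_real (x \<bullet> a) * f x) = (\<lambda>x. of_real (x \<bullet> a) * heat f x - D a (heat f) x)"
proof
  fix x
  obtain n where n: "\<forall>k\<ge>n. (Lap ^^ k) f = (\<lambda>x. 0)" using Lap_nilpotent[OF f] by blast
  have "(Lap ^^ k) (\<lambda>x. of_real (x \<bullet> a) * f x) = (\<lambda>x. 0)" if "k \<ge> Suc n" for k
    using Lap_pow_lin[OF f, of k a] n that by (auto simp: D_const)
  then have "heat (\<lambda>x. of_real (x \<bullet> a) * f x) x = (\<Sum>k<Suc n. heat_coeff k * (Lap ^^ k) (\<lambda>x. of_real (x \<bullet> a) * f x) x)"
    using heat_finite[of "Suc n"] by simp
  also have "\<dots> = (\<Sum>k<Suc n. heat_coeff k * (of_real (x \<bullet> a) * (Lap ^^ k) f x))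
      + (\<Sum>k<Suc n. heat_coeff k * (of_nat (2 * k) * D a ((Lap ^^ (k - 1)) f) x))"
    unfolding Lap_pow_lin[OF f] by (simp only: distrib_left sum.distrib)
  also have "(\<Sum>k<Suc n. heat_coeff k * (of_real (x \<bullet> a) * (Lap ^^ k) f x)) = of_real (x \<bullet> a) * heat f x"
    using n heat_finite[OF n] by (simp add: sum_distrib_left mult.left_commute)
  also have "(\<Sum>k<Suc n. heat_coeff k * (of_nat (2 * k) * D a ((Lap ^^ (k - 1)) f) x))
      = (\<Sum>k<n. - (heat_coeff k * D a ((Lap ^^ k) f) x))"
    unfolding sum.lessThan_Suc_shift
    by (auto intro!: sum.cong simp only: heat_coeff_Suc mult.assoc[symmetric] mult_minus_left diff_Suc_1)
      simp
  also have "\<dots> = - D a (heat f) x"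
    using heat_finite[OF n] f by (simp add: D_sum D_scale Pol_scale Lap_pow_Pol sum_negf)
  finally show "heat (\<lambda>x. of_real (x \<bullet> a) * f x) x = of_real (x \<bullet> a) * heat f x - D a (heat f) x" by simp
qed

text \<open>If \<open>m\<close> is the last exponent for which \<open>(Lap ^^ m) f\<close> is
  nonzero, then \<open>Lap ^^ m\<close> retains only the zeroth term of the heat series.\<close>

lemma heat_nonzero:
  assumes f: "f \<in> Pol" "f \<noteq> (\<lambda>x. 0)"
  shows "heat f \<noteq> (\<lambda>x. 0)"
proof
  assume h: "heat f = (\<lambda>x. 0)"
  define n where "n = (LEAST n. (Lap ^^ n) f = (\<lambda>x. 0))"
  have ex: "\<exists>n. (Lap ^^ n) f = (\<lambda>x. 0)" using Lap_nilpotent[OF f(1)] by blast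
  have n0: "(Lap ^^ n) f = (\<lambda>x. 0)" unfolding n_def by (rule LeastI_ex[OF ex])
  have n: "\<forall>k\<ge>n. (Lap ^^ k) f = (\<lambda>x. 0)"
  proof (intro allI impI)
    fix k assume "n \<le> k"
    then have "(Lap ^^ k) f = (Lap ^^ (k - n)) ((Lap ^^ n) f)"
      by (metis add.commute comp_apply funpow_add le_add_diff_inverse)
    then show "(Lap ^^ k) f = (\<lambda>x. 0)" using n0 Lap_pow_zero by simp
  qed
  have "n \<noteq> 0"
  proof
    assume "n = 0"
    then show False using n0 f(2) by simp
  qed
  then obtain m where m: "n = Suc m" by (cases n) auto
  have mne: "(Lap ^^ m) f \<noteq> (\<lambda>x. 0)"
  proof
    assume "(Lap ^^ m) f = (\<lambda>x. 0)"
    then have "n \<le> m" unfolding n_def by (rule Least_le)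
    then show False using m by simp
  qed
  have "(Lap ^^ m) (heat f) = (\<lambda>x. \<Sum>k<n. heat_coeff k * (Lap ^^ (m + k)) f x)"
    unfolding heat_finite[OF n] using f(1)
    by (subst Lap_pow_sum) (auto simp: Pol_scale Lap_pow_Pol Lap_pow_scale funpow_add)
  also have "\<dots> = (\<lambda>x. (Lap ^^ m) f x)"
  proof
    fix x
    have "(\<Sum>k<n. heat_coeff k * (Lap ^^ (m + k)) f x) = (\<Sum>k\<in>{0}. heat_coeff k * (Lap ^^ (m + k)) f x)"
      using n m by (intro sum.mono_neutral_right) auto
    then show "(\<Sum>k<n. heat_coeff k * (Lap ^^ (m + k)) f x) = (Lap ^^ m) f x" by (simp add: heat_coeff_def)
  qed
  finally show False using h mne Lap_pow_zero by simp
qed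

text \<open>The properties of the L2 product on which unitarity depends. The third says that the
  adjoint of \<open>D a\<close> is the coordinate minus \<open>D a\<close>. They are isolated here
  so that the algebra is independent of the integral.\<close>

definition gauss_form :: "('a \<Rightarrow> complex) set \<Rightarrow> (('a \<Rightarrow> complex) \<Rightarrow> ('a \<Rightarrow> complex) \<Rightarrow> complex) \<Rightarrow> bool" where
  "gauss_form U \<gamma> \<longleftrightarrow> herm_form U \<gamma> \<and> (\<forall>w\<in>W. \<forall>f\<in>U. \<forall>g\<in>U. \<gamma> (\<lambda>x. f (w x)) (\<lambda>x. g (w x)) = \<gamma> f g)
    \<and> (\<forall>a. \<forall>f\<in>U. \<forall>g\<in>U. \<gamma> (D a f) g + \<gamma> f (D a g) = \<gamma> f (\<lambda>x. of_real (x \<bullet> a) * g x))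
    \<and> (\<forall>f\<in>U. f \<noteq> (\<lambda>x. 0) \<longrightarrow> Re (\<gamma> f f) > 0)"

text \<open>The heat operator commutes with \<open>D a\<close> and turns the coordinate into the
  coordinate minus \<open>D a\<close>, so it converts the Gaussian adjointness into the
  contravariant one. Positivity is inherited because the heat operator is injective.\<close>

lemma gauss_cform:
  assumes U: "psub U" and g: "gauss_form U \<gamma>"
  shows "cform U (\<lambda>f h. \<gamma> (heat f) (heat h))"
    and "\<And>f. f \<in> U \<Longrightarrow> f \<noteq> (\<lambda>x. 0) \<Longrightarrow> Re (\<gamma> (heat f) (heat f)) > 0"
proof -
  interpret herm_form U \<gamma> using g unfolding gauss_form_def by blast
  have W: "\<gamma> (\<lambda>x. f (w x)) (\<lambda>x. h (w x)) = \<gamma> f h" if "w \<in> W" "f \<in> U" "h \<in> U" for w f h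
    using g that unfolding gauss_form_def by blast
  have adj: "\<gamma> (D a f) h + \<gamma> f (D a h) = \<gamma> f (\<lambda>x. of_real (x \<bullet> a) * h x)" if "f \<in> U" "h \<in> U" for a f h
    using g that unfolding gauss_form_def by blast
  have UP: "f \<in> U \<Longrightarrow> f \<in> Pol" for f by (rule psubD(1)[OF U])
  note hU = heat_in[OF U]
  show "cform U (\<lambda>f h. \<gamma> (heat f) (heat h))"
    unfolding cform_def
  proof (intro conjI ballI allI)
    show "herm_form U (\<lambda>f h. \<gamma> (heat f) (heat h))"
      by unfold_locales (auto simp: zero_closed add_closed scale_closed heat_add heat_scale UP q_add q_scale hU intro: q_cnj)
  next
    fix w f h assume "w \<in> W" "f \<in> U" "h \<in> U"
    then show "\<gamma> (heat (\<lambda>x. f (w x))) (heat (\<lambda>x. h (w x))) = \<gamma> (heat f) (heat h)"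
      using W[of w "heat f" "heat h"] by (simp add: heat_W UP hU)
  next
    fix a f h assume f: "f \<in> U" and h: "h \<in> U"
    have xU: "(\<lambda>x. of_real (x \<bullet> a) * heat h x) \<in> U" by (rule psubD(6)[OF U hU[OF h] linear_xb])
    have DU: "D a (heat h) \<in> U" by (rule psubD(7)[OF U hU[OF h]])
    have "\<gamma> (heat f) (heat (\<lambda>x. of_real (x \<bullet> a) * h x))
      = \<gamma> (heat f) (\<lambda>x. of_real (x \<bullet> a) * heat h x + (- 1) * D a (heat h) x)"
      by (simp add: heat_x[OF UP[OF h]])
    also have "\<dots> = \<gamma> (heat f) (\<lambda>x. of_real (x \<bullet> a) * heat h x) - \<gamma> (heat f) (D a (heat h))"
      using q_add2[OF xU scale_closed[OF DU, of "-1"] hU[OF f]] q_scale2[OF DU hU[OF f], of "-1"] by simp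
    also have "\<dots> = \<gamma> (D a (heat f)) (heat h)"
      using adj[OF hU[OF f] hU[OF h], of a] by (simp add: algebra_simps)
    finally show "\<gamma> (heat (D a f)) (heat h) = \<gamma> (heat f) (heat (\<lambda>x. of_real (x \<bullet> a) * h x))"
      by (simp add: heat_D[OF UP[OF f]])
  qed
  show "Re (\<gamma> (heat f) (heat f)) > 0" if "f \<in> U" "f \<noteq> (\<lambda>x. 0)" for f
    using g hU[OF that(1)] heat_nonzero[OF UP[OF that(1)] that(2)] unfolding gauss_form_def by blast
qed

text \<open>Unitarity asks both for a form positive in lowest degree and for positivity of every
  such form. The Gaussian form twisted by the heat operator provides the first, and
  \<open>cform_unique\<close> compares any other form with it.\<close>

theorem unitary_of_gauss_form:
  assumes c: "c \<ge> 0" and \<gamma>: "gauss_form min_psub \<gamma>"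
  shows "unitary N_min"
proof -
  let ?U = min_psub
  have U: "psub ?U" and nz: "nonzero_psub ?U" using nonzero_min_psub[OF c] by (auto simp: nonzero_psub_def)
  have UP: "f \<in> ?U \<Longrightarrow> f \<in> Pol" for f by (rule psubD(1)[OF U])
  have N: "N_min = \<Phi> ` ?U" by (rule N_min_eq[OF c])
  define b where "b = (\<lambda>f h. \<gamma> (heat f) (heat h))"
  have b: "cform ?U b" "\<And>f. f \<in> ?U \<Longrightarrow> f \<noteq> (\<lambda>x. 0) \<Longrightarrow> Re (b f f) > 0"
    using gauss_cform[OF U \<gamma>] by (simp_all add: b_def)
  have nz_iff: "\<Phi> f \<noteq> mzero \<longleftrightarrow> f \<noteq> (\<lambda>x. 0)" if "f \<in> Pol" for f
    using \<Phi>_inject[OF that Pol.const[of 0]] by (simp add: \<Phi>_zero)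
  define d where "d = (LEAST d. \<exists>g\<in>?U \<inter> Hom d. g \<noteq> (\<lambda>x. 0))"
  obtain v0 where v0: "v0 \<in> ?U" "v0 \<in> Hom d" "v0 \<noteq> (\<lambda>x. 0)"
    using LeastI_ex[OF psub_Hom_nonzero[OF U]] nz unfolding d_def nonzero_psub_def by blast
  have int: "\<Phi> ` ?U \<inter> \<Phi> ` Hom k = \<Phi> ` (?U \<inter> Hom k)" for k
  proof
    show "\<Phi> ` ?U \<inter> \<Phi> ` Hom k \<subseteq> \<Phi> ` (?U \<inter> Hom k)"
    proof
      fix m assume "m \<in> \<Phi> ` ?U \<inter> \<Phi> ` Hom k"
      then obtain f g where fg: "f \<in> ?U" "m = \<Phi> f" "g \<in> Hom k" "m = \<Phi> g" by blast
      then have "f = g" using \<Phi>_inject[OF UP Hom_Pol] by metis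
      then show "m \<in> \<Phi> ` (?U \<inter> Hom k)" using fg by blast
    qed
  qed blast
  have "(N_min \<inter> degree_part k \<noteq> {mzero}) \<longleftrightarrow> (\<exists>g\<in>?U \<inter> Hom k. g \<noteq> (\<lambda>x. 0))" for k
  proof -
    have "mzero \<in> \<Phi> ` (?U \<inter> Hom k)" using psubD(2)[OF U] Hom_zero \<Phi>_zero by blast
    then have "\<Phi> ` (?U \<inter> Hom k) \<noteq> {mzero} \<longleftrightarrow> (\<exists>g\<in>?U \<inter> Hom k. \<Phi> g \<noteq> mzero)" by blast
    also have "\<dots> \<longleftrightarrow> (\<exists>g\<in>?U \<inter> Hom k. g \<noteq> (\<lambda>x. 0))"
      using nz_iff[OF UP] by (intro bex_cong refl) auto
    finally show ?thesis unfolding N degree_part_eq int .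
  qed
  then have "(LEAST k. N_min \<inter> degree_part k \<noteq> {mzero}) = d" unfolding d_def by simp
  then have low: "lowest_part N_min = \<Phi> ` (?U \<inter> Hom d)"
    unfolding lowest_part_def by (simp only: N degree_part_eq int)
  have posN: "positive_definite_on (\<Phi> ` V) B \<longleftrightarrow> (\<forall>f\<in>V. f \<noteq> (\<lambda>x. 0) \<longrightarrow> Re (B (\<Phi> f) (\<Phi> f)) > 0)" if "V \<subseteq> ?U" for V B
  proof -
    have "positive_definite_on (\<Phi> ` V) B \<longleftrightarrow> (\<forall>f\<in>V. \<Phi> f \<noteq> mzero \<longrightarrow> Re (B (\<Phi> f) (\<Phi> f)) > 0)"
      unfolding positive_definite_on_def by simp
    also have "\<dots> \<longleftrightarrow> (\<forall>f\<in>V. f \<noteq> (\<lambda>x. 0) \<longrightarrow> Re (B (\<Phi> f) (\<Phi> f)) > 0)"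
      by (intro ball_cong refl) (simp add: nz_iff[OF UP] subsetD[OF that])
    finally show ?thesis .
  qed
  show ?thesis
    unfolding unitary_def
  proof (intro conjI allI impI)
    \<comment> \<open>\<open>\<Phi>\<close> is injective on \<open>min_psub\<close>, so the form on
      polynomials is carried over to cosets; its values off \<open>N_min\<close> do not
      matter.\<close>
    define \<Psi> where "\<Psi> = inv_into ?U \<Phi>"
    define B where "B m k = b (\<Psi> m) (\<Psi> k)" for m k
    have "inj_on \<Phi> ?U" using \<Phi>_inject UP by (auto simp: inj_on_def)
    then have \<Psi>: "\<Psi> (\<Phi> f) = f" if "f \<in> ?U" for f using that by (simp add: \<Psi>_def)
    have "cform ?U (\<lambda>f g. B (\<Phi> f) (\<Phi> g))"
    proof -
      interpret herm_form ?U b by (rule cformD(1)[OF b(1)])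
      have DU: "D a f \<in> ?U" "(\<lambda>x. of_real (x \<bullet> a) * f x) \<in> ?U" if "f \<in> ?U" for a f
        using psubD(7)[OF U that] psubD(6)[OF U that linear_xb] .
      have WU: "(\<lambda>x. f (w x)) \<in> ?U" if "f \<in> ?U" "w \<in> W" for f w by (rule psubD(5)[OF U that(2,1)])
      have h: "herm_form ?U (\<lambda>f g. B (\<Phi> f) (\<Phi> g))"
        by unfold_locales (auto simp: B_def \<Psi> zero_closed add_closed scale_closed q_add q_scale intro: q_cnj)
      show ?thesis unfolding cform_def
      proof (intro conjI ballI allI)
        fix w f g assume "w \<in> W" "f \<in> ?U" "g \<in> ?U"
        then show "B (\<Phi> (\<lambda>x. f (w x))) (\<Phi> (\<lambda>x. g (w x))) = B (\<Phi> f) (\<Phi> g)"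
          using cformD(2)[OF b(1), of w f g] WU[of f w] WU[of g w] by (simp add: B_def \<Psi>)
      next
        fix a f g assume "f \<in> ?U" "g \<in> ?U"
        then show "B (\<Phi> (D a f)) (\<Phi> g) = B (\<Phi> f) (\<Phi> (\<lambda>x. of_real (x \<bullet> a) * g x))"
          using cformD(3)[OF b(1), of f g a] by (simp add: B_def \<Psi> DU)
      qed (rule h)
    qed
    then have "contravariant_form N_min B" unfolding N contravariant_form_cform[OF U] .
    moreover have "positive_definite_on (lowest_part N_min) B"
      unfolding low using b(2) by (subst posN) (auto simp: B_def \<Psi>)
    ultimately show "\<exists>B. contravariant_form N_min B \<and> positive_definite_on (lowest_part N_min) B" by blast
  next
    fix B assume B: "contravariant_form N_min B \<and> positive_definite_on (lowest_part N_min) B"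
    then have b1: "cform ?U (\<lambda>f g. B (\<Phi> f) (\<Phi> g))" unfolding N contravariant_form_cform[OF U] by blast
    have pos1: "Re (B (\<Phi> f) (\<Phi> f)) > 0" if "f \<in> ?U" "f \<in> Hom d" "f \<noteq> (\<lambda>x. 0)" for f
    proof -
      have "\<forall>f\<in>?U \<inter> Hom d. f \<noteq> (\<lambda>x. 0) \<longrightarrow> Re (B (\<Phi> f) (\<Phi> f)) > 0"
        using B unfolding low by (subst (asm) posN) auto
      then show ?thesis using that by blast
    qed
    have "Re (B (\<Phi> f) (\<Phi> f)) > 0" if "f \<in> ?U" "f \<noteq> (\<lambda>x. 0)" for f
      by (rule cform_unique[OF U min_psub_least b(1) b1 b(2) pos1 v0 that])
    then show "positive_definite_on N_min B" unfolding N by (subst posN) auto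
  qed
qed

end

section \<open>Integration\<close>

lemma linear_borel_measurable:
  fixes T :: "'a::euclidean_space \<Rightarrow> 'b::real_normed_vector"
  shows "linear T \<Longrightarrow> T \<in> borel_measurable borel"
  by (intro borel_measurable_continuous_onI linear_continuous_on) (simp add: linear_conv_bounded_linear)

lemma nn_integral_lborel_shift:
  fixes c :: "'a::euclidean_space"
  assumes "f \<in> borel_measurable borel"
  shows "(\<integral>\<^sup>+x. f (c + x) \<partial>lborel) = (\<integral>\<^sup>+x. f x \<partial>lborel)"
proof -
  have "(\<integral>\<^sup>+x. f x \<partial>distr lborel borel ((+) c)) = (\<integral>\<^sup>+x. f (c + x) \<partial>lborel)"
    using assms by (intro nn_integral_distr) auto
  then show ?thesis by (simp add: lborel_distr_plus)
qed

lemma nn_integral_lborel_reflect: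
  fixes c :: "'a::euclidean_space"
  assumes "f \<in> borel_measurable borel"
  shows "(\<integral>\<^sup>+x. f (c - x) \<partial>lborel) = (\<integral>\<^sup>+x. f x \<partial>lborel)"
proof -
  have "lborel = density (distr lborel borel (\<lambda>x::'a. c + (- 1) *\<^sub>R x)) (\<lambda>_. ennreal (\<bar>- 1 :: real\<bar> ^ DIM('a)))"
    by (rule lborel_affine) simp
  then have "(lborel :: 'a measure) = distr lborel borel (\<lambda>x. c - x)" by (simp add: density_1)
  then have "(\<integral>\<^sup>+x. f x \<partial>lborel) = (\<integral>\<^sup>+x. f x \<partial>distr lborel borel (\<lambda>x. c - x))" by simp
  also have "\<dots> = (\<integral>\<^sup>+x. f (c - x) \<partial>lborel)" using assms by (intro nn_integral_distr) auto
  finally show ?thesis ..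
qed

text \<open>Change of variables with the Jacobian expressed by the volume of the preimage of the
  unit ball \<open>A\<close>. Integrating \<open>indicator A x * F (x + T z)\<close> over
  \<open>x\<close> and \<open>z\<close> in both orders gives the two sides, by translation and
  reflection invariance.\<close>

lemma nn_integral_linear_bij:
  fixes T :: "'a::euclidean_space \<Rightarrow> 'a" and F :: "'a \<Rightarrow> ennreal"
  assumes T: "linear T" "bij T" and F [measurable]: "F \<in> borel_measurable borel"
  shows "emeasure lborel (ball (0::'a) 1) * (\<integral>\<^sup>+x. F (T x) \<partial>lborel)
    = emeasure lborel (T -` ball 0 1) * (\<integral>\<^sup>+x. F x \<partial>lborel)"
proof -
  define A where "A = ball (0::'a) 1"
  have [measurable]: "A \<in> sets borel" by (simp add: A_def)
  let ?I = "\<lambda>x. indicator A x :: ennreal"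
  have [measurable]: "T \<in> borel_measurable borel" by (rule linear_borel_measurable[OF T(1)])
  have meas: "(\<lambda>z. ?I (T z)) \<in> borel_measurable borel" by measurable
  have 1: "(\<integral>\<^sup>+z. F (x + T z) \<partial>lborel) = (\<integral>\<^sup>+z. F (T z) \<partial>lborel)" for x
  proof -
    \<comment> \<open>Surjectivity turns a translation after \<open>T\<close> into a translation
      before it.\<close>
    obtain y where y: "x = T y" using T(2) by (meson bij_pointE)
    have "(\<lambda>z. F (T z)) \<in> borel_measurable borel" by measurable
    from nn_integral_lborel_shift[OF this, of y] show ?thesis unfolding y by (simp add: linear_add[OF T(1)])
  qed
  have 2: "(\<integral>\<^sup>+z. ?I (x - T z) \<partial>lborel) = (\<integral>\<^sup>+z. ?I (T z) \<partial>lborel)" for x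
  proof -
    obtain y where y: "x = T y" using T(2) by (meson bij_pointE)
    from nn_integral_lborel_reflect[OF meas, of y] show ?thesis unfolding y by (simp add: linear_diff[OF T(1)])
  qed
  have [measurable]: "(\<lambda>p::'a \<times> 'a. F (fst p + T (snd p))) \<in> borel_measurable (lborel \<Otimes>\<^sub>M lborel)"
    "(\<lambda>p::'a \<times> 'a. ?I (fst p - T (snd p))) \<in> borel_measurable (lborel \<Otimes>\<^sub>M lborel)"
    by measurable
  have "emeasure lborel A * (\<integral>\<^sup>+z. F (T z) \<partial>lborel) = (\<integral>\<^sup>+x. \<integral>\<^sup>+z. ?I x * F (x + T z) \<partial>lborel \<partial>lborel)"
    by (simp add: nn_integral_cmult 1 nn_integral_multc)
  also have "\<dots> = (\<integral>\<^sup>+z. \<integral>\<^sup>+x. ?I x * F (x + T z) \<partial>lborel \<partial>lborel)"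
    by (rule lborel_pair.Fubini') measurable
  also have "\<dots> = (\<integral>\<^sup>+z. \<integral>\<^sup>+x. ?I (x - T z) * F x \<partial>lborel \<partial>lborel)"
  proof (rule nn_integral_cong)
    fix z
    have "(\<lambda>x. ?I (x - T z) * F x) \<in> borel_measurable borel" by measurable
    from nn_integral_lborel_shift[OF this, of "T z"]
    show "(\<integral>\<^sup>+x. ?I x * F (x + T z) \<partial>lborel) = (\<integral>\<^sup>+x. ?I (x - T z) * F x \<partial>lborel)"
      by (simp add: add.commute)
  qed
  also have "\<dots> = (\<integral>\<^sup>+x. \<integral>\<^sup>+z. ?I (x - T z) * F x \<partial>lborel \<partial>lborel)"
    by (rule lborel_pair.Fubini') measurable
  also have "\<dots> = (\<integral>\<^sup>+z. ?I (T z) \<partial>lborel) * (\<integral>\<^sup>+x. F x \<partial>lborel)"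
    by (simp add: nn_integral_multc 2 nn_integral_cmult)
  also have "(\<integral>\<^sup>+z. ?I (T z) \<partial>lborel) = (\<integral>\<^sup>+z. indicator (T -` A) z \<partial>lborel)"
    by (simp add: indicator_def)
  also have "\<dots> = emeasure lborel (T -` A)"
    by (rule nn_integral_indicator) (use measurable_sets[of T borel borel A] in simp)
  finally show ?thesis by (simp add: A_def)
qed

lemma emeasure_ball_pos: "0 < emeasure lborel (ball (0::'a::euclidean_space) 1)" "emeasure lborel (ball (0::'a) 1) < \<infinity>"
proof -
  have "unit_ball_vol (real DIM('a)) \<noteq> 0"
    using unit_ball_vol_pos[of "real DIM('a)"] by (metis less_irrefl of_nat_0_le_iff)
  then show "0 < emeasure lborel (ball (0::'a) 1)" "emeasure lborel (ball (0::'a) 1) < \<infinity>"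
    using emeasure_lborel_ball_finite[of "0::'a" 1] by (auto simp: emeasure_ball zero_less_iff_neq_zero)
qed

lemma nn_integral_orthogonal:
  fixes T :: "'a::euclidean_space \<Rightarrow> 'a"
  assumes "orthogonal_transformation T" "F \<in> borel_measurable borel"
  shows "(\<integral>\<^sup>+x. F (T x) \<partial>lborel) = (\<integral>\<^sup>+x. F x \<partial>lborel)"
proof -
  have "T -` ball 0 1 = ball 0 1"
    using assms(1) by (auto simp: orthogonal_transformation)
  then have "emeasure lborel (ball (0::'a) 1) * (\<integral>\<^sup>+x. F (T x) \<partial>lborel)
    = emeasure lborel (ball (0::'a) 1) * (\<integral>\<^sup>+x. F x \<partial>lborel)"
    using nn_integral_linear_bij[of T F] assms orthogonal_transformation_bij[of T]
    by (simp add: orthogonal_transformation_def)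
  then show ?thesis using emeasure_ball_pos[where 'a = 'a]
    by (metis ennreal_mult_cancel_left less_irrefl infinity_ennreal_def)
qed

lemma distr_orthogonal:
  fixes T :: "'a::euclidean_space \<Rightarrow> 'a"
  assumes T: "orthogonal_transformation T"
  shows "distr lborel borel T = lborel"
proof (rule measure_eqI)
  have [measurable]: "T \<in> borel_measurable borel"
    by (rule linear_borel_measurable) (use T in \<open>simp add: orthogonal_transformation_def\<close>)
  show "sets (distr lborel borel T) = sets lborel" by simp
  fix A assume "A \<in> sets (distr lborel borel T)"
  then have A [measurable]: "A \<in> sets borel" by simp
  have "emeasure (distr lborel borel T) A = (\<integral>\<^sup>+x. indicator A x \<partial>distr lborel borel T)" by simp
  also have "\<dots> = (\<integral>\<^sup>+x. indicator A (T x) \<partial>lborel)" by (rule nn_integral_distr) auto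
  also have "\<dots> = (\<integral>\<^sup>+x. indicator A x \<partial>lborel)" by (rule nn_integral_orthogonal[OF T]) simp
  finally show "emeasure (distr lborel borel T) A = emeasure lborel A" by simp
qed

lemma integral_orthogonal:
  fixes T :: "'a::euclidean_space \<Rightarrow> 'a" and f :: "'a \<Rightarrow> 'b::{banach, second_countable_topology}"
  assumes T: "orthogonal_transformation T" and f: "f \<in> borel_measurable borel"
  shows "integrable lborel (\<lambda>x. f (T x)) \<longleftrightarrow> integrable lborel f"
    and "(\<integral>x. f (T x) \<partial>lborel) = (\<integral>x. f x \<partial>lborel)"
proof -
  have T': "T \<in> lborel \<rightarrow>\<^sub>M borel"
    using linear_borel_measurable[of T] T by (simp add: orthogonal_transformation_def)
  show "integrable lborel (\<lambda>x. f (T x)) \<longleftrightarrow> integrable lborel f"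
    using integrable_distr_eq[OF T' f] by (simp add: distr_orthogonal[OF T])
  show "(\<integral>x. f (T x) \<partial>lborel) = (\<integral>x. f x \<partial>lborel)"
    using integral_distr[OF T' f] by (simp add: distr_orthogonal[OF T])
qed

text \<open>Integrating \<open>G'\<close> over the segments from \<open>x\<close> to
  \<open>x + b\<close> and then over \<open>x\<close> gives the integral of \<open>G'\<close>, by
  translation invariance. By the fundamental theorem it is also the integral of
  \<open>G (x + b) - G x\<close>, which is zero. Integrability of \<open>G\<close> takes the place
  of a decay condition.\<close>

lemma integral_directional_derivative:
  fixes G G' :: "'a::euclidean_space \<Rightarrow> complex"
  assumes G: "integrable lborel G" and G': "integrable lborel G'"
    and deriv: "\<And>x t. ((\<lambda>t. G (x + t *\<^sub>R b)) has_vector_derivative G' (x + t *\<^sub>R b)) (at t)"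
  shows "(\<integral>x. G' x \<partial>lborel) = 0"
proof -
  have G_b: "integrable lborel (\<lambda>x. f (x + y))" "(\<integral>x. f (x + y) \<partial>lborel) = (\<integral>x. f x \<partial>lborel)"
    if "integrable lborel f" for y and f :: "'a \<Rightarrow> 'z::{banach, second_countable_topology}"
  proof -
    have m: "f \<in> borel_measurable borel" "((+) y) \<in> lborel \<rightarrow>\<^sub>M (borel :: 'a measure)" using that by auto
    show "integrable lborel (\<lambda>x. f (x + y))"
      using integrable_distr_eq[OF m(2,1)] that by (simp add: lborel_distr_plus add.commute)
    show "(\<integral>x. f (x + y) \<partial>lborel) = (\<integral>x. f x \<partial>lborel)"
      using integral_distr[OF m(2,1)] by (simp add: lborel_distr_plus add.commute)
  qed
  have [measurable]: "G' \<in> borel_measurable borel" using G' by auto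
  define K where "K = (\<lambda>(t::real) (x::'a). indicator {0..1} t *\<^sub>R G' (x + t *\<^sub>R b))"
  have K: "integrable (lborel \<Otimes>\<^sub>M lborel) (case_prod K)"
  proof (rule lborel_pair.Fubini_integrable)
    show "case_prod K \<in> borel_measurable (lborel \<Otimes>\<^sub>M lborel)"
      unfolding K_def by measurable
    have "(\<integral>x. norm (K t x) \<partial>lborel) = indicator {0..1} t * (\<integral>x. norm (G' x) \<partial>lborel)" for t
    proof -
      have "(\<integral>x. norm (K t x) \<partial>lborel) = (\<integral>x. indicator {0..1} t * norm (G' (x + t *\<^sub>R b)) \<partial>lborel)"
        by (simp add: K_def)
      also have "\<dots> = indicator {0..1} t * (\<integral>x. norm (G' x) \<partial>lborel)"
        using G_b(2)[OF integrable_norm[OF G'], of "t *\<^sub>R b"] by simp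
      finally show ?thesis .
    qed
    then show "integrable lborel (\<lambda>t. \<integral>x. norm (case_prod K (t, x)) \<partial>lborel)" by simp
    show "AE t in lborel. integrable lborel (\<lambda>x. case_prod K (t, x))"
      using G_b(1)[OF G'] by (simp add: K_def)
  qed
  have "(\<integral>x. (\<integral>t. K t x \<partial>lborel) \<partial>lborel) = (\<integral>t. (\<integral>x. K t x \<partial>lborel) \<partial>lborel)"
    by (rule lborel_pair.Fubini_integral[OF K])
  also have "\<dots> = (\<integral>t. indicator {0..1::real} t *\<^sub>R (\<integral>x. G' x \<partial>lborel) \<partial>lborel)"
    using G_b(2)[OF G'] by (intro Bochner_Integration.integral_cong refl) (simp add: K_def)
  also have "\<dots> = (\<integral>x. G' x \<partial>lborel)" by simp
  finally have 1: "(\<integral>x. (\<integral>t. K t x \<partial>lborel) \<partial>lborel) = (\<integral>x. G' x \<partial>lborel)" .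
  have "AE x in lborel. integrable lborel (\<lambda>t. K t x)"
    using lborel_pair.AE_integrable_snd[OF K] by simp
  then have "AE x in lborel. (\<integral>t. K t x \<partial>lborel) = G (x + b) - G x"
  proof (rule AE_mp, intro AE_I2 impI)
    fix x assume int: "integrable lborel (\<lambda>t. K t x)"
    have "(\<integral>t. K t x \<partial>lborel) = integral {0..1} (\<lambda>t. G' (x + t *\<^sub>R b))"
      using set_borel_integral_eq_integral(2)[of "{0..1}" "\<lambda>t. G' (x + t *\<^sub>R b)"] int
      by (simp add: K_def set_integrable_def set_lebesgue_integral_def)
    also have "((\<lambda>t. G' (x + t *\<^sub>R b)) has_integral (G (x + 1 *\<^sub>R b) - G (x + 0 *\<^sub>R b))) {0..1}"
      by (rule fundamental_theorem_of_calculus) (auto intro: has_vector_derivative_at_within deriv)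
    then have "integral {0..1} (\<lambda>t. G' (x + t *\<^sub>R b)) = G (x + b) - G x"
      by (simp add: integral_unique)
    finally show "(\<integral>t. K t x \<partial>lborel) = G (x + b) - G x" .
  qed
  then have "(\<integral>x. (\<integral>t. K t x \<partial>lborel) \<partial>lborel) = (\<integral>x. G (x + b) - G x \<partial>lborel)"
    using lborel_pair.integrable_snd[OF K] G G_b(1)[OF G, of b]
    by (intro integral_cong_AE) auto
  also have "\<dots> = 0" using G G_b[OF G, of b] by simp
  finally show ?thesis using 1 by simp
qed

text \<open>Half of the Gaussian absorbs the polynomial: \<open>(1 + r) ^ k\<close> is at most
  \<open>fact k * exp (1 + r)\<close>, and \<open>1 + r\<close> is at most
  \<open>2 + r^2 / 4\<close> by completing a square.\<close>

lemma one_plus_power_le_exp: "r \<ge> 0 \<Longrightarrow> (1 + r) ^ k * exp (- r\<^sup>2 / 2) \<le> fact k * exp 2 * exp (- r\<^sup>2 / 4)" for r :: real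
proof -
  assume r: "r \<ge> 0"
  have "(1 + r) ^ k / fact k \<le> exp (1 + r)"
    using exp_lower_Taylor_quadratic r
  proof -
    have "(\<Sum>n\<in>{k}. (1 + r) ^ n / fact n) \<le> suminf (\<lambda>n. (1 + r) ^ n / fact n)"
      using r summable_exp[of "1 + r"] by (intro sum_le_suminf) (auto simp: divide_inverse mult.commute)
    then show ?thesis by (simp add: exp_def divide_inverse mult.commute)
  qed
  also have "1 + r \<le> 2 + r\<^sup>2 / 4" using zero_le_power2[of "r / 2 - 1"] by (simp add: power2_eq_square algebra_simps)
  finally have "(1 + r) ^ k / fact k \<le> exp (2 + r\<^sup>2 / 4)" by simp
  then have "(1 + r) ^ k * exp (- r\<^sup>2 / 2) \<le> (fact k * exp (2 + r\<^sup>2 / 4)) * exp (- r\<^sup>2 / 2)"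
    by (intro mult_right_mono) (auto simp: field_simps)
  also have "\<dots> = fact k * exp 2 * exp (- r\<^sup>2 / 4)"
    by (simp add: mult.assoc flip: exp_add)
  finally show ?thesis .
qed

lemma nn_integral_powr_exp_abs:
  assumes "s < 1"
  shows "(\<integral>\<^sup>+t. ennreal (\<bar>t\<bar> powr (- s) * exp (- \<bar>t\<bar>)) \<partial>lborel) < \<infinity>"
proof -
  let ?f = "\<lambda>t::real. ennreal (indicator {0..} t * t powr (- s) / exp t)"
  have f: "(\<integral>\<^sup>+t. ?f t \<partial>lborel) < \<infinity>"
  proof -
    have "(\<integral>\<^sup>+t. ?f t \<partial>lborel) = ennreal (Gamma (1 - s))"
      using Gamma_conv_nn_integral_real[of "1 - s"] assms by simp
    then show ?thesis by simp
  qed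
  have "(\<integral>\<^sup>+t. ennreal (\<bar>t\<bar> powr (- s) * exp (- \<bar>t\<bar>)) \<partial>lborel) \<le> (\<integral>\<^sup>+t. ?f t + ?f (0 - t) \<partial>lborel)"
    by (intro nn_integral_mono) (auto simp: indicator_def exp_minus field_simps)
  also have "\<dots> = (\<integral>\<^sup>+t. ?f t \<partial>lborel) + (\<integral>\<^sup>+t. ?f (0 - t) \<partial>lborel)"
    by (rule nn_integral_add) measurable
  also have "(\<integral>\<^sup>+t. ?f (0 - t) \<partial>lborel) = (\<integral>\<^sup>+t. ?f t \<partial>lborel)"
    by (rule nn_integral_lborel_reflect) measurable
  also have "(\<integral>\<^sup>+t. ?f t \<partial>lborel) + (\<integral>\<^sup>+t. ?f t \<partial>lborel) < \<infinity>" using f by simp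
  finally show ?thesis .
qed

lemma nn_integral_powr_gauss:
  assumes s: "s < 1" and \<mu>: "\<mu> > 0"
  shows "(\<integral>\<^sup>+t. ennreal ((1 + \<bar>t\<bar> powr (- s)) * exp (- \<mu> * t\<^sup>2)) \<partial>lborel) < \<infinity>"
proof -
  let ?C = "exp (1 / (4 * \<mu>))"
  let ?g = "\<lambda>s t. ennreal (\<bar>t\<bar> powr (- s) * exp (- \<bar>t\<bar>))"
  have le: "exp (- \<mu> * t\<^sup>2) \<le> ?C * exp (- \<bar>t\<bar>)" for t
  proof -
    \<comment> \<open>Completing the square compares the Gaussian with
      \<open>exp (- \<bar>t\<bar>)\<close>, so that the Gamma integral applies.\<close>
    have "0 \<le> (2 * \<mu> * \<bar>t\<bar> - 1)\<^sup>2 / (4 * \<mu>)" using \<mu> by simp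
    also have "\<dots> = \<mu> * t\<^sup>2 - \<bar>t\<bar> + 1 / (4 * \<mu>)" using \<mu>
      by (simp add: power2_eq_square field_simps)
    finally have "- \<mu> * t\<^sup>2 \<le> 1 / (4 * \<mu>) + (- \<bar>t\<bar>)" by simp
    then show ?thesis unfolding exp_add[symmetric] by simp
  qed
  have "AE t in lborel. (t::real) \<noteq> 0"
    by (rule AE_lborel_singleton)
  then have "AE t in lborel. ennreal ((1 + \<bar>t\<bar> powr (- s)) * exp (- \<mu> * t\<^sup>2)) \<le> ennreal ?C * (?g 0 t + ?g s t)"
  proof (rule AE_mp, intro AE_I2 impI)
    fix t :: real assume "t \<noteq> 0"
    then have "(1 + \<bar>t\<bar> powr (- s)) * exp (- \<mu> * t\<^sup>2) \<le> (\<bar>t\<bar> powr (- 0) + \<bar>t\<bar> powr (- s)) * (?C * exp (- \<bar>t\<bar>))"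
      using le[of t] by (intro mult_mono) auto
    then show "ennreal ((1 + \<bar>t\<bar> powr (- s)) * exp (- \<mu> * t\<^sup>2)) \<le> ennreal ?C * (?g 0 t + ?g s t)"
      by (simp add: algebra_simps flip: ennreal_mult ennreal_plus)
  qed
  then have "(\<integral>\<^sup>+t. ennreal ((1 + \<bar>t\<bar> powr (- s)) * exp (- \<mu> * t\<^sup>2)) \<partial>lborel)
     \<le> (\<integral>\<^sup>+t. ennreal ?C * (?g 0 t + ?g s t) \<partial>lborel)" by (rule nn_integral_mono_AE)
  also have "\<dots> = ennreal ?C * ((\<integral>\<^sup>+t. ?g 0 t \<partial>lborel) + (\<integral>\<^sup>+t. ?g s t \<partial>lborel))"
    by (simp add: nn_integral_cmult nn_integral_add)
  also have "\<dots> < \<infinity>"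
    using nn_integral_powr_exp_abs[OF s] nn_integral_powr_exp_abs[of 0] by (simp add: ennreal_mult_less_top)
  finally show ?thesis .
qed

text \<open>Independent vectors extend to a basis, and the map \<open>T\<close> turns the inner
  products with this basis into orthonormal coordinates. The integrand is then dominated by a
  product of functions of one variable each.\<close>

lemma nn_integral_independent_powr:
  fixes a :: "'i \<Rightarrow> 'a::euclidean_space"
  assumes I: "finite I" and ind: "\<And>u. (\<Sum>i\<in>I. u i *\<^sub>R a i) = 0 \<Longrightarrow> \<forall>i\<in>I. u i = 0"
    and s: "0 \<le> s" "s < 1"
  shows "(\<integral>\<^sup>+x. ennreal ((\<Prod>i\<in>I. \<bar>x \<bullet> a i\<bar> powr (- s)) * (1 + norm x) ^ k * exp (- (norm x)\<^sup>2 / 2)) \<partial>lborel) < \<infinity>"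
proof -
  have inj: "inj_on a I"
  proof (rule inj_onI, rule ccontr)
    fix i j assume ij: "i \<in> I" "j \<in> I" "a i = a j" "i \<noteq> j"
    define u where "u k = (if k = i then 1 else if k = j then -1 else 0 :: real)" for k
    have "(\<Sum>k\<in>I. u k *\<^sub>R a k) = (\<Sum>k\<in>I. (if k = i then a i else 0) - (if k = j then a j else 0))"
      by (rule sum.cong) (use ij in \<open>auto simp: u_def\<close>)
    also have "\<dots> = 0" using I ij by (simp add: sum_subtractf)
    finally have "u i = 0" using ind ij by blast
    then show False by (simp add: u_def)
  qed
  have indep: "independent (a ` I)"
  proof (rule independent_if_scalars_zero)
    show "finite (a ` I)" using I by simp
    fix f y assume "(\<Sum>y\<in>a ` I. f y *\<^sub>R y) = 0" "y \<in> a ` I"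
    then show "f y = 0" using ind[of "f \<circ> a"] by (auto simp: sum.reindex[OF inj])
  qed
  obtain B where B: "a ` I \<subseteq> B" "independent B" "UNIV \<subseteq> span B"
    using maximal_independent_subset_extend[of "a ` I" UNIV] indep by auto
  have "card B = DIM('a)" using B by (metis basis_card_eq_dim dim_UNIV top.extremum)
  moreover have finB: "finite B" using B(2) by (rule independent_imp_finite)
  ultimately obtain \<beta> where \<beta>: "bij_betw \<beta> (Basis :: 'a set) B"
    using finite_same_card_bij[of Basis B] finite_Basis by auto
  define T where "T x = (\<Sum>b\<in>Basis. (x \<bullet> \<beta> b) *\<^sub>R b)" for x :: 'a
  have T_inner: "T x \<bullet> b = x \<bullet> \<beta> b" if "b \<in> Basis" for x b
    unfolding T_def using that by simp
  have T: "linear T" unfolding T_def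
    by (intro linearI) (auto simp: inner_add_left scaleR_add_left sum.distrib scaleR_sum_right)
  have "inj T"
  proof (subst linear_injective_0[OF T], intro allI impI)
    fix x assume "T x = 0"
    then have "x \<bullet> \<beta> b = 0" if "b \<in> Basis" for b using T_inner[OF that, of x] by simp
    then have "\<forall>y\<in>B. orthogonal x y" using \<beta> by (auto simp: bij_betw_def orthogonal_def)
    then have "orthogonal x x" using orthogonal_to_span[of x B x] B(3) by (auto simp: orthogonal_commute)
    then show "x = 0" by (simp add: orthogonal_def)
  qed
  then have bij: "bij T" using linear_injective_imp_surjective[OF T] by (simp add: bij_def)
  obtain K where K: "K > 0" "\<And>x. norm (T x) \<le> K * norm x" using linear_bounded_pos[OF T] by blast
  \<comment> \<open>Chosen so that \<open>\<mu>\<close> times the squared norm of \<open>T x\<close>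
    is at most a quarter of the squared norm of \<open>x\<close>, the share of the Gaussian left by
    \<open>one_plus_power_le_exp\<close>.\<close>
  define \<mu> where "\<mu> = 1 / (4 * K\<^sup>2)"
  have \<mu>: "\<mu> > 0" using K by (simp add: \<mu>_def)
  \<comment> \<open>The summand \<open>1\<close> makes the factor with the power at least
    \<open>1\<close>, so that the product over \<open>I\<close> may be enlarged to the whole
    basis.\<close>
  define \<phi> where "\<phi> t = (1 + \<bar>t\<bar> powr (- s)) * exp (- \<mu> * t\<^sup>2)" for t
  define F where "F y = (\<Prod>b\<in>Basis. ennreal (\<phi> (y \<bullet> b)))" for y :: 'a
  have [measurable]: "\<phi> \<in> borel_measurable borel" unfolding \<phi>_def[abs_def] by measurable
  have F [measurable]: "F \<in> borel_measurable borel" unfolding F_def[abs_def] by measurable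
  have \<phi>_nonneg: "\<phi> t \<ge> 0" for t by (simp add: \<phi>_def)
  have "(\<integral>\<^sup>+y. F y \<partial>lborel) = (\<Prod>b\<in>(Basis::'a set). (\<integral>\<^sup>+t. ennreal (\<phi> t) \<partial>lborel))"
    unfolding F_def by (rule nn_integral_lborel_prod) auto
  also have "\<dots> < \<infinity>"
    using nn_integral_powr_gauss[OF s(2) \<mu>] by (simp add: \<phi>_def power_less_top_ennreal)
  finally have F_fin: "(\<integral>\<^sup>+y. F y \<partial>lborel) < \<infinity>" .
  have T_fin: "(\<integral>\<^sup>+x. F (T x) \<partial>lborel) < \<infinity>"
  proof -
    have "bounded (T -` ball 0 1)"
    proof -
      have "bounded (inv_into UNIV T ` ball 0 1)"
        using bounded_linear_image[of "ball 0 1" "inv_into UNIV T"]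
          inj_linear_imp_inv_linear[OF T \<open>inj T\<close>] by (simp add: linear_conv_bounded_linear)
      then show ?thesis using bij by (simp add: bij_vimage_eq_inv_image)
    qed
    then have fin: "emeasure lborel (T -` ball 0 1) < \<infinity>" by (rule emeasure_bounded_finite)
    have "emeasure lborel (ball (0::'a) 1) * (\<integral>\<^sup>+x. F (T x) \<partial>lborel) < \<infinity>"
      unfolding nn_integral_linear_bij[OF T bij F] using F_fin fin by (simp add: ennreal_mult_less_top)
    then show ?thesis using emeasure_ball_pos(1)[where 'a = 'a] by (auto simp: ennreal_mult_less_top)
  qed
  let ?C = "fact k * exp 2 :: real"
  have "ennreal ((\<Prod>i\<in>I. \<bar>x \<bullet> a i\<bar> powr (- s)) * (1 + norm x) ^ k * exp (- (norm x)\<^sup>2 / 2)) \<le> ennreal ?C * F (T x)" for x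
  proof -
    have "(\<Prod>i\<in>I. \<bar>x \<bullet> a i\<bar> powr (- s)) = (\<Prod>y\<in>a ` I. \<bar>x \<bullet> y\<bar> powr (- s))"
      by (simp add: prod.reindex[OF inj])
    also have "\<dots> \<le> (\<Prod>y\<in>a ` I. 1 + \<bar>x \<bullet> y\<bar> powr (- s))" by (intro prod_mono) auto
    also have "\<dots> \<le> (\<Prod>y\<in>B. 1 + \<bar>x \<bullet> y\<bar> powr (- s))"
      by (intro prod_mono2[OF finB B(1)]) auto
    also have "\<dots> = (\<Prod>b\<in>Basis. 1 + \<bar>T x \<bullet> b\<bar> powr (- s))"
      unfolding prod.reindex_bij_betw[OF \<beta>, symmetric] by (intro prod.cong) (auto simp: T_inner)
    finally have 1: "(\<Prod>i\<in>I. \<bar>x \<bullet> a i\<bar> powr (- s)) \<le> (\<Prod>b\<in>Basis. 1 + \<bar>T x \<bullet> b\<bar> powr (- s))" .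
    have "(norm (T x))\<^sup>2 \<le> K\<^sup>2 * (norm x)\<^sup>2"
      using power_mono[OF K(2)[of x], of 2] by (simp add: power_mult_distrib)
    then have "\<mu> * (norm (T x))\<^sup>2 \<le> (norm x)\<^sup>2 / 4"
      using K(1) by (simp add: \<mu>_def field_simps)
    moreover have "(norm (T x))\<^sup>2 = (\<Sum>b\<in>Basis. (T x \<bullet> b)\<^sup>2)" 
      unfolding power2_norm_eq_inner by (subst euclidean_inner) (simp add: power2_eq_square)
    ultimately have "exp (- (norm x)\<^sup>2 / 4) \<le> exp (- (\<Sum>b\<in>Basis. \<mu> * (T x \<bullet> b)\<^sup>2))"
      by (simp add: sum_distrib_left)
    also have "\<dots> = (\<Prod>b\<in>Basis. exp (- \<mu> * (T x \<bullet> b)\<^sup>2))"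
      by (simp add: exp_sum flip: sum_negf)
    finally have 2: "exp (- (norm x)\<^sup>2 / 4) \<le> (\<Prod>b\<in>Basis. exp (- \<mu> * (T x \<bullet> b)\<^sup>2))" .
    have "(\<Prod>i\<in>I. \<bar>x \<bullet> a i\<bar> powr (- s)) * (1 + norm x) ^ k * exp (- (norm x)\<^sup>2 / 2)
      \<le> (\<Prod>b\<in>Basis. 1 + \<bar>T x \<bullet> b\<bar> powr (- s)) * (?C * (\<Prod>b\<in>Basis. exp (- \<mu> * (T x \<bullet> b)\<^sup>2)))"
      unfolding mult.assoc
    proof (rule mult_mono[OF 1])
      have "(1 + norm x) ^ k * exp (- (norm x)\<^sup>2 / 2) \<le> ?C * exp (- (norm x)\<^sup>2 / 4)"
        by (rule one_plus_power_le_exp) simp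
      also have "\<dots> \<le> ?C * (\<Prod>b\<in>Basis. exp (- \<mu> * (T x \<bullet> b)\<^sup>2))" by (rule mult_left_mono[OF 2]) simp
      finally show "(1 + norm x) ^ k * exp (- (norm x)\<^sup>2 / 2) \<le> fact k * (exp 2 * (\<Prod>b\<in>Basis. exp (- \<mu> * (T x \<bullet> b)\<^sup>2)))"
        by (simp add: mult.assoc)
    qed (auto intro!: prod_nonneg)
    also have "\<dots> = ?C * (\<Prod>b\<in>Basis. \<phi> (T x \<bullet> b))"
      by (simp add: \<phi>_def prod.distrib)
    finally show ?thesis
      by (simp add: F_def prod_ennreal \<phi>_nonneg prod_nonneg flip: ennreal_mult)
  qed
  then have "(\<integral>\<^sup>+x. ennreal ((\<Prod>i\<in>I. \<bar>x \<bullet> a i\<bar> powr (- s)) * (1 + norm x) ^ k * exp (- (norm x)\<^sup>2 / 2)) \<partial>lborel)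
     \<le> (\<integral>\<^sup>+x. ennreal ?C * F (T x) \<partial>lborel)" by (intro nn_integral_mono)
  also have "\<dots> = ennreal ?C * (\<integral>\<^sup>+x. F (T x) \<partial>lborel)"
  proof (rule nn_integral_cmult)
    have [measurable]: "T \<in> borel_measurable borel" by (rule linear_borel_measurable[OF T])
    show "(\<lambda>x. F (T x)) \<in> borel_measurable lborel" by measurable
  qed
  also have "\<dots> < \<infinity>" using T_fin by (simp add: ennreal_mult_less_top)
  finally show ?thesis .
qed

section \<open>Square integrable modules generated by singular vectors\<close>

text \<open>The singular factor \<open>exp (- e / u) * u powr (- c)\<close> of the regularised weight, as a function of
  \<open>u = (\<Prod>s. (\<alpha> s)\<^sup>2)\<close>; it extends by \<open>0\<close> to a differentiable function.\<close>

definition cutoff :: "real \<Rightarrow> real \<Rightarrow> real \<Rightarrow> real" where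
  "cutoff c e u = (if u > 0 then exp (- e / u) * u powr (- c) else 0)"

definition cutoff' :: "real \<Rightarrow> real \<Rightarrow> real \<Rightarrow> real" where
  "cutoff' c e u = (if u > 0 then (e / u - c) / u * (exp (- e / u) * u powr (- c)) else 0)"

text \<open>At \<open>0\<close> the exponential beats every power of \<open>u\<close>, so the
  difference quotient tends to \<open>0\<close> from the right; from the left it is
  \<open>0\<close>.\<close>

lemma cutoff_deriv:
  assumes e: "e > 0"
  shows "(cutoff c e has_real_derivative cutoff' c e u) (at u)"
proof -
  consider "u > 0" | "u < 0" | "u = 0" by linarith
  then show ?thesis
  proof cases
    case 1
    have "((\<lambda>u. exp (- e / u) * u powr (- c)) has_real_derivative cutoff' c e u) (at u)"
      using 1 by (auto intro!: derivative_eq_intros simp: cutoff'_def powr_diff field_simps power2_eq_square)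
    then show ?thesis
      by (rule has_field_derivative_transform_within_open[where S = "{0<..}"]) (use 1 in \<open>auto simp: cutoff_def\<close>)
  next
    case 2
    have "((\<lambda>u. 0) has_real_derivative cutoff' c e u) (at u)" using 2 by (simp add: cutoff'_def)
    then show ?thesis
      by (rule has_field_derivative_transform_within_open[where S = "{..<0}"]) (use 2 in \<open>auto simp: cutoff_def\<close>)
  next
    case 3
    have r: "((\<lambda>h. exp (- e / h) * h powr (- c) / h) \<longlongrightarrow> 0) (at_right 0)"
      using e by real_asymp
    have "((\<lambda>h. cutoff c e h / h) \<longlongrightarrow> 0) (at_right 0)"
    proof (rule Lim_transform_eventually[OF r])
      show "\<forall>\<^sub>F h in at_right 0. exp (- e / h) * h powr (- c) / h = cutoff c e h / h"
        using eventually_at_right_less[of "0::real"] by eventually_elim (simp add: cutoff_def)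
    qed
    moreover have "((\<lambda>h. cutoff c e h / h) \<longlongrightarrow> 0) (at_left 0)"
    proof (rule Lim_transform_eventually[OF tendsto_const])
      show "\<forall>\<^sub>F h in at_left 0. 0 = cutoff c e h / h"
        unfolding eventually_at_filter cutoff_def by (intro always_eventually) auto
    qed
    ultimately have "((\<lambda>h. cutoff c e h / h) \<longlongrightarrow> 0) (at 0)"
      by (simp add: filterlim_split_at)
    then show ?thesis unfolding 3 DERIV_def by (simp add: cutoff_def cutoff'_def)
  qed
qed

lemma exp_neg_bounds:
  fixes v :: real
  assumes "v \<ge> 0"
  shows "v * exp (- v) \<le> 1" "v\<^sup>2 * exp (- v) \<le> 2"
proof -
  have "1 + v + v\<^sup>2 / 2 \<le> exp v" using exp_lower_Taylor_quadratic assms by simp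
  then have "v \<le> exp v" "v\<^sup>2 \<le> 2 * exp v" using assms zero_le_power2[of v] by linarith+
  then show "v * exp (- v) \<le> 1" "v\<^sup>2 * exp (- v) \<le> 2"
    by (simp_all add: exp_minus field_simps)
qed

lemma integrable_mult_of_real_bounded:
  fixes J :: "'a \<Rightarrow> complex"
  assumes J: "integrable M J" and h: "h \<in> borel_measurable M" "\<And>x. \<bar>h x\<bar> \<le> B"
  shows "integrable M (\<lambda>x. J x * of_real (h x))"
proof (rule Bochner_Integration.integrable_bound[where f = "\<lambda>x. of_real B * J x"])
  show "integrable M (\<lambda>x. of_real B * J x)" using J by simp
  have [measurable]: "J \<in> borel_measurable M" using J by simp
  show "(\<lambda>x. J x * of_real (h x)) \<in> borel_measurable M" using h(1) by measurable
  have "B \<ge> 0" using h(2) by (meson abs_ge_zero order_trans)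
  then have "norm (J x * of_real (h x)) \<le> norm (of_real B * J x)" for x
    using mult_left_mono[OF h(2)[of x], of "norm (J x)"] by (simp add: norm_mult mult.commute)
  then show "AE x in M. norm (J x * of_real (h x)) \<le> norm (of_real B * J x)" by simp
qed

lemma integral_diff_add_diff:
  fixes f g h :: "'a \<Rightarrow> complex"
  assumes "integrable M f" "integrable M g" "integrable M h"
  shows "(\<integral>x. (f x - g x) + (f x - h x) \<partial>M) = ((\<integral>x. f x \<partial>M) - (\<integral>x. g x \<partial>M)) + ((\<integral>x. f x \<partial>M) - (\<integral>x. h x \<partial>M))"
  using assms by (subst Bochner_Integration.integral_add) auto

context rational_cherednik
begin

section \<open>The weight and the product of the squared roots\<close>

definition uu :: "'a \<Rightarrow> real" where "uu x = (\<Prod>s\<in>reflections. (\<alpha> s x)\<^sup>2)"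

text \<open>\<open>uu\<close> divided by one root, kept polynomial. Half of the directional
  derivative of \<open>uu\<close> is a combination of these, see \<open>uu_deriv\<close>.\<close>

definition cofactor :: "('a \<Rightarrow> 'a) \<Rightarrow> 'a \<Rightarrow> real" where
  "cofactor s x = \<alpha> s x * (\<Prod>t\<in>reflections - {s}. (\<alpha> t x)\<^sup>2)"

definition wt :: "'a \<Rightarrow> real" where
  "wt x = exp (- (norm x)\<^sup>2 / 2) * (\<Prod>s\<in>reflections. \<bar>\<alpha> s x\<bar> powr (- 2 * c))"

lemma mu_eq: "mu = density lborel (\<lambda>x. ennreal (wt x))"
  by (simp add: mu_def wt_def)

lemma uu_nonneg: "uu x \<ge> 0" by (simp add: uu_def prod_nonneg)

lemma wt_eq: "wt x = exp (- (norm x)\<^sup>2 / 2) * uu x powr (- c)"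
proof -
  have "\<bar>\<alpha> s x\<bar> powr (- 2 * c) = ((\<alpha> s x)\<^sup>2) powr (- c)" for s
  proof -
    have "((\<alpha> s x)\<^sup>2) powr (- c) = (\<bar>\<alpha> s x\<bar> powr 2) powr (- c)" by simp
    then show ?thesis by (simp only: powr_powr) simp
  qed
  then show ?thesis by (simp add: wt_def uu_def prod_powr_distrib)
qed

lemma wt_nonneg: "wt x \<ge> 0" by (simp add: wt_eq)

lemma wt_pos: "uu x \<noteq> 0 \<Longrightarrow> wt x > 0" by (simp add: wt_eq)

lemma cofactor_mult: "s \<in> reflections \<Longrightarrow> \<alpha> s x * cofactor s x = uu x"
  using finite_reflections by (simp add: cofactor_def uu_def prod.remove[of reflections s] power2_eq_square mult.assoc)

lemma \<alpha>_norm: "s \<in> reflections \<Longrightarrow> (\<alpha> s x)\<^sup>2 = (norm (x - s x))\<^sup>2 / (norm (\<alpha>v s))\<^sup>2"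
  using reflection_formula[of s x] \<alpha>v_nonzero[of s] by (simp add: power_mult_distrib)

text \<open>The chosen roots need not be permuted by \<open>W\<close>, not even up to sign. But the
  square of a root is the squared distance from \<open>x\<close> to \<open>s x\<close> over a
  constant, and these distances are permuted.\<close>

lemma uu_W:
  assumes w: "w \<in> W"
  shows "uu (w x) = uu x"
proof -
  have e: "uu x = (\<Prod>s\<in>reflections. (norm (x - s x))\<^sup>2) / (\<Prod>s\<in>reflections. (norm (\<alpha>v s))\<^sup>2)" for x
    by (simp add: uu_def \<alpha>_norm prod_dividef)
  have "(\<Prod>s\<in>reflections. (norm (w x - s (w x)))\<^sup>2)
      = (\<Prod>s\<in>reflections. (norm (w x - (w \<circ> s \<circ> inv_into UNIV w) (w x)))\<^sup>2)"
    by (rule prod.reindex_bij_betw[OF reflections_conj_bij[OF w], symmetric])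
  also have "\<dots> = (\<Prod>s\<in>reflections. (norm (x - s x))\<^sup>2)"
    using w by (simp add: norm_W flip: linear_diff[OF linear_W])
  finally show ?thesis by (simp add: e)
qed

lemma wt_W: "w \<in> W \<Longrightarrow> wt (w x) = wt x"
  by (simp add: wt_eq uu_W norm_W)

lemma measurable_\<alpha>: "s \<in> reflections \<Longrightarrow> \<alpha> s \<in> borel_measurable borel"
  by (rule linear_borel_measurable[OF linear_\<alpha>])

lemma measurable_uu [measurable]: "uu \<in> borel_measurable borel"
  unfolding uu_def[abs_def] by (intro borel_measurable_prod borel_measurable_power measurable_\<alpha>)

lemma measurable_wt [measurable]: "wt \<in> borel_measurable borel"
  unfolding wt_eq[abs_def] by measurable

lemma Pol_\<alpha>: "s \<in> reflections \<Longrightarrow> (\<lambda>x. complex_of_real (\<alpha> s x)) \<in> Pol"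
  by (intro Pol_lin1 linear_of_real linear_\<alpha>)

lemma Pol_\<alpha>2: "s \<in> reflections \<Longrightarrow> (\<lambda>x. (complex_of_real (\<alpha> s x))\<^sup>2) \<in> Pol"
  unfolding power2_eq_square by (rule Pol_mult[OF Pol_\<alpha> Pol_\<alpha>])

lemma Pol_cofactor: "s \<in> reflections \<Longrightarrow> (\<lambda>x. complex_of_real (cofactor s x)) \<in> Pol"
  unfolding cofactor_def of_real_mult of_real_prod of_real_power
  by (rule Pol_mult[OF Pol_\<alpha> Pol_prod[OF Pol_\<alpha>2]]) auto

lemma Pol_uu: "(\<lambda>x. complex_of_real (uu x)) \<in> Pol"
  unfolding uu_def of_real_prod of_real_power by (rule Pol_prod[OF Pol_\<alpha>2])

lemma uu_nonzero: "\<exists>x. uu x \<noteq> 0"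
proof -
  have "(\<lambda>x. \<Prod>s\<in>S. complex_of_real ((\<alpha> s x)\<^sup>2)) \<noteq> (\<lambda>x. 0)" if "finite S" "S \<subseteq> reflections" for S
    using that
  proof (induction S rule: finite_induct)
    case empty
    show ?case by (simp add: fun_eq_iff)
  next
    case (insert s S)
    show ?case
    proof
      assume "(\<lambda>x. \<Prod>s\<in>insert s S. complex_of_real ((\<alpha> s x)\<^sup>2)) = (\<lambda>x. 0)"
      then have z: "(\<Prod>s\<in>S. complex_of_real ((\<alpha> s x)\<^sup>2)) * complex_of_real ((\<alpha> s x)\<^sup>2) = 0" for x
        using insert.hyps by (auto simp: fun_eq_iff)
      have s: "s \<in> reflections" using insert.prems by simp
      have "(\<lambda>x. \<Prod>s\<in>S. complex_of_real ((\<alpha> s x)\<^sup>2)) \<in> Pol"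
        unfolding of_real_power using insert.prems by (intro Pol_prod[OF Pol_\<alpha>2]) auto
      moreover have "(\<lambda>x. complex_of_real ((\<alpha> s x)\<^sup>2)) \<in> Pol"
        unfolding of_real_power using s by (rule Pol_\<alpha>2)
      ultimately have "(\<Prod>s\<in>S. complex_of_real ((\<alpha> s x)\<^sup>2)) = 0" for x
        using Pol_domain[of _ _ "\<alpha>v s"] z \<alpha>_\<alpha>v[OF s] by (metis (no_types, lifting) of_real_eq_0_iff power_eq_0_iff zero_neq_numeral)
      then show False using insert.IH insert.prems by (auto simp: fun_eq_iff)
    qed
  qed
  from this[OF finite_reflections] have "(\<lambda>x. complex_of_real (uu x)) \<noteq> (\<lambda>x. 0)"
    by (simp add: uu_def)
  then show ?thesis by auto
qed

lemma uu_deriv: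
  "((\<lambda>t. uu (x + t *\<^sub>R b)) has_real_derivative 2 * (\<Sum>s\<in>reflections. \<alpha> s b * cofactor s (x + t *\<^sub>R b))) (at t)"
proof -
  have "((\<lambda>t. (\<alpha> s (x + t *\<^sub>R b))\<^sup>2) has_real_derivative 2 * \<alpha> s (x + t *\<^sub>R b) * \<alpha> s b) (at t)" if "s \<in> reflections" for s
    using that by (auto intro!: derivative_eq_intros simp: linear_add[OF linear_\<alpha>] linear_cmul[OF linear_\<alpha>])
  from has_field_derivative_prod[of reflections, OF this]
  show ?thesis by (simp add: uu_def cofactor_def sum_distrib_left mult_ac)
qed

lemma AE_uu: "AE x in lborel. uu x \<noteq> 0"
proof -
  have "negligible {x. \<alpha> s x = 0}" if s: "s \<in> reflections" for s
  proof -
    define a where "a = (2 / (\<alpha>v s \<bullet> \<alpha>v s)) *\<^sub>R \<alpha>v s"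
    have "\<alpha> s x = a \<bullet> x" for x
      using reflection_formula_aux(3)[OF s, of x] by (simp add: a_def inner_commute)
    moreover have "a \<noteq> 0" using \<alpha>v_nonzero[OF s] by (simp add: a_def)
    ultimately show ?thesis using negligible_hyperplane[of a 0] by simp
  qed
  then have n: "negligible (\<Union>s\<in>reflections. {x. \<alpha> s x = 0})"
    using finite_reflections by (intro negligible_Union) auto
  have "{x. uu x = 0} = (\<Union>s\<in>reflections. {x. \<alpha> s x = 0})"
    using finite_reflections by (auto simp: uu_def)
  with n have "{x. uu x = 0} \<in> null_sets lebesgue" by (simp add: negligible_iff_null_sets)
  moreover have "{x. uu x = 0} \<in> sets borel" by measurable
  ultimately have "{x. uu x = 0} \<in> null_sets lborel" by (simp add: null_sets_def)
  then show ?thesis by (rule AE_I') auto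
qed

end

text \<open>The interface between algebra and analysis. \<open>V\<close> is a set of singular
  vectors stable under \<open>W\<close>, not necessarily a subspace; integrability of the products
  is assumed with an arbitrary polynomial factor and also after one derivative. The group remains
  general.\<close>

locale singular_space = rational_cherednik W \<alpha> \<alpha>v c
  for W :: "('a::euclidean_space \<Rightarrow> 'a) set" and \<alpha> \<alpha>v c +
  fixes V :: "('a \<Rightarrow> complex) set"
  assumes c_pos: "c > 0"
    and V_nonzero: "\<exists>f\<in>V. f \<noteq> (\<lambda>x. 0)"
    and V_Pol: "f \<in> V \<Longrightarrow> f \<in> Pol"
    and V_W: "w \<in> W \<Longrightarrow> f \<in> V \<Longrightarrow> (\<lambda>x. f (w x)) \<in> V"
    and V_D: "f \<in> V \<Longrightarrow> D b f = (\<lambda>x. 0)"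
    and V_integrable: "f \<in> V \<Longrightarrow> g \<in> V \<Longrightarrow> p \<in> Pol \<Longrightarrow> integrable lborel (\<lambda>x. cmod (p x * f x * g x) * wt x)"
    and V_integrable': "f \<in> V \<Longrightarrow> g \<in> V \<Longrightarrow> p \<in> Pol \<Longrightarrow> integrable lborel (\<lambda>x. cmod (p x * pd b f x * g x) * wt x)"
begin

text \<open>The submodule generated by \<open>V\<close>. Closure under \<open>W\<close> and under
  Dunkl operators is derived: \<open>V\<close> is stable and singular, and \<open>D_lin\<close>
  moves \<open>D\<close> past linear factors.\<close>

inductive_set NV :: "('a \<Rightarrow> complex) set" where
  base: "f \<in> V \<Longrightarrow> f \<in> NV"
| scale: "f \<in> NV \<Longrightarrow> (\<lambda>x. a * f x) \<in> NV"
| lin: "linear \<xi> \<Longrightarrow> f \<in> NV \<Longrightarrow> (\<lambda>x. \<xi> x * f x) \<in> NV"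
| add: "f \<in> NV \<Longrightarrow> g \<in> NV \<Longrightarrow> (\<lambda>x. f x + g x) \<in> NV"

lemma NV_Pol: "f \<in> NV \<Longrightarrow> f \<in> Pol"
  by (induction rule: NV.induct) (auto intro: V_Pol Pol_scale Pol.intros)

lemma NV_zero: "(\<lambda>x. 0) \<in> NV"
proof -
  obtain f where "f \<in> V" using V_nonzero by blast
  from NV.scale[OF NV.base[OF this], of 0] show ?thesis by simp
qed

lemma NV_diff: "f \<in> NV \<Longrightarrow> g \<in> NV \<Longrightarrow> (\<lambda>x. f x - g x) \<in> NV"
  using NV.add[OF _ NV.scale[of g "-1"], of f] by simp

lemma NV_sum: "(\<And>i. i \<in> I \<Longrightarrow> f i \<in> NV) \<Longrightarrow> (\<lambda>x. \<Sum>i\<in>I. f i x) \<in> NV"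
  by (induction I rule: infinite_finite_induct) (auto intro: NV_zero NV.add)

lemma NV_W: "f \<in> NV \<Longrightarrow> w \<in> W \<Longrightarrow> (\<lambda>x. f (w x)) \<in> NV"
proof (induction rule: NV.induct)
  case (base f)
  from NV.base[OF V_W[OF base.prems base.hyps]] show ?case .
next
  case (scale f a)
  from NV.scale[OF scale.IH[OF scale.prems]] show ?case .
next
  case (lin \<xi> f)
  have "linear (\<lambda>x. \<xi> (w x))" using lin.hyps linear_W[OF lin.prems] by (auto simp: linear_iff)
  from NV.lin[OF this lin.IH[OF lin.prems]] show ?case .
next
  case (add f g)
  from NV.add[OF add.IH(1)[OF add.prems] add.IH(2)[OF add.prems]] show ?case .
qed

lemma NV_D: "f \<in> NV \<Longrightarrow> D b f \<in> NV"
proof (induction rule: NV.induct)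
  case (base f)
  then show ?case by (simp add: V_D NV_zero)
next
  case (scale f a)
  have "D b (\<lambda>x. a * f x) = (\<lambda>x. a * D b f x)" using NV_Pol[OF scale.hyps] by (auto simp: D_scale)
  then show ?case using NV.scale[OF scale.IH] by simp
next
  case (lin \<xi> f)
  have "D b (\<lambda>x. \<xi> x * f x) = (\<lambda>x. \<xi> x * D b f x + \<xi> b * f x - of_real c * (\<Sum>s\<in>reflections. \<xi> (b - s b) * f (s x)))"
    using D_lin[OF lin.hyps(1) NV_Pol[OF lin.hyps(2)]] by auto
  also have "\<dots> \<in> NV"
    by (rule NV_diff[OF NV.add[OF NV.lin[OF lin.hyps(1) lin.IH] NV.scale[OF lin.hyps(2)]]
      NV.scale[OF NV_sum[OF NV.scale[OF NV_W[OF lin.hyps(2) reflections_subset]]]]])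
  finally show ?case .
next
  case (add f g)
  have "D b (\<lambda>x. f x + g x) = (\<lambda>x. D b f x + D b g x)" using NV_Pol add.hyps by (auto simp: D_add)
  then show ?case using NV.add[OF add.IH] by simp
qed

lemma NV_psub: "psub NV"
  unfolding psub_def
proof (intro conjI ballI allI impI subsetI, goal_cases)
  case (1 f) then show ?case by (rule NV_Pol)
next
  case 2 show ?case by (rule NV_zero)
next
  case (3 f g) then show ?case by (rule NV.add)
next
  case (4 a f) then show ?case by (rule NV.scale)
next
  case (5 w f) then show ?case by (rule NV_W[rotated])
next
  case (6 \<xi> f) then show ?case by (rule NV.lin[rotated])
next
  case (7 b f) then show ?case by (rule NV_D)
qed

lemma NV_nonzero: "nonzero_psub NV"
  unfolding nonzero_psub_def using NV_psub V_nonzero NV.base by blast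

lemma min_psub_NV: "min_psub \<subseteq> NV"
  by (rule min_psub_least[OF NV_nonzero])

lemma min_psub: "psub min_psub"
  using nonzero_min_psub c_pos by (simp add: nonzero_psub_def)

section \<open>Integrability on the generated submodule\<close>

lemma integrable_base:
  assumes "integrable lborel (\<lambda>x. cmod (p x * f x * g x) * wt x)" "p \<in> Pol" "f \<in> Pol" "g \<in> Pol"
  shows "integrable lborel (\<lambda>x. p x * f x * cnj (g x) * of_real (wt x))"
proof -
  have [measurable]: "p \<in> borel_measurable borel" "f \<in> borel_measurable borel" "g \<in> borel_measurable borel"
    using assms Pol_measurable by auto
  have [measurable]: "(\<lambda>x. cnj (g x)) \<in> borel_measurable borel"
    by (rule Pol_measurable[OF Pol_cnj[OF assms(4)]])
  have m: "(\<lambda>x. p x * f x * cnj (g x) * of_real (wt x)) \<in> borel_measurable lborel" by measurable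
  have "integrable lborel (\<lambda>x. norm (p x * f x * cnj (g x) * of_real (wt x)))"
    using assms(1) wt_nonneg by (simp add: norm_mult)
  then show ?thesis using integrable_norm_iff[OF m] by blast
qed

text \<open>A linear factor of the second argument is absorbed, conjugated, into the arbitrary
  polynomial \<open>p\<close>. \<open>F\<close> stands for an element of \<open>V\<close> or a
  derivative of one.\<close>

lemma integrable_extend:
  assumes base: "\<And>g p. g \<in> V \<Longrightarrow> p \<in> Pol \<Longrightarrow> integrable lborel (\<lambda>x. p x * F x * cnj (g x) * of_real (wt x))"
  shows "Q \<in> NV \<Longrightarrow> p \<in> Pol \<Longrightarrow> integrable lborel (\<lambda>x. p x * F x * cnj (Q x) * of_real (wt x))"
proof (induction Q arbitrary: p rule: NV.induct)
  case (base f)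
  then show ?case by (rule assms)
next
  case (scale f a)
  from scale.IH[OF Pol_scale[OF scale.prems, of "cnj a"]] show ?case by (simp add: mult_ac)
next
  case (lin \<xi> f)
  have "(\<lambda>x. p x * cnj (\<xi> x)) \<in> Pol" by (intro Pol_mult lin.prems Pol_cnj Pol_lin1 lin.hyps)
  from lin.IH[OF this] show ?case by (simp add: mult_ac)
next
  case (add f g)
  from Bochner_Integration.integrable_add[OF add.IH[OF add.prems]]
  show ?case by (simp add: algebra_simps)
qed

lemma integrable_NV:
  assumes Q: "Q \<in> NV"
  shows "P \<in> NV \<Longrightarrow> p \<in> Pol \<Longrightarrow> integrable lborel (\<lambda>x. p x * P x * cnj (Q x) * of_real (wt x))"
proof (induction P arbitrary: p rule: NV.induct)
  case (base f)
  show ?case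
    by (rule integrable_extend[OF integrable_base[OF V_integrable[OF base(1)]] Q base(2)])
      (use base V_Pol in auto)
next
  case (scale f a)
  from scale.IH[OF Pol_scale[OF scale.prems, of a]] show ?case by (simp add: mult_ac)
next
  case (lin \<xi> f)
  have "(\<lambda>x. p x * \<xi> x) \<in> Pol" by (intro Pol_mult lin.prems Pol_lin1 lin.hyps)
  from lin.IH[OF this] show ?case by (simp add: mult_ac)
next
  case (add f g)
  from Bochner_Integration.integrable_add[OF add.IH[OF add.prems]]
  show ?case by (simp add: algebra_simps)
qed

lemma integrable_NV_pd:
  assumes Q: "Q \<in> NV"
  shows "P \<in> NV \<Longrightarrow> p \<in> Pol \<Longrightarrow> integrable lborel (\<lambda>x. p x * pd b P x * cnj (Q x) * of_real (wt x))"
proof (induction P arbitrary: p rule: NV.induct)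
  case (base f)
  show ?case
    by (rule integrable_extend[OF integrable_base[OF V_integrable'[OF base(1)]] Q base(2)])
      (use base V_Pol Pol_pd in auto)
next
  case (scale f a)
  have "pd b (\<lambda>x. a * f x) = (\<lambda>x. a * pd b f x)" using NV_Pol[OF scale.hyps] by (auto simp: pd_scale)
  with scale.IH[OF Pol_scale[OF scale.prems, of a]] show ?case by (simp add: mult_ac)
next
  case (lin \<xi> f)
  have e: "pd b (\<lambda>x. \<xi> x * f x) = (\<lambda>x. \<xi> b * f x + \<xi> x * pd b f x)"
    using NV_Pol[OF lin.hyps(2)] lin.hyps(1) by (auto simp: pd_lin)
  have "(\<lambda>x. p x * \<xi> x) \<in> Pol" by (intro Pol_mult lin.prems Pol_lin1 lin.hyps)
  from Bochner_Integration.integrable_add[OF integrable_NV[OF Q lin.hyps(2) Pol_scale[OF lin.prems, of "\<xi> b"]] lin.IH[OF this]]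
  show ?case unfolding e by (simp add: algebra_simps)
next
  case (add f g)
  have e: "pd b (\<lambda>x. f x + g x) = (\<lambda>x. pd b f x + pd b g x)"
    using NV_Pol add.hyps by (auto simp: pd_add)
  from Bochner_Integration.integrable_add[OF add.IH[OF add.prems]]
  show ?case unfolding e by (simp add: algebra_simps)
qed

lemma integrable_NV1: "P \<in> NV \<Longrightarrow> Q \<in> NV \<Longrightarrow> integrable lborel (\<lambda>x. P x * cnj (Q x) * of_real (wt x))"
  using integrable_NV[of Q P "\<lambda>x. 1"] Pol.const[of 1] by simp

lemma integrable_NV_pd1: "P \<in> NV \<Longrightarrow> Q \<in> NV \<Longrightarrow> integrable lborel (\<lambda>x. pd b P x * cnj (Q x) * of_real (wt x))"
  using integrable_NV_pd[of Q P "\<lambda>x. 1"] Pol.const[of 1] by simp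

lemma integrable_NV_pd2: "P \<in> NV \<Longrightarrow> Q \<in> NV \<Longrightarrow> integrable lborel (\<lambda>x. P x * cnj (pd b Q x) * of_real (wt x))"
proof -
  assume "P \<in> NV" "Q \<in> NV"
  from integrable_bounded_linear[OF bounded_linear_cnj integrable_NV_pd1[OF this(2,1), of b]]
  show ?thesis by (simp add: mult.commute mult.left_commute)
qed

text \<open>\<open>\<psi> e (uu x)\<close> and \<open>damp e (uu x)\<close> are \<open>cutoff'\<close> and \<open>cutoff\<close> divided by the weight.\<close>

definition damp :: "real \<Rightarrow> real \<Rightarrow> real" where "damp e u = exp (- e / u)"
definition \<psi> :: "real \<Rightarrow> real \<Rightarrow> real" where "\<psi> e u = (e / u - c) / u * exp (- e / u)"

lemma damp_bound: "e > 0 \<Longrightarrow> \<bar>damp e (uu x)\<bar> \<le> 1"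
  using uu_nonneg[of x] by (simp add: damp_def)

lemma vdamp_bound: "e > 0 \<Longrightarrow> \<bar>e / uu x * damp e (uu x)\<bar> \<le> 1"
  using exp_neg_bounds(1)[of "e / uu x"] uu_nonneg[of x] by (simp add: damp_def)

text \<open>In the variable \<open>v = e / uu x\<close> the function is
  \<open>(v^2 - c * v) * exp (- v) / e\<close>, which is bounded uniformly in \<open>x\<close> for
  each fixed \<open>e\<close>.\<close>

lemma \<psi>_bound:
  assumes e: "e > 0"
  shows "\<bar>\<psi> e (uu x)\<bar> \<le> (2 + c) / e"
proof (cases "uu x = 0")
  case True
  then show ?thesis using e c_pos by (simp add: \<psi>_def)
next
  case False
  define v where "v = e / uu x"
  have v: "v > 0" "1 / uu x = v / e" using False e uu_nonneg[of x] by (auto simp: v_def)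
  have "\<psi> e (uu x) = ((v\<^sup>2 * exp (- v)) - c * (v * exp (- v))) / e"
  proof -
    have "\<psi> e (uu x) = (v - c) * (1 / uu x) * exp (- v)" by (simp add: \<psi>_def v_def)
    then show ?thesis unfolding v(2) using e by (simp add: field_simps power2_eq_square)
  qed
  also have "\<bar>\<dots>\<bar> \<le> (2 + c * 1) / e"
  proof -
    have "\<bar>v\<^sup>2 * exp (- v) - c * (v * exp (- v))\<bar> \<le> \<bar>v\<^sup>2 * exp (- v)\<bar> + \<bar>c * (v * exp (- v))\<bar>"
      by (rule abs_triangle_ineq4)
    also have "\<dots> = v\<^sup>2 * exp (- v) + c * (v * exp (- v))" using v c_pos by simp
    also have "\<dots> \<le> 2 + c * 1" using exp_neg_bounds[of v] v c_pos by (intro add_mono mult_left_mono) auto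
    finally show ?thesis using e by (simp add: divide_right_mono)
  qed
  finally show ?thesis by simp
qed

lemma uu_\<psi>: "uu x \<noteq> 0 \<Longrightarrow> uu x * \<psi> e (uu x) = (e / uu x - c) * damp e (uu x)"
  by (simp add: \<psi>_def damp_def)

lemma cutoff_wt: "cutoff c e (uu x) * exp (- (norm x)\<^sup>2 / 2) = damp e (uu x) * wt x"
  "cutoff' c e (uu x) * exp (- (norm x)\<^sup>2 / 2) = \<psi> e (uu x) * wt x"
  using uu_nonneg[of x] by (auto simp: cutoff_def cutoff'_def damp_def \<psi>_def wt_eq)

lemma measurable_damp\<psi> [measurable]: "(\<lambda>x. damp e (uu x)) \<in> borel_measurable borel"
  "(\<lambda>x. \<psi> e (uu x)) \<in> borel_measurable borel"
  unfolding damp_def \<psi>_def by measurable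

lemma integrable_damp: "e > 0 \<Longrightarrow> integrable lborel J \<Longrightarrow> integrable lborel (\<lambda>x. J x * of_real (damp e (uu x)))"
  for J :: "'a \<Rightarrow> complex"
  by (rule integrable_mult_of_real_bounded[of _ _ _ 1]) (auto simp: damp_bound)

lemma integrable_\<psi>: "e > 0 \<Longrightarrow> integrable lborel J \<Longrightarrow> integrable lborel (\<lambda>x. J x * of_real (\<psi> e (uu x)))"
  for J :: "'a \<Rightarrow> complex"
  by (rule integrable_mult_of_real_bounded[of _ _ _ "(2 + c) / e"]) (auto simp: \<psi>_bound)

text \<open>The logarithmic derivative of the weight produces \<open>1 / \<alpha> s\<close>; reflecting half of the integral
  turns this singular factor into divided differences.\<close>

lemma symmetrise:
  assumes P: "P \<in> NV" and Q: "Q \<in> NV" and s: "s \<in> reflections" and e: "e > 0"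
  shows "2 * (\<integral>x. of_real (cofactor s x) * P x * cnj (Q x) * of_real (wt x) * of_real (\<psi> e (uu x)) \<partial>lborel)
    = (\<integral>x. (dd s P x * cnj (Q x) + P x * cnj (dd s Q x)) * of_real (wt x) * of_real (uu x * \<psi> e (uu x)) \<partial>lborel)"
    and "integrable lborel (\<lambda>x. (dd s P x * cnj (Q x) + P x * cnj (dd s Q x)) * of_real (wt x) * of_real (uu x * \<psi> e (uu x)))"
proof -
  have sW: "s \<in> W" using s by (rule reflections_subset)
  let ?I = "\<lambda>A B x. of_real (cofactor s x) * A x * cnj (B x) * of_real (wt x) * complex_of_real (\<psi> e (uu x))"
  define Ps where "Ps = (\<lambda>x. P (s x))"
  define Qs where "Qs = (\<lambda>x. Q (s x))"
  have N: "Ps \<in> NV" "Qs \<in> NV" unfolding Ps_def Qs_def using NV_W[OF P sW] NV_W[OF Q sW] .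
  have int: "integrable lborel (?I A B)" if "A \<in> NV" "B \<in> NV" for A B
    by (rule integrable_\<psi>[OF e integrable_NV[OF that(2,1) Pol_cofactor[OF s]]])
  \<comment> \<open>The reflection changes the sign of the cofactor and fixes the weight. Where
    \<open>uu\<close> vanishes, \<open>\<psi>\<close> is \<open>0\<close> because division by zero
    gives \<open>0\<close>.\<close>
  have flip: "?I Ps Q (s x) = - ?I P Qs x" for x
  proof (cases "uu x = 0")
    case True
    then show ?thesis using uu_W[OF sW, of x] by (simp add: \<psi>_def)
  next
    case False
    have 1: "\<alpha> s x * cofactor s x = uu x" by (rule cofactor_mult[OF s])
    have "\<alpha> s (s x) * cofactor s (s x) = uu (s x)" by (rule cofactor_mult[OF s])
    then have "- \<alpha> s x * cofactor s (s x) = \<alpha> s x * cofactor s x"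
      using 1 uu_W[OF sW, of x] \<alpha>_reflection[OF s, of x] by simp
    then have "\<alpha> s x * (cofactor s (s x) + cofactor s x) = 0" by (simp add: algebra_simps)
    moreover have "\<alpha> s x \<noteq> 0" using False 1 by auto
    ultimately have "cofactor s (s x) = - cofactor s x" by simp
    then show ?thesis
      using uu_W[OF sW, of x] wt_W[OF sW, of x] reflection_invol[OF s, of x] by (simp add: Ps_def Qs_def)
  qed
  have meas: "?I Ps Q \<in> borel_measurable borel" using int[OF N(1) Q] by simp
  have "(\<integral>x. ?I Ps Q (s x) \<partial>lborel) = (\<integral>x. ?I Ps Q x \<partial>lborel)"
    by (rule integral_orthogonal(2)[OF orthogonal_W[OF sW] meas])
  then have anti: "(\<integral>x. ?I Ps Q x \<partial>lborel) = - (\<integral>x. ?I P Qs x \<partial>lborel)"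
    unfolding flip by simp
  \<comment> \<open>\<open>uu\<close> times a divided difference is the cofactor times the
    difference of the function and its reflection. Of the four terms, the two mixed ones cancel
    after integration by \<open>anti\<close>.\<close>
  have eq: "(dd s P x * cnj (Q x) + P x * cnj (dd s Q x)) * of_real (wt x) * of_real (uu x * \<psi> e (uu x))
     = (?I P Q x - ?I Ps Q x) + (?I P Q x - ?I P Qs x)" for x
  proof -
    have "complex_of_real (uu x) * dd s P x = of_real (cofactor s x) * (P x - Ps x)"
      using dd_eq[OF s NV_Pol[OF P], of x] unfolding cofactor_mult[OF s, of x, symmetric] Ps_def
      by (simp add: mult_ac)
    moreover have "complex_of_real (uu x) * cnj (dd s Q x) = of_real (cofactor s x) * (cnj (Q x) - cnj (Qs x))"
      using arg_cong[OF dd_eq[OF s NV_Pol[OF Q], of x], of cnj] unfolding cofactor_mult[OF s, of x, symmetric] Qs_def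
      by (simp add: mult_ac)
    ultimately have "(dd s P x * cnj (Q x) + P x * cnj (dd s Q x)) * complex_of_real (uu x)
      = of_real (cofactor s x) * (P x - Ps x) * cnj (Q x) + P x * (of_real (cofactor s x) * (cnj (Q x) - cnj (Qs x)))"
    proof -
      assume a: "complex_of_real (uu x) * dd s P x = of_real (cofactor s x) * (P x - Ps x)"
        "complex_of_real (uu x) * cnj (dd s Q x) = of_real (cofactor s x) * (cnj (Q x) - cnj (Qs x))"
      have "(dd s P x * cnj (Q x) + P x * cnj (dd s Q x)) * complex_of_real (uu x)
        = (complex_of_real (uu x) * dd s P x) * cnj (Q x) + P x * (complex_of_real (uu x) * cnj (dd s Q x))"
        by (simp add: algebra_simps)
      then show ?thesis unfolding a .
    qed
    then have "(dd s P x * cnj (Q x) + P x * cnj (dd s Q x)) * complex_of_real (uu x) * (of_real (wt x) * of_real (\<psi> e (uu x)))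
      = (of_real (cofactor s x) * (P x - Ps x) * cnj (Q x) + P x * (of_real (cofactor s x) * (cnj (Q x) - cnj (Qs x))))
        * (of_real (wt x) * of_real (\<psi> e (uu x)))" by simp
    then show ?thesis by (simp add: algebra_simps)
  qed
  show "integrable lborel (\<lambda>x. (dd s P x * cnj (Q x) + P x * cnj (dd s Q x)) * of_real (wt x) * of_real (uu x * \<psi> e (uu x)))"
    unfolding eq by (intro Bochner_Integration.integrable_add Bochner_Integration.integrable_diff int P Q N)
  have "(\<integral>x. (dd s P x * cnj (Q x) + P x * cnj (dd s Q x)) * of_real (wt x) * of_real (uu x * \<psi> e (uu x)) \<partial>lborel)
    = ((\<integral>x. ?I P Q x \<partial>lborel) - (\<integral>x. ?I Ps Q x \<partial>lborel)) + ((\<integral>x. ?I P Q x \<partial>lborel) - (\<integral>x. ?I P Qs x \<partial>lborel))"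
    unfolding eq by (rule integral_diff_add_diff[OF int[OF P Q] int[OF N(1) Q] int[OF P N(2)]])
  then show "2 * (\<integral>x. ?I P Q x \<partial>lborel)
    = (\<integral>x. (dd s P x * cnj (Q x) + P x * cnj (dd s Q x)) * of_real (wt x) * of_real (uu x * \<psi> e (uu x)) \<partial>lborel)"
    unfolding anti by simp
qed

text \<open>The integral of the derivative of \<open>P * cnj Q\<close> times the regularised weight
  vanishes. \<open>J1\<close> is the defect in the adjointness sought. \<open>J2\<close> carries
  what the cutoff adds, with a factor \<open>e / u * exp (- e / u)\<close> that is bounded and tends
  to \<open>0\<close> with \<open>e\<close>.\<close>

lemma regularised_adjoint:
  fixes b :: 'a
  assumes P: "P \<in> NV" and Q: "Q \<in> NV" and e: "e > 0"
  defines "J1 \<equiv> \<lambda>x. (D b P x * cnj (Q x) + P x * cnj (D b Q x) - of_real (x \<bullet> b) * P x * cnj (Q x)) * of_real (wt x)"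
    and "J2 \<equiv> \<lambda>x. ((pd b P x - D b P x) * cnj (Q x) + P x * cnj (pd b Q x - D b Q x)) / of_real c * of_real (wt x)"
  shows "(\<integral>x. J1 x * of_real (damp e (uu x)) + J2 x * of_real (e / uu x * damp e (uu x)) \<partial>lborel) = 0"
proof -
  have PP: "P \<in> Pol" "Q \<in> Pol" using P Q NV_Pol by auto
  let ?E = "\<lambda>x::'a. exp (- (norm x)\<^sup>2 / 2)"
  define G where "G x = P x * cnj (Q x) * of_real (cutoff c e (uu x) * ?E x)" for x
  define A1 where "A1 x = (pd b P x * cnj (Q x) + P x * cnj (pd b Q x) - of_real (x \<bullet> b) * P x * cnj (Q x)) * of_real (wt x)" for x
  define B where "B s x = of_real (cofactor s x) * P x * cnj (Q x) * of_real (wt x)" for s x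
  define G' where "G' x = A1 x * of_real (damp e (uu x)) + 2 * (\<Sum>s\<in>reflections. of_real (\<alpha> s b) * (B s x * of_real (\<psi> e (uu x))))" for x
  have G_eq: "G x = P x * cnj (Q x) * of_real (wt x) * of_real (damp e (uu x))" for x
    unfolding G_def cutoff_wt by (simp add: mult_ac)
  have intG: "integrable lborel G" unfolding G_eq by (intro integrable_damp e integrable_NV1 P Q)
  have intA1: "integrable lborel A1"
  proof -
    have "integrable lborel (\<lambda>x. pd b P x * cnj (Q x) * of_real (wt x) + P x * cnj (pd b Q x) * of_real (wt x)
       - of_real (x \<bullet> b) * P x * cnj (Q x) * of_real (wt x))"
      by (intro Bochner_Integration.integrable_add Bochner_Integration.integrable_diff integrable_NV_pd1 integrable_NV_pd2
          integrable_NV P Q Pol_lin1 linear_xb)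
    then show ?thesis unfolding A1_def by (simp add: algebra_simps)
  qed
  have intB: "integrable lborel (\<lambda>x. B s x * of_real (\<psi> e (uu x)))" if "s \<in> reflections" for s
    unfolding B_def by (rule integrable_\<psi>[OF e integrable_NV[OF Q P Pol_cofactor[OF that]]])
  have intG': "integrable lborel G'"
    unfolding G'_def by (intro Bochner_Integration.integrable_add integrable_damp e intA1 integrable_mult_right
        Bochner_Integration.integrable_sum intB)
  have deriv: "((\<lambda>t. G (x + t *\<^sub>R b)) has_vector_derivative G' (x + t *\<^sub>R b)) (at t)" for x t
  proof -
    let ?y = "x + t *\<^sub>R b"
    have dPQ: "((\<lambda>t. P (x + t *\<^sub>R b) * cnj (Q (x + t *\<^sub>R b))) has_vector_derivative
       P ?y * cnj (pd b Q ?y) + pd b P ?y * cnj (Q ?y)) (at t)"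
      by (intro has_vector_derivative_mult has_vector_derivative_cnj Pol_has_pd PP)
    have dE: "((\<lambda>t. ?E (x + t *\<^sub>R b)) has_real_derivative (- (?y \<bullet> b)) * ?E ?y) (at t)"
    proof -
      have n: "(norm (x + t *\<^sub>R b))\<^sup>2 = x \<bullet> x + 2 * t * (x \<bullet> b) + t\<^sup>2 * (b \<bullet> b)" for t
        unfolding power2_norm_eq_inner
        by (simp add: inner_add_left inner_add_right inner_commute power2_eq_square algebra_simps)
      define q where "q t = x \<bullet> x + 2 * t * (x \<bullet> b) + t\<^sup>2 * (b \<bullet> b)" for t
      have "((\<lambda>t. - q t / 2) has_real_derivative - (?y \<bullet> b)) (at t)"
        unfolding q_def by (auto intro!: derivative_eq_intros simp: inner_add_left field_simps)
      from DERIV_chain2[OF DERIV_exp this] show ?thesis unfolding n q_def[symmetric] by (simp add: mult.commute)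
    qed
    have dC: "((\<lambda>t. cutoff c e (uu (x + t *\<^sub>R b))) has_real_derivative
       cutoff' c e (uu ?y) * (2 * (\<Sum>s\<in>reflections. \<alpha> s b * cofactor s ?y))) (at t)"
      by (rule DERIV_chain2[OF cutoff_deriv[OF e] uu_deriv])
    have dCE: "((\<lambda>t. cutoff c e (uu (x + t *\<^sub>R b)) * ?E (x + t *\<^sub>R b)) has_real_derivative
       cutoff c e (uu ?y) * ((- (?y \<bullet> b)) * ?E ?y) + cutoff' c e (uu ?y) * (2 * (\<Sum>s\<in>reflections. \<alpha> s b * cofactor s ?y)) * ?E ?y) (at t)"
      using DERIV_mult'[OF dC dE] by simp
    have dCE_eq: "cutoff c e (uu ?y) * ((- (?y \<bullet> b)) * ?E ?y) + cutoff' c e (uu ?y) * (2 * (\<Sum>s\<in>reflections. \<alpha> s b * cofactor s ?y)) * ?E ?y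
      = - (?y \<bullet> b) * (damp e (uu ?y) * wt ?y) + 2 * (\<Sum>s\<in>reflections. \<alpha> s b * cofactor s ?y) * (\<psi> e (uu ?y) * wt ?y)"
      unfolding cutoff_wt[symmetric] by (simp add: mult_ac)
    have dCE': "((\<lambda>t. complex_of_real (cutoff c e (uu (x + t *\<^sub>R b)) * ?E (x + t *\<^sub>R b))) has_vector_derivative
       of_real (- (?y \<bullet> b) * (damp e (uu ?y) * wt ?y) + 2 * (\<Sum>s\<in>reflections. \<alpha> s b * cofactor s ?y) * (\<psi> e (uu ?y) * wt ?y))) (at t)"
      by (rule has_vector_derivative_of_real) (use dCE[unfolded dCE_eq] in \<open>simp add: has_real_derivative_iff_has_vector_derivative\<close>)
    have "((\<lambda>t. G (x + t *\<^sub>R b)) has_vector_derivative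
       (P ?y * cnj (Q ?y)) * of_real (- (?y \<bullet> b) * (damp e (uu ?y) * wt ?y) + 2 * (\<Sum>s\<in>reflections. \<alpha> s b * cofactor s ?y) * (\<psi> e (uu ?y) * wt ?y))
       + (P ?y * cnj (pd b Q ?y) + pd b P ?y * cnj (Q ?y)) * of_real (cutoff c e (uu ?y) * ?E ?y)) (at t)"
      unfolding G_def by (rule has_vector_derivative_mult[OF dPQ dCE'])
    also have "(P ?y * cnj (Q ?y)) * of_real (- (?y \<bullet> b) * (damp e (uu ?y) * wt ?y) + 2 * (\<Sum>s\<in>reflections. \<alpha> s b * cofactor s ?y) * (\<psi> e (uu ?y) * wt ?y))
       + (P ?y * cnj (pd b Q ?y) + pd b P ?y * cnj (Q ?y)) * of_real (cutoff c e (uu ?y) * ?E ?y) = G' ?y"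
    proof -
      have "(\<Sum>s\<in>reflections. of_real (\<alpha> s b) * (B s ?y * of_real (\<psi> e (uu ?y))))
        = of_real (\<Sum>s\<in>reflections. \<alpha> s b * cofactor s ?y) * (P ?y * cnj (Q ?y) * of_real (wt ?y) * of_real (\<psi> e (uu ?y)))"
        unfolding of_real_sum sum_distrib_right B_def by (intro sum.cong refl) (simp add: mult_ac)
      then show ?thesis unfolding cutoff_wt G'_def A1_def by (simp add: algebra_simps)
    qed
    finally show ?thesis .
  qed
  have "(\<integral>x. G' x \<partial>lborel) = 0"
    by (rule integral_directional_derivative[OF intG intG' deriv])
  let ?S = "\<lambda>s x. (dd s P x * cnj (Q x) + P x * cnj (dd s Q x)) * complex_of_real (wt x) * of_real (uu x * \<psi> e (uu x))"
  have "(\<integral>x. G' x \<partial>lborel) = (\<integral>x. A1 x * of_real (damp e (uu x)) \<partial>lborel)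
      + (\<Sum>s\<in>reflections. of_real (\<alpha> s b) * (2 * (\<integral>x. B s x * of_real (\<psi> e (uu x)) \<partial>lborel)))"
  proof -
    have G'_eq: "G' x = A1 x * of_real (damp e (uu x)) + (\<Sum>s\<in>reflections. of_real (\<alpha> s b) * (2 * (B s x * of_real (\<psi> e (uu x)))))" for x
      by (simp only: G'_def sum_distrib_left mult.left_commute)
    have "(\<integral>x. G' x \<partial>lborel) = (\<integral>x. A1 x * of_real (damp e (uu x)) \<partial>lborel)
      + (\<integral>x. (\<Sum>s\<in>reflections. of_real (\<alpha> s b) * (2 * (B s x * of_real (\<psi> e (uu x))))) \<partial>lborel)"
      unfolding G'_eq by (intro Bochner_Integration.integral_add integrable_damp e intA1
          Bochner_Integration.integrable_sum integrable_mult_right intB)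
    also have "(\<integral>x. (\<Sum>s\<in>reflections. of_real (\<alpha> s b) * (2 * (B s x * of_real (\<psi> e (uu x))))) \<partial>lborel)
      = (\<Sum>s\<in>reflections. \<integral>x. of_real (\<alpha> s b) * (2 * (B s x * of_real (\<psi> e (uu x)))) \<partial>lborel)"
      by (intro Bochner_Integration.integral_sum integrable_mult_right intB)
    finally show ?thesis unfolding Bochner_Integration.integral_mult_right_zero .
  qed
  also have "(\<Sum>s\<in>reflections. of_real (\<alpha> s b) * (2 * (\<integral>x. B s x * of_real (\<psi> e (uu x)) \<partial>lborel)))
      = (\<Sum>s\<in>reflections. of_real (\<alpha> s b) * (\<integral>x. ?S s x \<partial>lborel))"
    unfolding B_def by (intro sum.cong refl) (simp only: symmetrise(1)[OF P Q _ e])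
  also have "\<dots> = (\<integral>x. (\<Sum>s\<in>reflections. of_real (\<alpha> s b) * ?S s x) \<partial>lborel)"
    using symmetrise(2)[OF P Q _ e] by (simp add: Bochner_Integration.integral_sum)
  also have "(\<integral>x. A1 x * of_real (damp e (uu x)) \<partial>lborel) + (\<integral>x. (\<Sum>s\<in>reflections. of_real (\<alpha> s b) * ?S s x) \<partial>lborel)
    = (\<integral>x. A1 x * of_real (damp e (uu x)) + (\<Sum>s\<in>reflections. of_real (\<alpha> s b) * ?S s x) \<partial>lborel)"
    using symmetrise(2)[OF P Q _ e] intA1 integrable_damp[OF e] by (subst Bochner_Integration.integral_add) auto
  also have "\<dots> = (\<integral>x. J1 x * of_real (damp e (uu x)) + J2 x * of_real (e / uu x * damp e (uu x)) \<partial>lborel)"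
  proof (rule Bochner_Integration.integral_cong[OF refl])
    fix x
    have dP: "of_real c * (\<Sum>s\<in>reflections. of_real (\<alpha> s b) * dd s f x) = pd b f x - D b f x" for f
      by (simp add: D_def)
    have "(\<Sum>s\<in>reflections. of_real (\<alpha> s b) * ?S s x)
      = ((\<Sum>s\<in>reflections. of_real (\<alpha> s b) * dd s P x) * cnj (Q x) + P x * cnj (\<Sum>s\<in>reflections. of_real (\<alpha> s b) * dd s Q x))
        * of_real (wt x) * of_real (uu x * \<psi> e (uu x))"
      unfolding cnj_sum sum_distrib_left sum_distrib_right sum.distrib[symmetric]
      by (intro sum.cong refl) (simp add: algebra_simps)
    also have "\<dots> = J2 x * of_real (uu x * \<psi> e (uu x))"
    proof -
      have s: "(\<Sum>s\<in>reflections. of_real (\<alpha> s b) * dd s f x) = (pd b f x - D b f x) / of_real c" for f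
        using dP[of f] c_pos by (simp add: field_simps)
      show ?thesis unfolding s J2_def by (simp add: add_divide_distrib)
    qed
    finally have S: "(\<Sum>s\<in>reflections. of_real (\<alpha> s b) * ?S s x) = J2 x * of_real (uu x * \<psi> e (uu x))" .
    show "A1 x * of_real (damp e (uu x)) + (\<Sum>s\<in>reflections. of_real (\<alpha> s b) * ?S s x)
      = J1 x * of_real (damp e (uu x)) + J2 x * of_real (e / uu x * damp e (uu x))"
    \<comment> \<open>Where \<open>uu\<close> vanishes so does \<open>wt\<close>, because
      \<open>0\<close> to any real power under \<open>powr\<close> is \<open>0\<close>.\<close>
    proof (cases "uu x = 0")
      case True
      then show ?thesis unfolding S by (simp add: A1_def J1_def J2_def wt_eq)
    next
      case False
      \<comment> \<open>By \<open>uu_\<psi>\<close> the reflection sum is \<open>J2\<close> times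
        \<open>(e / uu x - c) * damp e (uu x)\<close>; its part with \<open>- c\<close> cancels this
        multiple of \<open>J2\<close>.\<close>
      have "A1 x = J1 x + of_real c * J2 x"
      proof -
        have "of_real c * J2 x = ((pd b P x - D b P x) * cnj (Q x) + P x * cnj (pd b Q x - D b Q x)) * of_real (wt x)"
          using c_pos by (simp add: J2_def)
        then show ?thesis by (simp add: A1_def J1_def algebra_simps)
      qed
      then show ?thesis unfolding S unfolding uu_\<psi>[OF False] by (simp add: algebra_simps)
    qed
  qed
  finally show ?thesis using \<open>(\<integral>x. G' x \<partial>lborel) = 0\<close> by simp
qed

text \<open>Dominated convergence in \<open>regularised_adjoint\<close> along
  \<open>e = 1 / (n + 1)\<close>. Both damping factors are at most \<open>1\<close>, so
  \<open>cmod (J1 x) + cmod (J2 x)\<close> dominates.\<close>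

lemma D_adjoint:
  assumes P: "P \<in> NV" and Q: "Q \<in> NV"
  shows "(\<integral>x. (D b P x * cnj (Q x) + P x * cnj (D b Q x) - of_real (x \<bullet> b) * P x * cnj (Q x)) * of_real (wt x) \<partial>lborel) = 0"
proof -
  define J1 where "J1 = (\<lambda>x. (D b P x * cnj (Q x) + P x * cnj (D b Q x) - of_real (x \<bullet> b) * P x * cnj (Q x)) * of_real (wt x))"
  define J2 where "J2 = (\<lambda>x. ((pd b P x - D b P x) * cnj (Q x) + P x * cnj (pd b Q x - D b Q x)) / of_real c * of_real (wt x))"
  have i1: "integrable lborel J1"
  proof -
    have "integrable lborel (\<lambda>x. D b P x * cnj (Q x) * of_real (wt x) + P x * cnj (D b Q x) * of_real (wt x)
       - of_real (x \<bullet> b) * P x * cnj (Q x) * of_real (wt x))"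
      by (intro Bochner_Integration.integrable_add Bochner_Integration.integrable_diff integrable_NV1
          integrable_NV P Q NV_D Pol_lin1 linear_xb)
    then show ?thesis unfolding J1_def by (simp add: algebra_simps)
  qed
  have i2: "integrable lborel J2"
  proof -
    have "integrable lborel (\<lambda>x. ((pd b P x * cnj (Q x) * of_real (wt x) - D b P x * cnj (Q x) * of_real (wt x))
        + (P x * cnj (pd b Q x) * of_real (wt x) - P x * cnj (D b Q x) * of_real (wt x))) / of_real c)"
      by (intro Bochner_Integration.integrable_add Bochner_Integration.integrable_diff integrable_NV1 integrable_NV_pd1
          integrable_NV_pd2 integrable_divide P Q NV_D)
    then show ?thesis unfolding J2_def by (simp add: algebra_simps add_divide_distrib diff_divide_distrib)
  qed
  define F where "F n x = J1 x * of_real (damp (1 / real (Suc n)) (uu x)) + J2 x * of_real ((1 / real (Suc n)) / uu x * damp (1 / real (Suc n)) (uu x))" for n x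
  have "(\<lambda>n. \<integral>x. F n x \<partial>lborel) \<longlonglongrightarrow> (\<integral>x. J1 x \<partial>lborel)"
  proof (rule integral_dominated_convergence[where w = "\<lambda>x. cmod (J1 x) + cmod (J2 x)"])
    have [measurable]: "J1 \<in> borel_measurable lborel" "J2 \<in> borel_measurable lborel" using i1 i2 by auto
    show "J1 \<in> borel_measurable lborel" by simp
    show "F n \<in> borel_measurable lborel" for n unfolding F_def by measurable
    show "integrable lborel (\<lambda>x. cmod (J1 x) + cmod (J2 x))" using i1 i2 by simp
    show "AE x in lborel. (\<lambda>n. F n x) \<longlonglongrightarrow> J1 x"
      using AE_uu
    proof eventually_elim
      case (elim x)
      have "(\<lambda>n. (1 / real (Suc n)) / uu x) \<longlonglongrightarrow> 0 / uu x"
        by (intro tendsto_divide LIMSEQ_Suc[OF lim_1_over_n] tendsto_const elim)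
      then have v: "(\<lambda>n. (1 / real (Suc n)) / uu x) \<longlonglongrightarrow> 0" by simp
      have "(\<lambda>n. exp (- ((1 / real (Suc n)) / uu x))) \<longlonglongrightarrow> exp (- 0)"
        by (intro tendsto_exp tendsto_minus v)
      then have ch: "(\<lambda>n. damp (1 / real (Suc n)) (uu x)) \<longlonglongrightarrow> 1" by (simp add: damp_def)
      have "(\<lambda>n. F n x) \<longlonglongrightarrow> J1 x * of_real 1 + J2 x * of_real (0 * 1)"
        unfolding F_def by (intro tendsto_intros ch v)
      then show ?case by simp
    qed
    show "AE x in lborel. cmod (F n x) \<le> cmod (J1 x) + cmod (J2 x)" for n
    proof (rule AE_I2)
      fix x
      have "cmod (J1 x * of_real (damp (1 / real (Suc n)) (uu x))) \<le> cmod (J1 x) * 1"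
        unfolding norm_mult norm_of_real by (intro mult_left_mono damp_bound) auto
      moreover have "cmod (J2 x * of_real ((1 / real (Suc n)) / uu x * damp (1 / real (Suc n)) (uu x))) \<le> cmod (J2 x) * 1"
        unfolding norm_mult[of "J2 x"] norm_of_real by (intro mult_left_mono vdamp_bound) auto
      ultimately show "cmod (F n x) \<le> cmod (J1 x) + cmod (J2 x)"
        unfolding F_def using norm_triangle_ineq[of "J1 x * of_real (damp (1 / real (Suc n)) (uu x))"
          "J2 x * of_real ((1 / real (Suc n)) / uu x * damp (1 / real (Suc n)) (uu x))"] by linarith
    qed
  qed
  moreover have "(\<integral>x. F n x \<partial>lborel) = 0" for n
    unfolding F_def J1_def J2_def by (rule regularised_adjoint[OF P Q]) simp
  ultimately have "(\<lambda>n::nat. 0) \<longlonglongrightarrow> (\<integral>x. J1 x \<partial>lborel)" by simp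
  then have "(\<integral>x. J1 x \<partial>lborel) = 0" using LIMSEQ_unique tendsto_const by blast
  then show ?thesis by (simp add: J1_def)
qed

section \<open>The L2 product and its positivity\<close>

definition \<gamma> :: "('a \<Rightarrow> complex) \<Rightarrow> ('a \<Rightarrow> complex) \<Rightarrow> complex" where
  "\<gamma> P Q = (\<integral>x. P x * cnj (Q x) * of_real (wt x) \<partial>lborel)"

text \<open>A nonzero \<open>P\<close> has no zero on some ball avoiding the reflecting hyperplanes.
  There the weight is positive, and the ball has positive measure.\<close>

lemma \<gamma>_pos:
  assumes P: "P \<in> NV" "P \<noteq> (\<lambda>x. 0)"
  shows "Re (\<gamma> P P) > 0"
proof -
  have PP: "P \<in> Pol" using P NV_Pol by auto
  have eq: "P x * cnj (P x) * of_real (wt x) = of_real ((cmod (P x))\<^sup>2 * wt x)" for x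
    by (simp only: complex_norm_square of_real_mult)
  have int: "integrable lborel (\<lambda>x. (cmod (P x))\<^sup>2 * wt x)"
  proof -
    have "integrable lborel (\<lambda>x. complex_of_real ((cmod (P x))\<^sup>2 * wt x))"
      using integrable_NV1[OF P(1) P(1)] unfolding eq .
    from integrable_bounded_linear[OF bounded_linear_Re this]
    have "integrable lborel (\<lambda>x. Re (complex_of_real ((cmod (P x))\<^sup>2 * wt x)))" .
    then show ?thesis unfolding Re_complex_of_real .
  qed
  have "\<gamma> P P = of_real (\<integral>x. (cmod (P x))\<^sup>2 * wt x \<partial>lborel)"
    unfolding \<gamma>_def eq by (rule integral_of_real[OF int])
  then have g: "Re (\<gamma> P P) = (\<integral>x. (cmod (P x))\<^sup>2 * wt x \<partial>lborel)" by simp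
  have nn: "(\<integral>x. (cmod (P x))\<^sup>2 * wt x \<partial>lborel) \<ge> 0"
    by (intro integral_nonneg_AE AE_I2) (simp add: wt_nonneg)
  have "(\<integral>x. (cmod (P x))\<^sup>2 * wt x \<partial>lborel) \<noteq> 0"
  proof
    assume "(\<integral>x. (cmod (P x))\<^sup>2 * wt x \<partial>lborel) = 0"
    then have ae: "AE x in lborel. (cmod (P x))\<^sup>2 * wt x = 0"
      using integral_nonneg_eq_0_iff_AE[OF int] by (simp add: wt_nonneg)
    obtain z where z: "uu z \<noteq> 0" using uu_nonzero by blast
    have "\<exists>x. P x * of_real (uu x) \<noteq> 0"
    proof (rule ccontr)
      assume "\<not> ?thesis"
      then have "P x = 0" for x using Pol_domain[OF PP Pol_uu, of z x] z by auto
      then show False using P(2) by auto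
    qed
    then obtain x0 where x0: "P x0 * of_real (uu x0) \<noteq> 0" by blast
    define S where "S = {x. P x * of_real (uu x) \<noteq> 0}"
    have "continuous_on UNIV (\<lambda>x. P x * of_real (uu x))" by (rule Pol_continuous[OF Pol_mult[OF PP Pol_uu]])
    then have "open S" unfolding S_def by (intro open_Collect_neq) auto
    moreover have "x0 \<in> S" unfolding S_def using x0 by (rule CollectI)
    ultimately obtain r where r: "r > 0" "ball x0 r \<subseteq> S" by (rule openE)
    have "AE x in lborel. x \<notin> ball x0 r"
      using ae
    proof eventually_elim
      case (elim x)
      show ?case
      proof
        assume "x \<in> ball x0 r"
        then have "P x \<noteq> 0" "uu x \<noteq> 0" using r by (auto simp: S_def)
        then show False using elim wt_pos[of x] by simp
      qed
    qed
    then have "emeasure lborel (ball x0 r) = 0"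
      by (subst (asm) AE_iff_measurable[of "ball x0 r"]) auto
    then have "unit_ball_vol (real DIM('a)) * r ^ DIM('a) \<le> 0"
      using r(1) by (simp add: emeasure_ball ennreal_eq_0_iff)
    moreover have "unit_ball_vol (real DIM('a)) * r ^ DIM('a) > 0"
      using r(1) by (intro mult_pos_pos unit_ball_vol_pos zero_less_power) auto
    ultimately show False by linarith
  qed
  then show ?thesis using g nn by linarith
qed

lemma gauss_form_\<gamma>:
  assumes U: "psub U" "U \<subseteq> NV"
  shows "gauss_form U \<gamma>"
  unfolding gauss_form_def
proof (intro conjI ballI allI impI)
  have UN: "f \<in> U \<Longrightarrow> f \<in> NV" for f using U(2) by blast
  note int = integrable_NV1[OF UN UN]
  show "herm_form U \<gamma>"
  proof (rule herm_form.intro, goal_cases)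
    case 1 show ?case by (rule psubD(2)[OF U(1)])
  next
    case (2 f g) then show ?case by (rule psubD(3)[OF U(1)])
  next
    case (3 f a) then show ?case by (rule psubD(4)[OF U(1)])
  next
    case (4 f g h)
    have "\<gamma> (\<lambda>x. f x + g x) h = (\<integral>x. f x * cnj (h x) * of_real (wt x) + g x * cnj (h x) * of_real (wt x) \<partial>lborel)"
      by (simp add: \<gamma>_def algebra_simps)
    then show ?case using int 4 by (simp add: \<gamma>_def)
  next
    case (5 f h a)
    have "\<gamma> (\<lambda>x. a * f x) h = (\<integral>x. a * (f x * cnj (h x) * of_real (wt x)) \<partial>lborel)"
      by (simp add: \<gamma>_def algebra_simps)
    then show ?case by (simp add: \<gamma>_def)
  next
    case (6 f h)
    have "cnj (\<gamma> f h) = (\<integral>x. cnj (f x * cnj (h x) * of_real (wt x)) \<partial>lborel)"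
      unfolding \<gamma>_def by (rule Bochner_Integration.integral_cnj[symmetric])
    then show ?case by (simp add: \<gamma>_def mult.commute)
  qed
  fix w f g assume w: "w \<in> W" and f: "f \<in> U" and g: "g \<in> U"
  show "\<gamma> (\<lambda>x. f (w x)) (\<lambda>x. g (w x)) = \<gamma> f g"
    using integral_orthogonal(2)[OF orthogonal_W[OF w], of "\<lambda>x. f x * cnj (g x) * of_real (wt x)"] int[OF f g]
    by (simp add: \<gamma>_def wt_W[OF w])
next
  fix a f g assume fU: "f \<in> U" and gU: "g \<in> U"
  then have f: "f \<in> NV" and g: "g \<in> NV" using U(2) by auto
  have i1: "integrable lborel (\<lambda>x. D a f x * cnj (g x) * of_real (wt x))"
    and i2: "integrable lborel (\<lambda>x. f x * cnj (D a g x) * of_real (wt x))"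
    using integrable_NV1 NV_D f g by blast+
  have i3: "integrable lborel (\<lambda>x. of_real (x \<bullet> a) * f x * cnj (g x) * of_real (wt x))"
    by (intro integrable_NV f g Pol_lin1 linear_xb)
  have "(\<integral>x. D a f x * cnj (g x) * of_real (wt x) + f x * cnj (D a g x) * of_real (wt x)
      - of_real (x \<bullet> a) * f x * cnj (g x) * of_real (wt x) \<partial>lborel) = 0"
    using D_adjoint[OF f g, of a] by (simp add: algebra_simps)
  then have "\<gamma> (D a f) g + \<gamma> f (D a g) - (\<integral>x. of_real (x \<bullet> a) * f x * cnj (g x) * of_real (wt x) \<partial>lborel) = 0"
    using i1 i2 i3 by (simp add: \<gamma>_def)
  then show "\<gamma> (D a f) g + \<gamma> f (D a g) = \<gamma> f (\<lambda>x. of_real (x \<bullet> a) * g x)"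
    by (simp add: \<gamma>_def mult_ac)
next
  fix f assume "f \<in> U" "f \<noteq> (\<lambda>x. 0)"
  then show "Re (\<gamma> f f) > 0" using \<gamma>_pos U(2) by blast
qed

theorem unitary_N_min: "unitary N_min"
  by (rule unitary_of_gauss_form[OF _ gauss_form_\<gamma>[OF min_psub min_psub_NV]]) (use c_pos in simp)

theorem L2_N_min: "contained_in_L2 N_min"
  unfolding contained_in_L2_def
proof
  fix P assume "P \<in> polynomials N_min"
  then have P: "P \<in> NV"
    using N_min_eq c_pos polynomials_image[of min_psub] psubD(1)[OF min_psub] min_psub_NV by fastforce
  have [measurable]: "P \<in> borel_measurable borel" by (rule Pol_measurable[OF NV_Pol[OF P]])
  have "(\<integral>\<^sup>+z. ennreal ((cmod (P z))\<^sup>2) \<partial>mu) = (\<integral>\<^sup>+z. ennreal (wt z) * ennreal ((cmod (P z))\<^sup>2) \<partial>lborel)"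
    unfolding mu_eq by (rule nn_integral_density) measurable
  also have "\<dots> = (\<integral>\<^sup>+z. ennreal (norm (P z * cnj (P z) * of_real (wt z))) \<partial>lborel)"
    by (intro nn_integral_cong) (simp add: norm_mult wt_nonneg power2_eq_square ennreal_mult mult_ac)
  also have "\<dots> < \<infinity>"
    using integrable_NV1[OF P P] by (simp add: integrable_iff_bounded)
  finally show "(\<integral>\<^sup>+z. ennreal ((cmod (P z))\<^sup>2) \<partial>mu) < \<infinity>" .
qed

end

section \<open>Partial fractions\<close>

text \<open>In the application \<open>p\<close> is the value at \<open>t\<close> of an affine
  function of slope \<open>q\<close>, and \<open>a\<close> and \<open>b\<close> are \<open>t\<close>
  minus a root. Then \<open>p - q * a\<close> and \<open>p - q * b\<close> are the values of that
  function at the two roots, hence independent of \<open>t\<close>.\<close>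

lemma affine_fraction:
  fixes a b p q :: real
  assumes "a \<noteq> 0" "b \<noteq> 0" "a \<noteq> b"
  shows "p / (a * b) = (p - q * a) / (b - a) / a - (p - q * b) / (b - a) / b"
proof -
  have "b - a \<noteq> 0" using assms by simp
  have "(p - q * a) / (b - a) / a - (p - q * b) / (b - a) / b = ((p - q * a) * b - (p - q * b) * a) / ((b - a) * (a * b))"
    using assms \<open>b - a \<noteq> 0\<close> by (simp add: diff_divide_distrib)
  also have "(p - q * a) * b - (p - q * b) * a = (b - a) * p" by (simp add: algebra_simps)
  finally show ?thesis using \<open>b - a \<noteq> 0\<close> by simp
qed

text \<open>The degree of the numerator is at most that of the denominator, so the polynomial part
  is a constant \<open>a\<close>. The induction adds one root to the denominator and at most one
  factor to the numerator.\<close>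

lemma partial_fractions:
  fixes z :: "'i \<Rightarrow> real"
  assumes "finite H" "finite G" "card G \<le> card H" "inj_on z H"
  shows "\<exists>a. \<forall>t. t \<notin> z ` H \<longrightarrow> (\<Prod>k\<in>G. t - z k) / (\<Prod>k\<in>H. t - z k)
    = a + (\<Sum>j\<in>H. (\<Prod>k\<in>G. z j - z k) / (\<Prod>k\<in>H - {j}. z j - z k) / (t - z j))"
  using assms
proof (induction H arbitrary: G rule: finite_induct)
  case empty
  then show ?case by (intro exI[of _ 1]) simp
next
  case (insert h H)
  \<comment> \<open>\<open>L\<close> is the factor split off from the numerator, or \<open>1\<close>
    if there is none; in either case the bound on the degrees survives for \<open>G0\<close> and
    \<open>H\<close>.\<close>
  have "\<exists>G0 L p q. finite G0 \<and> card G0 \<le> card H \<and> (\<forall>t. L t = p + q * t) \<and> (\<forall>t. (\<Prod>k\<in>G. t - z k) = L t * (\<Prod>k\<in>G0. t - z k))"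
  proof (cases "G = {}")
    case True
    then show ?thesis
      by (intro exI[of _ "{}"] exI[of _ "\<lambda>t. 1"] exI[of _ 1] exI[of _ 0]) auto
  next
    case False
    then obtain g where g: "g \<in> G" by blast
    have "(\<Prod>k\<in>G. t - z k) = (t - z g) * (\<Prod>k\<in>G - {g}. t - z k)" for t
      by (rule prod.remove[OF insert.prems(1) g])
    moreover have "card (G - {g}) \<le> card H" using insert.prems(1,2) insert.hyps g by simp
    ultimately show ?thesis using insert.prems(1)
      by (intro exI[of _ "G - {g}"] exI[of _ "\<lambda>t. t - z g"] exI[of _ "- z g"] exI[of _ 1]) auto
  qed
  then obtain G0 L p q where G0: "finite G0" "card G0 \<le> card H" and L: "\<And>t. L t = p + q * t"
    and G: "\<And>t. (\<Prod>k\<in>G. t - z k) = L t * (\<Prod>k\<in>G0. t - z k)" by blast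
  have zh: "z h \<notin> z ` H" and inj: "inj_on z H" using insert.prems(3) insert.hyps by auto
  define \<mu> where "\<mu> j = (\<Prod>k\<in>G0. z j - z k) / (\<Prod>k\<in>H - {j}. z j - z k)" for j
  obtain a where a: "\<And>t. t \<notin> z ` H \<Longrightarrow> (\<Prod>k\<in>G0. t - z k) / (\<Prod>k\<in>H. t - z k) = a + (\<Sum>j\<in>H. \<mu> j / (t - z j))"
    using insert.IH[OF G0 inj] unfolding \<mu>_def by blast
  show ?case
  proof (intro exI[of _ "a * q"] allI impI)
    fix t assume "t \<notin> z ` insert h H"
    then have t: "t \<notin> z ` H" "t \<noteq> z h" by auto
    have j: "\<mu> j / (t - z j) * L t / (t - z h) = (\<Prod>k\<in>G. z j - z k) / (\<Prod>k\<in>insert h H - {j}. z j - z k) / (t - z j)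
        + L (z h) * (\<mu> j / (z h - z j)) / (t - z h)" if "j \<in> H" for j
    proof -
      have "z j \<in> z ` H" using that by (rule imageI)
      then have ne: "z j \<noteq> z h" "t \<noteq> z j" using zh t by metis+
      have "insert h H - {j} = insert h (H - {j})" using that insert.hyps by auto
      then have "(\<Prod>k\<in>G. z j - z k) / (\<Prod>k\<in>insert h H - {j}. z j - z k) = L (z j) / (z j - z h) * \<mu> j"
        using insert.hyps by (simp add: G \<mu>_def)
      moreover have "L t / ((t - z j) * (t - z h)) = L (z j) / (z j - z h) / (t - z j) + L (z h) / (z h - z j) / (t - z h)"
      proof -
        have "L t / ((t - z j) * (t - z h)) = (L t - q * (t - z j)) / ((t - z h) - (t - z j)) / (t - z j)
          - (L t - q * (t - z h)) / ((t - z h) - (t - z j)) / (t - z h)"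
          using ne t by (intro affine_fraction) auto
        also have "L t - q * (t - z j) = L (z j)" by (simp add: L algebra_simps)
        also have "L t - q * (t - z h) = L (z h)" by (simp add: L algebra_simps)
        also have "L (z h) / ((t - z h) - (t - z j)) / (t - z h) = - (L (z h) / (z h - z j) / (t - z h))"
        proof -
          have "(t - z h) - (t - z j) = - (z h - z j)" by simp
          then show ?thesis by (simp only: divide_minus_right divide_minus_left)
        qed
        finally show ?thesis by simp
      qed
      then have "\<mu> j * (L t / ((t - z j) * (t - z h))) = \<mu> j * (L (z j) / (z j - z h) / (t - z j) + L (z h) / (z h - z j) / (t - z h))"
        by simp
      ultimately show ?thesis by (simp add: algebra_simps)
    qed
    have "(\<Prod>k\<in>G. t - z k) / (\<Prod>k\<in>insert h H. t - z k) = (\<Prod>k\<in>G0. t - z k) / (\<Prod>k\<in>H. t - z k) * L t / (t - z h)"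
      using insert.hyps by (simp add: G mult_ac)
    also have "\<dots> = a * L t / (t - z h) + (\<Sum>j\<in>H. \<mu> j / (t - z j) * L t / (t - z h))"
      unfolding a[OF t(1)] by (simp add: algebra_simps sum_distrib_left sum_distrib_right sum_divide_distrib add_divide_distrib)
    also have "\<dots> = a * L t / (t - z h) + ((\<Sum>j\<in>H. (\<Prod>k\<in>G. z j - z k) / (\<Prod>k\<in>insert h H - {j}. z j - z k) / (t - z j))
        + L (z h) * (\<Sum>j\<in>H. \<mu> j / (z h - z j)) / (t - z h))"
      unfolding sum_distrib_left sum_divide_distrib sum.distrib[symmetric]
      by (intro arg_cong2[where f = "(+)"] refl sum.cong j)
    also have "a * L t / (t - z h) = a * q + a * L (z h) / (t - z h)"
      using t by (simp add: L field_simps)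
    also have "a * q + a * L (z h) / (t - z h) + ((\<Sum>j\<in>H. (\<Prod>k\<in>G. z j - z k) / (\<Prod>k\<in>insert h H - {j}. z j - z k) / (t - z j))
        + L (z h) * (\<Sum>j\<in>H. \<mu> j / (z h - z j)) / (t - z h))
      = a * q + (L (z h) * (a + (\<Sum>j\<in>H. \<mu> j / (z h - z j))) / (t - z h)
        + (\<Sum>j\<in>H. (\<Prod>k\<in>G. z j - z k) / (\<Prod>k\<in>insert h H - {j}. z j - z k) / (t - z j)))"
      by (simp add: algebra_simps add_divide_distrib)
    \<comment> \<open>The residue at the new root comes from evaluating the expansion for
      \<open>H\<close> there.\<close>
    also have "L (z h) * (a + (\<Sum>j\<in>H. \<mu> j / (z h - z j))) = (\<Prod>k\<in>G. z h - z k) / (\<Prod>k\<in>insert h H - {h}. z h - z k)"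
      using insert.hyps by (simp add: a[OF zh, symmetric] G)
    finally show "(\<Prod>k\<in>G. t - z k) / (\<Prod>k\<in>insert h H. t - z k)
      = a * q + (\<Sum>j\<in>insert h H. (\<Prod>k\<in>G. z j - z k) / (\<Prod>k\<in>insert h H - {j}. z j - z k) / (t - z j))"
      using insert.hyps by simp
  qed
qed

lemma has_real_derivative_prod_diff:
  fixes z :: "'i \<Rightarrow> real"
  assumes "finite G" "t \<notin> z ` G"
  shows "((\<lambda>t. \<Prod>k\<in>G. t - z k) has_real_derivative (\<Prod>k\<in>G. t - z k) * (\<Sum>k\<in>G. 1 / (t - z k))) (at t)"
  by (rule has_field_derivative_prod') (use assms in \<open>auto intro!: derivative_eq_intros\<close>)

text \<open>The derivative of the partial fraction expansion of \<open>A / B\<close>, where \<open>A\<close> and \<open>B\<close> have the roots \<open>z k\<close>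
  with \<open>k \<in> G\<close> and \<open>k \<in> H\<close>; the quotient in the sum is the effect of exchanging \<open>t\<close> and \<open>z j\<close>.\<close>

lemma exchange_identity:
  fixes z :: "'i \<Rightarrow> real"
  assumes H: "finite H" and G: "finite G" and card: "card G \<le> card H" and inj: "inj_on z H"
    and t: "t \<notin> z ` G" "t \<notin> z ` H"
  shows "(\<Sum>j\<in>H. (1 - (\<Prod>k\<in>G. z j - z k) * (\<Prod>k\<in>H - {j}. t - z k)
      / ((\<Prod>k\<in>G. t - z k) * (\<Prod>k\<in>H - {j}. z j - z k))) / (t - z j)) = (\<Sum>k\<in>G. 1 / (t - z k))"
proof -
  define A where "A t = (\<Prod>k\<in>G. t - z k)" for t
  define B where "B t = (\<Prod>k\<in>H. t - z k)" for t
  define \<mu> where "\<mu> j = A (z j) / (\<Prod>k\<in>H - {j}. z j - z k)" for j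
  obtain a where a: "\<And>t. t \<notin> z ` H \<Longrightarrow> A t / B t = a + (\<Sum>j\<in>H. \<mu> j / (t - z j))"
    using partial_fractions[OF H G card inj] unfolding A_def B_def \<mu>_def by blast
  have nz: "A t \<noteq> 0" "B t \<noteq> 0" using t G H by (auto simp: A_def B_def)
  \<comment> \<open>The derivative is computed by the quotient rule and again from the expansion,
    where the constant \<open>a\<close> drops out.\<close>
  have "((\<lambda>t. A t / B t) has_real_derivative
      (A t * (\<Sum>k\<in>G. 1 / (t - z k)) * B t - A t * (B t * (\<Sum>k\<in>H. 1 / (t - z k)))) / (B t * B t)) (at t)"
    using nz has_real_derivative_prod_diff[OF G t(1)] has_real_derivative_prod_diff[OF H t(2)]
    unfolding A_def B_def by (intro DERIV_divide) auto
  moreover have "((\<lambda>t. A t / B t) has_real_derivative (\<Sum>j\<in>H. - \<mu> j / (t - z j)\<^sup>2)) (at t)"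
  proof (rule has_field_derivative_transform_within_open)
    show "((\<lambda>t. a + (\<Sum>j\<in>H. \<mu> j / (t - z j))) has_real_derivative (\<Sum>j\<in>H. - \<mu> j / (t - z j)\<^sup>2)) (at t)"
    proof -
      have "((\<lambda>t. \<mu> j / (t - z j)) has_real_derivative - \<mu> j / (t - z j)\<^sup>2) (at t)" if "j \<in> H" for j
        using that t by (auto intro!: derivative_eq_intros simp: power2_eq_square)
      then have "((\<lambda>t. a + (\<Sum>j\<in>H. \<mu> j / (t - z j))) has_real_derivative 0 + (\<Sum>j\<in>H. - \<mu> j / (t - z j)\<^sup>2)) (at t)"
        by (intro DERIV_add DERIV_const DERIV_sum)
      then show ?thesis by simp
    qed
    show "open (- z ` H)" using H by (simp add: finite_imp_closed open_Compl)
  qed (use t a in auto)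
  ultimately have "(\<Sum>j\<in>H. - \<mu> j / (t - z j)\<^sup>2)
      = (A t * (\<Sum>k\<in>G. 1 / (t - z k)) * B t - A t * (B t * (\<Sum>k\<in>H. 1 / (t - z k)))) / (B t * B t)"
    by (rule DERIV_unique[symmetric])
  also have "\<dots> = A t / B t * ((\<Sum>k\<in>G. 1 / (t - z k)) - (\<Sum>k\<in>H. 1 / (t - z k)))"
    using nz by (simp add: field_simps)
  finally have *: "(\<Sum>k\<in>H. 1 / (t - z k)) - B t / A t * (\<Sum>j\<in>H. \<mu> j / (t - z j)\<^sup>2) = (\<Sum>k\<in>G. 1 / (t - z k))"
    using nz by (simp add: field_simps sum_negf)
  have "(\<Prod>k\<in>G. z j - z k) * (\<Prod>k\<in>H - {j}. t - z k) / ((\<Prod>k\<in>G. t - z k) * (\<Prod>k\<in>H - {j}. z j - z k)) / (t - z j)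
      = B t / A t * (\<mu> j / (t - z j)\<^sup>2)" if "j \<in> H" for j
  proof -
    have "B t = (t - z j) * (\<Prod>k\<in>H - {j}. t - z k)" unfolding B_def by (rule prod.remove[OF H that])
    moreover have "t - z j \<noteq> 0" using that t by auto
    ultimately show ?thesis by (simp add: \<mu>_def A_def power2_eq_square mult_ac)
  qed
  then show ?thesis using * by (simp add: diff_divide_distrib sum_subtractf sum_distrib_left)
qed

section \<open>Power counting\<close>

text \<open>Points are added in increasing order. If there is no gap yet, a new largest point is
  either separated from all others by more than \<open>g\<close>, or within \<open>g\<close> of one
  of them, which raises the bound on the diameter by \<open>g\<close>.\<close>

lemma gap_split:
  fixes z :: "'i \<Rightarrow> real" and g :: real
  assumes "finite I" "g \<ge> 0"
  shows "(\<exists>I1 I2. I1 \<noteq> {} \<and> I2 \<noteq> {} \<and> I1 \<inter> I2 = {} \<and> I1 \<union> I2 = I \<and> (\<forall>i\<in>I1. \<forall>j\<in>I2. z j - z i > g))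
    \<or> (\<forall>i\<in>I. \<forall>j\<in>I. \<bar>z i - z j\<bar> \<le> card I * g)"
  using assms(1)
proof (induction I rule: finite_ranking_induct[where f = z])
  case empty
  then show ?case by simp
next
  case (insert x S)
  consider "x \<in> S" | "S = {}" | "x \<notin> S" "S \<noteq> {}" by blast
  then show ?case
  proof cases
    case 1
    then show ?thesis using insert.IH by (simp add: insert_absorb)
  next
    case 2
    then show ?thesis using assms(2) by simp
  next
    case 3
    show ?thesis
    proof (cases "\<exists>I1 I2. I1 \<noteq> {} \<and> I2 \<noteq> {} \<and> I1 \<inter> I2 = {} \<and> I1 \<union> I2 = S \<and> (\<forall>i\<in>I1. \<forall>j\<in>I2. z j - z i > g)")
      case True
      then obtain I1 I2 where I: "I1 \<noteq> {}" "I2 \<noteq> {}" "I1 \<inter> I2 = {}" "I1 \<union> I2 = S"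
        "\<And>i j. i \<in> I1 \<Longrightarrow> j \<in> I2 \<Longrightarrow> z j - z i > g" by blast
      obtain j0 where j0: "j0 \<in> I2" using I by blast
      have "z x - z i > g" if "i \<in> I1" for i
        using I(5)[OF that j0] insert.hyps(2)[of j0] j0 I(4) by fastforce
      then show ?thesis using I 3
        by (intro disjI1 exI[of _ I1] exI[of _ "insert x I2"]) auto
    next
      case False
      then have S: "\<And>i j. i \<in> S \<Longrightarrow> j \<in> S \<Longrightarrow> \<bar>z i - z j\<bar> \<le> card S * g" using insert.IH by blast
      show ?thesis
      proof (cases "\<forall>i\<in>S. z x - z i > g")
        case True
        then show ?thesis using 3 by (intro disjI1 exI[of _ S] exI[of _ "{x}"]) auto
      next
        case False
        then obtain y where y: "y \<in> S" "z x - z y \<le> g" by force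
        have x: "\<bar>z x - z i\<bar> \<le> (1 + real (card S)) * g" if "i \<in> S" for i
        proof -
          have "z i \<le> z x" using insert.hyps(2)[OF that] .
          moreover have "z x - z i \<le> g + card S * g" using S[OF y(1) that] y(2) by linarith
          ultimately show ?thesis by (simp add: algebra_simps)
        qed
        have "\<bar>z i - z j\<bar> \<le> (1 + real (card S)) * g" if "i \<in> insert x S" "j \<in> insert x S" for i j
        proof -
          have "card S * g \<le> (1 + real (card S)) * g" using assms(2) by (simp add: algebra_simps)
          then show ?thesis using that x[of i] x[of j] S[of i j] assms(2) by (auto simp: abs_minus_commute)
        qed
        then show ?thesis using 3 insert.hyps(1) by (intro disjI2) simp
      qed
    qed
  qed
qed

text \<open>Spanning trees presented by gluing two parts along one edge, as the recursive splitting
  at gaps produces them.\<close>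

inductive is_tree :: "'i set \<Rightarrow> ('i \<times> 'i) set \<Rightarrow> bool" where
  single: "is_tree {i} {}"
| join: "is_tree I1 T1 \<Longrightarrow> is_tree I2 T2 \<Longrightarrow> I1 \<inter> I2 = {} \<Longrightarrow> i \<in> I1 \<Longrightarrow> j \<in> I2
    \<Longrightarrow> is_tree (I1 \<union> I2) (insert (i, j) (T1 \<union> T2))"

lemma is_tree_subset: "is_tree I T \<Longrightarrow> T \<subseteq> I \<times> I"
  by (induction rule: is_tree.induct) auto

text \<open>Differences along the edges of a tree can be prescribed freely. This is the dual form of
  the linear independence of the edge vectors and is used as such in
  \<open>dif_independent\<close>.\<close>

lemma is_tree_differences:
  fixes b :: "'i \<times> 'i \<Rightarrow> real"
  shows "is_tree I T \<Longrightarrow> \<exists>z. \<forall>(i, j)\<in>T. z i - z j = b (i, j)"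
proof (induction rule: is_tree.induct)
  case (single i)
  show ?case by simp
next
  case (join I1 T1 I2 T2 i j)
  then obtain z1 z2 where z: "\<forall>(i, j)\<in>T1. z1 i - z1 j = b (i, j)" "\<forall>(i, j)\<in>T2. z2 i - z2 j = b (i, j)" by blast
  \<comment> \<open>The second solution is shifted by a constant so that the new edge gets its
    prescribed difference.\<close>
  define z where "z k = (if k \<in> I1 then z1 k else z2 k - z2 j + z1 i - b (i, j))" for k
  have "z k - z l = b (k, l)" if "(k, l) \<in> insert (i, j) (T1 \<union> T2)" for k l
    using that
  proof (elim insertE UnE)
    assume "(k, l) = (i, j)"
    then show ?thesis using join.hyps by (auto simp: z_def)
  next
    assume "(k, l) \<in> T1"
    then show ?thesis using z(1) is_tree_subset[OF join.hyps(1)] by (auto simp: z_def)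
  next
    assume "(k, l) \<in> T2"
    moreover from this have "k \<notin> I1" "l \<notin> I1" using is_tree_subset[OF join.hyps(2)] join.hyps(3) by auto
    ultimately show ?thesis using z(2) by (auto simp: z_def)
  qed
  then show ?case by (intro exI[of _ z]) auto
qed

text \<open>\<open>s * (card I - 1)\<close> is the total exponent of the edges of a spanning tree, so the hypothesis says that
  the product behaves well when a set of variables collides.  A configuration is split at a gap comparable
  to its diameter, which costs one edge of the tree.\<close>

lemma power_counting:
  fixes e :: "'n::finite \<Rightarrow> 'n \<Rightarrow> real" and z :: "'n \<Rightarrow> real" and s :: real
  defines "M \<equiv> (\<Sum>i\<in>UNIV. \<Sum>j\<in>UNIV. \<bar>e i j\<bar>) * ln (real CARD('n) + 1)"
  assumes sym: "\<And>i j. e i j = e j i" and diag: "\<And>i. e i i = 0" and s: "s \<ge> 0"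
    and pos: "\<And>K. 2 \<le> card K \<Longrightarrow> (\<Sum>i\<in>K. \<Sum>j\<in>K. e i j) / 2 + s * (card K - 1) \<ge> 0"
  shows "I \<noteq> {} \<Longrightarrow> inj_on z I \<Longrightarrow> D > 0 \<Longrightarrow> (\<And>i j. i \<in> I \<Longrightarrow> j \<in> I \<Longrightarrow> \<bar>z i - z j\<bar> \<le> D)
    \<Longrightarrow> \<exists>T. is_tree I T \<and> (\<Sum>i\<in>I. \<Sum>j\<in>I. e i j * ln \<bar>z i - z j\<bar>) / 2 + s * (\<Sum>(i, j)\<in>T. ln \<bar>z i - z j\<bar>)
      \<le> ((\<Sum>i\<in>I. \<Sum>j\<in>I. e i j) / 2 + s * (real (card I) - 1)) * ln D + (real (card I) - 1) * M"
proof (induction "card I" arbitrary: I D rule: less_induct)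
  case less
  have fin: "finite I" by simp
  show ?case
  proof (cases "card I = 1")
    case True
    then obtain i where i: "I = {i}" by (auto simp: card_1_singleton_iff)
    show ?thesis unfolding i by (rule exI[of _ "{}"]) (simp add: is_tree.single diag)
  next
    case False
    moreover have "card I \<noteq> 0" using less.prems(1) by simp
    ultimately have k: "card I \<ge> 2" by linarith
    define L where "L i j = ln \<bar>z i - z j\<bar>" for i j
    have L_sym: "L i j = L j i" for i j by (simp add: L_def abs_minus_commute)
    define h where "h K = (\<Sum>i\<in>K. \<Sum>j\<in>K. e i j) / 2 + s * (real (card K) - 1)" for K
    \<comment> \<open>The exact diameter, needed for a gap comparable to it; the given bound
      \<open>D\<close> returns at the end through the sign hypothesis \<open>pos\<close>.\<close>
    define D0 where "D0 = Max ((\<lambda>(i, j). \<bar>z i - z j\<bar>) ` (I \<times> I))"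
    have D0: "\<bar>z i - z j\<bar> \<le> D0" if "i \<in> I" "j \<in> I" for i j
      unfolding D0_def using that by (intro Max_ge) force+
    have "D0 \<in> (\<lambda>(i, j). \<bar>z i - z j\<bar>) ` (I \<times> I)" unfolding D0_def using less.prems(1) by (intro Max_in) auto
    then obtain i0 j0 where ij0: "i0 \<in> I" "j0 \<in> I" "D0 = \<bar>z i0 - z j0\<bar>" by auto
    have D0_pos: "D0 > 0"
    proof -
      obtain a b where "a \<in> I" "b \<in> I" "a \<noteq> b" using k by (metis card_le_Suc0_iff_eq fin not_less_eq_eq numeral_2_eq_2)
      then have "\<bar>z a - z b\<bar> > 0" using less.prems(2) by (auto simp: inj_on_def)
      then show ?thesis using D0 \<open>a \<in> I\<close> \<open>b \<in> I\<close> by fastforce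
    qed
    have D0_le: "D0 \<le> D" using less.prems(4) ij0 by simp
    \<comment> \<open>The denominator exceeds the number of points, so a set without a gap of this
      size would have a diameter below \<open>D0\<close>.\<close>
    define g where "g = D0 / (real CARD('n) + 1)"
    have g: "g > 0" using D0_pos by (simp add: g_def)
    have "card I * g < D0"
    proof -
      have "real (card I) < real CARD('n) + 1" using card_mono[of UNIV I] by simp
      then have "real (card I) * D0 < (real CARD('n) + 1) * D0" using D0_pos by (rule mult_strict_right_mono)
      then show ?thesis by (simp add: g_def field_simps)
    qed
    then have "\<not> (\<forall>i\<in>I. \<forall>j\<in>I. \<bar>z i - z j\<bar> \<le> card I * g)" using ij0 by fastforce
    then obtain I1 I2 where I: "I1 \<noteq> {}" "I2 \<noteq> {}" "I1 \<inter> I2 = {}" "I1 \<union> I2 = I"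
      "\<And>i j. i \<in> I1 \<Longrightarrow> j \<in> I2 \<Longrightarrow> z j - z i > g"
      using gap_split[OF fin, of g z] less_imp_le[OF g] by blast
    have cardI: "card I = card I1 + card I2" using I(3,4) card_Un_disjoint[of I1 I2] by simp
    have sub: "I1 \<subseteq> I" "I2 \<subseteq> I" and lt: "card I1 < card I" "card I2 < card I"
      using I(1,2,4) cardI by (auto simp: card_gt_0_iff)
    have IH: "\<exists>T. is_tree J T \<and> (\<Sum>i\<in>J. \<Sum>j\<in>J. e i j * L i j) / 2 + s * (\<Sum>(i, j)\<in>T. L i j)
      \<le> h J * ln D0 + (real (card J) - 1) * M" if "J = I1 \<or> J = I2" for J
      unfolding L_def h_def
      by (rule less.hyps) (use that lt sub I D0 D0_pos less.prems(2) in \<open>auto intro: inj_on_subset\<close>)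
    obtain T1 where T1: "is_tree I1 T1" "(\<Sum>i\<in>I1. \<Sum>j\<in>I1. e i j * L i j) / 2 + s * (\<Sum>(i, j)\<in>T1. L i j)
      \<le> h I1 * ln D0 + (real (card I1) - 1) * M" using IH[of I1] by blast
    obtain T2 where T2: "is_tree I2 T2" "(\<Sum>i\<in>I2. \<Sum>j\<in>I2. e i j * L i j) / 2 + s * (\<Sum>(i, j)\<in>T2. L i j)
      \<le> h I2 * ln D0 + (real (card I2) - 1) * M" using IH[of I2] by blast
    obtain i j where ij: "i \<in> I1" "j \<in> I2" using I by blast
    have split: "(\<Sum>i\<in>I. \<Sum>j\<in>I. f i j) = (\<Sum>i\<in>I1. \<Sum>j\<in>I1. f i j) + (\<Sum>i\<in>I2. \<Sum>j\<in>I2. f i j) + 2 * (\<Sum>i\<in>I1. \<Sum>j\<in>I2. f i j)"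
      if f: "\<And>i j. f i j = f j i" for f :: "'n \<Rightarrow> 'n \<Rightarrow> real"
    proof -
      have "(\<Sum>i\<in>I2. \<Sum>j\<in>I1. f i j) = (\<Sum>i\<in>I1. \<Sum>j\<in>I2. f i j)"
        by (subst sum.swap) (subst f, rule refl)
      then show ?thesis unfolding I(4)[symmetric] using I(3) by (simp add: sum.union_disjoint sum.distrib)
    qed
    \<comment> \<open>Across the gap a distance lies between \<open>g\<close> and \<open>D0\<close>,
      so replacing its logarithm by \<open>ln D0\<close> costs a bounded error, whatever the sign of
      the exponent.\<close>
    have cross: "e i j * L i j \<le> e i j * ln D0 + \<bar>e i j\<bar> * ln (real CARD('n) + 1)" if ij: "i \<in> I1" "j \<in> I2" for i j
    proof -
      have "g \<le> \<bar>z i - z j\<bar>" using I(5)[OF ij] by linarith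
      then have "ln g \<le> L i j" using g by (simp add: L_def)
      moreover have "ln g = ln D0 - ln (real CARD('n) + 1)" using D0_pos by (simp add: g_def ln_div)
      moreover have "L i j \<le> ln D0" using D0[of i j] ij sub I(5)[OF ij] g D0_pos by (simp add: L_def subset_iff)
      ultimately have "\<bar>L i j - ln D0\<bar> \<le> ln (real CARD('n) + 1)" by linarith
      then have "\<bar>e i j\<bar> * \<bar>L i j - ln D0\<bar> \<le> \<bar>e i j\<bar> * ln (real CARD('n) + 1)" by (intro mult_left_mono) auto
      then have "e i j * (L i j - ln D0) \<le> \<bar>e i j\<bar> * ln (real CARD('n) + 1)"
        using abs_ge_self[of "e i j * (L i j - ln D0)"] by (simp add: abs_mult)
      then show ?thesis by (simp add: algebra_simps)
    qed
    have "(\<Sum>i\<in>I1. \<Sum>j\<in>I2. e i j * L i j) \<le> (\<Sum>i\<in>I1. \<Sum>j\<in>I2. e i j * ln D0 + \<bar>e i j\<bar> * ln (real CARD('n) + 1))"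
      by (intro sum_mono cross)
    also have "\<dots> = (\<Sum>i\<in>I1. \<Sum>j\<in>I2. e i j) * ln D0 + (\<Sum>i\<in>I1. \<Sum>j\<in>I2. \<bar>e i j\<bar>) * ln (real CARD('n) + 1)"
      by (simp add: sum.distrib sum_distrib_right)
    also have "(\<Sum>i\<in>I1. \<Sum>j\<in>I2. \<bar>e i j\<bar>) * ln (real CARD('n) + 1) \<le> M"
      unfolding M_def
    proof (rule mult_right_mono)
      have "(\<Sum>i\<in>I1. \<Sum>j\<in>I2. \<bar>e i j\<bar>) \<le> (\<Sum>i\<in>I1. \<Sum>j\<in>UNIV. \<bar>e i j\<bar>)"
        by (intro sum_mono sum_mono2) auto
      also have "\<dots> \<le> (\<Sum>i\<in>UNIV. \<Sum>j\<in>UNIV. \<bar>e i j\<bar>)" by (intro sum_mono2 sum_nonneg) auto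
      finally show "(\<Sum>i\<in>I1. \<Sum>j\<in>I2. \<bar>e i j\<bar>) \<le> (\<Sum>i\<in>UNIV. \<Sum>j\<in>UNIV. \<bar>e i j\<bar>)" .
    qed simp
    finally have c: "(\<Sum>i\<in>I1. \<Sum>j\<in>I2. e i j * L i j) \<le> (\<Sum>i\<in>I1. \<Sum>j\<in>I2. e i j) * ln D0 + M" by simp
    have "L i j \<le> ln D0" using D0[of i j] ij sub I(5)[OF ij] g D0_pos by (simp add: L_def subset_iff)
    then have sl: "s * L i j \<le> s * ln D0" using s by (rule mult_left_mono)
    have T12: "T1 \<inter> T2 = {}" "(i, j) \<notin> T1 \<union> T2"
      using is_tree_subset[OF T1(1)] is_tree_subset[OF T2(1)] I(3) ij by auto
    have sumT: "(\<Sum>(i, j)\<in>insert (i, j) (T1 \<union> T2). L i j) = L i j + (\<Sum>(i, j)\<in>T1. L i j) + (\<Sum>(i, j)\<in>T2. L i j)"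
      using T12 by (simp add: sum.union_disjoint)
    \<comment> \<open>The last \<open>s\<close> belongs to the joining edge:
      \<open>card I - 1\<close> is the sum of the two values for the parts plus one.\<close>
    have hI: "h I = h I1 + h I2 + (\<Sum>i\<in>I1. \<Sum>j\<in>I2. e i j) + s"
      unfolding h_def split[OF sym] cardI by (simp add: algebra_simps add_divide_distrib)
    have "(\<Sum>i\<in>I. \<Sum>j\<in>I. e i j * L i j) / 2 + s * (\<Sum>(i, j)\<in>insert (i, j) (T1 \<union> T2). L i j)
      \<le> h I * ln D0 + (real (card I) - 1) * M"
    proof -
      have "(\<Sum>i\<in>I. \<Sum>j\<in>I. e i j * L i j) = (\<Sum>i\<in>I1. \<Sum>j\<in>I1. e i j * L i j) + (\<Sum>i\<in>I2. \<Sum>j\<in>I2. e i j * L i j)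
          + 2 * (\<Sum>i\<in>I1. \<Sum>j\<in>I2. e i j * L i j)"
        by (rule split) (simp add: sym[of _ i for i] L_sym[of _ i for i] sym L_sym)
      then show ?thesis unfolding sumT hI cardI using T1(2) T2(2) c sl by (simp add: algebra_simps add_divide_distrib)
    qed
    also have "h I * ln D0 \<le> h I * ln D"
      using pos[OF k] k D0_pos D0_le by (intro mult_left_mono) (auto simp: h_def of_nat_diff)
    finally show ?thesis
      using is_tree.join[OF T1(1) T2(1) I(3) ij] unfolding I(4) h_def L_def by (intro exI[of _ "insert (i, j) (T1 \<union> T2)"]) auto
  qed
qed

lemma is_tree_irrefl: "is_tree I T \<Longrightarrow> (i, j) \<in> T \<Longrightarrow> i \<noteq> j"
  by (induction rule: is_tree.induct) auto

text \<open>For symmetric \<open>e\<close>, the product over unordered pairs of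
  \<open>\<bar>z i - z j\<bar>\<close> to the power \<open>e i j\<close>; the half accounts for the
  double counting. In logarithmic form exponents add, and the value \<open>0\<close> off the
  injective points keeps \<open>ln 0\<close> out.\<close>

definition pair_weight :: "('n::finite \<Rightarrow> 'n \<Rightarrow> real) \<Rightarrow> ('n \<Rightarrow> real) \<Rightarrow> real" where
  "pair_weight e z = (if inj z then exp ((\<Sum>i\<in>UNIV. \<Sum>j\<in>UNIV. e i j * ln \<bar>z i - z j\<bar>) / 2) else 0)"

lemma pair_weight_nonneg: "pair_weight e z \<ge> 0"
  by (simp add: pair_weight_def)

lemma pair_weight_add: "pair_weight (\<lambda>i j. e i j + e' i j) z = pair_weight e z * pair_weight e' z"
  by (simp add: pair_weight_def sum.distrib distrib_right add_divide_distrib exp_add)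

definition exponent_sum :: "('n \<Rightarrow> 'n \<Rightarrow> real) \<Rightarrow> 'n set \<Rightarrow> real" where
  "exponent_sum e K = (\<Sum>i\<in>K. \<Sum>j\<in>K. e i j)"

text \<open>The hypothesis is strict and concerns finitely many sets \<open>K\<close>, so some
  \<open>s\<close> below \<open>1\<close> satisfies the weak inequality needed for
  \<open>power_counting\<close>. Summing over all trees removes the dependence of the tree on
  \<open>z\<close>.\<close>

lemma pair_weight_bound:
  fixes e :: "'n::finite \<Rightarrow> 'n \<Rightarrow> real"
  assumes sym: "\<And>i j. e i j = e j i" and diag: "\<And>i. e i i = 0"
    and pos: "\<And>K. 2 \<le> card K \<Longrightarrow> exponent_sum e K / 2 + (real (card K) - 1) > 0"
  obtains s C k where "0 \<le> s" "s < (1::real)" "C \<ge> 0"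
    "\<And>z D. D \<ge> 1 \<Longrightarrow> (\<And>i j. \<bar>z i - z j\<bar> \<le> D) \<Longrightarrow>
      pair_weight e z \<le> C * D ^ k * (\<Sum>T | is_tree UNIV T. \<Prod>(i, j)\<in>T. \<bar>z i - z j\<bar> powr (- s))"
proof -
  \<comment> \<open>Its maximum is the least admissible \<open>s\<close>; the element
    \<open>0\<close> enforces \<open>s \<ge> 0\<close>, which \<open>power_counting\<close>
    requires.\<close>
  define S where "S = insert 0 ((\<lambda>K. - (exponent_sum e K / 2) / (real (card K) - 1)) ` {K. 2 \<le> card K})"
  define s where "s = Max S"
  have fS: "finite S" "S \<noteq> {}" by (auto simp: S_def)
  have s0: "0 \<le> s" unfolding s_def by (rule Max_ge[OF fS(1)]) (simp add: S_def)
  have "x < 1" if "x \<in> S" for x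
    using that pos by (auto simp: S_def field_simps)
  then have s1: "s < 1" unfolding s_def using fS by simp
  have pos': "(\<Sum>i\<in>K. \<Sum>j\<in>K. e i j) / 2 + s * real (card K - 1) \<ge> 0" if K: "2 \<le> card K" for K
  proof -
    have "- (exponent_sum e K / 2) / (real (card K) - 1) \<le> s"
      unfolding s_def by (rule Max_ge[OF fS(1)]) (use K in \<open>auto simp: S_def\<close>)
    then show ?thesis using K by (simp add: exponent_sum_def field_simps of_nat_diff)
  qed
  define M where "M = (\<Sum>i\<in>UNIV. \<Sum>j\<in>UNIV. \<bar>e i j\<bar>) * ln (real CARD('n) + 1)"
  define h where "h = exponent_sum e UNIV / 2 + s * (real CARD('n) - 1)"
  define C where "C = exp ((real CARD('n) - 1) * M)"
  define k where "k = nat \<lceil>h\<rceil>"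
  show thesis
  proof (rule that[OF s0 s1, of C k])
    show "C \<ge> 0" by (simp add: C_def)
    fix z :: "'n \<Rightarrow> real" and D :: real
    assume D: "D \<ge> 1" and zD: "\<And>i j. \<bar>z i - z j\<bar> \<le> D"
    show "pair_weight e z \<le> C * D ^ k * (\<Sum>T | is_tree UNIV T. \<Prod>(i, j)\<in>T. \<bar>z i - z j\<bar> powr (- s))"
    proof (cases "inj z")
      case False
      have "0 \<le> C * D ^ k * (\<Sum>T | is_tree UNIV T. \<Prod>(i, j)\<in>T. \<bar>z i - z j\<bar> powr (- s))"
        using D by (intro mult_nonneg_nonneg sum_nonneg prod_nonneg) (auto simp: C_def)
      then show ?thesis using False by (simp add: pair_weight_def)
    next
      case True
      obtain T where T: "is_tree UNIV T" "(\<Sum>i\<in>UNIV. \<Sum>j\<in>UNIV. e i j * ln \<bar>z i - z j\<bar>) / 2 + s * (\<Sum>(i, j)\<in>T. ln \<bar>z i - z j\<bar>)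
          \<le> h * ln D + (real CARD('n) - 1) * M"
        using power_counting[of e s UNIV z D, OF sym diag s0 pos' _ True] D zD
        unfolding h_def M_def exponent_sum_def by auto
      have "h * ln D \<le> real k * ln D"
        using D by (intro mult_right_mono) (auto simp: k_def intro: real_nat_ceiling_ge)
      with T(2) have "(\<Sum>i\<in>UNIV. \<Sum>j\<in>UNIV. e i j * ln \<bar>z i - z j\<bar>) / 2
        \<le> (real CARD('n) - 1) * M + real k * ln D + (\<Sum>(i, j)\<in>T. - s * ln \<bar>z i - z j\<bar>)"
        by (simp add: sum_distrib_left sum_negf case_prod_unfold)
      then have "pair_weight e z \<le> exp ((real CARD('n) - 1) * M + real k * ln D + (\<Sum>(i, j)\<in>T. - s * ln \<bar>z i - z j\<bar>))"
        using True by (simp add: pair_weight_def)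
      also have "\<dots> = C * D ^ k * (\<Prod>(i, j)\<in>T. exp (- s * ln \<bar>z i - z j\<bar>))"
        using D by (simp add: exp_add C_def exp_sum case_prod_unfold exp_of_nat_mult)
      also have "(\<Prod>(i, j)\<in>T. exp (- s * ln \<bar>z i - z j\<bar>)) = (\<Prod>(i, j)\<in>T. \<bar>z i - z j\<bar> powr (- s))"
      proof (rule prod.cong[OF refl], clarify)
        fix i j assume "(i, j) \<in> T"
        then have "z i \<noteq> z j" using is_tree_irrefl[OF T(1)] True by (auto dest: injD)
        then show "exp (- s * ln \<bar>z i - z j\<bar>) = \<bar>z i - z j\<bar> powr (- s)" by (simp add: powr_def)
      qed
      also have "\<dots> \<le> (\<Sum>T | is_tree UNIV T. \<Prod>(i, j)\<in>T. \<bar>z i - z j\<bar> powr (- s))"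
        using T(1) by (intro member_le_sum[where f = "\<lambda>T. \<Prod>(i, j)\<in>T. \<bar>z i - z j\<bar> powr (- s)"]) (auto intro!: prod_nonneg)
      finally show ?thesis using D by (simp add: C_def mult_left_mono)
    qed
  qed
qed

section \<open>Coordinates\<close>

text \<open>Covers both representations: the identity of the full coordinate space and the embedding
  of the reflection representation. The image contains the zero sum vectors in both cases.\<close>

locale coordinates =
  fixes \<iota> :: "'a::euclidean_space \<Rightarrow> real ^ 'n::finite"
  assumes linear_\<iota>: "linear \<iota>"
    and norm_\<iota>: "norm (\<iota> v) = norm v"
    and zero_sum_range: "(\<Sum>i\<in>UNIV. z $ i) = 0 \<Longrightarrow> z \<in> range \<iota>"
begin

definition crd :: "'a \<Rightarrow> 'n \<Rightarrow> real" where "crd x i = \<iota> x $ i"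

definition dif :: "'n \<times> 'n \<Rightarrow> 'a" where
  "dif p = (SOME a. \<iota> a = axis (fst p) 1 - axis (snd p) 1)"

lemma inj_\<iota>: "\<iota> x = \<iota> y \<Longrightarrow> x = y"
  using norm_\<iota>[of "x - y"] by (simp add: linear_diff[OF linear_\<iota>])

lemma inner_\<iota>: "\<iota> x \<bullet> \<iota> y = x \<bullet> y"
  by (simp add: dot_norm norm_\<iota> flip: linear_add[OF linear_\<iota>])

lemma zero_sumE:
  assumes "(\<Sum>i\<in>UNIV. z i) = 0"
  obtains x where "\<And>i. crd x i = z i"
proof -
  have "(\<chi> i. z i) \<in> range \<iota>" using assms by (intro zero_sum_range) simp
  then obtain x where x: "(\<chi> i. z i) = \<iota> x" by blast
  have "crd x i = z i" for i by (simp add: crd_def x[symmetric])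
  then show thesis by (rule that)
qed

lemma \<iota>_dif: "\<iota> (dif (i, j)) = axis i 1 - axis j 1"
proof -
  have "axis i 1 - axis j 1 \<in> range \<iota>"
    by (rule zero_sum_range) (simp add: axis_def sum_subtractf)
  then obtain a where "\<iota> a = axis i 1 - axis j 1" by force
  then have "\<iota> (SOME a. \<iota> a = axis i 1 - axis j 1) = axis i 1 - axis j 1" by (rule someI)
  then show ?thesis by (simp add: dif_def)
qed

lemma inner_dif: "x \<bullet> dif (i, j) = crd x i - crd x j"
  unfolding inner_\<iota>[symmetric] \<iota>_dif by (simp add: inner_diff_right inner_axis crd_def)

lemma linear_crd: "linear (\<lambda>x. crd x i)"
  unfolding crd_def using linear_\<iota> by (auto simp: linear_iff)

lemma crd_line: "crd (x + t *\<^sub>R b) i = crd x i + t * crd b i"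
  by (simp add: linear_add[OF linear_crd] linear_cmul[OF linear_crd])

lemma crd_bound: "\<bar>crd x i - crd x j\<bar> \<le> 2 * (1 + norm x)"
  using component_le_norm_cart[of "\<iota> x" i] component_le_norm_cart[of "\<iota> x" j]
  by (simp add: crd_def norm_\<iota>)

lemma measurable_pair_weight [measurable]: "(\<lambda>x. pair_weight e (crd x)) \<in> borel_measurable borel"
proof -
  have [measurable]: "(\<lambda>x. crd x i) \<in> borel_measurable borel" for i
    by (rule linear_borel_measurable[OF linear_crd])
  show ?thesis unfolding pair_weight_def inj_def by measurable
qed

text \<open>Choose \<open>x\<close> with \<open>x \<bullet> dif t = u t\<close> along the tree. Then
  the sum of the squares of the \<open>u t\<close> is the inner product of \<open>x\<close> with the
  vanishing combination.\<close>

lemma dif_independent: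
  assumes T: "is_tree UNIV T" and u: "(\<Sum>t\<in>T. u t *\<^sub>R dif t) = 0"
  shows "\<forall>t\<in>T. u t = 0"
proof -
  obtain z where z: "\<forall>(i, j)\<in>T. z i - z j = u (i, j)" using is_tree_differences[OF T] by blast
  \<comment> \<open>Subtracting the mean keeps all differences and puts the point into the image of
    the embedding.\<close>
  define a where "a = (\<Sum>i\<in>UNIV. z i) / CARD('n)"
  have "(\<Sum>i\<in>UNIV. z i - a) = 0" by (simp add: sum_subtractf a_def)
  then obtain x where x: "\<And>i. crd x i = z i - a" by (rule zero_sumE) blast
  have "x \<bullet> dif t = u t" if "t \<in> T" for t
    using z that by (cases t) (auto simp: inner_dif x)
  then have "(\<Sum>t\<in>T. (u t)\<^sup>2) = x \<bullet> (\<Sum>t\<in>T. u t *\<^sub>R dif t)"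
    by (simp add: inner_sum_right power2_eq_square)
  then have "(\<Sum>t\<in>T. (u t)\<^sup>2) = 0" using u by simp
  then show ?thesis by (subst (asm) sum_nonneg_eq_0_iff) auto
qed

text \<open>Each tree contributes a product of powers above \<open>-1\<close> of independent linear
  functionals, which is integrable against a polynomial times the Gaussian; there are finitely many
  trees.\<close>

lemma integrable_pair_weight:
  assumes sym: "\<And>i j. e i j = e j i" and diag: "\<And>i. e i i = 0"
    and pos: "\<And>K. 2 \<le> card K \<Longrightarrow> exponent_sum e K / 2 + (real (card K) - 1) > 0"
    and p: "p \<in> Pol"
  shows "integrable lborel (\<lambda>x. cmod (p x) * pair_weight e (crd x) * exp (- (norm x)\<^sup>2 / 2))"
proof -
  obtain s C k where s: "0 \<le> s" "s < (1::real)" "C \<ge> 0" and bound: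
    "\<And>z D. D \<ge> 1 \<Longrightarrow> (\<And>i j. \<bar>z i - z j\<bar> \<le> D) \<Longrightarrow>
      pair_weight e z \<le> C * D ^ k * (\<Sum>T | is_tree UNIV T. \<Prod>(i, j)\<in>T. \<bar>z i - z j\<bar> powr (- s))"
    using pair_weight_bound[OF sym diag pos] by metis
  obtain K l where K: "K \<ge> 0" "\<And>x. cmod (p x) \<le> K * (1 + norm x) ^ l" using Pol_growth[OF p] by blast
  define F where "F T x = (\<Prod>t\<in>T. \<bar>x \<bullet> dif t\<bar> powr (- s)) * (1 + norm x) ^ (l + k) * exp (- (norm x)\<^sup>2 / 2)" for T and x :: 'a
  have F_nonneg: "F T x \<ge> 0" for T x by (simp add: F_def prod_nonneg)
  have F_int: "integrable lborel (F T)" if T: "is_tree UNIV T" for T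
  proof (rule integrableI_bounded)
    show "F T \<in> borel_measurable lborel" unfolding F_def by measurable
    show "(\<integral>\<^sup>+x. ennreal (norm (F T x)) \<partial>lborel) < \<infinity>"
      using nn_integral_independent_powr[OF _ dif_independent[OF T] s(1,2), where k = "l + k"] F_nonneg by (simp add: F_def)
  qed
  have "integrable lborel (\<lambda>x. K * C * 2 ^ k * (\<Sum>T | is_tree UNIV T. F T x))"
    using F_int by (intro integrable_mult_right Bochner_Integration.integrable_sum) auto
  then show ?thesis
  proof (rule Bochner_Integration.integrable_bound)
    have [measurable]: "p \<in> borel_measurable borel" by (rule Pol_measurable[OF p])
    show "(\<lambda>x. cmod (p x) * pair_weight e (crd x) * exp (- (norm x)\<^sup>2 / 2)) \<in> borel_measurable lborel" by measurable
    show "AE x in lborel. norm (cmod (p x) * pair_weight e (crd x) * exp (- (norm x)\<^sup>2 / 2))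
       \<le> norm (K * C * 2 ^ k * (\<Sum>T | is_tree UNIV T. F T x))"
    proof (rule AE_I2)
      fix x :: 'a
      let ?P = "\<lambda>T. \<Prod>t\<in>T. \<bar>x \<bullet> dif t\<bar> powr (- s)"
      have D: "2 * (1 + norm x) \<ge> 1" by simp
      have "pair_weight e (crd x) \<le> C * (2 * (1 + norm x)) ^ k * (\<Sum>T | is_tree UNIV T. ?P T)"
      proof -
        have "(\<Prod>(i, j)\<in>T. \<bar>crd x i - crd x j\<bar> powr (- s)) = ?P T" for T
          by (rule prod.cong) (auto simp: inner_dif)
        then show ?thesis using bound[of _ "crd x", OF D crd_bound] by simp
      qed
      then have "cmod (p x) * pair_weight e (crd x) * exp (- (norm x)\<^sup>2 / 2)
        \<le> (K * (1 + norm x) ^ l) * (C * (2 * (1 + norm x)) ^ k * (\<Sum>T | is_tree UNIV T. ?P T)) * exp (- (norm x)\<^sup>2 / 2)"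
        using K s by (intro mult_right_mono mult_mono) (auto simp: pair_weight_nonneg)
      also have "\<dots> = K * C * 2 ^ k * (\<Sum>T | is_tree UNIV T. F T x)"
        unfolding F_def power_mult_distrib power_add by (simp add: sum_distrib_left sum_distrib_right mult_ac)
      finally show "norm (cmod (p x) * pair_weight e (crd x) * exp (- (norm x)\<^sup>2 / 2))
        \<le> norm (K * C * 2 ^ k * (\<Sum>T | is_tree UNIV T. F T x))"
        using K s F_nonneg by (simp add: pair_weight_nonneg sum_nonneg)
    qed
  qed
qed

end

section \<open>Products of Vandermonde determinants\<close>

text \<open>The index type carries no order, so an injection \<open>ord\<close> into the naturals
  selects one representative of each unordered pair.\<close>

lemma sum_ordered_pairs:
  fixes F :: "'n::finite \<Rightarrow> 'n \<Rightarrow> real"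
  assumes ord: "inj (ord :: 'n \<Rightarrow> nat)" and sym: "\<And>i j. F i j = F j i" and diag: "\<And>i. F i i = 0"
  shows "(\<Sum>(i, j) | ord i < ord j. F i j) = (\<Sum>i\<in>UNIV. \<Sum>j\<in>UNIV. F i j) / 2"
proof -
  have "(\<Sum>i\<in>UNIV. \<Sum>j\<in>UNIV. F i j) = (\<Sum>(i, j)\<in>UNIV. F i j)"
    by (simp add: sum.cartesian_product)
  also have "(UNIV :: ('n \<times> 'n) set) = {(i, j). ord i < ord j} \<union> ({(i, j). ord j < ord i} \<union> {(i, j). i = j})"
    using ord by (auto dest: injD) (metis injD linorder_neqE_nat)
  also have "(\<Sum>(i, j)\<in>\<dots>. F i j) = (\<Sum>(i, j) | ord i < ord j. F i j) + ((\<Sum>(i, j) | ord j < ord i. F i j) + (\<Sum>(i, j) | i = j. F i j))"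
    using ord by (subst sum.union_disjoint; (subst sum.union_disjoint)?) auto
  also have "(\<Sum>(i, j) | i = j. F i j) = 0" by (rule sum.neutral) (auto simp: diag)
  also have "(\<Sum>(i, j) | ord j < ord i. F i j) = (\<Sum>(i, j) | ord i < ord j. F i j)"
    by (rule sum.reindex_bij_witness[where i = prod.swap and j = prod.swap]) (auto simp: sym)
  finally show ?thesis by simp
qed

text \<open>The product of the Vandermonde determinants of the colour classes, up to the sign fixed
  by \<open>ord\<close>, restricted to indices in \<open>X\<close> so that single indices can be
  split off.\<close>

definition vdm :: "('n::finite \<Rightarrow> nat) \<Rightarrow> ('n \<Rightarrow> nat) \<Rightarrow> 'n set \<Rightarrow> ('n \<Rightarrow> real) \<Rightarrow> real" where
  "vdm ord col X z = (\<Prod>(i, j) | i \<in> X \<and> j \<in> X \<and> ord i < ord j \<and> col i = col j. z i - z j)"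

definition same :: "('n \<Rightarrow> nat) \<Rightarrow> 'n \<Rightarrow> 'n \<Rightarrow> real" where
  "same col i j = of_bool (i \<noteq> j \<and> col i = col j)"

lemma vdm_cong: "(\<And>k. k \<in> X \<Longrightarrow> z k = w k) \<Longrightarrow> vdm ord col X z = vdm ord col X w"
  unfolding vdm_def by (rule prod.cong) auto

lemma vdm_remove:
  assumes ord: "inj ord" and i: "i \<in> X"
  shows "vdm ord col X z = (\<Prod>k | k \<in> X - {i} \<and> col k = col i. if ord i < ord k then 1 else - 1)
    * (\<Prod>k | k \<in> X - {i} \<and> col k = col i. z i - z k) * vdm ord col (X - {i}) z"
proof -
  let ?K = "{k. k \<in> X - {i} \<and> col k = col i}"
  let ?f = "\<lambda>k. if ord i < ord k then (i, k) else (k, i)"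
  let ?P = "\<lambda>X. {(i, j). i \<in> X \<and> j \<in> X \<and> ord i < ord j \<and> col i = col j}"
  have P: "?P X = ?f ` ?K \<union> ?P (X - {i})"
  proof (intro equalityI subsetI)
    fix q assume "q \<in> ?P X"
    then obtain a b where q: "q = (a, b)" "a \<in> X" "b \<in> X" "ord a < ord b" "col a = col b" by auto
    consider "a = i" | "b = i" | "a \<noteq> i" "b \<noteq> i" by blast
    then show "q \<in> ?f ` ?K \<union> ?P (X - {i})"
    proof cases
      case 1
      then show ?thesis using q by (intro UnI1 image_eqI[of _ _ b]) auto
    next
      case 2
      then show ?thesis using q by (intro UnI1 image_eqI[of _ _ a]) auto
    next
      case 3
      then show ?thesis using q by simp
    qed
  next
    fix q assume "q \<in> ?f ` ?K \<union> ?P (X - {i})"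
    moreover have "ord k < ord i" if "\<not> ord i < ord k" "k \<noteq> i" for k
      using that ord by (meson injD linorder_neqE_nat)
    ultimately show "q \<in> ?P X" using i by (auto split: if_splits)
  qed
  have "vdm ord col X z = (\<Prod>(i, j)\<in>?f ` ?K. z i - z j) * vdm ord col (X - {i}) z"
    unfolding vdm_def P by (rule prod.union_disjoint) (auto split: if_splits)
  also have "(\<Prod>(i, j)\<in>?f ` ?K. z i - z j) = (\<Prod>k\<in>?K. case ?f k of (i, j) \<Rightarrow> z i - z j)"
    by (subst prod.reindex) (auto simp: inj_on_def split: if_splits)
  also have "\<dots> = (\<Prod>k\<in>?K. (if ord i < ord k then 1 else - 1) * (z i - z k))"
    by (rule prod.cong) auto
  finally show ?thesis by (simp only: prod.distrib)
qed

text \<open>Only the factors involving \<open>i\<close> or \<open>j\<close> change. The ratio of the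
  two values is stated with cleared denominators, so coincident points need no exception.\<close>

lemma vdm_exchange:
  fixes z :: "'n::finite \<Rightarrow> real"
  assumes ord: "inj ord" and ij: "i \<noteq> j" and col: "col i \<noteq> col j"
  defines "G \<equiv> {k. col k = col i} - {i}" and "H \<equiv> {k. col k = col j} - {j}"
  shows "vdm ord col UNIV (z \<circ> Transposition.transpose i j) * ((\<Prod>k\<in>G. z i - z k) * (\<Prod>k\<in>H. z j - z k))
    = vdm ord col UNIV z * ((\<Prod>k\<in>G. z j - z k) * (\<Prod>k\<in>H. z i - z k))"
proof -
  have G: "{k. k \<in> UNIV - {i} \<and> col k = col i} = G" by (auto simp: G_def)
  have H: "{k. k \<in> UNIV - {i} - {j} \<and> col k = col j} = H" using col by (auto simp: H_def)
  define a where "a = (\<Prod>k\<in>G. if ord i < ord k then 1 else (- 1::real))"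
  define b where "b = (\<Prod>k\<in>H. if ord j < ord k then 1 else (- 1::real))"
  have v: "vdm ord col UNIV w = a * (\<Prod>k\<in>G. w i - w k) * (b * (\<Prod>k\<in>H. w j - w k) * vdm ord col (UNIV - {i} - {j}) w)" for w
    unfolding vdm_remove[OF ord UNIV_I[of i]] vdm_remove[OF ord, of j "UNIV - {i}"] G a_def b_def
    using vdm_remove[OF ord, of j "UNIV - {i}" col w] ij unfolding H by simp
  let ?w = "z \<circ> Transposition.transpose i j"
  have "(\<Prod>k\<in>G. ?w i - ?w k) = (\<Prod>k\<in>G. z j - z k)"
    using col by (intro prod.cong) (auto simp: G_def Transposition.transpose_def)
  moreover have "(\<Prod>k\<in>H. ?w j - ?w k) = (\<Prod>k\<in>H. z i - z k)"
    using col by (intro prod.cong) (auto simp: H_def Transposition.transpose_def)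
  moreover have "vdm ord col (UNIV - {i} - {j}) ?w = vdm ord col (UNIV - {i} - {j}) z"
    by (rule vdm_cong) (auto simp: Transposition.transpose_def)
  ultimately show ?thesis unfolding v[of ?w] v[of z] by (simp add: mult_ac)
qed

lemma vdm_alternating:
  fixes z :: "'n::finite \<Rightarrow> real"
  assumes ord: "inj ord" and ij: "i \<noteq> j" and col: "col i = col j"
  shows "vdm ord col UNIV (z \<circ> Transposition.transpose i j) = - vdm ord col UNIV z"
proof -
  define G where "G = {k. col k = col i} - {i} - {j}"
  have G: "{k. k \<in> UNIV - {i} \<and> col k = col i} = insert j G" using ij col by (auto simp: G_def)
  have H: "{k. k \<in> UNIV - {i} - {j} \<and> col k = col j} = G" using col by (auto simp: G_def)
  define a where "a = (\<Prod>k\<in>insert j G. if ord i < ord k then 1 else (- 1::real))"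
  define b where "b = (\<Prod>k\<in>G. if ord j < ord k then 1 else (- 1::real))"
  have jG: "j \<notin> G" by (simp add: G_def)
  have v: "vdm ord col UNIV w = a * ((w i - w j) * (\<Prod>k\<in>G. w i - w k)) * (b * (\<Prod>k\<in>G. w j - w k) * vdm ord col (UNIV - {i} - {j}) w)" for w
    unfolding vdm_remove[OF ord UNIV_I[of i]] G a_def b_def
    using vdm_remove[OF ord, of j "UNIV - {i}" col w] ij jG unfolding H by simp
  let ?w = "z \<circ> Transposition.transpose i j"
  have "(\<Prod>k\<in>G. ?w i - ?w k) = (\<Prod>k\<in>G. z j - z k)" "(\<Prod>k\<in>G. ?w j - ?w k) = (\<Prod>k\<in>G. z i - z k)"
    by (auto simp: G_def Transposition.transpose_def intro!: prod.cong)
  moreover have "vdm ord col (UNIV - {i} - {j}) ?w = vdm ord col (UNIV - {i} - {j}) z"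
    by (rule vdm_cong) (auto simp: Transposition.transpose_def)
  moreover have "?w i - ?w j = - (z i - z j)" by simp
  moreover have "a * (- d * P) * (b * Q * V) = - (a * (d * Q) * (b * P * V))" for d P Q V :: real by simp
  ultimately show ?thesis unfolding v[of ?w] v[of z] by (simp only:)
qed

definition balanced :: "nat \<Rightarrow> ('n::finite \<Rightarrow> nat) \<Rightarrow> bool" where
  "balanced r col \<longleftrightarrow> (\<forall>k. col k < r) \<and> (\<forall>g<r. \<forall>h<r. card {k. col k = g} \<le> card {k. col k = h} + 1)"

text \<open>The colour of \<open>i\<close> contributes \<open>2 * S\<close>, because the product is
  alternating in its variables; each of the other \<open>m - 2\<close> colours contributes
  \<open>S\<close> by \<open>exchange_identity\<close>. The total \<open>m * S\<close> is what
  \<open>c = 1 / m\<close> cancels.\<close>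

lemma vdm_singular:
  fixes z :: "'n::finite \<Rightarrow> real"
  assumes ord: "inj ord" and z: "inj z" and m: "2 \<le> m" and bal: "balanced (m - 1) col"
  shows "(\<Sum>j\<in>UNIV - {i}. (vdm ord col UNIV z - vdm ord col UNIV (z \<circ> Transposition.transpose i j)) / (z i - z j))
    = real m * (\<Sum>j\<in>{k. col k = col i} - {i}. vdm ord col UNIV z / (z i - z j))"
proof -
  define G where "G = {k. col k = col i} - {i}"
  define v where "v = vdm ord col UNIV z"
  define S where "S = (\<Sum>j\<in>G. v / (z i - z j))"
  define t where "t j = (v - vdm ord col UNIV (z \<circ> Transposition.transpose i j)) / (z i - z j)" for j
  have same: "(\<Sum>j | j \<in> UNIV - {i} \<and> col j = col i. t j) = 2 * S"
  proof -
    have "(\<Sum>j | j \<in> UNIV - {i} \<and> col j = col i. t j) = (\<Sum>j\<in>G. 2 * (v / (z i - z j)))"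
      unfolding t_def v_def by (rule sum.cong) (auto simp: G_def vdm_alternating[OF ord])
    then show ?thesis by (simp add: S_def sum_distrib_left)
  qed
  have other: "(\<Sum>j | j \<in> UNIV - {i} \<and> col j = g. t j) = S" if g: "g < m - 1" "g \<noteq> col i" for g
  proof -
    define H where "H = {k. col k = g}"
    have H: "{j. j \<in> UNIV - {i} \<and> col j = g} = H" using g by (auto simp: H_def)
    \<comment> \<open>\<open>G\<close> omits \<open>i\<close> itself, so the tolerance of one in
      \<open>balanced\<close> is exactly what the partial fractions allow.\<close>
    have "card G \<le> card H"
    proof -
      have "card {k. col k = col i} \<le> card H + 1" using bal g by (simp add: balanced_def H_def)
      then show ?thesis by (simp add: G_def card_Diff_singleton)
    qed
    moreover have "inj_on z H" using z by (rule inj_on_subset) simp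
    moreover have "z i \<notin> z ` G" "z i \<notin> z ` H" using z g by (auto simp: G_def H_def dest: injD)
    ultimately have ex: "(\<Sum>j\<in>H. (1 - (\<Prod>k\<in>G. z j - z k) * (\<Prod>k\<in>H - {j}. z i - z k)
      / ((\<Prod>k\<in>G. z i - z k) * (\<Prod>k\<in>H - {j}. z j - z k))) / (z i - z j)) = (\<Sum>k\<in>G. 1 / (z i - z k))"
      by (intro exchange_identity) auto
    have "t j = v * ((1 - (\<Prod>k\<in>G. z j - z k) * (\<Prod>k\<in>H - {j}. z i - z k)
      / ((\<Prod>k\<in>G. z i - z k) * (\<Prod>k\<in>H - {j}. z j - z k))) / (z i - z j))" if j: "j \<in> H" for j
    proof -
      have nz: "(\<Prod>k\<in>G. z i - z k) * (\<Prod>k\<in>H - {j}. z j - z k) \<noteq> 0"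
        using z by (auto simp: G_def dest: injD)
      have "H = {k. col k = col j}" "i \<noteq> j" "col i \<noteq> col j" using j g by (auto simp: H_def)
      from vdm_exchange[OF ord this(2,3), of z, folded this(1)]
      have "vdm ord col UNIV (z \<circ> Transposition.transpose i j) = v * ((\<Prod>k\<in>G. z j - z k) * (\<Prod>k\<in>H - {j}. z i - z k)
          / ((\<Prod>k\<in>G. z i - z k) * (\<Prod>k\<in>H - {j}. z j - z k)))"
        using nz by (simp add: G_def v_def eq_divide_eq)
      then show ?thesis unfolding t_def by (simp add: right_diff_distrib)
    qed
    then have "(\<Sum>j\<in>H. t j) = v * (\<Sum>k\<in>G. 1 / (z i - z k))"
      unfolding ex[symmetric] sum_distrib_left by (rule sum.cong[OF refl])
    then show ?thesis unfolding H by (simp add: S_def sum_distrib_left)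
  qed
  have ci: "col i < m - 1" using bal by (simp add: balanced_def)
  have "(\<Sum>j\<in>UNIV - {i}. t j) = (\<Sum>g\<in>{..<m - 1}. \<Sum>j | j \<in> UNIV - {i} \<and> col j = g. t j)"
    using bal by (intro sum.group[symmetric]) (auto simp: balanced_def)
  also have "\<dots> = (\<Sum>j | j \<in> UNIV - {i} \<and> col j = col i. t j) + (\<Sum>g\<in>{..<m - 1} - {col i}. \<Sum>j | j \<in> UNIV - {i} \<and> col j = g. t j)"
    using ci by (intro sum.remove) auto
  also have "(\<Sum>g\<in>{..<m - 1} - {col i}. \<Sum>j | j \<in> UNIV - {i} \<and> col j = g. t j) = (\<Sum>g\<in>{..<m - 1} - {col i}. S)"
    by (rule sum.cong[OF refl]) (rule other, auto)
  also have "\<dots> = (real m - 2) * S" using ci m by (simp add: of_nat_diff)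
  finally show ?thesis unfolding same by (simp add: t_def S_def v_def G_def algebra_simps)
qed

lemma vdm_nonzero: "inj z \<Longrightarrow> vdm ord col X z \<noteq> 0"
  unfolding vdm_def by (auto dest: injD)

lemma abs_vdm:
  fixes z :: "'n::finite \<Rightarrow> real"
  assumes ord: "inj ord" and z: "inj z"
  shows "\<bar>vdm ord col UNIV z\<bar> = pair_weight (same col) z"
proof -
  let ?L = "\<lambda>i j. same col i j * ln \<bar>z i - z j\<bar>"
  have "\<bar>vdm ord col UNIV z\<bar> = (\<Prod>(i, j) | ord i < ord j \<and> col i = col j. \<bar>z i - z j\<bar>)"
    by (simp add: vdm_def abs_prod case_prod_unfold)
  also have "\<dots> = (\<Prod>(i, j) | ord i < ord j \<and> col i = col j. exp (?L i j))"
    by (intro prod.cong) (auto simp: same_def inj_eq[OF z])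
  also have "\<dots> = (\<Prod>(i, j) | ord i < ord j. exp (?L i j))"
    by (rule prod.mono_neutral_left) (auto simp: same_def)
  also have "\<dots> = exp (\<Sum>(i, j) | ord i < ord j. ?L i j)"
    by (simp add: exp_sum case_prod_unfold)
  also have "(\<Sum>(i, j) | ord i < ord j. ?L i j) = (\<Sum>i\<in>UNIV. \<Sum>j\<in>UNIV. ?L i j) / 2"
    by (rule sum_ordered_pairs[OF ord]) (auto simp: same_def abs_minus_commute)
  finally show ?thesis using z by (simp add: pair_weight_def)
qed

lemma vdm_deriv:
  fixes z :: "'n::finite \<Rightarrow> real"
  assumes ord: "inj ord" and z: "inj z"
  shows "((\<lambda>t. vdm ord col UNIV (\<lambda>i. z i + t * b i)) has_real_derivative
    vdm ord col UNIV z * ((\<Sum>i\<in>UNIV. \<Sum>j\<in>UNIV. same col i j * ((b i - b j) / (z i - z j))) / 2)) (at 0)"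
proof -
  let ?P = "{(i, j). ord i < ord j \<and> col i = col j}"
  have "((\<lambda>t. \<Prod>p\<in>?P. case p of (i, j) \<Rightarrow> (z i + t * b i) - (z j + t * b j)) has_real_derivative
     (\<Prod>p\<in>?P. case p of (i, j) \<Rightarrow> (z i + 0 * b i) - (z j + 0 * b j))
      * (\<Sum>p\<in>?P. (case p of (i, j) \<Rightarrow> b i - b j) / (case p of (i, j) \<Rightarrow> (z i + 0 * b i) - (z j + 0 * b j)))) (at 0)"
    using z by (intro has_field_derivative_prod') (auto intro!: derivative_eq_intros dest: injD)
  note d = this
  have e1: "(\<Sum>p\<in>?P. (case p of (i, j) \<Rightarrow> b i - b j) / (case p of (i, j) \<Rightarrow> (z i + 0 * b i) - (z j + 0 * b j)))
     = (\<Sum>(i, j) | ord i < ord j. same col i j * ((b i - b j) / (z i - z j)))"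
    by (rule sum.mono_neutral_cong_left) (auto simp: same_def)
  have e2: "(\<Sum>(i, j) | ord i < ord j. same col i j * ((b i - b j) / (z i - z j))) = (\<Sum>i\<in>UNIV. \<Sum>j\<in>UNIV. same col i j * ((b i - b j) / (z i - z j))) / 2"
  proof (rule sum_ordered_pairs[OF ord])
    fix i j
    have "(b i - b j) / (z i - z j) = (b j - b i) / (z j - z i)"
      using minus_divide_divide[of "b i - b j" "z i - z j"] by simp
    then show "same col i j * ((b i - b j) / (z i - z j)) = same col j i * ((b j - b i) / (z j - z i))"
      by (auto simp: same_def)
  qed simp
  show ?thesis using d unfolding e1 e2 by (simp add: vdm_def case_prod_unfold)
qed

lemma vdm_permute:
  assumes "bij \<sigma>"
  shows "vdm ord col UNIV (z \<circ> \<sigma>) = vdm (ord \<circ> inv_into UNIV \<sigma>) (col \<circ> inv_into UNIV \<sigma>) UNIV z"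
  unfolding vdm_def
  by (rule prod.reindex_bij_witness[where i = "\<lambda>(i, j). (inv_into UNIV \<sigma> i, inv_into UNIV \<sigma> j)" and j = "\<lambda>(i, j). (\<sigma> i, \<sigma> j)"])
    (use assms in \<open>auto simp: bij_is_inj bij_is_surj surj_f_inv_f\<close>)

lemma balanced_permute:
  assumes "bij \<sigma>" "balanced r col"
  shows "balanced r (col \<circ> \<sigma>)"
proof -
  have "card {k. (col \<circ> \<sigma>) k = g} = card {k. col k = g}" for g
  proof (rule bij_betw_same_card[of \<sigma>], rule bij_betw_imageI)
    show "inj_on \<sigma> {k. (col \<circ> \<sigma>) k = g}" using bij_is_inj[OF assms(1)] by (rule inj_on_subset) simp
    show "\<sigma> ` {k. (col \<circ> \<sigma>) k = g} = {k. col k = g}"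
      using surj_image_vimage_eq[OF bij_is_surj[OF assms(1)], of "{k. col k = g}"] by (simp add: vimage_def)
  qed
  then show ?thesis using assms(2) by (simp add: balanced_def)
qed

text \<open>Colour an enumeration of the indices by residues modulo \<open>r\<close>.\<close>

lemma balanced_exists:
  assumes r: "r > 0"
  shows "\<exists>col :: 'n::finite \<Rightarrow> nat. balanced r col"
proof -
  obtain f :: "'n \<Rightarrow> nat" where f: "bij_betw f UNIV {0..<CARD('n)}"
    using ex_bij_betw_finite_nat[of "UNIV :: 'n set"] by auto
  let ?N = "CARD('n)"
  let ?C = "\<lambda>g. {t. t < ?N \<and> t mod r = g}"
  have c: "card {k. f k mod r = g} = card (?C g)" for g
  proof (rule bij_betw_same_card[of f])
    show "bij_betw f {k. f k mod r = g} (?C g)"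
      using f by (auto simp: bij_betw_def inj_on_def image_iff set_eq_iff) (metis)
  qed
  have "card (?C g) \<le> card (?C h) + 1" if gh: "g < r" "h < r" for g h
  proof -
    \<comment> \<open>At most one element of a residue class lies below \<open>r\<close>. The others
      are sent to the element of the class of \<open>h\<close> in the preceding block of length
      \<open>r\<close>, which is still below \<open>?N\<close>.\<close>
    have sub: "?C g \<subseteq> insert g {t \<in> ?C g. t \<ge> r}"
      by (auto simp: not_le) (metis mod_less not_le)
    have "card (?C g) \<le> card (insert g {t \<in> ?C g. t \<ge> r})"
      by (rule card_mono[OF _ sub]) simp
    also have "\<dots> \<le> card {t \<in> ?C g. t \<ge> r} + 1" by (simp add: card_insert_if)
    also have "card {t \<in> ?C g. t \<ge> r} \<le> card (?C h)"
    proof (rule card_inj_on_le[where f = "\<lambda>t. (t div r - 1) * r + h"])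
      show "inj_on (\<lambda>t. (t div r - 1) * r + h) {t \<in> ?C g. t \<ge> r}"
      proof (rule inj_onI)
        fix t u assume t: "t \<in> {t \<in> ?C g. t \<ge> r}" and u: "u \<in> {t \<in> ?C g. t \<ge> r}"
          and e: "(t div r - 1) * r + h = (u div r - 1) * r + h"
        have "t div r \<ge> 1" "u div r \<ge> 1" using t u r div_le_mono[of r _ r] by (auto simp: Suc_le_eq div_greater_zero_iff)
        then have "t div r = u div r" using e r by simp
        moreover have "t mod r = u mod r" using t u by simp
        ultimately show "t = u" by (metis div_mult_mod_eq)
      qed
      show "(\<lambda>t. (t div r - 1) * r + h) ` {t \<in> ?C g. t \<ge> r} \<subseteq> ?C h"
      proof clarify
        fix t assume t: "t < ?N" "r \<le> t"
        have "t div r \<ge> 1" using t r by (simp add: Suc_le_eq div_greater_zero_iff)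
        then obtain q where q: "t div r = Suc q" by (cases "t div r") auto
        have "q * r + h < Suc q * r" using gh by simp
        also have "\<dots> \<le> t" using q div_times_less_eq_dividend[of t r] by (metis)
        finally show "(t div r - 1) * r + h < ?N \<and> ((t div r - 1) * r + h) mod r = h"
          using t gh q by simp
      qed
    qed simp
    finally show ?thesis by simp
  qed
  then have "balanced r (\<lambda>k. f k mod r)" unfolding balanced_def c using r by simp
  then show ?thesis by blast
qed

text \<open>With the diagonal restored, the exponents of the same-colour pairs add up to the sum of
  the squares of the class sizes; the bound is Cauchy-Schwarz over \<open>r\<close> classes.\<close>

lemma exponent_sum_same:
  fixes col :: "'n::finite \<Rightarrow> nat"
  assumes "\<And>k. col k < r"
  shows "(real (card K))\<^sup>2 \<le> real r * (exponent_sum (same col) K + real (card K))"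
proof -
  define n where "n g = real (card {k \<in> K. col k = g})" for g
  have n: "(\<Sum>g<r. n g) = real (card K)"
  proof -
    have "(\<Sum>g<r. \<Sum>k | k \<in> K \<and> col k = g. (1::real)) = (\<Sum>k\<in>K. 1)"
      using assms by (intro sum.group) auto
    then show ?thesis by (simp add: n_def)
  qed
  have "exponent_sum (same col) K + real (card K) = (\<Sum>i\<in>K. \<Sum>j\<in>K. of_bool (col i = col j))"
  proof -
    have "(\<Sum>i\<in>K. \<Sum>j\<in>K. of_bool (col i = col j)) = (\<Sum>i\<in>K. \<Sum>j\<in>K. same col i j + (if i = j then 1 else 0))"
      by (intro sum.cong refl) (auto simp: same_def)
    then show ?thesis by (simp add: exponent_sum_def sum.distrib)
  qed
  also have "\<dots> = (\<Sum>i\<in>K. n (col i))"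
    by (intro sum.cong refl) (simp add: n_def of_bool_def sum.If_cases Int_def eq_commute)
  also have "\<dots> = (\<Sum>g<r. \<Sum>i | i \<in> K \<and> col i = g. n (col i))"
    using assms by (intro sum.group[symmetric]) auto
  also have "\<dots> = (\<Sum>g<r. (n g)\<^sup>2)"
    by (intro sum.cong refl) (simp add: n_def power2_eq_square)
  finally show ?thesis using sum_squared_le_sum_of_squares[of n "{..<r}"] n by (simp add: mult.commute)
qed

text \<open>\<open>d\<close> accounts for a pole of order one along a hyperplane on which the first product vanishes.\<close>

lemma exponents_positive:
  fixes c1 c2 :: "'n::finite \<Rightarrow> nat" and K :: "'n set"
  assumes m: "2 \<le> m" and c: "\<And>k. c1 k < m - 1" "\<And>k. c2 k < m - 1"
    and d: "\<And>i j. d i j \<le> same c1 i j" "exponent_sum d K \<le> 2" and K: "2 \<le> card K"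
  defines "e \<equiv> \<lambda>i j. same c1 i j + same c2 i j + (- 2 / real m) * of_bool (i \<noteq> j) + - d i j"
  shows "exponent_sum e K / 2 + (real (card K) - 1) > 0"
proof -
  define k where "k = real (card K)"
  define M where "M = real m"
  have M: "M \<ge> 2" "real (m - 1) = M - 1" and k2: "k \<ge> 2" using m K by (auto simp: M_def k_def of_nat_diff)
  have off: "exponent_sum (\<lambda>i j. of_bool (i \<noteq> j)) K = k * (k - 1)"
  proof -
    have "(\<Sum>j\<in>K. of_bool (i \<noteq> j)) = k - 1" if "i \<in> K" for i
    proof -
      have "(\<Sum>j\<in>K. of_bool (i \<noteq> j)) = (\<Sum>j\<in>K. 1 - (if i = j then 1 else 0::real))"
        by (intro sum.cong refl) auto
      then show ?thesis using that by (simp add: sum_subtractf k_def)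
    qed
    then show ?thesis by (simp add: exponent_sum_def k_def)
  qed
  define q where "q = k * (k - 1) / M"
  have e: "exponent_sum e K = exponent_sum (same c1) K + exponent_sum (same c2) K - 2 * q - exponent_sum d K"
  proof -
    have "exponent_sum e K = exponent_sum (same c1) K + exponent_sum (same c2) K + (- 2 / M) * (k * (k - 1)) + - exponent_sum d K"
      unfolding e_def off[symmetric] by (simp only: exponent_sum_def sum.distrib sum_negf sum_distrib_left M_def)
    then show ?thesis by (simp add: q_def)
  qed
  have s1: "exponent_sum d K \<le> exponent_sum (same c1) K" unfolding exponent_sum_def by (intro sum_mono d(1))
  have s2: "exponent_sum (same c2) K \<ge> 0" unfolding exponent_sum_def by (intro sum_nonneg) (simp add: same_def)
  show ?thesis
  proof (cases "k < M")
    case True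
    \<comment> \<open>For fewer than \<open>m\<close> variables the weight alone is integrable, and
      the vanishing of the first product pays for the pole \<open>d\<close>.\<close>
    have "(k - 1) * (1 - k / M) > 0" using True k2 M by (intro mult_pos_pos) auto
    moreover have "(k - 1) * (1 - k / M) = k - 1 - q"
      by (simp add: q_def algebra_simps diff_divide_distrib)
    ultimately have "k - 1 - q > 0" by (simp only:)
    moreover have "0 < x - 1 - y \<Longrightarrow> a \<le> b \<Longrightarrow> 0 \<le> b' \<Longrightarrow> 0 < (b + b' - 2 * y - a) / 2 + (x - 1)" for x y a b b' :: real
      by (simp add: field_simps)
    ultimately show ?thesis unfolding e k_def[symmetric] using s1 s2 by blast
  next
    case False
    \<comment> \<open>From \<open>m\<close> variables on, convexity supplies the exponent. What
      remains to beat is the constant \<open>2\<close>, of which one unit is the pole; it is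
      exceeded because \<open>k^2 / (M * (M - 1)) \<ge> 1 + 1 / (M - 1)\<close> and
      \<open>k / M \<ge> 1\<close>.\<close>
    have sq: "k\<^sup>2 / (M - 1) \<le> exponent_sum (same col) K + k" if "\<And>k. col k < m - 1" for col
      using exponent_sum_same[of col "m - 1" K, OF that] M(1) unfolding k_def[symmetric] M(2) by (simp add: pos_divide_le_eq mult.commute)
    have "k\<^sup>2 / (M - 1) - k\<^sup>2 / M + k / M - 2 > 0"
    proof -
      have "k\<^sup>2 / (M - 1) - k\<^sup>2 / M = k\<^sup>2 / (M * (M - 1))" using M by (simp add: field_simps)
      also have "\<dots> \<ge> M\<^sup>2 / (M * (M - 1))" using False M by (intro divide_right_mono power_mono) auto
      also have "M\<^sup>2 / (M * (M - 1)) = 1 + 1 / (M - 1)" using M by (simp add: field_simps power2_eq_square)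
      finally have "k\<^sup>2 / (M - 1) - k\<^sup>2 / M \<ge> 1 + 1 / (M - 1)" .
      moreover have "1 / (M - 1) > 0" using M by simp
      moreover have "k / M \<ge> 1" using False M by simp
      ultimately show ?thesis by linarith
    qed
    moreover have "exponent_sum e K / 2 \<ge> k\<^sup>2 / (M - 1) - k - k\<^sup>2 / M + k / M - 1"
    proof -
      have "q = k\<^sup>2 / M - k / M" by (simp add: q_def power2_eq_square algebra_simps diff_divide_distrib)
      moreover have "(s + t - 2 * y - x) / 2 \<ge> C - l - A + B - 1"
        if "y = A - B" "C \<le> s + l" "C \<le> t + l" "x \<le> 2" for s t x y A B C l :: real
        using that by (simp add: field_simps)
      ultimately show ?thesis unfolding e using sq[of c1, OF c(1)] sq[of c2, OF c(2)] d(2) by blast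
    qed
    ultimately show ?thesis unfolding k_def[symmetric] by linarith
  qed
qed

section \<open>The symmetric group\<close>

lemma double_sum_delta:
  fixes f :: "'n \<Rightarrow> 'n \<Rightarrow> real"
  assumes "finite K"
  shows "(\<Sum>i\<in>K. \<Sum>j\<in>K. if i = a \<and> j = b then f i j else 0) = (if a \<in> K \<and> b \<in> K then f a b else 0)"
proof -
  have "(\<Sum>j\<in>K. if i = a \<and> j = b then f i j else 0) = (if i = a then if b \<in> K then f a b else 0 else 0)" for i
    using assms by (cases "i = a") simp_all
  then show ?thesis using assms by simp
qed

text \<open>The symmetric indicator of one pair; subtracting it from the exponents adds a simple
  pole along \<open>z a = z b\<close>.\<close>

definition edge :: "'n \<Rightarrow> 'n \<Rightarrow> 'n \<Rightarrow> 'n \<Rightarrow> real" where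
  "edge a b i j = (if i = a \<and> j = b then 1 else 0) + (if i = b \<and> j = a then 1 else 0)"

lemma edge_sum:
  fixes f :: "'n \<Rightarrow> 'n \<Rightarrow> real"
  assumes "finite K"
  shows "(\<Sum>i\<in>K. \<Sum>j\<in>K. edge a b i j * f i j)
    = (if a \<in> K \<and> b \<in> K then f a b else 0) + (if b \<in> K \<and> a \<in> K then f b a else 0)"
proof -
  have r: "(if P then 1 else 0) * y = (if P then y else 0)" for P and y :: real by simp
  have "edge a b i j * f i j = (if i = a \<and> j = b then f i j else 0) + (if i = b \<and> j = a then f i j else 0)" for i j
    by (simp only: edge_def distrib_right r)
  then show ?thesis using assms by (simp only: sum.distrib double_sum_delta)
qed

lemma pair_weight_edge:
  fixes z :: "'n::finite \<Rightarrow> real"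
  assumes z: "inj z" and ab: "a \<noteq> b"
  shows "pair_weight (\<lambda>i j. - edge a b i j) z = 1 / \<bar>z a - z b\<bar>"
proof -
  have "(\<Sum>i\<in>UNIV. \<Sum>j\<in>UNIV. - edge a b i j * ln \<bar>z i - z j\<bar>) = - (\<Sum>i\<in>UNIV. \<Sum>j\<in>UNIV. edge a b i j * ln \<bar>z i - z j\<bar>)"
    by (simp add: sum_negf)
  also have "\<dots> = - 2 * ln \<bar>z a - z b\<bar>"
    by (subst edge_sum) (simp_all add: abs_minus_commute)
  finally show ?thesis using z ab by (simp add: pair_weight_def exp_minus inj_eq inverse_eq_divide)
qed

text \<open>The part with \<open>b i\<close> contains the vanishing row sums, and antisymmetry turns
  the part with \<open>b j\<close> into the same shape.\<close>

lemma sum_antisymmetric: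
  fixes b :: "'n::finite \<Rightarrow> real"
  assumes anti: "\<And>i j. K i j = - K j i" and zero: "\<And>i. (\<Sum>j\<in>UNIV. K i j) = 0"
  shows "(\<Sum>i\<in>UNIV. \<Sum>j\<in>UNIV. (b i - b j) * K i j) = 0"
proof -
  have "(\<Sum>i\<in>UNIV. \<Sum>j\<in>UNIV. b j * K i j) = (\<Sum>j\<in>UNIV. \<Sum>i\<in>UNIV. b j * K i j)"
    by (rule sum.swap)
  also have "\<dots> = (\<Sum>j\<in>UNIV. b j * - (\<Sum>i\<in>UNIV. K j i))"
    unfolding sum_negf[symmetric] sum_distrib_left by (subst anti) (rule refl)
  finally have "(\<Sum>i\<in>UNIV. \<Sum>j\<in>UNIV. b j * K i j) = 0" by (simp add: zero)
  then show ?thesis by (simp add: left_diff_distrib sum_subtractf sum_negf sum_distrib_left[symmetric] zero)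
qed

text \<open>The condition on \<open>W\<close> describes \<open>sym_group\<close> when the embedding
  is the identity, and it is the definition of \<open>sym_group_refl\<close> for a reflection
  embedding.\<close>

locale type_A = coordinates \<iota> + rational_cherednik W \<alpha> \<alpha>v "1 / real m"
  for \<iota> :: "'a::euclidean_space \<Rightarrow> real ^ 'n::finite" and W :: "('a \<Rightarrow> 'a) set" and \<alpha> \<alpha>v and m :: nat +
  assumes W_eq: "W = {g. \<exists>\<sigma>. \<sigma> permutes UNIV \<and> (\<forall>v. \<iota> (g v) = perm_act \<sigma> (\<iota> v))}"
    and m: "2 \<le> m"
begin

section \<open>Transpositions as the reflections of the group\<close>

lemma crd_eqI: "(\<And>i. crd x i = crd y i) \<Longrightarrow> x = y"
  by (rule inj_\<iota>) (simp add: crd_def vec_eq_iff)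

lemma W_E:
  assumes "w \<in> W"
  obtains \<sigma> where "bij \<sigma>" "\<And>x. crd (w x) = crd x \<circ> inv_into UNIV \<sigma>"
proof -
  obtain \<sigma> where "\<sigma> permutes UNIV" "\<And>v. \<iota> (w v) = perm_act \<sigma> (\<iota> v)" using assms by (auto simp: W_eq)
  then show thesis by (intro that[of \<sigma>]) (auto simp: permutes_bij crd_def perm_act_def)
qed

definition swap :: "'n \<Rightarrow> 'n \<Rightarrow> 'a \<Rightarrow> 'a" where
  "swap i j x = x - (crd x i - crd x j) *\<^sub>R dif (i, j)"

lemma crd_dif: "crd (dif (i, j)) k = of_bool (k = i) - of_bool (k = j)"
  by (simp add: crd_def \<iota>_dif axis_def)

lemma crd_swap: "i \<noteq> j \<Longrightarrow> crd (swap i j x) = crd x \<circ> Transposition.transpose i j"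
  by (rule ext) (auto simp: swap_def linear_diff[OF linear_crd] linear_cmul[OF linear_crd] crd_dif Transposition.transpose_def)

lemma swap_commute: "i \<noteq> j \<Longrightarrow> swap i j = swap j i"
  by (intro ext crd_eqI) (simp add: crd_swap transpose_commute)

lemma dif_nonzero: "i \<noteq> j \<Longrightarrow> dif (i, j) \<noteq> 0"
  using crd_dif[of i j i] linear_0[OF linear_crd, of i] by auto

lemma swap_reflection:
  assumes ij: "i \<noteq> j"
  shows "swap i j \<in> reflections"
  unfolding reflections_def
proof (intro CollectI conjI)
  have inv: "inv_into UNIV (Transposition.transpose i j) = Transposition.transpose i j"
    by (rule inv_unique_comp) auto
  have "\<iota> (swap i j v) = perm_act (Transposition.transpose i j) (\<iota> v)" for v
    using crd_swap[OF ij, of v] by (simp add: vec_eq_iff perm_act_def inv fun_eq_iff crd_def)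
  moreover have "Transposition.transpose i j permutes UNIV" by (rule permutes_swap_id) auto
  ultimately show "swap i j \<in> W" by (auto simp: W_eq)
  have "range (\<lambda>v. swap i j v - v) = span {dif (i, j)}"
  proof (intro equalityI subsetI)
    fix y assume "y \<in> range (\<lambda>v. swap i j v - v)"
    then obtain v where "y = - ((crd v i - crd v j) *\<^sub>R dif (i, j))" by (auto simp: swap_def)
    then show "y \<in> span {dif (i, j)}" by (simp add: span_neg span_scale span_base)
  next
    fix y assume "y \<in> span {dif (i, j)}"
    then obtain t where y: "y = t *\<^sub>R dif (i, j)" by (auto simp: span_singleton)
    have "y = swap i j ((- t / 2) *\<^sub>R dif (i, j)) - (- t / 2) *\<^sub>R dif (i, j)"
      using ij by (simp add: y swap_def linear_cmul[OF linear_crd] linear_neg[OF linear_crd] crd_dif)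
    then show "y \<in> range (\<lambda>v. swap i j v - v)" by (rule range_eqI)
  qed
  then show "dim (range (\<lambda>v. swap i j v - v)) = 1" using dif_nonzero[OF ij] by simp
qed

text \<open>On a point with one exceptional coordinate \<open>p\<close>, the reflection changes only
  the coordinates \<open>p\<close> and \<open>\<sigma> p\<close>. So the coroot is a multiple of
  \<open>dif (p, \<sigma> p)\<close>, and a reflection is determined by the line of its
  coroot.\<close>

lemma reflection_swapE:
  assumes s: "s \<in> reflections"
  obtains i j where "i \<noteq> j" "s = swap i j"
proof -
  have sW: "s \<in> W" using s reflections_subset by blast
  obtain \<sigma> where \<sigma>: "bij \<sigma>" "\<And>x. crd (s x) = crd x \<circ> inv_into UNIV \<sigma>" using W_E[OF sW] by blast
  let ?N = "real CARD('n)"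
  have "\<exists>p. \<sigma> p \<noteq> p"
  proof (rule ccontr)
    assume "\<not> ?thesis"
    then have "inv_into UNIV \<sigma> k = k" for k using \<sigma>(1) by (metis bij_is_inj inv_f_f)
    then have "s (\<alpha>v s) = \<alpha>v s" by (intro crd_eqI) (simp add: \<sigma>(2))
    then have "2 *\<^sub>R \<alpha>v s = 0" using reflection_formula[OF s, of "\<alpha>v s"] \<alpha>_\<alpha>v[OF s] by simp
    then show False using \<alpha>v_nonzero[OF s] by simp
  qed
  then obtain p where p: "\<sigma> p \<noteq> p" by blast
  \<comment> \<open>The constant \<open>1\<close> is subtracted to make the coordinate sum
    zero.\<close>
  have "(\<Sum>k\<in>UNIV. (if k = p then ?N else 0) - 1) = 0" by (simp add: sum_subtractf)
  then obtain x where x: "\<And>k. crd x k = (if k = p then ?N else 0) - 1" by (rule zero_sumE) blast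
  have sx: "crd (s x) k = (if k = \<sigma> p then ?N else 0) - 1" for k
    using \<sigma>(1) by (auto simp: \<sigma>(2) x bij_is_inj bij_is_surj surj_f_inv_f)
  have "crd (s x) k = crd x k - \<alpha> s x * crd (\<alpha>v s) k" for k
    unfolding reflection_formula[OF s, of x] by (simp add: linear_diff[OF linear_crd] linear_cmul[OF linear_crd])
  note c = this
  have a: "\<alpha> s x * crd (\<alpha>v s) k = ?N * (of_bool (k = p) - of_bool (k = \<sigma> p))" for k
  proof -
    have "\<alpha> s x * crd (\<alpha>v s) k = crd x k - crd (s x) k" using c[of k] by simp
    then show ?thesis by (simp add: sx x)
  qed
  have nz: "\<alpha> s x \<noteq> 0" using a[of p] p by auto
  define \<kappa> where "\<kappa> = ?N / \<alpha> s x"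
  have \<kappa>: "\<kappa> \<noteq> 0" using nz by (simp add: \<kappa>_def)
  have av: "\<alpha>v s = \<kappa> *\<^sub>R dif (p, \<sigma> p)"
    using a nz by (intro crd_eqI) (simp add: linear_cmul[OF linear_crd] crd_dif \<kappa>_def field_simps)
  have "s v = swap p (\<sigma> p) v" for v
  proof -
    have "dif (p, \<sigma> p) \<bullet> dif (p, \<sigma> p) = 2" using p by (simp add: inner_dif crd_dif)
    then have "\<alpha> s v * \<kappa> = crd v p - crd v (\<sigma> p)"
      unfolding reflection_formula_aux(3)[OF s, of v] av using \<kappa> p
      by (simp add: inner_dif linear_cmul[OF linear_crd] crd_dif field_simps)
    then show ?thesis unfolding reflection_formula[OF s, of v] av by (simp add: swap_def)
  qed
  then show thesis using p by (intro that[of p "\<sigma> p"]) auto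
qed

lemma reflections_bij:
  assumes ord: "inj (ord :: 'n \<Rightarrow> nat)"
  shows "bij_betw (\<lambda>(i, j). swap i j) {(i, j). ord i < ord j} reflections"
proof (rule bij_betw_imageI)
  show "inj_on (\<lambda>(i, j). swap i j) {(i, j). ord i < ord j}"
  proof (rule inj_onI, clarify)
    fix i j k l assume o: "ord i < ord j" "ord k < ord l" and e: "swap i j = swap k l"
    then have ne: "i \<noteq> j" "k \<noteq> l" by auto
    have "crd (dif (i, j)) (Transposition.transpose i j i) = crd (dif (i, j)) (Transposition.transpose k l i)"
      using crd_swap[OF ne(1), of "dif (i, j)"] crd_swap[OF ne(2), of "dif (i, j)"] e by (metis comp_apply)
    then have "Transposition.transpose k l i = j"
      using ne by (simp add: crd_dif of_bool_def split: if_splits)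
    then show "i = k \<and> j = l" using o ne by (auto simp: Transposition.transpose_def split: if_splits)
  qed
  show "(\<lambda>(i, j). swap i j) ` {(i, j). ord i < ord j} = reflections"
  proof (intro equalityI subsetI)
    fix s assume "s \<in> (\<lambda>(i, j). swap i j) ` {(i, j). ord i < ord j}"
    then show "s \<in> reflections" by (auto intro: swap_reflection)
  next
    fix s assume "s \<in> reflections"
    then obtain i j where ij: "i \<noteq> j" "s = swap i j" by (rule reflection_swapE)
    then have "ord i < ord j \<or> ord j < ord i" using ord by (metis injD linorder_neqE_nat)
    then show "s \<in> (\<lambda>(i, j). swap i j) ` {(i, j). ord i < ord j}"
    proof
      assume "ord i < ord j"
      then show ?thesis using ij by (intro image_eqI[of _ _ "(i, j)"]) auto
    next
      assume "ord j < ord i"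
      then show ?thesis using ij swap_commute[of i j] by (intro image_eqI[of _ _ "(j, i)"]) auto
    qed
  qed
qed

text \<open>The root is prescribed only up to a factor, which cancels in the Dunkl operators and
  becomes a constant in the weight.\<close>

lemma \<alpha>_swap:
  assumes ij: "i \<noteq> j"
  shows "\<exists>\<kappa>. \<kappa> \<noteq> 0 \<and> (\<forall>x. \<alpha> (swap i j) x = (crd x i - crd x j) / \<kappa>)"
proof -
  note s = swap_reflection[OF ij]
  have e: "\<alpha> (swap i j) x *\<^sub>R \<alpha>v (swap i j) = (crd x i - crd x j) *\<^sub>R dif (i, j)" for x
    using reflection_formula[OF s, of x] by (simp add: swap_def)
  define a where "a = \<alpha> (swap i j) (dif (i, j))"
  have av: "a *\<^sub>R \<alpha>v (swap i j) = 2 *\<^sub>R dif (i, j)"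
    using e[of "dif (i, j)"] ij by (simp add: a_def crd_dif)
  have a: "a \<noteq> 0" using av dif_nonzero[OF ij] by auto
  have "\<alpha> (swap i j) x = (crd x i - crd x j) / (2 / a)" for x
  proof -
    have "(\<alpha> (swap i j) x * 2) *\<^sub>R dif (i, j) = \<alpha> (swap i j) x *\<^sub>R (a *\<^sub>R \<alpha>v (swap i j))"
      by (simp add: av)
    also have "\<dots> = a *\<^sub>R ((crd x i - crd x j) *\<^sub>R dif (i, j))"
      unfolding e[symmetric] by (simp add: mult.commute)
    finally have "(\<alpha> (swap i j) x * 2) *\<^sub>R dif (i, j) = (a * (crd x i - crd x j)) *\<^sub>R dif (i, j)" by simp
    then have "\<alpha> (swap i j) x * 2 = a * (crd x i - crd x j)" using dif_nonzero[OF ij] by (simp only: scaleR_cancel_right) simp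
    then show ?thesis by (simp add: field_simps)
  qed
  then show ?thesis using a by (intro exI[of _ "2 / a"]) auto
qed

lemma uu_inj: "uu x \<noteq> 0 \<Longrightarrow> inj (crd x)"
proof (rule injI, rule ccontr)
  fix i j assume u: "uu x \<noteq> 0" and e: "crd x i = crd x j" "i \<noteq> j"
  have "\<alpha> (swap i j) x = 0" using \<alpha>_swap[OF e(2)] e(1) by auto
  then show False using u swap_reflection[OF e(2)] finite_reflections by (auto simp: uu_def)
qed

definition off :: "'n \<Rightarrow> 'n \<Rightarrow> real" where
  "off i j = - 2 / real m * of_bool (i \<noteq> j)"

lemma wt_pair_weight:
  "\<exists>C>0. \<forall>x. wt x = C * pair_weight off (crd x) * exp (- (norm x)\<^sup>2 / 2)"
proof -
  obtain ord :: "'n \<Rightarrow> nat" where "bij_betw ord UNIV {0..<CARD('n)}"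
    using ex_bij_betw_finite_nat[of "UNIV :: 'n set"] by auto
  then have ord: "inj ord" by (rule bij_betw_imp_inj_on)
  let ?P = "{(i, j). ord i < ord j}" and ?c = "- 2 * (1 / real m)"
  have "\<forall>p\<in>?P. \<exists>\<kappa>. \<kappa> \<noteq> 0 \<and> (\<forall>x. \<alpha> (swap (fst p) (snd p)) x = (crd x (fst p) - crd x (snd p)) / \<kappa>)"
  proof
    fix p assume "p \<in> ?P"
    then have "fst p \<noteq> snd p" by auto
    then show "\<exists>\<kappa>. \<kappa> \<noteq> 0 \<and> (\<forall>x. \<alpha> (swap (fst p) (snd p)) x = (crd x (fst p) - crd x (snd p)) / \<kappa>)" by (rule \<alpha>_swap)
  qed
  from bchoice[OF this] obtain \<kappa> where \<kappa>: "\<And>i j. ord i < ord j \<Longrightarrow> \<kappa> (i, j) \<noteq> 0"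
    "\<And>i j x. ord i < ord j \<Longrightarrow> \<alpha> (swap i j) x = (crd x i - crd x j) / \<kappa> (i, j)"
    by (metis (mono_tags, lifting) case_prodI fst_conv mem_Collect_eq snd_conv)
  define C where "C = (\<Prod>p\<in>?P. (1 / \<bar>\<kappa> p\<bar>) powr ?c)"
  have C: "C > 0" unfolding C_def using \<kappa>(1) by (intro prod_pos) auto
  have "wt x = C * pair_weight off (crd x) * exp (- (norm x)\<^sup>2 / 2)" for x
  proof -
    have "(\<Prod>s\<in>reflections. \<bar>\<alpha> s x\<bar> powr ?c) = (\<Prod>(i, j)\<in>?P. \<bar>\<alpha> (swap i j) x\<bar> powr ?c)"
      using prod.reindex_bij_betw[OF reflections_bij[OF ord], of "\<lambda>s. \<bar>\<alpha> s x\<bar> powr ?c"] by (simp add: case_prod_unfold)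
    also have "\<dots> = (\<Prod>(i, j)\<in>?P. (1 / \<bar>\<kappa> (i, j)\<bar>) powr ?c * \<bar>crd x i - crd x j\<bar> powr ?c)"
    proof (rule prod.cong[OF refl], clarify)
      fix i j assume "ord i < ord j"
      then have "\<bar>\<alpha> (swap i j) x\<bar> = 1 / \<bar>\<kappa> (i, j)\<bar> * \<bar>crd x i - crd x j\<bar>" by (simp add: \<kappa>(2) abs_divide)
      then show "\<bar>\<alpha> (swap i j) x\<bar> powr ?c = (1 / \<bar>\<kappa> (i, j)\<bar>) powr ?c * \<bar>crd x i - crd x j\<bar> powr ?c"
        by (simp only: powr_mult abs_ge_zero zero_le_divide_1_iff)
    qed
    also have "\<dots> = C * (\<Prod>(i, j)\<in>?P. \<bar>crd x i - crd x j\<bar> powr ?c)"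
      by (simp only: C_def case_prod_unfold prod.distrib prod.collapse)
    also have "(\<Prod>(i, j)\<in>?P. \<bar>crd x i - crd x j\<bar> powr ?c) = pair_weight off (crd x)"
    proof (cases "inj (crd x)")
      case True
      have "(\<Prod>(i, j)\<in>?P. \<bar>crd x i - crd x j\<bar> powr ?c) = (\<Prod>(i, j)\<in>?P. exp (off i j * ln \<bar>crd x i - crd x j\<bar>))"
        using True by (intro prod.cong) (auto simp: powr_def off_def inj_eq)
      also have "\<dots> = exp (\<Sum>(i, j)\<in>?P. off i j * ln \<bar>crd x i - crd x j\<bar>)" by (simp add: exp_sum case_prod_unfold)
      also have "(\<Sum>(i, j)\<in>?P. off i j * ln \<bar>crd x i - crd x j\<bar>) = (\<Sum>i\<in>UNIV. \<Sum>j\<in>UNIV. off i j * ln \<bar>crd x i - crd x j\<bar>) / 2"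
        by (rule sum_ordered_pairs[OF ord]) (auto simp: off_def abs_minus_commute)
      finally show ?thesis using True by (simp add: pair_weight_def)
    next
      case False
      then obtain i j where "crd x i = crd x j" "i \<noteq> j" by (auto simp: inj_def)
      then have "\<exists>i j. crd x i = crd x j \<and> ord i < ord j" using ord by (metis injD linorder_neqE_nat)
      then obtain i j where ij: "crd x i = crd x j" "ord i < ord j" by blast
      \<comment> \<open>Although the exponent is negative, \<open>0 powr ?c\<close> is
        \<open>0\<close>, in agreement with the default value of \<open>pair_weight\<close>.\<close>
      then have "(\<Prod>(i, j)\<in>?P. \<bar>crd x i - crd x j\<bar> powr ?c) = 0"
        by (intro prod_zero bexI[of _ "(i, j)"]) auto
      then show ?thesis using False by (simp add: pair_weight_def)
    qed
    finally show ?thesis by (simp add: wt_def)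
  qed
  then show ?thesis using C by blast
qed

section \<open>Singular vectors of the symmetric group and their integrability\<close>

definition vd :: "('n \<Rightarrow> nat) \<Rightarrow> ('n \<Rightarrow> nat) \<Rightarrow> 'a \<Rightarrow> complex" where
  "vd ord col x = complex_of_real (vdm ord col UNIV (crd x))"

definition V :: "('a \<Rightarrow> complex) set" where
  "V = {vd ord col |ord col. inj ord \<and> balanced (m - 1) col}"

lemma vd_Pol: "vd ord col \<in> Pol"
proof -
  have "(\<lambda>x. \<Prod>p | fst p \<in> UNIV \<and> snd p \<in> UNIV \<and> ord (fst p) < ord (snd p) \<and> col (fst p) = col (snd p).
      complex_of_real (crd x (fst p) - crd x (snd p))) \<in> Pol"
    by (intro Pol_prod Pol_lin1 linear_of_real linear_compose_sub linear_crd)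
  then show ?thesis by (simp add: vd_def[abs_def] vdm_def case_prod_unfold)
qed

lemma vd_pd:
  assumes "inj ord" "inj (crd x)"
  shows "pd b (vd ord col) x = of_real (vdm ord col UNIV (crd x)
    * ((\<Sum>i\<in>UNIV. \<Sum>j\<in>UNIV. same col i j * ((crd b i - crd b j) / (crd x i - crd x j))) / 2))"
proof (rule pd_eqI)
  have "(\<lambda>t. vd ord col (x + t *\<^sub>R b)) = (\<lambda>t. of_real (vdm ord col UNIV (\<lambda>i. crd x i + t * crd b i)))"
    by (simp add: vd_def crd_line[abs_def] fun_eq_iff)
  note eq = this
  show "((\<lambda>t. vd ord col (x + t *\<^sub>R b)) has_vector_derivative of_real (vdm ord col UNIV (crd x)
    * ((\<Sum>i\<in>UNIV. \<Sum>j\<in>UNIV. same col i j * ((crd b i - crd b j) / (crd x i - crd x j))) / 2))) (at 0)"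
    unfolding eq by (rule has_vector_derivative_of_real[OF vdm_deriv[OF assms]])
qed

text \<open>Away from coincident coordinates the Dunkl derivative is half the sum of
  \<open>(crd b i - crd b j) * K i j\<close> for an antisymmetric kernel \<open>K\<close> whose row
  sums vanish by \<open>vdm_singular\<close>. Being a polynomial, it then vanishes
  everywhere.\<close>

lemma vd_singular:
  assumes ord: "inj ord" and bal: "balanced (m - 1) col"
  shows "D b (vd ord col) = (\<lambda>x. 0)"
proof
  fix x
  have main: "D b (vd ord col) x = 0" if z: "inj (crd x)" for x
  proof -
    define z where "z = crd x"
    define v where "v = vdm ord col UNIV z"
    define \<Delta> where "\<Delta> i j = v - vdm ord col UNIV (z \<circ> Transposition.transpose i j)" for i j
    let ?F = "\<lambda>i j. (crd b i - crd b j) / (z i - z j) * \<Delta> i j"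
    have "(\<Sum>s\<in>reflections. of_real (\<alpha> s b) * dd s (vd ord col) x) = (\<Sum>(i, j) | ord i < ord j. of_real (\<alpha> (swap i j) b) * dd (swap i j) (vd ord col) x)"
      using sum.reindex_bij_betw[OF reflections_bij[OF ord], of "\<lambda>s. of_real (\<alpha> s b) * dd s (vd ord col) x"]
      by (simp add: case_prod_unfold)
    also have "\<dots> = (\<Sum>(i, j) | ord i < ord j. of_real (?F i j))"
    proof (rule sum.cong[OF refl], clarify)
      fix i j assume "ord i < ord j"
      then have ij: "i \<noteq> j" by auto
      obtain \<kappa> where \<kappa>: "\<kappa> \<noteq> 0" "\<And>x. \<alpha> (swap i j) x = (crd x i - crd x j) / \<kappa>" using \<alpha>_swap[OF ij] by blast
      have nz: "z i - z j \<noteq> 0" using that ij by (simp add: z_def inj_eq)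
      have "of_real (\<alpha> (swap i j) x) * dd (swap i j) (vd ord col) x = of_real (\<Delta> i j)"
        unfolding dd_eq[OF swap_reflection[OF ij] vd_Pol] by (simp add: vd_def crd_swap[OF ij] \<Delta>_def v_def z_def)
      then have "dd (swap i j) (vd ord col) x = of_real (\<Delta> i j) / of_real ((z i - z j) / \<kappa>)"
        using nz \<kappa> by (simp add: z_def field_simps)
      then have "of_real (\<alpha> (swap i j) b) * dd (swap i j) (vd ord col) x
        = complex_of_real ((crd b i - crd b j) / \<kappa> * (\<Delta> i j / ((z i - z j) / \<kappa>)))"
        by (simp add: \<kappa>(2))
      also have "(crd b i - crd b j) / \<kappa> * (\<Delta> i j / ((z i - z j) / \<kappa>)) = ?F i j"
        using \<kappa>(1) by simp
      finally show "of_real (\<alpha> (swap i j) b) * dd (swap i j) (vd ord col) x = complex_of_real (?F i j)" .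
    qed
    also have "\<dots> = of_real (\<Sum>(i, j) | ord i < ord j. ?F i j)" by (simp add: case_prod_unfold)
    also have "(\<Sum>(i, j) | ord i < ord j. ?F i j) = (\<Sum>i\<in>UNIV. \<Sum>j\<in>UNIV. ?F i j) / 2"
    proof (rule sum_ordered_pairs[OF ord])
      show "?F i j = ?F j i" for i j
        using minus_divide_divide[of "crd b i - crd b j" "z i - z j"] by (simp add: \<Delta>_def transpose_commute)
    qed simp
    finally have refl_sum: "(\<Sum>s\<in>reflections. of_real (\<alpha> s b) * dd s (vd ord col) x)
      = of_real ((\<Sum>i\<in>UNIV. \<Sum>j\<in>UNIV. ?F i j) / 2)" .
    \<comment> \<open>The kernel combines the terms of the logarithmic derivative with those of the
      divided differences; the factor \<open>1 / real m\<close> is the parameter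
      \<open>c\<close>.\<close>
    define K where "K i j = same col i j * (v / (z i - z j)) - (1 / real m) * (\<Delta> i j / (z i - z j))" for i j
    have anti: "K i j = - K j i" for i j
    proof -
      have "y / (z i - z j) = - (y / (z j - z i))" for y by (metis minus_diff_eq divide_minus_right)
      then show ?thesis by (simp add: K_def same_def \<Delta>_def transpose_commute[of i j] eq_commute[of i] eq_commute[of "col i"])
    qed
    have zero: "(\<Sum>j\<in>UNIV. K i j) = 0" for i
    proof -
      have "(\<Sum>j\<in>UNIV. same col i j * (v / (z i - z j))) = (\<Sum>j\<in>{k. col k = col i} - {i}. v / (z i - z j))"
        by (rule sum.mono_neutral_cong_right) (auto simp: same_def)
      moreover have "(\<Sum>j\<in>UNIV. \<Delta> i j / (z i - z j)) = (\<Sum>j\<in>UNIV - {i}. \<Delta> i j / (z i - z j))"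
        by (rule sum.mono_neutral_right) auto
      moreover have "(\<Sum>j\<in>UNIV - {i}. \<Delta> i j / (z i - z j)) = real m * (\<Sum>j\<in>{k. col k = col i} - {i}. v / (z i - z j))"
        using vdm_singular[OF ord _ m bal, of z i] that by (simp add: \<Delta>_def v_def z_def)
      moreover have "(\<Sum>j\<in>UNIV. K i j) = (\<Sum>j\<in>UNIV. same col i j * (v / (z i - z j))) - 1 / real m * (\<Sum>j\<in>UNIV. \<Delta> i j / (z i - z j))"
        by (simp only: K_def sum_subtractf sum_distrib_left)
      ultimately have "(\<Sum>j\<in>UNIV. K i j) = y - 1 / real m * (real m * y)"
        if "y = (\<Sum>j\<in>{k. col k = col i} - {i}. v / (z i - z j))" for y
        by (simp only: that)
      then show ?thesis using m by simp
    qed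
    have "D b (vd ord col) x = of_real (v * ((\<Sum>i\<in>UNIV. \<Sum>j\<in>UNIV. same col i j * ((crd b i - crd b j) / (z i - z j))) / 2)
      - 1 / real m * ((\<Sum>i\<in>UNIV. \<Sum>j\<in>UNIV. ?F i j) / 2))"
      unfolding D_def vd_pd[OF ord that] refl_sum by (simp add: v_def z_def)
    also have "v * ((\<Sum>i\<in>UNIV. \<Sum>j\<in>UNIV. same col i j * ((crd b i - crd b j) / (z i - z j))) / 2)
      - 1 / real m * ((\<Sum>i\<in>UNIV. \<Sum>j\<in>UNIV. ?F i j) / 2)
      = (\<Sum>i\<in>UNIV. \<Sum>j\<in>UNIV. (crd b i - crd b j) * K i j) / 2"
    proof -
      have "(crd b i - crd b j) * K i j = v * (same col i j * ((crd b i - crd b j) / (z i - z j))) - 1 / real m * ?F i j" for i j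
        by (simp add: K_def right_diff_distrib) (simp add: algebra_simps)
      then have "(\<Sum>i\<in>UNIV. \<Sum>j\<in>UNIV. (crd b i - crd b j) * K i j)
        = v * (\<Sum>i\<in>UNIV. \<Sum>j\<in>UNIV. same col i j * ((crd b i - crd b j) / (z i - z j))) - 1 / real m * (\<Sum>i\<in>UNIV. \<Sum>j\<in>UNIV. ?F i j)"
        by (simp only: sum_subtractf sum_distrib_left)
      then show ?thesis by (simp add: diff_divide_distrib)
    qed
    also have "\<dots> = 0" by (simp add: sum_antisymmetric[of K "crd b", OF anti zero])
    finally show ?thesis by simp
  qed
  \<comment> \<open>Multiplication by \<open>uu\<close> disposes of the points with coincident
    coordinates.\<close>
  obtain y where y: "uu y \<noteq> 0" using uu_nonzero by blast
  have "D b (vd ord col) x * of_real (uu x) = 0" for x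
    using main[of x] uu_inj[of x] by (cases "uu x = 0") auto
  then show "D b (vd ord col) x = 0"
    using Pol_domain[OF D_Pol[OF vd_Pol] Pol_uu, of b ord col y x] y by simp
qed

lemma cmod_vd: "inj ord \<Longrightarrow> inj (crd x) \<Longrightarrow> cmod (vd ord col x) = pair_weight (same col) (crd x)"
  by (simp add: vd_def abs_vdm)

text \<open>\<open>d\<close> is \<open>0\<close> for the products themselves and \<open>edge\<close>
  of a same-colour pair for their derivatives.\<close>

lemma integrable_exponents:
  assumes c: "balanced (m - 1) c1" "balanced (m - 1) c2" and p: "p \<in> Pol"
    and d: "\<And>i j. d i j \<le> same c1 i j" "\<And>i j. d i j = d j i" "\<And>i. d i i = 0" "\<And>K. exponent_sum d K \<le> 2"
  shows "integrable lborel (\<lambda>x. cmod (p x) * (pair_weight (same c1) (crd x) * pair_weight (same c2) (crd x)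
    * pair_weight off (crd x) * pair_weight (\<lambda>i j. - d i j) (crd x)) * exp (- (norm x)\<^sup>2 / 2))"
  unfolding pair_weight_add[symmetric]
proof (rule integrable_pair_weight[OF _ _ _ p])
  show "same c1 i j + same c2 i j + off i j + - d i j = same c1 j i + same c2 j i + off j i + - d j i" for i j
    using d(2)[of i j] by (auto simp: same_def off_def)
  show "same c1 i i + same c2 i i + off i i + - d i i = 0" for i by (simp add: same_def off_def d(3))
  show "0 < exponent_sum (\<lambda>i j. same c1 i j + same c2 i j + off i j + - d i j) K / 2 + (real (card K) - 1)"
    if "2 \<le> card K" for K
    unfolding off_def by (rule exponents_positive[OF m _ _ d(1) d(4) that]) (use c in \<open>auto simp: balanced_def\<close>)
qed

lemma edge_exponents:
  fixes a b :: 'n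
  assumes "same col a b \<noteq> 0"
  shows "edge a b i j \<le> same col i j" "edge a b i j = edge a b j i" "edge a b i i = 0" "exponent_sum (edge a b) K \<le> 2"
proof -
  have ab: "a \<noteq> b" "col a = col b" using assms by (auto simp: same_def split: if_splits)
  show "edge a b i j \<le> same col i j" "edge a b i j = edge a b j i" "edge a b i i = 0"
    using ab by (auto simp: edge_def same_def)
  show "exponent_sum (edge a b) K \<le> 2"
    using edge_sum[of K a b "\<lambda>_ _. 1"] by (simp add: exponent_sum_def split: if_splits)
qed

lemma vd_integrable:
  assumes ord: "inj o1" "inj o2" and bal: "balanced (m - 1) c1" "balanced (m - 1) c2" and p: "p \<in> Pol"
  shows "integrable lborel (\<lambda>x. cmod (p x * vd o1 c1 x * vd o2 c2 x) * wt x)"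
proof -
  obtain C where C: "C > 0" "\<And>x. wt x = C * pair_weight off (crd x) * exp (- (norm x)\<^sup>2 / 2)"
    using wt_pair_weight by blast
  \<comment> \<open>The last factor, with exponent \<open>0\<close>, is \<open>1\<close> at
    injective points; it matches the shape of \<open>integrable_exponents\<close> with
    \<open>d = 0\<close>.\<close>
  have "cmod (p x * vd o1 c1 x * vd o2 c2 x) * wt x
    = C * (cmod (p x) * (pair_weight (same c1) (crd x) * pair_weight (same c2) (crd x)
    * pair_weight off (crd x) * pair_weight (\<lambda>i j. - 0) (crd x)) * exp (- (norm x)\<^sup>2 / 2))" for x
  proof (cases "inj (crd x)")
    case True
    then have "pair_weight (\<lambda>i j. - 0) (crd x) = 1" by (simp add: pair_weight_def)
    then show ?thesis using cmod_vd ord True by (simp add: norm_mult C(2) mult_ac)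
  next
    case False
    then show ?thesis by (simp add: C(2) pair_weight_def)
  qed
  moreover have "integrable lborel (\<lambda>x. C * (cmod (p x) * (pair_weight (same c1) (crd x) * pair_weight (same c2) (crd x)
    * pair_weight off (crd x) * pair_weight (\<lambda>i j. - 0) (crd x)) * exp (- (norm x)\<^sup>2 / 2)))"
    by (rule integrable_mult_right, rule integrable_exponents[OF bal p]) (auto simp: same_def exponent_sum_def)
  ultimately show ?thesis by simp
qed

text \<open>The derivative is the product times its logarithmic derivative. The poles of the latter
  occur only along pairs of equal colour, where the first product vanishes, so each term is a case
  of \<open>integrable_exponents\<close> with one edge.\<close>

lemma vd_integrable_pd:
  assumes ord: "inj o1" "inj o2" and bal: "balanced (m - 1) c1" "balanced (m - 1) c2" and p: "p \<in> Pol"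
  shows "integrable lborel (\<lambda>x. cmod (p x * pd b (vd o1 c1) x * vd o2 c2 x) * wt x)"
proof -
  obtain C where C: "C > 0" "\<And>x. wt x = C * pair_weight off (crd x) * exp (- (norm x)\<^sup>2 / 2)"
    using wt_pair_weight by blast
  define E where "E i j x = cmod (p x) * (pair_weight (same c1) (crd x) * pair_weight (same c2) (crd x)
    * pair_weight off (crd x) * pair_weight (\<lambda>k l. - edge i j k l) (crd x)) * exp (- (norm x)\<^sup>2 / 2)" for i j x
  have E_nonneg: "E i j x \<ge> 0" for i j x by (simp add: E_def pair_weight_nonneg)
  let ?B = "\<lambda>i j. C * \<bar>crd b i - crd b j\<bar> * same c1 i j"
  have int: "integrable lborel (\<lambda>x. ?B i j * E i j x)" for i j
  proof (cases "same c1 i j = 0")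
    case False
    have "integrable lborel (E i j)"
      unfolding E_def by (rule integrable_exponents[OF bal p]) (rule edge_exponents[OF False])+
    then show ?thesis by simp
  qed simp
  have B: "?B i j \<ge> 0" for i j using C(1) by (simp add: same_def)
  have "integrable lborel (\<lambda>x. \<Sum>i\<in>UNIV. \<Sum>j\<in>UNIV. ?B i j * E i j x)"
    by (intro Bochner_Integration.integrable_sum int)
  then show ?thesis
  proof (rule Bochner_Integration.integrable_bound)
    have [measurable]: "(\<lambda>x. p x * pd b (vd o1 c1) x * vd o2 c2 x) \<in> borel_measurable borel"
      by (intro Pol_measurable Pol_mult p Pol_pd vd_Pol)
    show "(\<lambda>x. cmod (p x * pd b (vd o1 c1) x * vd o2 c2 x) * wt x) \<in> borel_measurable lborel" by measurable
    show "AE x in lborel. norm (cmod (p x * pd b (vd o1 c1) x * vd o2 c2 x) * wt x)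
      \<le> norm (\<Sum>i\<in>UNIV. \<Sum>j\<in>UNIV. ?B i j * E i j x)"
    proof (rule AE_I2)
      fix x
      let ?z = "crd x"
      have nonneg: "(\<Sum>i\<in>UNIV. \<Sum>j\<in>UNIV. ?B i j * E i j x) \<ge> 0"
        by (intro sum_nonneg mult_nonneg_nonneg B E_nonneg)
      have "cmod (p x * pd b (vd o1 c1) x * vd o2 c2 x) * wt x \<le> (\<Sum>i\<in>UNIV. \<Sum>j\<in>UNIV. ?B i j * E i j x)"
      proof (cases "inj ?z")
        case False
        then have "wt x = 0" by (simp add: C(2) pair_weight_def)
        then show ?thesis using nonneg by simp
      next
        case True
        let ?A = "cmod (p x) * pair_weight (same c1) ?z * pair_weight (same c2) ?z * wt x"
        have A: "?A \<ge> 0" by (simp add: pair_weight_nonneg wt_nonneg)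
        let ?S = "\<lambda>i j. same c1 i j * ((crd b i - crd b j) / (?z i - ?z j))"
        have "cmod (pd b (vd o1 c1) x) = pair_weight (same c1) ?z * (\<bar>\<Sum>i\<in>UNIV. \<Sum>j\<in>UNIV. ?S i j\<bar> / 2)"
          unfolding vd_pd[OF ord(1) True] norm_of_real abs_mult abs_vdm[OF ord(1) True] by simp
        also have "\<dots> \<le> pair_weight (same c1) ?z * (\<Sum>i\<in>UNIV. \<Sum>j\<in>UNIV. \<bar>?S i j\<bar>)"
        proof (rule mult_left_mono[OF _ pair_weight_nonneg])
          have "\<bar>\<Sum>i\<in>UNIV. \<Sum>j\<in>UNIV. ?S i j\<bar> \<le> (\<Sum>i\<in>UNIV. \<Sum>j\<in>UNIV. \<bar>?S i j\<bar>)"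
            by (intro order_trans[OF sum_abs] sum_mono sum_abs)
          then show "\<bar>\<Sum>i\<in>UNIV. \<Sum>j\<in>UNIV. ?S i j\<bar> / 2 \<le> (\<Sum>i\<in>UNIV. \<Sum>j\<in>UNIV. \<bar>?S i j\<bar>)"
            by linarith
        qed
        finally have "cmod (pd b (vd o1 c1) x) \<le> pair_weight (same c1) ?z * (\<Sum>i\<in>UNIV. \<Sum>j\<in>UNIV. \<bar>?S i j\<bar>)" .
        then have "cmod (p x) * cmod (pd b (vd o1 c1) x) * pair_weight (same c2) ?z * wt x
          \<le> cmod (p x) * (pair_weight (same c1) ?z * (\<Sum>i\<in>UNIV. \<Sum>j\<in>UNIV. \<bar>?S i j\<bar>)) * pair_weight (same c2) ?z * wt x"
          by (intro mult_right_mono mult_left_mono pair_weight_nonneg wt_nonneg norm_ge_zero)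
        also have "\<dots> = (\<Sum>i\<in>UNIV. \<Sum>j\<in>UNIV. ?A * \<bar>?S i j\<bar>)"
          unfolding sum_distrib_left[symmetric] by (simp only: mult_ac)
        also have "\<dots> = (\<Sum>i\<in>UNIV. \<Sum>j\<in>UNIV. ?B i j * E i j x)"
        proof (intro sum.cong refl)
          fix i j
          show "?A * \<bar>?S i j\<bar> = ?B i j * E i j x"
          proof (cases "same c1 i j = 0")
            case False
            then have ij: "i \<noteq> j" by (auto simp: same_def)
            have "\<bar>?S i j\<bar> = same c1 i j * \<bar>crd b i - crd b j\<bar> * pair_weight (\<lambda>k l. - edge i j k l) ?z"
              by (simp add: pair_weight_edge[OF True ij] abs_mult same_def)
            then show ?thesis by (simp only: E_def C(2) mult_ac)
          qed simp
        qed
        finally show ?thesis by (simp add: norm_mult cmod_vd[OF ord(2) True])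
      qed
      then show "norm (cmod (p x * pd b (vd o1 c1) x * vd o2 c2 x) * wt x) \<le> norm (\<Sum>i\<in>UNIV. \<Sum>j\<in>UNIV. ?B i j * E i j x)"
        using nonneg by (simp add: wt_nonneg)
    qed
  qed
qed

lemma vd_W:
  assumes w: "w \<in> W" and ord: "inj ord" and bal: "balanced (m - 1) col"
  shows "(\<lambda>x. vd ord col (w x)) \<in> V"
proof -
  obtain \<sigma> where \<sigma>: "bij \<sigma>" "\<And>x. crd (w x) = crd x \<circ> inv_into UNIV \<sigma>" using W_E[OF w] by blast
  have b: "bij (inv_into UNIV \<sigma>)" "inv_into UNIV (inv_into UNIV \<sigma>) = \<sigma>"
    using \<sigma>(1) by (auto simp: bij_imp_bij_inv inv_inv_eq)
  have "(\<lambda>x. vd ord col (w x)) = vd (ord \<circ> \<sigma>) (col \<circ> \<sigma>)"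
    by (simp add: vd_def[abs_def] \<sigma>(2) vdm_permute[OF b(1)] b(2))
  moreover have "inj (ord \<circ> \<sigma>)" using ord bij_is_inj[OF \<sigma>(1)] by (rule inj_compose)
  moreover have "balanced (m - 1) (col \<circ> \<sigma>)" by (rule balanced_permute[OF \<sigma>(1) bal])
  ultimately show ?thesis unfolding V_def by blast
qed

lemma V_nontrivial: "\<exists>f\<in>V. f \<noteq> (\<lambda>x. 0)"
proof -
  obtain ord :: "'n \<Rightarrow> nat" where "bij_betw ord UNIV {0..<CARD('n)}"
    using ex_bij_betw_finite_nat[of "UNIV :: 'n set"] by auto
  then have ord: "inj ord" by (rule bij_betw_imp_inj_on)
  obtain col :: "'n \<Rightarrow> nat" where col: "balanced (m - 1) col" using balanced_exists[of "m - 1"] m by auto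
  define a where "a = (\<Sum>i\<in>UNIV. real (ord i)) / CARD('n)"
  have "(\<Sum>i\<in>UNIV. real (ord i) - a) = 0" by (simp add: sum_subtractf a_def)
  then obtain x where x: "\<And>i. crd x i = real (ord i) - a" by (rule zero_sumE) blast
  have "inj (crd x)" using ord by (auto simp: inj_def x)
  then have "vd ord col x \<noteq> 0" by (simp add: vd_def vdm_nonzero)
  then have "vd ord col \<noteq> (\<lambda>x. 0)" by auto
  moreover have "vd ord col \<in> V" using ord col by (auto simp: V_def)
  ultimately show ?thesis by (rule bexI)
qed

sublocale singular_space W \<alpha> \<alpha>v "1 / real m" V
proof
  show "1 / real m > 0" using m by simp
  show "\<exists>f\<in>V. f \<noteq> (\<lambda>x. 0)" by (rule V_nontrivial)
  show "f \<in> Pol" if "f \<in> V" for f using that vd_Pol by (auto simp: V_def)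
  show "(\<lambda>x. f (w x)) \<in> V" if "w \<in> W" "f \<in> V" for f w
    using that(2) vd_W[OF that(1)] unfolding V_def by blast
  show "D b f = (\<lambda>x. 0)" if "f \<in> V" for f b using that vd_singular unfolding V_def by blast
  show "integrable lborel (\<lambda>x. cmod (p x * f x * g x) * wt x)" if "f \<in> V" "g \<in> V" "p \<in> Pol" for f g p
    using that vd_integrable unfolding V_def by blast
  show "integrable lborel (\<lambda>x. cmod (p x * pd b f x * g x) * wt x)" if "f \<in> V" "g \<in> V" "p \<in> Pol" for f g p b
    using that vd_integrable_pd unfolding V_def by blast
qed

end

lemma type_A_L2_unitary:
  assumes "coordinates \<iota>" "rational_cherednik W \<alpha> \<alpha>v"
    "W = {g. \<exists>\<sigma>. \<sigma> permutes UNIV \<and> (\<forall>v. \<iota> (g v) = perm_act \<sigma> (\<iota> v))}" "2 \<le> m"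
  shows "rational_cherednik.contained_in_L2 W \<alpha> \<alpha>v (1 / real m) (rational_cherednik.N_min W \<alpha> \<alpha>v (1 / real m))
    \<and> rational_cherednik.unitary W \<alpha> \<alpha>v (1 / real m) (rational_cherednik.N_min W \<alpha> \<alpha>v (1 / real m))"
proof -
  interpret type_A \<iota> W \<alpha> \<alpha>v m
    using assms by (simp add: type_A_def type_A_axioms_def)
  show ?thesis using L2_N_min unitary_N_min by simp
qed

theorem theorem5p14:
  shows
   "(\<forall>(m::nat) \<alpha> \<alpha>v. 2 \<le> m \<and> m \<le> CARD('n::finite)
        \<and> rational_cherednik (sym_group :: (real ^ 'n \<Rightarrow> real ^ 'n) set) \<alpha> \<alpha>v
      \<longrightarrow> rational_cherednik.contained_in_L2 sym_group \<alpha> \<alpha>v (1 / real m)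
            (rational_cherednik.N_min sym_group \<alpha> \<alpha>v (1 / real m))
        \<and> rational_cherednik.unitary sym_group \<alpha> \<alpha>v (1 / real m)
            (rational_cherednik.N_min sym_group \<alpha> \<alpha>v (1 / real m)))
  \<and> (\<forall>(d::nat) (\<iota> :: 'a::euclidean_space \<Rightarrow> real ^ 'n) \<alpha> \<alpha>v. 2 \<le> d \<and> d \<le> CARD('n)
        \<and> reflection_embedding \<iota> \<and> rational_cherednik (sym_group_refl \<iota>) \<alpha> \<alpha>v
      \<longrightarrow> rational_cherednik.contained_in_L2 (sym_group_refl \<iota>) \<alpha> \<alpha>v (1 / real d)
            (rational_cherednik.N_min (sym_group_refl \<iota>) \<alpha> \<alpha>v (1 / real d))
        \<and> rational_cherednik.unitary (sym_group_refl \<iota>) \<alpha> \<alpha>v (1 / real d)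
            (rational_cherednik.N_min (sym_group_refl \<iota>) \<alpha> \<alpha>v (1 / real d)))"
proof (intro conjI[of "All _"] allI impI)
  fix m :: nat and \<alpha> and \<alpha>v :: "(real ^ 'n \<Rightarrow> real ^ 'n) \<Rightarrow> real ^ 'n"
  assume "2 \<le> m \<and> m \<le> CARD('n) \<and> rational_cherednik (sym_group :: (real ^ 'n \<Rightarrow> real ^ 'n) set) \<alpha> \<alpha>v"
  \<comment> \<open>The full coordinate space is the case of the identity embedding.\<close>
  moreover have "coordinates (id :: real ^ 'n \<Rightarrow> real ^ 'n)" by standard (auto simp: linear_iff)
  moreover have "sym_group = {g. \<exists>\<sigma>. \<sigma> permutes UNIV \<and> (\<forall>v :: real ^ 'n. id (g v) = perm_act \<sigma> (id v))}"
    by (auto simp: sym_group_def fun_eq_iff)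
  ultimately show "rational_cherednik.contained_in_L2 sym_group \<alpha> \<alpha>v (1 / real m)
            (rational_cherednik.N_min sym_group \<alpha> \<alpha>v (1 / real m))
        \<and> rational_cherednik.unitary sym_group \<alpha> \<alpha>v (1 / real m)
            (rational_cherednik.N_min sym_group \<alpha> \<alpha>v (1 / real m))"
    using type_A_L2_unitary[of id sym_group \<alpha> \<alpha>v m] by blast
next
  fix d :: nat and \<iota> :: "'a \<Rightarrow> real ^ 'n" and \<alpha> \<alpha>v
  assume "2 \<le> d \<and> d \<le> CARD('n) \<and> reflection_embedding \<iota> \<and> rational_cherednik (sym_group_refl \<iota>) \<alpha> \<alpha>v"
  moreover from this have "coordinates \<iota>" by (auto simp: reflection_embedding_def coordinates_def)
  ultimately show "rational_cherednik.contained_in_L2 (sym_group_refl \<iota>) \<alpha> \<alpha>v (1 / real d)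
            (rational_cherednik.N_min (sym_group_refl \<iota>) \<alpha> \<alpha>v (1 / real d))
        \<and> rational_cherednik.unitary (sym_group_refl \<iota>) \<alpha> \<alpha>v (1 / real d)
            (rational_cherednik.N_min (sym_group_refl \<iota>) \<alpha> \<alpha>v (1 / real d))"
    by (intro type_A_L2_unitary) (auto simp: sym_group_refl_def)
qed

end
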